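(* Let $M$ be a connected complex manifold of dimension $n\ge 1$ with a commutative and associative $\mathcal O_M$-bilinear multiplication $\circ$ on $\mathcal T_M$ and a global unit field $e$, and suppose that $(M,\circ,e)$ is massive, i.e. the multiplication is generically semisimple. Let $L\subset T^*M$ be its analytic spectrum, $\pi:L\to M$ the projection, and $\mathcal K\subset M$ the caustic. Then $L\subset T^*M$ is an everywhere reduced subvariety, the map $\pi:L\to M$ is finite and flat, and it is a branched covering of degree $n$, branched above $\mathcal K$. Moreover the following conditions are equivalent: (i) $(M,\circ,e)$ is a massive F-manifold. (ii) At any semisimple point $p\in M-\mathcal K$, the idempotent vector fields $e_1,\dots,e_n\in\mathcal T_{M,p}$ (those with $e_i\circ e_j=\delta_{ij}e_i$ and $\sum_i e_i=e$) commute. (iii) $L\subset T^*M$ is a Lagrange variety, i.e. $\alpha|_{L_{reg}}$ is closed.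
   Context: An F-manifold is a triple $(M,\circ,e)$ with $M$ a connected complex manifold of dimension $\geq 1$, $\circ$ a commutative, associative $\mathcal O_M$-bilinear multiplication on the tangent sheaf $\mathcal T_M$, and $e$ a global unit field, such that $\mathrm{Lie}_{X\circ Y}(\circ)=X\circ \mathrm{Lie}_Y(\circ)+Y\circ\mathrm{Lie}_X(\circ)$ for all local vector fields $X,Y$, where $\mathrm{Lie}_X(\circ)(Z,W)=[X,Z\circ W]-[X,Z]\circ W-Z\circ[X,W]$. The multiplication at $p$ is semisimple if $(T_pM,\circ)$ is isomorphic to $\mathbb C^n$ as an algebra. The caustic $\mathcal K$ is the set of points of $M$ where the multiplication is not semisimple (empty or a hypersurface in the massive case). The analytic spectrum $L=\mathrm{Specan}(\mathcal T_M)\subset T^*M$ has as underlying set the union over $p\in M$ of all algebra homomorphisms $T_pM\to\mathbb C$ (mapping $e(p)$ to $1$). Its complex structure is given locally as follows: if $\delta_1=e,\delta_2,\dots,\delta_n$ is a local basis of $\mathcal T_M$ with $\delta_i\circ\delta_j=\sum_k a_{ij}^k\delta_k$, and $y_1,\dots,y_n$ are the fiberwise linear functions on $T^*M$ induced by the $\delta_i$, then $L$ is defined by the ideal generated by $y_1-1$ and all $y_iy_j-\sum_k a_{ij}^ky_k$. $\alpha$ is the canonical 1-form on $T^*M$ ($\alpha=\sum y_i\,dt_i$ in coordinates $t_i$ of $M$ and dual fiber coordinates $y_i$), and $L_{reg}$ is the regular locus of $L$. *)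

theory Defs
  imports
    "HOL-Analysis.Analysis"
    "HOL-Library.Function_Algebras"
    "HOL-Algebra.QuotRing"
    "HOL-Algebra.Module"
    "HOL-Algebra.Generated_Groups"
    "HOL-Algebra.Free_Abelian_Groups"
begin

section \<open>Complex manifolds\<close>

text \<open>A function on an open subset of \<open>\<complex>\<^sup>k\<close> is holomorphic if it has a complex linear
  (Frechet) derivative at every point.\<close>

definition holo :: "(complex^'k \<Rightarrow> complex) \<Rightarrow> (complex^'k) set \<Rightarrow> bool" where
  "holo f S \<longleftrightarrow>
     (\<forall>x\<in>S. \<exists>D. (f has_derivative D) (at x) \<and> (\<forall>a v. D (a *s v) = a * D v))"

text \<open>A chart is a domain together with a coordinate map; a manifold is given by an atlas, which
  determines both its underlying set and its topology.\<close>

type_synonym ('a, 'k) chart = "'a set \<times> ('a \<Rightarrow> complex^'k)"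

definition chart_inv :: "('a, 'k) chart \<Rightarrow> complex^'k \<Rightarrow> 'a" where
  "chart_inv c = inv_into (fst c) (snd c)"

definition complex_atlas :: "('a, 'k::finite) chart set \<Rightarrow> bool" where
  "complex_atlas A \<longleftrightarrow>
     (\<forall>c\<in>A. inj_on (snd c) (fst c)) \<and>
     (\<forall>c\<in>A. \<forall>d\<in>A. open (snd c ` (fst c \<inter> fst d)) \<and>
        (\<forall>i. holo (\<lambda>z. snd d (chart_inv c z) $ i) (snd c ` (fst c \<inter> fst d))))"

definition mspace :: "('a, 'k) chart set \<Rightarrow> 'a set" where
  "mspace A = (\<Union>c\<in>A. fst c)"

definition mtop :: "('a, 'k::finite) chart set \<Rightarrow> 'a topology" where
  "mtop A = topology (\<lambda>S. S \<subseteq> mspace A \<and> (\<forall>c\<in>A. open (snd c ` (S \<inter> fst c))))"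

definition complex_manifold :: "('a, 'k::finite) chart set \<Rightarrow> bool" where
  "complex_manifold A \<longleftrightarrow>
     complex_atlas A \<and> Hausdorff_space (mtop A) \<and> second_countable (mtop A)"

text \<open>The charts of the maximal atlas.\<close>

definition compatible_chart :: "('a, 'k::finite) chart set \<Rightarrow> ('a, 'k) chart \<Rightarrow> bool" where
  "compatible_chart A c \<longleftrightarrow> fst c \<subseteq> mspace A \<and> complex_atlas (insert c A)"

definition mholo :: "('a, 'k::finite) chart set \<Rightarrow> 'a set \<Rightarrow> ('a \<Rightarrow> complex) \<Rightarrow> bool" where
  "mholo A U f \<longleftrightarrow> (\<forall>c\<in>A. holo (\<lambda>z. f (chart_inv c z)) (snd c ` (U \<inter> fst c)))"

definition holo_map ::
  "('a, 'k::finite) chart set \<Rightarrow> ('b, 'l::finite) chart set \<Rightarrow> 'a set \<Rightarrow> ('a \<Rightarrow> 'b) \<Rightarrow> bool" where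
  "holo_map A B U f \<longleftrightarrow>
     continuous_map (subtopology (mtop A) U) (mtop B) f \<and>
     (\<forall>d\<in>B. \<forall>i. mholo A {x\<in>U. f x \<in> fst d} (\<lambda>x. snd d (f x) $ i))"

definition analytic_subset :: "('a, 'k::finite) chart set \<Rightarrow> 'a set \<Rightarrow> bool" where
  "analytic_subset A S \<longleftrightarrow> S \<subseteq> mspace A \<and>
     (\<forall>p\<in>mspace A. \<exists>U F. openin (mtop A) U \<and> p \<in> U \<and> finite F \<and> (\<forall>f\<in>F. mholo A U f) \<and>
        S \<inter> U = {x\<in>U. \<forall>f\<in>F. f x = 0})"


section \<open>Tangent vectors and vector fields\<close>

text \<open>A tangent vector at \<open>p\<close> is the family of its components in all charts around \<open>p\<close>
  (and \<open>0\<close> in the remaining arguments), transforming with the Jacobi matrices of the coordinate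
  changes.\<close>

type_synonym ('a, 'k) tvec = "('a, 'k) chart \<Rightarrow> complex^'k"

definition tangent_space :: "('a, 'k::finite) chart set \<Rightarrow> 'a \<Rightarrow> ('a, 'k) tvec set" where
  "tangent_space A p = {v.
     (\<forall>c\<in>A. \<forall>d\<in>A. p \<in> fst c \<longrightarrow> p \<in> fst d \<longrightarrow>
        v d = frechet_derivative (\<lambda>z. snd d (chart_inv c z)) (at (snd c p)) (v c)) \<and>
     (\<forall>c. \<not> (c \<in> A \<and> p \<in> fst c) \<longrightarrow> v c = 0)}"

definition cscale :: "complex \<Rightarrow> ('a, 'k::finite) tvec \<Rightarrow> ('a, 'k) tvec" where
  "cscale a v = (\<lambda>c. a *s v c)"

text \<open>The coordinate vector \<open>\<partial>/\<partial>z\<^sub>i\<close> at \<open>p\<close> of a chart \<open>c\<close> of the maximal atlas.\<close>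

definition coord_vector ::
  "('a, 'k::finite) chart set \<Rightarrow> ('a, 'k) chart \<Rightarrow> 'k \<Rightarrow> 'a \<Rightarrow> ('a, 'k) tvec" where
  "coord_vector A c i p = (\<lambda>d. if d \<in> A \<and> p \<in> fst d
     then frechet_derivative (\<lambda>z. snd d (chart_inv c z)) (at (snd c p)) (axis i 1) else 0)"

text \<open>The differential of a holomorphic map at \<open>p\<close>, computed in any chart around \<open>p\<close>.\<close>

definition tangent_map ::
  "('a, 'k::finite) chart set \<Rightarrow> ('b, 'l::finite) chart set \<Rightarrow> ('a \<Rightarrow> 'b) \<Rightarrow> 'a \<Rightarrow>
    ('a, 'k) tvec \<Rightarrow> ('b, 'l) tvec" where
  "tangent_map A B f p v = (\<lambda>d. if d \<in> B \<and> f p \<in> fst d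
     then (let c = (SOME c. c \<in> A \<and> p \<in> fst c)
           in frechet_derivative (\<lambda>z. snd d (f (chart_inv c z))) (at (snd c p)) (v c))
     else 0)"

text \<open>The sections of the tangent sheaf over an open set \<open>U\<close>, extended by \<open>0\<close> outside \<open>U\<close>.\<close>

type_synonym ('a, 'k) vfield = "'a \<Rightarrow> ('a, 'k) tvec"

definition vfields :: "('a, 'k::finite) chart set \<Rightarrow> 'a set \<Rightarrow> ('a, 'k) vfield set" where
  "vfields A U = {X. (\<forall>p\<in>U. X p \<in> tangent_space A p) \<and> (\<forall>p. p \<notin> U \<longrightarrow> X p = 0) \<and>
     (\<forall>c\<in>A. \<forall>i. holo (\<lambda>z. X (chart_inv c z) c $ i) (snd c ` (U \<inter> fst c)))}"

definition vrestrict :: "'a set \<Rightarrow> ('a, 'k::finite) vfield \<Rightarrow> ('a, 'k) vfield" where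
  "vrestrict V X = (\<lambda>p. if p \<in> V then X p else 0)"

definition fscale :: "('a \<Rightarrow> complex) \<Rightarrow> ('a, 'k::finite) vfield \<Rightarrow> ('a, 'k) vfield" where
  "fscale f X = (\<lambda>p. cscale (f p) (X p))"

definition bracket ::
  "('a, 'k::finite) chart set \<Rightarrow> 'a set \<Rightarrow> ('a, 'k) vfield \<Rightarrow> ('a, 'k) vfield \<Rightarrow> ('a, 'k) vfield" where
  "bracket A U X Y = (\<lambda>p c. if p \<in> U \<and> c \<in> A \<and> p \<in> fst c
     then frechet_derivative (\<lambda>z. Y (chart_inv c z) c) (at (snd c p)) (X p c)
        - frechet_derivative (\<lambda>z. X (chart_inv c z) c) (at (snd c p)) (Y p c)
     else 0)"

text \<open>A basis of the tangent sheaf over \<open>U\<close>.\<close>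

definition frame :: "('a, 'k::finite) chart set \<Rightarrow> 'a set \<Rightarrow> ('k \<Rightarrow> ('a, 'k) vfield) \<Rightarrow> bool" where
  "frame A U \<delta> \<longleftrightarrow> (\<forall>i. \<delta> i \<in> vfields A U) \<and>
     (\<forall>p\<in>U. \<forall>v\<in>tangent_space A p. \<exists>!a :: complex^'k. v = (\<Sum>i\<in>UNIV. cscale (a $ i) (\<delta> i p)))"


section \<open>Multiplications on the tangent sheaf and F-manifolds\<close>

type_synonym ('a, 'k) tmult = "'a set \<Rightarrow> ('a, 'k) vfield \<Rightarrow> ('a, 'k) vfield \<Rightarrow> ('a, 'k) vfield"

text \<open>A commutative, associative, \<open>\<O>\<^sub>M\<close>-bilinear morphism of sheaves
  \<open>\<T>\<^sub>M \<times> \<T>\<^sub>M \<rightarrow> \<T>\<^sub>M\<close> (bilinearity in the second argument follows by commutativity), with a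
  global unit field \<open>e\<close>.\<close>

definition unital_mult ::
  "('a, 'k::finite) chart set \<Rightarrow> ('a, 'k) tmult \<Rightarrow> ('a, 'k) vfield \<Rightarrow> bool" where
  "unital_mult A m e \<longleftrightarrow>
     e \<in> vfields A (mspace A) \<and>
     (\<forall>U. openin (mtop A) U \<longrightarrow> (\<forall>X\<in>vfields A U. \<forall>Y\<in>vfields A U.
        m U X Y \<in> vfields A U \<and>
        m U X Y = m U Y X \<and>
        (\<forall>Z\<in>vfields A U. m U (m U X Y) Z = m U X (m U Y Z)) \<and>
        (\<forall>Z\<in>vfields A U. m U (X + Z) Y = m U X Y + m U Z Y) \<and>
        (\<forall>f. mholo A U f \<longrightarrow> m U (fscale f X) Y = fscale f (m U X Y)) \<and>
        (\<forall>V. openin (mtop A) V \<and> V \<subseteq> U \<longrightarrow>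
           m V (vrestrict V X) (vrestrict V Y) = vrestrict V (m U X Y)) \<and>
        m U (vrestrict U e) X = X))"

definition lie_mult ::
  "('a, 'k::finite) chart set \<Rightarrow> ('a, 'k) tmult \<Rightarrow> 'a set \<Rightarrow> ('a, 'k) vfield \<Rightarrow>
    ('a, 'k) vfield \<Rightarrow> ('a, 'k) vfield \<Rightarrow> ('a, 'k) vfield" where
  "lie_mult A m U X Z W =
     bracket A U X (m U Z W) - m U (bracket A U X Z) W - m U Z (bracket A U X W)"

definition F_manifold ::
  "('a, 'k::finite) chart set \<Rightarrow> ('a, 'k) tmult \<Rightarrow> ('a, 'k) vfield \<Rightarrow> bool" where
  "F_manifold A m e \<longleftrightarrow>
     complex_manifold A \<and> connected_space (mtop A) \<and> unital_mult A m e \<and>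
     (\<forall>U. openin (mtop A) U \<longrightarrow>
        (\<forall>X\<in>vfields A U. \<forall>Y\<in>vfields A U. \<forall>Z\<in>vfields A U. \<forall>W\<in>vfields A U.
           lie_mult A m U (m U X Y) Z W =
             m U X (lie_mult A m U Y Z W) + m U Y (lie_mult A m U X Z W)))"

text \<open>The multiplication induced on \<open>T\<^sub>pM\<close>: extend the two vectors to local vector fields, multiply
  these and evaluate at \<open>p\<close>; by \<open>\<O>\<^sub>M\<close>-bilinearity the result does not depend on the extensions.\<close>

definition fibre_mult ::
  "('a, 'k::finite) chart set \<Rightarrow> ('a, 'k) tmult \<Rightarrow> 'a \<Rightarrow> ('a, 'k) tvec \<Rightarrow> ('a, 'k) tvec \<Rightarrow>
    ('a, 'k) tvec" where
  "fibre_mult A m p v w = (THE u. \<exists>U X Y. openin (mtop A) U \<and> p \<in> U \<and>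
     X \<in> vfields A U \<and> Y \<in> vfields A U \<and> X p = v \<and> Y p = w \<and> m U X Y p = u)"

text \<open>In the next definition, \<open>*\<close> on \<open>complex^'k\<close> is the componentwise product.\<close>

definition semisimple_at :: "('a, 'k::finite) chart set \<Rightarrow> ('a, 'k) tmult \<Rightarrow> 'a \<Rightarrow> bool" where
  "semisimple_at A m p \<longleftrightarrow> (\<exists>f :: ('a, 'k) tvec \<Rightarrow> complex^'k.
     bij_betw f (tangent_space A p) UNIV \<and>
     (\<forall>v\<in>tangent_space A p. \<forall>w\<in>tangent_space A p. f (v + w) = f v + f w) \<and>
     (\<forall>a. \<forall>v\<in>tangent_space A p. f (cscale a v) = a *s f v) \<and>
     (\<forall>v\<in>tangent_space A p. \<forall>w\<in>tangent_space A p. f (fibre_mult A m p v w) = f v * f w))"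

definition caustic :: "('a, 'k::finite) chart set \<Rightarrow> ('a, 'k) tmult \<Rightarrow> 'a set" where
  "caustic A m = {p \<in> mspace A. \<not> semisimple_at A m p}"

definition massive :: "('a, 'k::finite) chart set \<Rightarrow> ('a, 'k) tmult \<Rightarrow> bool" where
  "massive A m \<longleftrightarrow> mtop A closure_of (mspace A - caustic A m) = mspace A"

text \<open>\<open>\<epsilon>\<close> represents the system of idempotent germs at \<open>p\<close>.  They are required to be nonzero, as
  otherwise a decomposition of \<open>e\<close> into fewer summands could be padded with zeros.\<close>

definition idempotents_at ::
  "('a, 'k::finite) chart set \<Rightarrow> ('a, 'k) tmult \<Rightarrow> ('a, 'k) vfield \<Rightarrow> 'a \<Rightarrow> 'a set \<Rightarrow>
    ('k \<Rightarrow> ('a, 'k) vfield) \<Rightarrow> bool" where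
  "idempotents_at A m e p U \<epsilon> \<longleftrightarrow>
     openin (mtop A) U \<and> p \<in> U \<and> (\<forall>i. \<epsilon> i \<in> vfields A U \<and> \<epsilon> i p \<noteq> 0) \<and>
     (\<forall>i j. m U (\<epsilon> i) (\<epsilon> j) = (if i = j then \<epsilon> i else 0)) \<and>
     (\<Sum>i\<in>UNIV. \<epsilon> i) = vrestrict U e"

definition germs_commute_at ::
  "('a, 'k::finite) chart set \<Rightarrow> 'a \<Rightarrow> 'a set \<Rightarrow> ('k \<Rightarrow> ('a, 'k) vfield) \<Rightarrow> bool" where
  "germs_commute_at A p U \<epsilon> \<longleftrightarrow> (\<forall>i j. \<exists>V. openin (mtop A) V \<and> p \<in> V \<and> V \<subseteq> U \<and>
     vrestrict V (bracket A U (\<epsilon> i) (\<epsilon> j)) = 0)"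

definition idempotents_commute ::
  "('a, 'k::finite) chart set \<Rightarrow> ('a, 'k) tmult \<Rightarrow> ('a, 'k) vfield \<Rightarrow> bool" where
  "idempotents_commute A m e \<longleftrightarrow> (\<forall>p \<in> mspace A - caustic A m.
     (\<exists>U \<epsilon>. idempotents_at A m e p U \<epsilon>) \<and>
     (\<forall>U \<epsilon>. idempotents_at A m e p U \<epsilon> \<longrightarrow> germs_commute_at A p U \<epsilon>))"


section \<open>The cotangent bundle\<close>

text \<open>Linear forms on \<open>T\<^sub>pM\<close>, extended by \<open>0\<close>.\<close>

definition cotangent_space ::
  "('a, 'k::finite) chart set \<Rightarrow> 'a \<Rightarrow> (('a, 'k) tvec \<Rightarrow> complex) set" where
  "cotangent_space A p = {l.
     (\<forall>v\<in>tangent_space A p. \<forall>w\<in>tangent_space A p. l (v + w) = l v + l w) \<and>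
     (\<forall>a. \<forall>v\<in>tangent_space A p. l (cscale a v) = a * l v) \<and>
     (\<forall>v. v \<notin> tangent_space A p \<longrightarrow> l v = 0)}"

type_synonym ('a, 'k) cotpoint = "'a \<times> (('a, 'k) tvec \<Rightarrow> complex)"

text \<open>A chart \<open>c\<close> with coordinates \<open>t\<^sub>i\<close> induces coordinates \<open>(t\<^sub>i, y\<^sub>i)\<close> on the cotangent bundle,
  where \<open>y\<^sub>i\<close> is evaluation at \<open>\<partial>/\<partial>t\<^sub>i\<close>; \<open>t\<^sub>i\<close> has index \<open>Inl i\<close> and \<open>y\<^sub>i\<close> has index \<open>Inr i\<close>.\<close>

definition cot_chart ::
  "('a, 'k::finite) chart set \<Rightarrow> ('a, 'k) chart \<Rightarrow> (('a, 'k) cotpoint, 'k + 'k) chart" where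
  "cot_chart A c =
     ({q. fst q \<in> fst c \<and> snd q \<in> cotangent_space A (fst q)},
      \<lambda>q. \<chi> s. case s of Inl i \<Rightarrow> snd c (fst q) $ i
                       | Inr i \<Rightarrow> snd q (coord_vector A c i (fst q)))"

definition cot_atlas ::
  "('a, 'k::finite) chart set \<Rightarrow> (('a, 'k) cotpoint, 'k + 'k) chart set" where
  "cot_atlas A = cot_chart A ` A"

text \<open>The canonical 1-form \<open>\<Sum>\<^sub>i y\<^sub>i dt\<^sub>i\<close>: its value at \<open>q = (p, \<lambda>)\<close> is \<open>\<lambda> \<circ> d\<pi>\<close>.\<close>

definition canonical_form ::
  "('a, 'k::finite) chart set \<Rightarrow> ('a, 'k) cotpoint \<Rightarrow> (('a, 'k) cotpoint, 'k + 'k) tvec \<Rightarrow> complex"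
  where
  "canonical_form A q \<xi> = snd q (tangent_map (cot_atlas A) A fst q \<xi>)"


section \<open>Submanifold charts and Lagrange varieties\<close>

text \<open>A chart of the ambient manifold in which \<open>S\<close> is the coordinate plane \<open>z\<^sub>k = 0\<close> for
  \<open>k \<notin> J\<close>; the \<open>z\<^sub>j\<close> with \<open>j \<in> J\<close> are then coordinates on \<open>S\<close>.\<close>

definition submanifold_chart ::
  "('a, 'k::finite) chart set \<Rightarrow> 'a set \<Rightarrow> ('a, 'k) chart \<Rightarrow> 'k set \<Rightarrow> bool" where
  "submanifold_chart A S c J \<longleftrightarrow> compatible_chart A c \<and>
     S \<inter> fst c = {x \<in> fst c. \<forall>k. k \<notin> J \<longrightarrow> snd c x $ k = 0}"

definition regular_locus :: "('a, 'k::finite) chart set \<Rightarrow> 'a set \<Rightarrow> 'a set" where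
  "regular_locus A S = {x \<in> S. \<exists>c J. submanifold_chart A S c J \<and> x \<in> fst c}"

text \<open>Closedness of the restriction of a holomorphic 1-form \<open>\<omega>\<close> to the manifold
  \<open>regular_locus A S\<close>: in coordinates \<open>z\<^sub>j\<close> (\<open>j \<in> J\<close>) of the latter the restriction is
  \<open>\<Sum>\<^sub>j a\<^sub>j dz\<^sub>j\<close> with \<open>a\<^sub>j = \<omega>(\<partial>/\<partial>z\<^sub>j)\<close>, and the condition is
  \<open>\<partial>a\<^sub>k/\<partial>z\<^sub>j = \<partial>a\<^sub>j/\<partial>z\<^sub>k\<close> for \<open>j, k \<in> J\<close>.\<close>

definition form_partial ::
  "('a, 'k::finite) chart set \<Rightarrow> ('a \<Rightarrow> ('a, 'k) tvec \<Rightarrow> complex) \<Rightarrow> ('a, 'k) chart \<Rightarrow>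
    'k \<Rightarrow> 'k \<Rightarrow> 'a \<Rightarrow> complex" where
  "form_partial A \<omega> c j k x =
     frechet_derivative (\<lambda>z. \<omega> (chart_inv c z) (coord_vector A c k (chart_inv c z)))
       (at (snd c x)) (axis j 1)"

definition closed_on_regular_locus ::
  "('a, 'k::finite) chart set \<Rightarrow> 'a set \<Rightarrow> ('a \<Rightarrow> ('a, 'k) tvec \<Rightarrow> complex) \<Rightarrow> bool" where
  "closed_on_regular_locus A S \<omega> \<longleftrightarrow>
     (\<forall>c J. submanifold_chart A S c J \<longrightarrow>
        (\<forall>x \<in> regular_locus A S \<inter> fst c. \<forall>j\<in>J. \<forall>k\<in>J.
           form_partial A \<omega> c j k x = form_partial A \<omega> c k j x))"

definition lagrange_variety ::
  "('a, 'k::finite) chart set \<Rightarrow> ('a, 'k) cotpoint set \<Rightarrow> bool" where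
  "lagrange_variety A L \<longleftrightarrow> closed_on_regular_locus (cot_atlas A) L (canonical_form A)"


section \<open>Local rings\<close>

text \<open>The ring of functions holomorphic in some neighbourhood of \<open>p\<close>, the ideal of those vanishing
  in some neighbourhood of \<open>p\<close>, and their quotient \<open>\<O>\<^sub>M\<^sub>,\<^sub>p\<close>.\<close>

definition near_ring :: "('a, 'k::finite) chart set \<Rightarrow> 'a \<Rightarrow> ('a \<Rightarrow> complex) ring" where
  "near_ring A p =
     \<lparr>carrier = {f. \<exists>U. openin (mtop A) U \<and> p \<in> U \<and> mholo A U f},
      monoid.mult = (\<lambda>f g x. f x * g x), monoid.one = (\<lambda>x. 1),
      ring.zero = (\<lambda>x. 0), ring.add = (\<lambda>f g x. f x + g x)\<rparr>"

definition vanish_near :: "('a, 'k::finite) chart set \<Rightarrow> 'a \<Rightarrow> ('a \<Rightarrow> complex) set" where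
  "vanish_near A p = {f. \<exists>U. openin (mtop A) U \<and> p \<in> U \<and> (\<forall>x\<in>U. f x = 0)}"

definition local_ring :: "('a, 'k::finite) chart set \<Rightarrow> 'a \<Rightarrow> ('a \<Rightarrow> complex) set ring" where
  "local_ring A p = near_ring A p Quot vanish_near A p"

definition germ ::
  "('a, 'k::finite) chart set \<Rightarrow> 'a \<Rightarrow> ('a \<Rightarrow> complex) \<Rightarrow> ('a \<Rightarrow> complex) set" where
  "germ A p f = vanish_near A p +>\<^bsub>near_ring A p\<^esub> f"

definition reduced_ring :: "('r, 's) ring_scheme \<Rightarrow> bool" where
  "reduced_ring R \<longleftrightarrow>
     (\<forall>x\<in>carrier R. \<forall>n::nat. x [^]\<^bsub>R\<^esub> n = \<zero>\<^bsub>R\<^esub> \<longrightarrow> x = \<zero>\<^bsub>R\<^esub>)"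


section \<open>The analytic spectrum\<close>

definition spectrum ::
  "('a, 'k::finite) chart set \<Rightarrow> ('a, 'k) tmult \<Rightarrow> ('a, 'k) vfield \<Rightarrow> ('a, 'k) cotpoint set" where
  "spectrum A m e = {(p, l). p \<in> mspace A \<and> l \<in> cotangent_space A p \<and> l (e p) = 1 \<and>
     (\<forall>v\<in>tangent_space A p. \<forall>w\<in>tangent_space A p. l (fibre_mult A m p v w) = l v * l w)}"

definition fibre_fun :: "('a, 'k::finite) vfield \<Rightarrow> ('a, 'k) cotpoint \<Rightarrow> complex" where
  "fibre_fun X q = snd q (X (fst q))"

text \<open>The functions \<open>y\<^sub>1 - 1\<close> and \<open>y\<^sub>i y\<^sub>j - \<Sum>\<^sub>k a\<^sub>i\<^sub>j\<^sup>k y\<^sub>k\<close> for all bases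
  \<open>\<delta>\<close> of the tangent sheaf near \<open>fst q\<close> that have \<open>e\<close> as a member.  Each basis separately
  generates the same ideal of germs, so taking all of them only avoids a choice.\<close>

definition spectrum_equations ::
  "('a, 'k::finite) chart set \<Rightarrow> ('a, 'k) tmult \<Rightarrow> ('a, 'k) vfield \<Rightarrow> ('a, 'k) cotpoint \<Rightarrow>
    (('a, 'k) cotpoint \<Rightarrow> complex) set" where
  "spectrum_equations A m e q = {g. \<exists>U \<delta> i\<^sub>1 a.
     openin (mtop A) U \<and> fst q \<in> U \<and> frame A U \<delta> \<and> \<delta> i\<^sub>1 = vrestrict U e \<and>
     (\<forall>i j k. mholo A U (a i j k)) \<and>
     (\<forall>i j. m U (\<delta> i) (\<delta> j) = (\<Sum>k\<in>UNIV. fscale (a i j k) (\<delta> k))) \<and>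
     (g = (\<lambda>r. fibre_fun (\<delta> i\<^sub>1) r - 1) \<or>
      (\<exists>i j. g = (\<lambda>r. fibre_fun (\<delta> i) r * fibre_fun (\<delta> j) r
                        - (\<Sum>k\<in>UNIV. a i j k (fst r) * fibre_fun (\<delta> k) r))))}"

definition spectrum_ideal ::
  "('a, 'k::finite) chart set \<Rightarrow> ('a, 'k) tmult \<Rightarrow> ('a, 'k) vfield \<Rightarrow> ('a, 'k) cotpoint \<Rightarrow>
    (('a, 'k) cotpoint \<Rightarrow> complex) set set" where
  "spectrum_ideal A m e q =
     Idl\<^bsub>local_ring (cot_atlas A) q\<^esub> (germ (cot_atlas A) q ` spectrum_equations A m e q)"

definition spectrum_local_ring ::
  "('a, 'k::finite) chart set \<Rightarrow> ('a, 'k) tmult \<Rightarrow> ('a, 'k) vfield \<Rightarrow> ('a, 'k) cotpoint \<Rightarrow>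
    (('a, 'k) cotpoint \<Rightarrow> complex) set set ring" where
  "spectrum_local_ring A m e q = local_ring (cot_atlas A) q Quot spectrum_ideal A m e q"

text \<open>The homomorphism \<open>\<O>\<^sub>M\<^sub>,\<^sub>\<pi>\<^sub>(\<^sub>q\<^sub>) \<rightarrow> \<O>\<^sub>L\<^sub>,\<^sub>q\<close> given by composition with \<open>\<pi>\<close>.\<close>

definition spectrum_pullback ::
  "('a, 'k::finite) chart set \<Rightarrow> ('a, 'k) tmult \<Rightarrow> ('a, 'k) vfield \<Rightarrow> ('a, 'k) cotpoint \<Rightarrow>
    ('a \<Rightarrow> complex) set \<Rightarrow> (('a, 'k) cotpoint \<Rightarrow> complex) set set" where
  "spectrum_pullback A m e q G =
     spectrum_ideal A m e q +>\<^bsub>local_ring (cot_atlas A) q\<^esub>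
       (\<Union>f\<in>G. germ (cot_atlas A) q (\<lambda>r. f (fst r)))"


section \<open>Flatness\<close>

definition tensor_relations ::
  "('r, 's) ring_scheme \<Rightarrow> ('r, 'x) module \<Rightarrow> ('r, 'y) module \<Rightarrow> ('x \<times> 'y \<Rightarrow>\<^sub>0 int) set" where
  "tensor_relations R N F = generate (free_Abelian_group (carrier N \<times> carrier F))
     ({frag_of (x \<oplus>\<^bsub>N\<^esub> x', y) - frag_of (x, y) - frag_of (x', y) | x x' y.
         x \<in> carrier N \<and> x' \<in> carrier N \<and> y \<in> carrier F} \<union>
      {frag_of (x, y \<oplus>\<^bsub>F\<^esub> y') - frag_of (x, y) - frag_of (x, y') | x y y'.
         x \<in> carrier N \<and> y \<in> carrier F \<and> y' \<in> carrier F} \<union>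
      {frag_of (r \<odot>\<^bsub>N\<^esub> x, y) - frag_of (x, r \<odot>\<^bsub>F\<^esub> y) | r x y.
         r \<in> carrier R \<and> x \<in> carrier N \<and> y \<in> carrier F})"

definition tensor_product ::
  "('r, 's) ring_scheme \<Rightarrow> ('r, 'x) module \<Rightarrow> ('r, 'y) module \<Rightarrow> ('x \<times> 'y \<Rightarrow>\<^sub>0 int) set monoid" where
  "tensor_product R N F =
     free_Abelian_group (carrier N \<times> carrier F) Mod tensor_relations R N F"

text \<open>The map \<open>f \<otimes> id : N \<otimes> F \<rightarrow> N' \<otimes> F\<close> on cosets.\<close>

definition tensor_map ::
  "('r, 's) ring_scheme \<Rightarrow> ('r, 'z) module \<Rightarrow> ('r, 'y) module \<Rightarrow> ('x \<Rightarrow> 'z) \<Rightarrow>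
    ('x \<times> 'y \<Rightarrow>\<^sub>0 int) set \<Rightarrow> ('z \<times> 'y \<Rightarrow>\<^sub>0 int) set" where
  "tensor_map R N' F f C = (\<Union>c\<in>C.
     tensor_relations R N' F #>\<^bsub>free_Abelian_group (carrier N' \<times> carrier F)\<^esub>
       frag_extend (\<lambda>(x, y). frag_of (f x, y)) c)"

text \<open>\<open>F\<close> is flat if tensoring with \<open>F\<close> preserves injectivity.  The modules \<open>N\<close> and \<open>N'\<close> range
  over all modules with elements of type \<open>'x\<close> and \<open>'z\<close>; a theorem that concludes flatness with
  these as type variables asserts it for all modules.\<close>

definition flat_module ::
  "'x itself \<Rightarrow> 'z itself \<Rightarrow> ('r, 's) ring_scheme \<Rightarrow> ('r, 'y) module \<Rightarrow> bool" where
  "flat_module _ _ R F \<longleftrightarrow> Module.module R F \<and>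
     (\<forall>(N :: ('r, 'x) module) (N' :: ('r, 'z) module) f.
        Module.module R N \<and> Module.module R N' \<and>
        f \<in> carrier N \<rightarrow> carrier N' \<and> inj_on f (carrier N) \<and>
        (\<forall>x\<in>carrier N. \<forall>y\<in>carrier N. f (x \<oplus>\<^bsub>N\<^esub> y) = f x \<oplus>\<^bsub>N'\<^esub> f y) \<and>
        (\<forall>r\<in>carrier R. \<forall>x\<in>carrier N. f (r \<odot>\<^bsub>N\<^esub> x) = r \<odot>\<^bsub>N'\<^esub> f x) \<longrightarrow>
        inj_on (tensor_map R N' F f) (carrier (tensor_product R N F)))"

text \<open>\<open>S\<close> as a module over the source of a ring homomorphism \<open>h\<close> into \<open>S\<close>.\<close>

definition restrict_scalars :: "('r \<Rightarrow> 'y) \<Rightarrow> 'y ring \<Rightarrow> ('r, 'y) module" where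
  "restrict_scalars h S =
     \<lparr>carrier = carrier S, monoid.mult = monoid.mult S, monoid.one = monoid.one S,
      ring.zero = ring.zero S, ring.add = ring.add S, module.smult = (\<lambda>r y. h r \<otimes>\<^bsub>S\<^esub> y)\<rparr>"

definition spectrum_flat ::
  "'x itself \<Rightarrow> 'z itself \<Rightarrow> ('a, 'k::finite) chart set \<Rightarrow> ('a, 'k) tmult \<Rightarrow> ('a, 'k) vfield \<Rightarrow> bool"
  where
  "spectrum_flat tx tz A m e \<longleftrightarrow> (\<forall>q\<in>spectrum A m e.
     spectrum_pullback A m e q \<in> ring_hom (local_ring A (fst q)) (spectrum_local_ring A m e q) \<and>
     flat_module tx tz (local_ring A (fst q))
       (restrict_scalars (spectrum_pullback A m e q) (spectrum_local_ring A m e q)))"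


section \<open>Finite maps and branched coverings\<close>

definition finite_map :: "'a topology \<Rightarrow> 'b topology \<Rightarrow> ('a \<Rightarrow> 'b) \<Rightarrow> bool" where
  "finite_map X Y f \<longleftrightarrow> continuous_map X Y f \<and> proper_map X Y f \<and>
     (\<forall>y\<in>topspace Y. finite {x\<in>topspace X. f x = y})"

text \<open>The restriction of \<open>f\<close> to the subvariety \<open>L\<close> of \<open>B\<close> is a branched covering of \<open>A\<close> of degree
  \<open>d\<close>, branched precisely above the thin set \<open>K\<close>: off \<open>K\<close> it is locally a disjoint union of
  \<open>d\<close> sheets mapped biholomorphically, while points of \<open>K\<close> have less than \<open>d\<close> preimages.\<close>

definition branched_covering ::
  "('b, 'l::finite) chart set \<Rightarrow> 'b set \<Rightarrow> ('a, 'k::finite) chart set \<Rightarrow> ('b \<Rightarrow> 'a) \<Rightarrow> nat \<Rightarrow>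
    'a set \<Rightarrow> bool" where
  "branched_covering B L A f d K \<longleftrightarrow>
     holo_map B A (mspace B) f \<and>
     finite_map (subtopology (mtop B) L) (mtop A) f \<and>
     f ` L = mspace A \<and>
     analytic_subset A K \<and>
     mtop A interior_of K = {} \<and>
     subtopology (mtop B) L interior_of {x\<in>L. f x \<in> K} = {} \<and>
     (\<forall>p \<in> mspace A - K. \<exists>U V. openin (mtop A) U \<and> p \<in> U \<and> U \<inter> K = {} \<and>
        (\<forall>i<d. openin (subtopology (mtop B) L) (V i) \<and> bij_betw f (V i) U \<and>
               holo_map A B U (inv_into (V i) f)) \<and>
        disjoint_family_on V {..<d} \<and>
        {x\<in>L. f x \<in> U} = (\<Union>i<d. V i)) \<and>
     (\<forall>p\<in>K. card {x\<in>L. f x = p} < d)"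

end

theory Submission
  imports Defs "HOL-Complex_Analysis.Cauchy_Integral_Formula"
begin

text \<open>Near a point of \<open>M\<close> the multiplication is a holomorphic family of commutative algebras on \<open>\<complex>\<^sup>n\<close>,
  and the fibre of \<open>L\<close> consists of the characters of the algebra.  A point is semisimple iff there are \<open>n\<close>
  characters iff the discriminant, the determinant of \<open>tr(\<partial>\<^sub>i \<circ> \<partial>\<^sub>j)\<close>, does not vanish.  Such points are
  dense, so identities between vector fields can be tested on characters over semisimple points.

  Let \<open>q \<in> L\<close> lie over \<open>p\<close>.  A Riesz projection yields an idempotent germ \<open>\<epsilon>\<close> at \<open>p\<close> that splits the
  character \<open>q\<close> from the others.  Weierstrass division by the characteristic polynomials of the
  multiplications by \<open>\<partial>\<^sub>i\<close> reduces every germ at \<open>q\<close> modulo the equations of \<open>L\<close> to a fibrewise linear function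
  \<open>y(X)\<close>.  If it vanishes on \<open>L\<close>, then \<open>\<epsilon> \<circ> X = 0\<close> by density, and \<open>y(X)\<close> lies in the ideal because
  \<open>y(\<epsilon>) - 1\<close> does.  So the ideal is reduced, and \<open>y(X) \<mapsto> \<epsilon> \<circ> X\<close> identifies the local ring of \<open>L\<close> at \<open>q\<close> with a
  direct summand of the free module of germs of vector fields at \<open>p\<close>, which is flat.

  All three conditions say that each sheet of \<open>L\<close> over the semisimple points, read as a 1-form \<open>l\<close>,
  is closed.  For (iii) this is the local form \<open>\<Sum>\<^sub>i dy\<^sub>i \<and> dt\<^sub>i\<close> of the differential of \<open>\<alpha>\<close>.  For (ii)
  it is \<open>dl(e\<^sub>i, e\<^sub>j) = - l([e\<^sub>i, e\<^sub>j])\<close>, as the functions \<open>l(e\<^sub>i)\<close> are constant.  In an F-manifold the identity for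
  \<open>e\<^sub>i \<circ> e\<^sub>i = e\<^sub>i\<close> makes the Lie derivative of the multiplication along \<open>e\<^sub>i\<close> vanish, whence \<open>[e\<^sub>i, e\<^sub>j] = 2 e\<^sub>j \<circ> [e\<^sub>i, e\<^sub>j]\<close>
  and so \<open>[e\<^sub>i, e\<^sub>j] = 0\<close>.  Conversely, for closed \<open>l\<close> the value of \<open>l\<close> on the Lie derivative of the
  multiplication along \<open>X\<close> is a derivation in the function \<open>l(X)\<close>.\<close>

section \<open>Holomorphic functions of several variables\<close>

text \<open>\<open>holo\<close> asks for a complex linear derivative at each point and nothing about
  how it varies, so holomorphy of partial derivatives, their symmetry and holomorphic dependence of
  integrals on parameters are all won from Cauchy's formula on complex lines. The obstacle is the
  caustic: there the algebras have nilpotents, the characters no longer separate vectors, their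
  number drops, and there is no idempotent frame. Two facts get around it. Characters are bounded by
  the structure constants, so those over nearby points cannot stray from the ones over p. Traces,
  determinants and products are holomorphic in the base point, so bounds and identities read off
  from characters at semisimple points pass to the limit. Division in a fibre coordinate needs a
  polynomial in that coordinate alone which lies in the ideal; a characteristic polynomial qualifies
  at every point because its coefficients depend on the base only. Flatness speaks of arbitrary
  modules, so the direct summand is presented by an explicit finite dual basis, which can be applied
  to formal sums.\<close>

definition pd :: "'k::finite \<Rightarrow> (complex^'k \<Rightarrow> complex) \<Rightarrow> complex^'k \<Rightarrow> complex" where
  "pd i f z = frechet_derivative f (at z) (axis i 1)"

definition hmap :: "(complex^'k::finite \<Rightarrow> complex^'l::finite) \<Rightarrow> (complex^'k) set \<Rightarrow> bool" where
  "hmap F S \<longleftrightarrow> (\<forall>i. holo (\<lambda>z. F z $ i) S)"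

lemma norm_smult_vec: "norm (a *s (v :: complex^'k::finite)) = cmod a * norm v"
  by (simp add: norm_vec_def norm_mult L2_set_right_distrib)

lemma bounded_linear_smult_vec: "bounded_linear (\<lambda>a. a *s (v :: complex^'k::finite))"
  by (rule bounded_linear_intro[where K="norm v"])
     (simp_all add: norm_smult_vec vec_eq_iff scaleR_conv_of_real[symmetric] algebra_simps)

lemma hd_linear:
  assumes "(f has_derivative D) (at x)" "\<forall>a v. D (a *s v) = a * D (v :: complex^'k::finite)"
  shows "D v = (\<Sum>i\<in>UNIV. v $ i * (D (axis i 1) :: complex))"
proof -
  have lin: "linear D" using assms(1) has_derivative_linear by blast
  have "D v = D (\<Sum>i\<in>UNIV. v $ i *s axis i 1)"
    by (simp only: basis_expansion)
  also have "\<dots> = (\<Sum>i\<in>UNIV. v $ i * D (axis i 1))"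
    unfolding linear_sum[OF lin] assms(2)[rule_format] ..
  finally show ?thesis .
qed

text \<open>Derivatives are unique, so one formula for the total derivative gives holomorphy through
  \<open>holoI\<close> and the partials through this lemma; the \<open>hd_\<close> rules below are
  stated for that double use.\<close>

lemma pd_eqI:
  assumes "(f has_derivative (\<lambda>v. \<Sum>i\<in>UNIV. v $ i * d i)) (at (x :: complex^'k::finite))"
  shows "pd i f x = d i"
proof -
  have "frechet_derivative f (at x) = (\<lambda>v. \<Sum>i\<in>UNIV. v $ i * d i)"
    using frechet_derivative_at[OF assms] by simp
  then have "pd i f x = (\<Sum>j\<in>UNIV. (axis i 1 :: complex^'k) $ j * d j)"
    by (simp add: pd_def)
  also have "\<dots> = (\<Sum>j\<in>UNIV. if j = i then d j else 0)"
    by (rule sum.cong) (auto simp: axis_def)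
  finally show ?thesis by simp
qed

lemma holo_has_derivative:
  assumes "holo f S" "x \<in> S"
  shows "(f has_derivative (\<lambda>v. \<Sum>i\<in>UNIV. v $ i * pd i f x)) (at (x :: complex^'k::finite))"
proof -
  from assms obtain D where D: "(f has_derivative D) (at x)" "\<forall>a v. D (a *s v) = a * D v"
    unfolding holo_def by blast
  have "D = (\<lambda>v. \<Sum>i\<in>UNIV. v $ i * D (axis i 1))"
    using hd_linear[OF D] by blast
  with D(1) have D': "(f has_derivative (\<lambda>v. \<Sum>i\<in>UNIV. v $ i * D (axis i 1))) (at x)"
    by simp
  show ?thesis using D' by (simp add: pd_eqI[OF D'])
qed

lemma holoI:
  assumes "\<And>x. x \<in> S \<Longrightarrow> (f has_derivative (\<lambda>v. \<Sum>i\<in>UNIV. v $ i * d x i)) (at (x :: complex^'k::finite))"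
  shows "holo f S"
  unfolding holo_def
proof
  fix x assume "x \<in> S"
  then have "(f has_derivative (\<lambda>v. \<Sum>i\<in>UNIV. v $ i * d x i)) (at x)" using assms by blast
  then show "\<exists>D. (f has_derivative D) (at x) \<and> (\<forall>a v. D (a *s v) = a * D v)"
    by (intro exI conjI) (auto simp: sum_distrib_left algebra_simps)
qed

lemma holo_continuous_on: "holo f S \<Longrightarrow> continuous_on S f"
  unfolding holo_def
  by (meson continuous_at_imp_continuous_on has_derivative_continuous)

lemma holo_subset: "holo f S \<Longrightarrow> T \<subseteq> S \<Longrightarrow> holo f T"
  unfolding holo_def by blast

lemma holo_local:
  assumes "\<And>x. x \<in> S \<Longrightarrow> \<exists>T g. open T \<and> x \<in> T \<and> holo g T \<and> (\<forall>y\<in>T. f y = g y)"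
  shows "holo f (S :: (complex^'k::finite) set)"
proof (rule holoI)
  fix x assume "x \<in> S"
  then obtain T g where T: "open T" "x \<in> T" "holo g T" "\<forall>y\<in>T. f y = g y" using assms by blast
  have h: "(f has_derivative (\<lambda>v. \<Sum>i\<in>UNIV. v $ i * pd i g x)) (at x)"
    by (rule has_derivative_transform_within_open[OF holo_has_derivative[OF T(3,2)] T(1,2)])
       (use T in auto)
  show "(f has_derivative (\<lambda>v. \<Sum>i\<in>UNIV. v $ i * pd i f x)) (at x)"
    unfolding pd_eqI[OF h] by (rule h)
qed

lemma holo_cong:
  assumes "open S" "\<And>x. x \<in> S \<Longrightarrow> f x = g x" "holo g (S :: (complex^'k::finite) set)"
  shows "holo f S"
  by (rule holo_local) (use assms in blast)

lemma pd_cong: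
  assumes "open S" "x \<in> S" "\<And>y. y \<in> S \<Longrightarrow> f y = g y" "holo g (S :: (complex^'k::finite) set)"
  shows "pd i f x = pd i g x"
proof -
  have "(f has_derivative (\<lambda>v. \<Sum>i\<in>UNIV. v $ i * pd i g x)) (at x)"
    by (rule has_derivative_transform_within_open[OF holo_has_derivative[OF assms(4,2)] assms(1,2)])
       (use assms in auto)
  then show ?thesis by (rule pd_eqI)
qed

lemma holo_const: "holo (\<lambda>z. c) S"
  by (rule holoI[where d="\<lambda>x i. 0"]) simp

lemma pd_const: "pd i (\<lambda>z. c) x = 0"
  by (rule pd_eqI[where d="\<lambda>i. 0"]) simp

lemma hd_coord: "((\<lambda>z. z $ k) has_derivative (\<lambda>v. \<Sum>i\<in>UNIV. v $ i * (if i = k then 1 else 0)))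
   (at (x :: complex^'k::finite))"
  by (simp add: if_distrib cong: if_cong) (rule bounded_linear_imp_has_derivative, rule bounded_linear_vec_nth)

lemma holo_coord: "holo (\<lambda>z. z $ k) (S :: (complex^'k::finite) set)"
  by (rule holoI, rule hd_coord)

lemma pd_coord: "pd i (\<lambda>z. z $ k) (x :: complex^'k::finite) = (if i = k then 1 else 0)"
  by (rule pd_eqI[OF hd_coord])

lemma hd_add:
  assumes "holo f S" "holo g S" "x \<in> S"
  shows "((\<lambda>z. f z + g z) has_derivative (\<lambda>v. \<Sum>i\<in>UNIV. v $ i * (pd i f x + pd i g x)))
    (at (x :: complex^'k::finite))"
  using has_derivative_add[OF holo_has_derivative[OF assms(1,3)] holo_has_derivative[OF assms(2,3)]]
  by (simp add: sum.distrib algebra_simps)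

lemma hd_mult:
  assumes "holo f S" "holo g S" "x \<in> S"
  shows "((\<lambda>z. f z * g z) has_derivative (\<lambda>v. \<Sum>i\<in>UNIV. v $ i * (f x * pd i g x + pd i f x * g x)))
    (at (x :: complex^'k::finite))"
proof -
  have "(\<lambda>h. f x * (\<Sum>i\<in>UNIV. h $ i * pd i g x) + (\<Sum>i\<in>UNIV. h $ i * pd i f x) * g x)
    = (\<lambda>v. \<Sum>i\<in>UNIV. v $ i * (f x * pd i g x + pd i f x * g x))"
    by (simp add: fun_eq_iff sum_distrib_left sum_distrib_right sum.distrib[symmetric] algebra_simps)
  then show ?thesis
    using has_derivative_mult[OF holo_has_derivative[OF assms(1,3)] holo_has_derivative[OF assms(2,3)]]
    by simp
qed

lemma holo_add: "holo f S \<Longrightarrow> holo g S \<Longrightarrow> holo (\<lambda>z. f z + g z) S"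
  by (rule holoI, rule hd_add)

lemma holo_mult: "holo f S \<Longrightarrow> holo g S \<Longrightarrow> holo (\<lambda>z. f z * g z) S"
  by (rule holoI, rule hd_mult)

lemma pd_add: "holo f S \<Longrightarrow> holo g S \<Longrightarrow> x \<in> S \<Longrightarrow> pd i (\<lambda>z. f z + g z) x = pd i f x + pd i g x"
  by (rule pd_eqI[OF hd_add])

lemma pd_mult: "holo f S \<Longrightarrow> holo g S \<Longrightarrow> x \<in> S \<Longrightarrow>
   pd i (\<lambda>z. f z * g z) x = f x * pd i g x + pd i f x * g x"
  by (rule pd_eqI[OF hd_mult])

lemma holo_uminus: "holo f S \<Longrightarrow> holo (\<lambda>z. - f z) S"
  using holo_mult[OF holo_const[of "-1"]] by simp

lemma holo_diff: "holo f S \<Longrightarrow> holo g S \<Longrightarrow> holo (\<lambda>z. f z - g z) S"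
  using holo_add[OF _ holo_uminus, of f S g] by simp

lemma holo_sum: "(\<And>i. i \<in> I \<Longrightarrow> holo (f i) S) \<Longrightarrow> holo (\<lambda>z. \<Sum>i\<in>I. f i z) S"
  by (induction I rule: infinite_finite_induct) (auto intro: holo_const holo_add)

lemma pd_sum: "(\<And>i. i \<in> I \<Longrightarrow> holo (f i) S) \<Longrightarrow> x \<in> S \<Longrightarrow>
   pd k (\<lambda>z. \<Sum>i\<in>I. f i z) x = (\<Sum>i\<in>I. pd k (f i) x)"
proof (induction I rule: infinite_finite_induct)
  case (insert a I)
  then show ?case using pd_add[of "f a" S "\<lambda>z. \<Sum>i\<in>I. f i z" x k] holo_sum[of I f S] by auto
qed (auto simp: pd_const)

lemma holo_prod: "(\<And>i. i \<in> I \<Longrightarrow> holo (f i) S) \<Longrightarrow> holo (\<lambda>z. \<Prod>i\<in>I. f i z) S"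
  by (induction I rule: infinite_finite_induct) (auto intro: holo_const holo_mult)

lemma holo_power: "holo f S \<Longrightarrow> holo (\<lambda>z. f z ^ n) S"
  by (induction n) (auto intro: holo_const holo_mult)

lemma hd_inverse:
  assumes "holo f S" "x \<in> S" "f x \<noteq> 0"
  shows "((\<lambda>z. inverse (f z)) has_derivative
      (\<lambda>v. \<Sum>i\<in>UNIV. v $ i * (- (inverse (f x) * pd i f x * inverse (f x))))) (at (x :: complex^'k::finite))"
  using Deriv.has_derivative_inverse[OF assms(3) holo_has_derivative[OF assms(1,2)]]
  by (simp add: sum_distrib_left sum_distrib_right sum_negf[symmetric] algebra_simps)

lemma holo_inverse: "holo f S \<Longrightarrow> (\<And>x. x \<in> S \<Longrightarrow> f x \<noteq> 0) \<Longrightarrow> holo (\<lambda>z. inverse (f z)) S"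
  by (rule holoI, rule hd_inverse) auto

lemma holo_divide: "holo f S \<Longrightarrow> holo g S \<Longrightarrow> (\<And>x. x \<in> S \<Longrightarrow> g x \<noteq> 0) \<Longrightarrow> holo (\<lambda>z. f z / g z) S"
  unfolding divide_inverse by (intro holo_mult holo_inverse)

section \<open>Holomorphic maps and the chain rule\<close>

lemma hmap_hd:
  fixes F :: "complex^'k::finite \<Rightarrow> complex^'l::finite"
  assumes "hmap F S" "x \<in> S"
  shows "(F has_derivative (\<lambda>v. \<chi> j. \<Sum>i\<in>UNIV. v $ i * pd i (\<lambda>z. F z $ j) x)) (at (x :: complex^'k::finite))"
proof (rule has_derivative_componentwise_within[THEN iffD2], rule ballI)
  fix b :: "complex^'l" assume "b \<in> Basis"
  \<comment> \<open>The real basis of the target consists of axis vectors with entry 1 or \<i>, so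
    an inner product with one of them sees a single component.\<close>
  then obtain j u where b: "b = axis j u" "u \<in> Basis" by (auto simp: Basis_vec_def)
  have "((\<lambda>z. F z $ j) has_derivative (\<lambda>v. \<Sum>i\<in>UNIV. v $ i * pd i (\<lambda>z. F z $ j) x)) (at x)"
    using assms holo_has_derivative unfolding hmap_def by blast
  from has_derivative_inner_left[OF this, of u]
  show "((\<lambda>x. F x \<bullet> b) has_derivative (\<lambda>xa. (\<chi> j. \<Sum>i\<in>UNIV. xa $ i * pd i (\<lambda>z. F z $ j) x) \<bullet> b)) (at x)"
    by (simp add: b inner_axis)
qed

lemma hd_compose:
  assumes "hmap F S" "holo g T" "x \<in> S" "F x \<in> T"
  shows "((\<lambda>z. g (F z)) has_derivative (\<lambda>v. \<Sum>i\<in>UNIV. v $ i *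
     (\<Sum>j\<in>UNIV. pd j g (F x) * pd i (\<lambda>z. F z $ j) x))) (at (x :: complex^'k::finite))"
proof -
  have eq: "(\<lambda>v. \<Sum>j\<in>UNIV. (\<chi> j. \<Sum>i\<in>UNIV. v $ i * pd i (\<lambda>z. F z $ j) x) $ j * pd j g (F x))
    = (\<lambda>v. \<Sum>i\<in>UNIV. v $ i * (\<Sum>j\<in>UNIV. pd j g (F x) * pd i (\<lambda>z. F z $ j) x))"
    (is "?l = ?r")
  proof
    fix v
    have "?l v = (\<Sum>j\<in>UNIV. \<Sum>i\<in>UNIV. v $ i * (pd j g (F x) * pd i (\<lambda>z. F z $ j) x))"
      by (simp add: sum_distrib_left mult.assoc mult.left_commute mult.commute)
    also have "\<dots> = ?r v" by (subst sum.swap) (simp add: sum_distrib_left)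
    finally show "?l v = ?r v" .
  qed
  show ?thesis
    using has_derivative_compose[OF hmap_hd[OF assms(1,3)] holo_has_derivative[OF assms(2,4)]]
    unfolding eq .
qed

lemma holo_compose:
  assumes "hmap F S" "holo g T" "\<And>x. x \<in> S \<Longrightarrow> F x \<in> T"
  shows "holo (\<lambda>z. g (F z)) S"
  by (rule holoI, rule hd_compose[OF assms(1,2)]) (use assms(3) in auto)

lemma pd_compose:
  assumes "hmap F S" "holo g T" "x \<in> S" "F x \<in> T"
  shows "pd i (\<lambda>z. g (F z)) x = (\<Sum>j\<in>UNIV. pd j g (F x) * pd i (\<lambda>z. F z $ j) x)"
  by (rule pd_eqI[OF hd_compose[OF assms]])

lemma hmap_frechet:
  assumes "hmap F S" "x \<in> S"
  shows "frechet_derivative F (at x) v $ j = (\<Sum>i\<in>UNIV. v $ i * pd i (\<lambda>z. F z $ j) x)"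
  unfolding frechet_derivative_at[OF hmap_hd[OF assms], symmetric] by simp

lemma hmap_continuous_on: "hmap F S \<Longrightarrow> continuous_on S F"
  by (rule continuous_at_imp_continuous_on, rule ballI, rule has_derivative_continuous, rule hmap_hd)

lemma hmap_nth: "hmap F S \<Longrightarrow> holo (\<lambda>z. F z $ i) S" unfolding hmap_def by blast

lemma hmap_compose: "hmap F S \<Longrightarrow> hmap G T \<Longrightarrow> (\<And>x. x \<in> S \<Longrightarrow> F x \<in> T) \<Longrightarrow> hmap (\<lambda>z. G (F z)) S"
  unfolding hmap_def[of _ S, where F="\<lambda>z. G (F z)"]
  by (intro allI, rule holo_compose[where g="\<lambda>w. G w $ i" for i, OF _ hmap_nth])

lemma hmap_subset: "hmap F S \<Longrightarrow> T \<subseteq> S \<Longrightarrow> hmap F T"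
  unfolding hmap_def by (blast intro: holo_subset)

lemma hmap_id: "hmap (\<lambda>z. z) S" unfolding hmap_def by (simp add: holo_coord)

lemma hmap_const: "hmap (\<lambda>z. c) S" unfolding hmap_def by (simp add: holo_const)

lemma hmap_cong: "open S \<Longrightarrow> (\<And>x. x \<in> S \<Longrightarrow> f x = g x) \<Longrightarrow> hmap g S \<Longrightarrow> hmap f S"
  unfolding hmap_def by (intro allI, rule holo_cong) auto

lemma holo_det:
  assumes "\<And>i j. holo (\<lambda>z. M z $ i $ j) S"
  shows "holo (\<lambda>z. det (M z :: complex^'l^'l::finite)) S"
  unfolding det_def by (intro holo_sum holo_mult holo_const holo_prod assms)

lemmas holo_intros = holo_const holo_coord holo_add holo_diff holo_uminus holo_mult holo_sum
  holo_prod holo_power hmap_nth holo_det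

subsection \<open>Cauchy estimates\<close>

text \<open>After subtracting Cauchy's formulas for the value and the derivative at 0, the remainder
  has the kernel \<open>u^2 / (x^2 * (x - u))\<close>. On the circle \<open>cmod (x - u)\<close> is
  at least \<open>r / 2\<close>, which is where the factor 2 comes from.\<close>

lemma cauchy_second_order:
  assumes hol: "f holomorphic_on ball 0 r" and cont: "continuous_on (cball 0 r) f" and r: "0 < r"
    and M: "\<And>x. cmod x = r \<Longrightarrow> cmod (f x) \<le> M"
    and d: "(f has_field_derivative f') (at 0)" and u: "cmod u \<le> r / 2"
  shows "cmod (f u - f 0 - f' * u) \<le> 2 * M * (cmod u)\<^sup>2 / r\<^sup>2"
proof -
  have M0: "0 \<le> M" using M[of "complex_of_real r"] r by (simp) (meson norm_ge_zero order_trans)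
  have u': "u \<in> ball 0 r" using u r by simp
  let ?c = "2 * of_real pi * \<i> :: complex"
  have i1: "((\<lambda>x. f x / (x - u)) has_contour_integral (?c * f u)) (circlepath 0 r)"
    using Cauchy_integral_circlepath[OF cont hol] u' by simp
  have i2: "((\<lambda>x. f x / (x - 0)) has_contour_integral (?c * f 0)) (circlepath 0 r)"
    using Cauchy_integral_circlepath[OF cont hol, of 0] r by simp
  note cd = Cauchy_derivative_integral_circlepath[OF cont hol, of 0]
  have "f' = 1 / ?c * contour_integral (circlepath 0 r) (\<lambda>u. f u / (u - 0)\<^sup>2)"
    using DERIV_unique[OF d cd(2)] r by simp
  then have "contour_integral (circlepath 0 r) (\<lambda>u. f u / (u - 0)\<^sup>2) = ?c * f'" by simp
  then have i3: "((\<lambda>x. f x / (x - 0)\<^sup>2) has_contour_integral (?c * f')) (circlepath 0 r)"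
    using cd(1) r has_contour_integral_integral by fastforce
  have i4: "((\<lambda>x. f x / (x - u) - f x / (x - 0) - f x / (x - 0)\<^sup>2 * u)
     has_contour_integral (?c * f u - ?c * f 0 - ?c * f' * u)) (circlepath 0 r)"
    by (intro has_contour_integral_diff has_contour_integral_rmul i1 i2 i3)
  have "cmod (?c * f u - ?c * f 0 - ?c * f' * u) \<le> (2 * M * (cmod u)\<^sup>2 / r ^ 3) * (2 * pi * r)"
  proof (rule has_contour_integral_bound_circlepath[OF i4])
    fix x :: complex assume "cmod (x - 0) = r"
    then have x: "cmod x = r" by simp
    then have x0: "x \<noteq> 0" "x \<noteq> u" using u r by auto
    have e: "f x / (x - u) - f x / (x - 0) - f x / (x - 0)\<^sup>2 * u = f x * u\<^sup>2 / (x\<^sup>2 * (x - u))"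
      using x0 by (simp add: field_simps power2_eq_square)
    have "cmod (x - u) \<ge> r / 2" using norm_triangle_ineq2[of x u] x u by linarith
    then have "cmod (f x * u\<^sup>2 / (x\<^sup>2 * (x - u))) \<le> M * (cmod u)\<^sup>2 / (r\<^sup>2 * (r / 2))"
      unfolding norm_divide norm_mult norm_power x
      by (intro frac_le mult_mono M x) (use r M0 in auto)
    then show "cmod (f x / (x - u) - f x / (x - 0) - f x / (x - 0)\<^sup>2 * u) \<le> 2 * M * (cmod u)\<^sup>2 / r ^ 3"
      unfolding e using r by (simp add: power3_eq_cube power2_eq_square field_simps)
  qed (use M0 r in auto)
  moreover have "?c * f u - ?c * f 0 - ?c * f' * u = ?c * (f u - f 0 - f' * u)"
    by (simp add: algebra_simps)
  moreover have "cmod ?c = 2 * pi" by (simp add: norm_mult)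
  ultimately have "2 * pi * cmod (f u - f 0 - f' * u) \<le> 2 * pi * (2 * M * (cmod u)\<^sup>2 / r ^ 3 * r)"
    by (simp only: norm_mult) (simp only: mult_ac)
  then have "cmod (f u - f 0 - f' * u) \<le> 2 * M * (cmod u)\<^sup>2 / r ^ 3 * r"
    by (rule mult_left_le_imp_le) simp
  also have "\<dots> = 2 * M * (cmod u)\<^sup>2 / r\<^sup>2" using r by (simp add: power3_eq_cube power2_eq_square)
  finally show ?thesis .
qed

lemma holo_line:
  assumes "holo f S" "z + u *s k \<in> (S :: (complex^'k::finite) set)"
  shows "((\<lambda>u. f (z + u *s k)) has_field_derivative (\<Sum>i\<in>UNIV. k $ i * pd i f (z + u *s k))) (at u)"
proof -
  have "((\<lambda>u. z + u *s k) has_derivative (\<lambda>u. u *s k)) (at u)"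
    by (rule has_derivative_eq_rhs, rule has_derivative_add, rule has_derivative_const,
        rule bounded_linear_imp_has_derivative[OF bounded_linear_smult_vec]) simp
  from has_derivative_compose[OF this holo_has_derivative[OF assms]]
  show ?thesis unfolding has_field_derivative_def
    by (rule has_derivative_eq_rhs) (simp add: sum_distrib_right sum_distrib_left mult.assoc mult.left_commute mult.commute fun_eq_iff)
qed

lemma holo_line_holomorphic:
  assumes "holo f S" "\<And>u. u \<in> T \<Longrightarrow> z + u *s k \<in> (S :: (complex^'k::finite) set)"
  shows "(\<lambda>u. f (z + u *s k)) holomorphic_on T"
  unfolding holomorphic_on_def
  using holo_line[OF assms(1)] assms(2) field_differentiable_at_within field_differentiable_def by blast

text \<open>The one-variable estimate on the complex line through z in direction h, parametrised by
  the unit vector k; the point \<open>z + h\<close> has parameter \<open>norm h\<close> on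
  it.\<close>

lemma holo_taylor1:
  assumes f: "holo f S" and S: "cball z r \<subseteq> (S :: (complex^'k::finite) set)" and r: "0 < r"
    and M: "\<And>x. x \<in> cball z r \<Longrightarrow> cmod (f x) \<le> M" and h: "norm h \<le> r / 2"
  shows "cmod (f (z + h) - f z - (\<Sum>i\<in>UNIV. h $ i * pd i f z)) \<le> 2 * M * (norm h)\<^sup>2 / r\<^sup>2"
proof (cases "h = 0")
  case True
  have "0 \<le> M" using M[of z] r by simp (meson norm_ge_zero order_trans)
  then show ?thesis by (simp add: True)
next
  case False
  define k where "k = inverse (complex_of_real (norm h)) *s h"
  have nk: "norm k = 1" using False by (simp add: k_def norm_smult_vec norm_inverse)
  have hk: "h = complex_of_real (norm h) *s k" using False by (simp add: k_def vec_eq_iff)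
  have inS: "z + u *s k \<in> cball z r" if "u \<in> cball 0 r" for u
    using that by (simp add: dist_norm norm_smult_vec nk)
  have hol: "(\<lambda>u. f (z + u *s k)) holomorphic_on cball 0 r"
    by (rule holo_line_holomorphic[OF f]) (use inS S in blast)
  have "cmod (f (z + complex_of_real (norm h) *s k) - f (z + 0 *s k)
      - (\<Sum>i\<in>UNIV. k $ i * pd i f (z + 0 *s k)) * complex_of_real (norm h))
     \<le> 2 * M * (cmod (complex_of_real (norm h)))\<^sup>2 / r\<^sup>2"
  proof (rule cauchy_second_order[where f="\<lambda>u. f (z + u *s k)"])
    show "(\<lambda>u. f (z + u *s k)) holomorphic_on ball 0 r" using hol holomorphic_on_subset by fastforce
    show "continuous_on (cball 0 r) (\<lambda>u. f (z + u *s k))" using hol holomorphic_on_imp_continuous_on by blast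
    show "cmod (f (z + x *s k)) \<le> M" if "cmod x = r" for x using M inS that by simp
    show "((\<lambda>u. f (z + u *s k)) has_field_derivative (\<Sum>i\<in>UNIV. k $ i * pd i f (z + 0 *s k))) (at 0)"
      by (rule holo_line[OF f]) (use S r in auto)
  qed (use r h in auto)
  moreover have "(\<Sum>i\<in>UNIV. k $ i * pd i f z) * complex_of_real (norm h) = (\<Sum>i\<in>UNIV. h $ i * pd i f z)"
    by (subst (2) hk) (simp add: sum_distrib_left mult.assoc mult.left_commute mult.commute)
  ultimately show ?thesis by (simp add: hk[symmetric])
qed

lemma norm_axis1: "norm (axis i 1 :: complex^'k::finite) = 1"
proof -
  have "norm (axis i 1 :: complex^'k) = sqrt (\<Sum>j\<in>UNIV. (if j = i then 1 else 0))"
    unfolding norm_vec_def L2_set_def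
    by (intro arg_cong[where f=sqrt] sum.cong) (auto simp: axis_def)
  then show ?thesis by simp
qed

lemma circle_param_bound:
  assumes "open S" "continuous_on (S \<times> sphere (w :: complex) r) (\<lambda>(z, \<zeta>). F z \<zeta>)" "z \<in> (S :: (complex^'k::finite) set)"
  obtains d M where "0 < d" "cball z d \<subseteq> S" "\<And>x \<zeta>. x \<in> cball z d \<Longrightarrow> \<zeta> \<in> sphere w r \<Longrightarrow> cmod (F x \<zeta>) \<le> M"
proof -
  obtain d where d: "0 < d" "cball z d \<subseteq> S" using assms(1,3) open_contains_cball by blast
  have "compact ((\<lambda>(z, \<zeta>). F z \<zeta>) ` (cball z d \<times> sphere w r))"
    by (intro compact_continuous_image continuous_on_subset[OF assms(2)] compact_Times compact_cball
        compact_sphere) (use d in auto)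
  then have "bounded ((\<lambda>(z, \<zeta>). F z \<zeta>) ` (cball z d \<times> sphere w r))" by (rule compact_imp_bounded)
  then obtain M where "\<forall>y\<in>((\<lambda>(z, \<zeta>). F z \<zeta>) ` (cball z d \<times> sphere w r)). cmod y \<le> M"
    using bounded_iff by blast
  then have "cmod (F x \<zeta>) \<le> M" if "x \<in> cball z d" "\<zeta> \<in> sphere w r" for x \<zeta>
    using that by (force simp del: mem_cball mem_sphere)
  then show ?thesis using d that[of d M] by blast
qed

lemma circle_param_integrable:
  assumes "continuous_on (S \<times> sphere (w :: complex) r) (\<lambda>(z, \<zeta>). F z \<zeta>)" "z \<in> S" "0 < r"
  shows "F z contour_integrable_on circlepath w r"
proof (rule contour_integrable_continuous_circlepath)
  have "continuous_on (sphere w r) ((\<lambda>(z, \<zeta>). F z \<zeta>) \<circ> (\<lambda>\<zeta>. (z, \<zeta>)))"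
    by (intro continuous_on_compose continuous_intros continuous_on_subset[OF assms(1)]) (use assms in auto)
  then show "continuous_on (path_image (circlepath w r)) (F z)" using assms(3) by (simp add: o_def)
qed

text \<open>Difference quotients are continuous in \<zeta>, and \<open>holo_taylor1\<close> bounds
  their distance from the partial derivative with the same constant for all \<zeta>, so the limit is
  uniform on the circle.\<close>

lemma circle_pd_continuous:
  assumes S: "open S" and cont: "continuous_on (S \<times> sphere (w :: complex) r) (\<lambda>(z, \<zeta>). F z \<zeta>)"
    and hol: "\<And>\<zeta>. \<zeta> \<in> sphere w r \<Longrightarrow> holo (\<lambda>z. F z \<zeta>) S" and z: "z \<in> (S :: (complex^'k::finite) set)"
  shows "continuous_on (sphere w r) (\<lambda>\<zeta>. pd i (\<lambda>z. F z \<zeta>) z)"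
proof -
  obtain d M where d: "0 < d" "cball z d \<subseteq> S"
    and M: "\<And>x \<zeta>. x \<in> cball z d \<Longrightarrow> \<zeta> \<in> sphere w r \<Longrightarrow> cmod (F x \<zeta>) \<le> M"
    using circle_param_bound[OF S cont z] by blast
  \<comment> \<open>Nonzero real steps tending to 0, of size at most \<open>d / 2\<close> as the
    Taylor estimate requires.\<close>
  define h where "h = (\<lambda>n. complex_of_real (d / 2 / real (Suc n)))"
  have h0: "h n \<noteq> 0" "cmod (h n) \<le> d / 2" "cmod (h n) = d / 2 / real (Suc n)" for n
  proof -
    have "\<bar>d\<bar> / 2 / real (Suc n) \<le> \<bar>d\<bar> / 2 / 1" by (rule divide_left_mono) auto
    then show "h n \<noteq> 0" "cmod (h n) \<le> d / 2" "cmod (h n) = d / 2 / real (Suc n)"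
      using d(1) by (auto simp: h_def norm_divide norm_mult simp del: of_nat_Suc)
  qed
  have inb: "z + u *s axis i 1 \<in> cball z d" if "cmod u \<le> d / 2" for u
    using that d(1) by (simp add: dist_norm norm_smult_vec norm_axis1)
  have est: "cmod ((F (z + h n *s axis i 1) \<zeta> - F z \<zeta>) / h n - pd i (\<lambda>z. F z \<zeta>) z) \<le> 2 * M / d\<^sup>2 * cmod (h n)"
    if "\<zeta> \<in> sphere w r" for n \<zeta>
  proof -
    have "cmod (F (z + h n *s axis i 1) \<zeta> - F z \<zeta> - (\<Sum>j\<in>UNIV. (h n *s axis i 1) $ j * pd j (\<lambda>z. F z \<zeta>) z))
       \<le> 2 * M * (norm (h n *s axis i 1 :: complex^'k))\<^sup>2 / d\<^sup>2"
      using holo_taylor1[OF hol[OF that] d(2,1) M[OF _ that], where h="h n *s axis i 1"] h0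
      by (simp add: norm_smult_vec norm_axis1)
    also have "(\<Sum>j\<in>UNIV. (h n *s axis i 1) $ j * pd j (\<lambda>z. F z \<zeta>) z) = h n * pd i (\<lambda>z. F z \<zeta>) z"
      by (subst sum.remove[of _ i]) (auto simp: axis_def intro!: sum.neutral)
    also have "norm (h n *s axis i 1 :: complex^'k) = cmod (h n)" by (simp add: norm_smult_vec norm_axis1)
    finally have "cmod (F (z + h n *s axis i 1) \<zeta> - F z \<zeta> - h n * pd i (\<lambda>z. F z \<zeta>) z) / cmod (h n)
       \<le> 2 * M / d\<^sup>2 * cmod (h n)"
      using h0(1)[of n] by (simp add: field_simps power2_eq_square)
    then show ?thesis
      unfolding norm_divide[symmetric] using h0(1)[of n] by (simp add: diff_divide_distrib)
  qed
  have M0: "0 \<le> M" if "\<zeta> \<in> sphere w r" for \<zeta>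
    using order_trans[OF norm_ge_zero M[OF _ that, of z]] d by simp
  show ?thesis
  proof (rule uniform_limit_theorem[where F=sequentially and f="\<lambda>n \<zeta>. (F (z + h n *s axis i 1) \<zeta> - F z \<zeta>) / h n"])
    have ct: "continuous_on (sphere w r) (F x)" if "x \<in> cball z d" for x
    proof -
      have "continuous_on (sphere w r) ((\<lambda>(z, \<zeta>). F z \<zeta>) \<circ> (\<lambda>\<zeta>. (x, \<zeta>)))"
        by (intro continuous_on_compose continuous_intros continuous_on_subset[OF cont]) (use d that in auto)
      then show ?thesis by (simp add: o_def)
    qed
    show "\<forall>\<^sub>F n in sequentially. continuous_on (sphere w r) (\<lambda>\<zeta>. (F (z + h n *s axis i 1) \<zeta> - F z \<zeta>) / h n)"
      using h0 d(1) inb by (intro always_eventually allI continuous_intros ct) auto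
    show "uniform_limit (sphere w r) (\<lambda>n \<zeta>. (F (z + h n *s axis i 1) \<zeta> - F z \<zeta>) / h n)
       (\<lambda>\<zeta>. pd i (\<lambda>z. F z \<zeta>) z) sequentially"
    proof (rule uniform_limitI)
      fix e :: real assume "0 < e"
      have "(\<lambda>n. 2 * M / d\<^sup>2 * (d / 2 * (1 / real (Suc n)))) \<longlonglongrightarrow> 2 * M / d\<^sup>2 * (d / 2 * 0)"
        by (intro tendsto_intros LIMSEQ_Suc lim_1_over_n)
      then have "(\<lambda>n. 2 * M / d\<^sup>2 * cmod (h n)) \<longlonglongrightarrow> 0" by (simp add: h0 del: of_nat_Suc)
      then have "\<forall>\<^sub>F n in sequentially. 2 * M / d\<^sup>2 * cmod (h n) < e"
        using \<open>0 < e\<close> order_tendstoD(2) by blast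
      then show "\<forall>\<^sub>F n in sequentially. \<forall>\<zeta>\<in>sphere w r.
         dist ((F (z + h n *s axis i 1) \<zeta> - F z \<zeta>) / h n) (pd i (\<lambda>z. F z \<zeta>) z) < e"
        by eventually_elim (use est in \<open>simp only: dist_norm, blast intro: le_less_trans\<close>)
    qed
  qed auto
qed

text \<open>Holomorphy under the integral sign: the second order Cauchy estimate along complex lines is
  uniform in the parameter, so no continuity of the derivative is needed.\<close>

lemma hd_circle_integral:
  assumes S: "open S" and r: "0 < r" and cont: "continuous_on (S \<times> sphere (w :: complex) r) (\<lambda>(z, \<zeta>). F z \<zeta>)"
    and hol: "\<And>\<zeta>. \<zeta> \<in> sphere w r \<Longrightarrow> holo (\<lambda>z. F z \<zeta>) S" and z: "z \<in> (S :: (complex^'k::finite) set)"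
  shows "((\<lambda>z. contour_integral (circlepath w r) (F z)) has_derivative
    (\<lambda>v. \<Sum>i\<in>UNIV. v $ i * contour_integral (circlepath w r) (\<lambda>\<zeta>. pd i (\<lambda>z. F z \<zeta>) z))) (at z)"
proof -
  obtain d M where d: "0 < d" "cball z d \<subseteq> S"
    and M: "\<And>x \<zeta>. x \<in> cball z d \<Longrightarrow> \<zeta> \<in> sphere w r \<Longrightarrow> cmod (F x \<zeta>) \<le> M"
    using circle_param_bound[OF S cont z] by blast
  let ?\<gamma> = "circlepath w r"
  let ?I = "\<lambda>z. contour_integral ?\<gamma> (F z)"
  let ?D = "\<lambda>v. \<Sum>i\<in>UNIV. v $ i * contour_integral ?\<gamma> (\<lambda>\<zeta>. pd i (\<lambda>z. F z \<zeta>) z)"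
  have M0: "0 \<le> M"
    using order_trans[OF norm_ge_zero M[of z "w + of_real r"]] d r by (simp add: dist_norm)
  have ipd: "(\<lambda>\<zeta>. pd i (\<lambda>z. F z \<zeta>) z) contour_integrable_on ?\<gamma>" for i
    using circle_pd_continuous[OF S cont hol z] r by (intro contour_integrable_continuous_circlepath) simp
  have est: "cmod (?I (z + h) - ?I z - ?D h) \<le> (2 * M * (norm h)\<^sup>2 / d\<^sup>2) * (2 * pi * r)"
    if h: "norm h \<le> d / 2" for h
  proof -
    have zh: "z + h \<in> S" using d h by (intro subsetD[OF d(2)]) (simp add: dist_norm)
    have "((\<lambda>\<zeta>. F (z + h) \<zeta> - F z \<zeta> - (\<Sum>i\<in>UNIV. h $ i * pd i (\<lambda>z. F z \<zeta>) z)) has_contour_integral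
       (?I (z + h) - ?I z - ?D h)) ?\<gamma>"
      by (intro has_contour_integral_diff has_contour_integral_sum has_contour_integral_lmul
          has_contour_integral_integral circle_param_integrable[OF cont] ipd z zh r) auto
    then show ?thesis
    proof (rule has_contour_integral_bound_circlepath)
      fix \<zeta> assume "cmod (\<zeta> - w) = r"
      then have s: "\<zeta> \<in> sphere w r" by (simp add: dist_norm norm_minus_commute)
      show "cmod (F (z + h) \<zeta> - F z \<zeta> - (\<Sum>i\<in>UNIV. h $ i * pd i (\<lambda>z. F z \<zeta>) z)) \<le> 2 * M * (norm h)\<^sup>2 / d\<^sup>2"
        by (rule holo_taylor1[OF hol[OF s] d(2,1) M[OF _ s] h])
    qed (use M0 r in auto)
  qed
  have bl: "bounded_linear ?D"
    by (intro bounded_linear_sum bounded_linear_mult_left[THEN bounded_linear_compose] bounded_linear_vec_nth)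
  show ?thesis
    unfolding has_derivative_at
  proof (intro conjI bl)
    let ?C = "2 * M / d\<^sup>2 * (2 * pi * r)"
    show "(\<lambda>h. norm (?I (z + h) - ?I z - ?D h) / norm h) \<midarrow>0\<rightarrow> 0"
    proof (rule Lim_null_comparison[where g="\<lambda>h. ?C * norm h"])
      have "\<forall>\<^sub>F h in at 0. norm (h :: complex^'k) < d / 2"
        using d(1) by (auto simp: eventually_at intro!: exI[of _ "d/2"])
      then show "\<forall>\<^sub>F h in at 0. norm (norm (?I (z + h) - ?I z - ?D h) / norm h) \<le> ?C * norm h"
      proof eventually_elim
        case (elim h)
        show ?case
        proof (cases "h = 0")
          case False
          have "norm (?I (z + h) - ?I z - ?D h) / norm h \<le> (2 * M * (norm h)\<^sup>2 / d\<^sup>2) * (2 * pi * r) / norm h"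
            by (intro divide_right_mono est) (use elim in auto)
          also have "\<dots> = ?C * norm h" using False by (simp add: power2_eq_square)
          finally show ?thesis by simp
        qed simp
      qed
      have "((\<lambda>h. ?C * norm (h :: complex^'k)) \<longlongrightarrow> ?C * norm (0 :: complex^'k)) (at 0)"
        by (intro tendsto_intros)
      then show "((\<lambda>h. ?C * norm (h :: complex^'k)) \<longlongrightarrow> 0) (at 0)" by simp
    qed
  qed
qed

lemma holo_circle_integral:
  assumes "open S" "0 < r" "continuous_on (S \<times> sphere (w :: complex) r) (\<lambda>(z, \<zeta>). F z \<zeta>)"
    "\<And>\<zeta>. \<zeta> \<in> sphere w r \<Longrightarrow> holo (\<lambda>z. F z \<zeta>) (S :: (complex^'k::finite) set)"
  shows "holo (\<lambda>z. contour_integral (circlepath w r) (F z)) S"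
  by (rule holoI, rule hd_circle_integral[OF assms])

text \<open>Cauchy's formula for the derivative on the i-th coordinate line through z. The right
  side contains no derivative of f, so it can itself be differentiated in z.\<close>

lemma pd_circle_formula:
  assumes f: "holo f S" and S: "cball z r \<subseteq> (S :: (complex^'k::finite) set)" and r: "0 < r"
  shows "pd i f z = 1 / (2 * of_real pi * \<i>) *
     contour_integral (circlepath 0 r) (\<lambda>\<zeta>. f (z + \<zeta> *s axis i 1) / \<zeta>\<^sup>2)"
proof -
  have hol: "(\<lambda>u. f (z + u *s axis i 1)) holomorphic_on cball 0 r"
    by (rule holo_line_holomorphic[OF f])
       (use S in \<open>auto simp: dist_norm norm_smult_vec norm_axis1 subset_iff\<close>)
  have 1: "continuous_on (cball 0 r) (\<lambda>u. f (z + u *s axis i 1))"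
     "(\<lambda>u. f (z + u *s axis i 1)) holomorphic_on ball 0 r"
    using hol holomorphic_on_imp_continuous_on holomorphic_on_subset by fastforce+
  have "((\<lambda>u. f (z + u *s axis i 1)) has_field_derivative (\<Sum>j\<in>UNIV. axis i 1 $ j * pd j f (z + 0 *s axis i 1))) (at 0)"
    by (rule holo_line[OF f]) (use S r in auto)
  moreover have "(\<Sum>j\<in>UNIV. axis i 1 $ j * pd j f (z + 0 *s axis i 1)) = pd i f z"
    by (subst sum.remove[of _ i]) (auto simp: axis_def intro!: sum.neutral)
  ultimately show ?thesis
    using DERIV_unique[OF _ Cauchy_derivative_integral_circlepath(2)[OF 1, of 0]] r by simp
qed

text \<open>The radius \<open>2 * r\<close> leaves r for moving the base point and r for the
  integration variable. The claims are the hypotheses of \<open>holo_circle_integral\<close> for the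
  shifted circle.\<close>

lemma circle_shift_continuous:
  assumes f: "holo f S" and S: "cball z0 (2 * r) \<subseteq> (S :: (complex^'k::finite) set)" and r: "0 < r"
  shows "continuous_on (ball z0 r \<times> sphere 0 r) (\<lambda>(z, \<zeta>). f (z + \<zeta> *s axis i 1) / \<zeta>\<^sup>2)"
    and "\<zeta> \<in> sphere 0 r \<Longrightarrow> holo (\<lambda>z. f (z + \<zeta> *s axis i 1) / \<zeta>\<^sup>2) (ball z0 r)"
    and "z \<in> ball z0 r \<Longrightarrow> \<zeta> \<in> cball 0 r \<Longrightarrow> z + \<zeta> *s axis i 1 \<in> S"
proof -
  show inS: "z + \<zeta> *s axis i 1 \<in> S" if "z \<in> ball z0 r" "\<zeta> \<in> cball 0 r" for z \<zeta>
  proof -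
    have "norm (z - z0 + \<zeta> *s axis i 1) \<le> r + r"
      by (rule norm_triangle_mono)
         (use that in \<open>auto simp: dist_norm norm_smult_vec norm_axis1 norm_minus_commute\<close>)
    then show ?thesis using S by (auto simp: dist_norm norm_minus_commute algebra_simps subset_iff)
  qed
  have "continuous_on UNIV (\<lambda>p :: (complex^'k) \<times> complex. fst p + snd p *s axis i 1)"
    by (intro continuous_intros bounded_linear.continuous_on[OF bounded_linear_smult_vec])
  then have "continuous_on (ball z0 r \<times> sphere 0 r) (\<lambda>p. f (fst p + snd p *s axis i 1))"
    by (intro continuous_on_compose2[OF holo_continuous_on[OF f]])
       (use inS in \<open>auto intro: continuous_on_subset\<close>)
  then show "continuous_on (ball z0 r \<times> sphere 0 r) (\<lambda>(z, \<zeta>). f (z + \<zeta> *s axis i 1) / \<zeta>\<^sup>2)"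
    using r unfolding case_prod_beta by (intro continuous_intros) auto
  assume z: "\<zeta> \<in> sphere 0 r"
  have "hmap (\<lambda>z :: complex^'k. z + \<zeta> *s axis i 1) (ball z0 r)"
    unfolding hmap_def by (auto intro!: holo_intros)
  then have "holo (\<lambda>z. f (z + \<zeta> *s axis i 1)) (ball z0 r)"
    by (rule holo_compose[OF _ f]) (use inS z in auto)
  then show "holo (\<lambda>z. f (z + \<zeta> *s axis i 1) / \<zeta>\<^sup>2) (ball z0 r)"
    using z r by (intro holo_divide holo_const) auto
qed

lemma cball_double: "open S \<Longrightarrow> z \<in> S \<Longrightarrow> \<exists>r>0. cball z (2 * r) \<subseteq> (S :: 'a::metric_space set)"
  by (metis open_contains_cball field_sum_of_halves half_gt_zero mult_2)

lemma pd_circle_ball: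
  assumes f: "holo f S" and S: "cball z0 (2 * r) \<subseteq> (S :: (complex^'k::finite) set)" and r: "0 < r"
    and z: "z \<in> ball z0 r"
  shows "pd i f z = 1 / (2 * of_real pi * \<i>) *
       contour_integral (circlepath 0 r) (\<lambda>\<zeta>. f (z + \<zeta> *s axis i 1) / \<zeta>\<^sup>2)"
proof (rule pd_circle_formula[OF f _ r])
  show "cball z r \<subseteq> S"
  proof
    fix x assume "x \<in> cball z r"
    then have "dist z0 x \<le> 2 * r" using z dist_triangle[of z0 x z] by simp
    then show "x \<in> S" using S by auto
  qed
qed

text \<open>Locally a partial derivative is a Cauchy integral over a circle of fixed radius, and
  such integrals are holomorphic in the base point.\<close>

lemma holo_pd:
  assumes f: "holo f S" and S: "open (S :: (complex^'k::finite) set)"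
  shows "holo (pd i f) S"
proof (rule holo_local)
  fix z0 assume "z0 \<in> S"
  then obtain r where r: "0 < r" "cball z0 (2 * r) \<subseteq> S" using cball_double[OF S] by blast
  let ?g = "\<lambda>z. 1 / (2 * of_real pi * \<i>) *
       contour_integral (circlepath 0 r) (\<lambda>\<zeta>. f (z + \<zeta> *s axis i 1) / \<zeta>\<^sup>2)"
  have "holo ?g (ball z0 r)"
    by (intro holo_mult holo_const holo_circle_integral[OF open_ball r(1)]
        circle_shift_continuous(1,2)[OF f r(2,1)])
  moreover have "\<forall>y\<in>ball z0 r. pd i f y = ?g y"
    using pd_circle_ball[OF f r(2,1)] by blast
  ultimately show "\<exists>T g. open T \<and> z0 \<in> T \<and> holo g T \<and> (\<forall>y\<in>T. pd i f y = g y)"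
    using r(1) by (intro exI[of _ "ball z0 r"] exI[of _ ?g]) auto
qed

text \<open>Differentiating the Cauchy integral for the i-th partial under the integral sign in
  direction j gives the Cauchy integral for the i-th partial of \<open>pd j f\<close>.\<close>

lemma pd_commute:
  assumes f: "holo f S" and S: "open (S :: (complex^'k::finite) set)" and z: "z \<in> S"
  shows "pd j (pd i f) z = pd i (pd j f) z"
proof -
  obtain r where r: "0 < r" "cball z (2 * r) \<subseteq> S" using cball_double[OF S z] by blast
  let ?c = "1 / (2 * of_real pi * \<i>) :: complex"
  let ?F = "\<lambda>z \<zeta>. f (z + \<zeta> *s axis i 1) / \<zeta>\<^sup>2"
  note sh = circle_shift_continuous[OF f r(2,1), where i=i]
  note hI = holo_circle_integral[OF open_ball r(1) sh(1,2)]
  have zb: "z \<in> ball z r" using r by simp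
  have "pd j (pd i f) z = pd j (\<lambda>z. ?c * contour_integral (circlepath 0 r) (?F z)) z"
    by (rule pd_cong[OF open_ball zb], rule pd_circle_ball[OF f r(2,1)], assumption)
       (intro holo_mult hI holo_const)
  also have "\<dots> = ?c * pd j (\<lambda>z. contour_integral (circlepath 0 r) (?F z)) z"
    by (subst pd_mult[OF holo_const hI zb]) (simp_all only: pd_const, simp)
  also have "pd j (\<lambda>z. contour_integral (circlepath 0 r) (?F z)) z =
      contour_integral (circlepath 0 r) (\<lambda>\<zeta>. pd j (\<lambda>z. ?F z \<zeta>) z)"
    by (rule pd_eqI[OF hd_circle_integral[OF open_ball r(1) sh(1,2) zb]])
  also have "\<dots> = contour_integral (circlepath 0 r) (\<lambda>\<zeta>. pd j f (z + \<zeta> *s axis i 1) / \<zeta>\<^sup>2)"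
  proof (rule contour_integral_cong)
    fix \<zeta> assume "\<zeta> \<in> path_image (circlepath 0 r)"
    then have s: "\<zeta> \<in> sphere 0 r" using r by simp
    have hm: "hmap (\<lambda>z :: complex^'k. z + \<zeta> *s axis i 1) (ball z r)"
      unfolding hmap_def by (auto intro!: holo_intros)
    have sub: "x + \<zeta> *s axis i 1 \<in> S" if "x \<in> ball z r" for x using sh(3) s that by simp
    have "pd j (\<lambda>z. ?F z \<zeta>) z = pd j (\<lambda>z. inverse (\<zeta>\<^sup>2) * f (z + \<zeta> *s axis i 1)) z"
      by (simp add: field_simps)
    also have "\<dots> = inverse (\<zeta>\<^sup>2) * pd j (\<lambda>z. f (z + \<zeta> *s axis i 1)) z"
      using pd_mult[OF holo_const holo_compose[OF hm f sub] zb] by (simp add: pd_const)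
    also have "pd j (\<lambda>z. f (z + \<zeta> *s axis i 1)) z =
       (\<Sum>k\<in>UNIV. pd k f (z + \<zeta> *s axis i 1) * pd j (\<lambda>z. (z + \<zeta> *s axis i 1) $ k) z)"
      by (rule pd_compose[OF hm f zb sub[OF zb]])
    also have "\<dots> = (\<Sum>k\<in>UNIV. pd k f (z + \<zeta> *s axis i 1) * (if j = k then 1 else 0))"
      using pd_add[OF holo_coord holo_const zb] by (simp add: pd_coord pd_const)
    also have "\<dots> = pd j f (z + \<zeta> *s axis i 1)" by (simp add: if_distrib cong: if_cong)
    finally show "pd j (\<lambda>z. ?F z \<zeta>) z = pd j f (z + \<zeta> *s axis i 1) / \<zeta>\<^sup>2" by (simp add: field_simps)
  qed simp
  also have "?c * \<dots> = pd i (pd j f) z"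
    using pd_circle_ball[OF holo_pd[OF f S] r(2,1) zb] by simp
  finally show ?thesis .
qed

subsection \<open>Division by a polynomial in one of the variables\<close>

text \<open>Polydiscs rather than balls, because changing or freezing a single coordinate within the
  allowed radius does not leave them.\<close>

definition polydisc :: "complex^'k::finite \<Rightarrow> real \<Rightarrow> (complex^'k) set" where
  "polydisc z0 r = {z. \<forall>i. cmod (z $ i - z0 $ i) < r}"

definition upd :: "'k::finite \<Rightarrow> complex^'k \<Rightarrow> complex \<Rightarrow> complex^'k" where
  "upd s z \<zeta> = (\<chi> i. if i = s then \<zeta> else z $ i)"

text \<open>\<open>g (pin J z0 z) = g z\<close> expresses that g does not depend on the coordinates
  in J.\<close>

definition pin :: "'k::finite set \<Rightarrow> complex^'k \<Rightarrow> complex^'k \<Rightarrow> complex^'k" where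
  "pin J z0 z = (\<chi> i. if i \<in> J then z0 $ i else z $ i)"

lemma open_polydisc: "open (polydisc z0 r)"
proof -
  have "polydisc z0 r = (\<Inter>i. {z. cmod (z $ i - z0 $ i) < r})" by (auto simp: polydisc_def)
  moreover have "open {z. cmod (z $ i - z0 $ i) < r}" for i
    by (intro open_Collect_less continuous_intros)
  ultimately show ?thesis by (simp add: open_INT)
qed

lemma polydisc_center: "0 < r \<Longrightarrow> z0 \<in> polydisc z0 r" by (simp add: polydisc_def)

lemma polydisc_mono: "r \<le> s \<Longrightarrow> polydisc z0 r \<subseteq> polydisc z0 s"
  by (auto simp: polydisc_def intro: less_le_trans)

lemma polydisc_in_open:
  assumes "open B" "z0 \<in> (B :: (complex^'k::finite) set)"
  obtains r where "0 < r" "polydisc z0 r \<subseteq> B"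
proof -
  obtain e where e: "0 < e" "ball z0 e \<subseteq> B" using assms open_contains_ball by blast
  \<comment> \<open>The norm is at most the sum of the moduli of the coordinates, of which there are
    \<open>CARD('k)\<close>.\<close>
  let ?r = "e / real CARD('k)"
  have "z \<in> ball z0 e" if "z \<in> polydisc z0 ?r" for z
  proof -
    have "norm (z - z0) \<le> (\<Sum>i\<in>UNIV. cmod ((z - z0) $ i))"
      unfolding norm_vec_def by (rule L2_set_le_sum) simp
    also have "\<dots> < (\<Sum>i\<in>(UNIV :: 'k set). ?r)"
      by (rule sum_strict_mono) (use that in \<open>auto simp: polydisc_def\<close>)
    finally show ?thesis by (simp add: dist_norm norm_minus_commute)
  qed
  then have "polydisc z0 ?r \<subseteq> B" using e(2) by blast
  moreover have "0 < ?r" using e(1) by simp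
  ultimately show ?thesis using that by blast
qed

lemma hmap_upd: "hmap (\<lambda>z. upd s z \<zeta>) S"
  unfolding hmap_def
proof
  fix i show "holo (\<lambda>z. upd s z \<zeta> $ i) S"
    by (cases "i = s") (auto simp: upd_def intro: holo_intros)
qed

lemma poly_sum_le_degree:
  fixes p :: "'a::comm_semiring_1 poly"
  assumes "degree p \<le> d"
  shows "poly p x = (\<Sum>k\<le>d. coeff p k * x ^ k)"
  unfolding poly_altdef
  by (rule sum.mono_neutral_left) (use assms in \<open>auto simp: coeff_eq_0 not_le\<close>)

text \<open>The coefficients of \<open>(p(\<zeta>) - p(y)) / (\<zeta> - y)\<close> as a polynomial in \<open>y\<close>.\<close>

definition diffquot :: "complex poly \<Rightarrow> nat \<Rightarrow> complex \<Rightarrow> nat \<Rightarrow> complex" where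
  "diffquot p d \<zeta> k = (\<Sum>j\<in>{k<..d}. coeff p j * \<zeta> ^ (j - 1 - k))"

text \<open>Each monomial contributes a geometric sum; exchanging the order of summation collects
  the coefficient of \<open>y ^ k\<close>.\<close>

lemma diffquot:
  assumes "degree p \<le> d"
  shows "poly p \<zeta> - poly p y = (\<zeta> - y) * (\<Sum>k\<le>d. diffquot p d \<zeta> k * y ^ k)"
proof -
  have "poly p \<zeta> - poly p y = (\<Sum>j\<le>d. coeff p j * (\<zeta> ^ j - y ^ j))"
    unfolding poly_sum_le_degree[OF assms] by (simp add: sum_subtractf right_diff_distrib)
  also have "\<dots> = (\<Sum>j\<le>d. coeff p j * ((\<zeta> - y) * (\<Sum>k<j. \<zeta> ^ (j - 1 - k) * y ^ k)))"
  proof (intro sum.cong refl arg_cong2[where f="(*)"])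
    fix j
    have "(\<Sum>k<j. y ^ (j - Suc k) * \<zeta> ^ k) = (\<Sum>k<j. \<zeta> ^ (j - 1 - k) * y ^ k)"
      by (subst sum.nat_diff_reindex[symmetric]) (auto intro!: sum.cong simp: mult.commute)
    then show "\<zeta> ^ j - y ^ j = (\<zeta> - y) * (\<Sum>k<j. \<zeta> ^ (j - 1 - k) * y ^ k)"
      using power_diff_sumr2[of \<zeta> j y] by simp
  qed
  also have "\<dots> = (\<zeta> - y) * (\<Sum>j\<le>d. \<Sum>k | k < j. coeff p j * \<zeta> ^ (j - 1 - k) * y ^ k)"
    by (simp add: sum_distrib_left mult_ac lessThan_def)
  also have "(\<Sum>j\<le>d. \<Sum>k | k < j. coeff p j * \<zeta> ^ (j - 1 - k) * y ^ k)
     = (\<Sum>j\<le>d. \<Sum>k | k \<in> {..d} \<and> k < j. coeff p j * \<zeta> ^ (j - 1 - k) * y ^ k)"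
    by (intro sum.cong refl) auto
  also have "\<dots> = (\<Sum>k\<le>d. \<Sum>j | j \<in> {..d} \<and> k < j. coeff p j * \<zeta> ^ (j - 1 - k) * y ^ k)"
    by (rule sum.swap_restrict) auto
  also have "\<dots> = (\<Sum>k\<le>d. diffquot p d \<zeta> k * y ^ k)"
    unfolding diffquot_def sum_distrib_right by (intro sum.cong refl) auto
  finally show ?thesis .
qed

lemma tube_nbhd:
  assumes "compact K" "open W" "{x0 :: 'a::topological_space} \<times> K \<subseteq> (W :: ('a \<times> 'b::topological_space) set)"
  obtains X0 where "open X0" "x0 \<in> X0" "X0 \<times> K \<subseteq> W"
proof -
  have "\<exists>U V. openin euclidean U \<and> openin euclidean V \<and> x0 \<in> U \<and> K \<subseteq> V \<and> U \<times> V \<subseteq> W"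
    by (rule tube_lemma_right) (use assms in auto)
  then obtain U V where "open U" "x0 \<in> U" "K \<subseteq> V" "U \<times> V \<subseteq> W" by auto
  then show ?thesis using that[of U] by blast
qed

text \<open>Weierstrass division, with \<open>P\<close> required to be nonzero only on a circle: remainder and quotient are
  the Cauchy integrals of \<open>g(\<zeta>) / P(\<zeta>)\<close> against \<open>(P(\<zeta>) - P(y)) / (\<zeta> - y)\<close> and
  \<open>1 / (\<zeta> - y)\<close>.\<close>

lemma polynomial_division:
  fixes P :: "complex^'k::finite \<Rightarrow> complex poly"
  assumes r0: "0 < r0" and g: "holo g (polydisc z0 r0)"
    and P: "\<And>k. holo (\<lambda>z. coeff (P z) k) (polydisc z0 r0)"
    and deg: "\<And>z. z \<in> polydisc z0 r0 \<Longrightarrow> degree (P z) \<le> d" and nz: "P z0 \<noteq> 0"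
    and indP: "\<And>z. P (pin (insert s J) z0 z) = P z"
    and indg: "\<And>z. z \<in> polydisc z0 r0 \<Longrightarrow> g (pin J z0 z) = g z"
    and s: "s \<notin> J"
  obtains r Q R where "0 < r" "r \<le> r0" "holo Q (polydisc z0 r)" "\<And>k. holo (R k) (polydisc z0 r)"
    "\<And>k z. z \<in> polydisc z0 r \<Longrightarrow> R k (pin (insert s J) z0 z) = R k z"
    "\<And>z. z \<in> polydisc z0 r \<Longrightarrow> g z = Q z * poly (P z) (z $ s) + (\<Sum>k\<le>d. R k z * z $ s ^ k)"
proof -
  have z0: "z0 \<in> polydisc z0 r0" by (rule polydisc_center[OF r0])
  have "finite {x. poly (P z0) x = 0}" by (rule poly_roots_finite[OF nz])
  then have fin: "finite ((\<lambda>x. cmod (x - z0 $ s)) ` {x. poly (P z0) x = 0})" by simp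
  \<comment> \<open>Only finitely many radii meet a root of \<open>P z0\<close>, so some circle of
    radius below r0 avoids them all.\<close>
  have "infinite {0<..<r0}" using r0 by (rule infinite_Ioo)
  then obtain \<rho> where \<rho>: "\<rho> \<in> {0<..<r0}" "\<rho> \<notin> (\<lambda>x. cmod (x - z0 $ s)) ` {x. poly (P z0) x = 0}"
    using fin by (meson finite_subset subsetI)
  have nzs: "poly (P z0) \<zeta> \<noteq> 0" if "\<zeta> \<in> sphere (z0 $ s) \<rho>" for \<zeta>
    using \<rho>(2) that by (auto simp: dist_norm norm_minus_commute image_iff)
  have contP: "continuous_on (polydisc z0 r0 \<times> UNIV) (\<lambda>(z, \<zeta>). poly (P z) \<zeta>)"
  proof -
    have c: "continuous_on (polydisc z0 r0 \<times> (UNIV :: complex set)) (\<lambda>x. coeff (P (fst x)) k)" for k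
      by (rule continuous_on_compose2[OF holo_continuous_on[OF P] continuous_on_fst[OF continuous_on_id]]) auto
    have "continuous_on (polydisc z0 r0 \<times> UNIV) (\<lambda>x. \<Sum>k\<le>d. coeff (P (fst x)) k * snd x ^ k)"
      by (intro continuous_intros c)
    then show ?thesis
      by (rule continuous_on_eq) (use deg in \<open>auto simp: poly_sum_le_degree[of _ d]\<close>)
  qed
  define W where "W = {x \<in> polydisc z0 r0 \<times> UNIV. (\<lambda>(z, \<zeta>). poly (P z) \<zeta>) x \<in> - {0}}"
  have "open W" unfolding W_def
    using continuous_open_preimage[OF contP open_Times[OF open_polydisc open_UNIV] open_Compl[OF closed_singleton]]
    by (simp add: vimage_def Int_def)
  moreover have "{z0} \<times> sphere (z0 $ s) \<rho> \<subseteq> W" using nzs z0 by (auto simp: W_def)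
  ultimately obtain X0 where X0: "z0 \<in> X0" "open X0" "X0 \<times> sphere (z0 $ s) \<rho> \<subseteq> W"
    using tube_nbhd[OF compact_sphere] by metis
  obtain r1 where r1: "0 < r1" "polydisc z0 r1 \<subseteq> X0" using polydisc_in_open[OF X0(2,1)] by blast
  \<comment> \<open>The bound by \<rho> keeps the coordinate \<open>z $ s\<close> inside the circle
    of integration; the bound by r1 keeps that circle free of zeros of \<open>P z\<close>.\<close>
  define r where "r = min r1 \<rho>"
  have r: "0 < r" "r \<le> \<rho>" "r \<le> r1" "\<rho> < r0" "0 < \<rho>" using r1 \<rho> by (auto simp: r_def)
  let ?D = "polydisc z0 r" and ?c = "1 / (2 * of_real pi * \<i>) :: complex" and ?S = "sphere (z0 $ s) \<rho>"
  have sub: "?D \<subseteq> polydisc z0 r0" by (rule polydisc_mono) (use r in simp)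
  have nzD: "poly (P z) \<zeta> \<noteq> 0" if "z \<in> ?D" "\<zeta> \<in> ?S" for z \<zeta>
    using that X0(3) r1(2) polydisc_mono[OF r(3), of z0] by (force simp: W_def)
  have updin: "upd s z \<zeta> \<in> polydisc z0 r0" if "z \<in> ?D" "\<zeta> \<in> cball (z0 $ s) \<rho>" for z \<zeta>
    using that r by (auto simp: polydisc_def upd_def dist_norm norm_minus_commute intro: less_le_trans)
  have ne: "\<zeta> \<noteq> z $ s" if "z \<in> ?D" "\<zeta> \<in> ?S" for z \<zeta>
    using that r by (auto simp: polydisc_def dist_norm norm_minus_commute dest: spec[of _ s])
  define G where "G = (\<lambda>z \<zeta>. g (upd s z \<zeta>) / poly (P z) \<zeta>)"
  define Q where "Q = (\<lambda>z. ?c * contour_integral (circlepath (z0 $ s) \<rho>) (\<lambda>\<zeta>. G z \<zeta> / (\<zeta> - z $ s)))"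
  define R where "R = (\<lambda>k z. ?c * contour_integral (circlepath (z0 $ s) \<rho>) (\<lambda>\<zeta>. G z \<zeta> * diffquot (P z) d \<zeta> k))"
  have contu: "continuous_on A (\<lambda>x. upd s (fst x) (snd x))" for A :: "((complex^'k) \<times> complex) set"
  proof -
    have "continuous_on A (\<lambda>x. if i = s then snd x else fst x $ i)" for i
      by (cases "i = s") (auto intro!: continuous_intros)
    then show ?thesis unfolding upd_def by (intro continuous_on_vec_lambda)
  qed
  have contG: "continuous_on (?D \<times> ?S) (\<lambda>(z, \<zeta>). G z \<zeta>)"
  proof -
    have 1: "continuous_on (?D \<times> ?S) (\<lambda>x. g (upd s (fst x) (snd x)))"
      by (rule continuous_on_compose2[OF holo_continuous_on[OF g] contu]) (use updin in auto)
    have 2: "continuous_on (?D \<times> ?S) (\<lambda>x. poly (P (fst x)) (snd x))"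
      using continuous_on_subset[OF contP, of "?D \<times> ?S"] sub by (auto simp: case_prod_beta)
    show ?thesis unfolding G_def case_prod_beta
      by (intro continuous_intros 1 2) (use nzD in auto)
  qed
  have holP: "holo (\<lambda>z. poly (P z) \<zeta>) ?D" for \<zeta>
    by (rule holo_cong[OF open_polydisc, where g="\<lambda>z. \<Sum>k\<le>d. coeff (P z) k * \<zeta> ^ k"])
       (use deg sub in \<open>auto simp: poly_sum_le_degree[of _ d] intro!: holo_intros holo_subset[OF P]\<close>)
  have holG: "holo (\<lambda>z. G z \<zeta>) ?D" if "\<zeta> \<in> ?S" for \<zeta>
    unfolding G_def
    by (intro holo_divide holP holo_compose[OF hmap_upd g]) (use that updin nzD in auto)
  have contQ: "continuous_on (?D \<times> ?S) (\<lambda>(z, \<zeta>). G z \<zeta> / (\<zeta> - z $ s))"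
    using contG unfolding case_prod_beta by (intro continuous_intros) (use ne in auto)
  have contR: "continuous_on (?D \<times> ?S) (\<lambda>(z, \<zeta>). G z \<zeta> * diffquot (P z) d \<zeta> k)" for k
  proof -
    have "continuous_on (?D \<times> ?S) (\<lambda>x. coeff (P (fst x)) k)" for k
      by (rule continuous_on_compose2[OF holo_continuous_on[OF P] continuous_on_fst[OF continuous_on_id]])
         (use sub in auto)
    then show ?thesis
      using contG unfolding case_prod_beta diffquot_def by (intro continuous_intros)
  qed
  have Q: "holo Q ?D"
    unfolding Q_def
    by (intro holo_mult holo_const holo_circle_integral[OF open_polydisc r(5) contQ] holo_divide holG
        holo_diff holo_coord) (use ne in auto)
  have R: "holo (R k) ?D" for k
    unfolding R_def
    by (intro holo_mult holo_const holo_circle_integral[OF open_polydisc r(5) contR] holG)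
       (auto simp: diffquot_def intro!: holo_intros holo_subset[OF P sub])
  \<comment> \<open>The coordinate s is integrated out, and P ignores s and J, so the remainder
    loses its dependence on s.\<close>
  have indR: "R k (pin (insert s J) z0 z) = R k z" if z: "z \<in> ?D" for k z
  proof -
    have "G (pin (insert s J) z0 z) \<zeta> = G z \<zeta>" if "\<zeta> \<in> ?S" for \<zeta>
    proof -
      have "upd s (pin (insert s J) z0 z) \<zeta> = pin J z0 (upd s z \<zeta>)"
        using s by (auto simp: upd_def pin_def vec_eq_iff)
      then show ?thesis using indg[OF updin[OF z]] that by (simp add: G_def indP)
    qed
    then show ?thesis unfolding R_def indP
      by (intro arg_cong2[where f="(*)"] refl contour_integral_cong) (use r in auto)
  qed
  have "g z = Q z * poly (P z) (z $ s) + (\<Sum>k\<le>d. R k z * z $ s ^ k)" if z: "z \<in> ?D" for z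
  proof -
    let ?\<gamma> = "circlepath (z0 $ s) \<rho>" and ?y = "z $ s"
    have hol: "(\<lambda>\<zeta>. g (upd s z \<zeta>)) holomorphic_on cball (z0 $ s) \<rho>"
    proof -
      have eq: "upd s z 0 + \<zeta> *s axis s 1 = upd s z \<zeta>" for \<zeta>
        by (auto simp: upd_def axis_def vec_eq_iff)
      show ?thesis
        using holo_line_holomorphic[OF g, of "cball (z0 $ s) \<rho>" "upd s z 0" "axis s 1"] updin[OF z]
        unfolding eq by blast
    qed
    have y: "?y \<in> ball (z0 $ s) \<rho>" using z r by (auto simp: polydisc_def dist_norm norm_minus_commute intro: less_le_trans)
    have "((\<lambda>\<zeta>. g (upd s z \<zeta>) / (\<zeta> - ?y)) has_contour_integral (2 * of_real pi * \<i> * g (upd s z ?y))) ?\<gamma>"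
      using Cauchy_integral_circlepath[of "z0 $ s" \<rho> "\<lambda>\<zeta>. g (upd s z \<zeta>)" ?y] hol y
        holomorphic_on_imp_continuous_on[OF hol] holomorphic_on_subset[OF hol ball_subset_cball]
      by (simp add: dist_norm norm_minus_commute)
    moreover have "upd s z ?y = z" by (simp add: upd_def vec_eq_iff)
    ultimately have "g z = ?c * contour_integral ?\<gamma> (\<lambda>\<zeta>. g (upd s z \<zeta>) / (\<zeta> - ?y))"
      using contour_integral_unique by fastforce
    also have "contour_integral ?\<gamma> (\<lambda>\<zeta>. g (upd s z \<zeta>) / (\<zeta> - ?y)) =
       contour_integral ?\<gamma> (\<lambda>\<zeta>. G z \<zeta> / (\<zeta> - ?y) * poly (P z) ?y
          + (\<Sum>k\<le>d. G z \<zeta> * diffquot (P z) d \<zeta> k * ?y ^ k))"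
    proof (rule contour_integral_cong)
      fix \<zeta> assume "\<zeta> \<in> path_image ?\<gamma>"
      then have zs: "\<zeta> \<in> ?S" using r by simp
      have nz': "poly (P z) \<zeta> \<noteq> 0" "\<zeta> - ?y \<noteq> 0" using nzD[OF z zs] ne[OF z zs] by auto
      have "(\<Sum>k\<le>d. G z \<zeta> * diffquot (P z) d \<zeta> k * ?y ^ k) = G z \<zeta> * ((poly (P z) \<zeta> - poly (P z) ?y) / (\<zeta> - ?y))"
        using nz' unfolding diffquot[OF deg[OF subsetD[OF sub z]]]
        by (simp add: nonzero_mult_div_cancel_left sum_distrib_left[symmetric] mult.assoc)
      also have "\<dots> + G z \<zeta> / (\<zeta> - ?y) * poly (P z) ?y = G z \<zeta> * poly (P z) \<zeta> / (\<zeta> - ?y)"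
        using nz' by (simp only: times_divide_eq_right times_divide_eq_left add_divide_distrib[symmetric]
            distrib_left[symmetric] diff_add_cancel)
      also have "G z \<zeta> * poly (P z) \<zeta> = g (upd s z \<zeta>)" using nz' by (simp add: G_def)
      finally show "g (upd s z \<zeta>) / (\<zeta> - ?y) = G z \<zeta> / (\<zeta> - ?y) * poly (P z) ?y
          + (\<Sum>k\<le>d. G z \<zeta> * diffquot (P z) d \<zeta> k * ?y ^ k)" by (simp add: add.commute)
    qed simp
    also have "\<dots> = contour_integral ?\<gamma> (\<lambda>\<zeta>. G z \<zeta> / (\<zeta> - ?y)) * poly (P z) ?y
         + (\<Sum>k\<le>d. contour_integral ?\<gamma> (\<lambda>\<zeta>. G z \<zeta> * diffquot (P z) d \<zeta> k) * ?y ^ k)"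
      by (intro contour_integral_unique has_contour_integral_add has_contour_integral_sum
          has_contour_integral_rmul has_contour_integral_integral
          circle_param_integrable[OF contQ z r(5)] circle_param_integrable[OF contR z r(5)]) auto
    finally show ?thesis
      by (simp only: Q_def R_def distrib_left sum_distrib_left mult.assoc)
  qed
  then show ?thesis using that[OF r(1) _ Q R indR] r by simp
qed

section \<open>Families of commutative algebras\<close>

definition dot :: "complex^'n::finite \<Rightarrow> complex^'n \<Rightarrow> complex" where
  "dot y v = (\<Sum>i\<in>UNIV. y $ i * v $ i)"

definition mul :: "('t \<Rightarrow> 'n::finite \<Rightarrow> 'n \<Rightarrow> 'n \<Rightarrow> complex) \<Rightarrow> 't \<Rightarrow> complex^'n \<Rightarrow> complex^'n \<Rightarrow> complex^'n" where
  "mul a t x y = (\<chi> k. \<Sum>i\<in>UNIV. \<Sum>j\<in>UNIV. a t i j k * x $ i * y $ j)"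

definition chars :: "('t \<Rightarrow> 'n::finite \<Rightarrow> 'n \<Rightarrow> 'n \<Rightarrow> complex) \<Rightarrow> ('t \<Rightarrow> complex^'n) \<Rightarrow> 't \<Rightarrow> (complex^'n) set" where
  "chars a E t = {y. dot y (E t) = 1 \<and> (\<forall>v w. dot y (mul a t v w) = dot y v * dot y w)}"

text \<open>Distinct characters are linearly independent, so n of them already identify the algebra
  with \<complex>^n; \<open>semisimple_iff\<close> makes this precise.\<close>

definition sem :: "('t \<Rightarrow> 'n::finite \<Rightarrow> 'n \<Rightarrow> 'n \<Rightarrow> complex) \<Rightarrow> ('t \<Rightarrow> complex^'n) \<Rightarrow> 't \<Rightarrow> bool" where
  "sem a E t \<longleftrightarrow> (\<exists>\<Lambda> :: 'n \<Rightarrow> complex^'n. inj \<Lambda> \<and> range \<Lambda> \<subseteq> chars a E t)"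

definition lmat :: "('t \<Rightarrow> 'n::finite \<Rightarrow> 'n \<Rightarrow> 'n \<Rightarrow> complex) \<Rightarrow> 't \<Rightarrow> complex^'n \<Rightarrow> complex^'n^'n" where
  "lmat a t x = (\<chi> k j. \<Sum>i\<in>UNIV. a t i j k * x $ i)"

section \<open>Bilinear algebra in coordinates\<close>

lemma dot_add: "dot y (v + w) = dot y v + dot y w"
  by (simp add: dot_def algebra_simps sum.distrib)

lemma dot_diff: "dot y (v - w) = dot y v - dot y w"
  by (simp add: dot_def algebra_simps sum_subtractf)

lemma dot_smult: "dot y (c *s v) = c * dot y v"
  by (simp add: dot_def sum_distrib_left algebra_simps)

lemma dot_zero: "dot y 0 = 0"
  by (simp add: dot_def)

lemma dot_sum: "dot y (\<Sum>i\<in>I. f i) = (\<Sum>i\<in>I. dot y (f i))"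
  by (induction I rule: infinite_finite_induct) (auto simp: dot_zero dot_add)

lemma dot_axis: "dot y (axis i 1) = y $ i"
  unfolding dot_def by (subst sum.remove[of _ i]) (auto simp: axis_def intro!: sum.neutral)

lemmas dot_linear = dot_add dot_diff dot_smult dot_zero dot_sum

lemma dot_vec_eq_iff: "y = z \<longleftrightarrow> (\<forall>v. dot y v = dot z v)"
  by (metis dot_axis vec_eq_iff)

lemma mul_add_right: "mul a t x (y + z) = mul a t x y + mul a t x z"
  by (simp add: mul_def vec_eq_iff algebra_simps sum.distrib)

lemma mul_add_left: "mul a t (x + y) z = mul a t x z + mul a t y z"
  by (simp add: mul_def vec_eq_iff algebra_simps sum.distrib)

lemma mul_smult_right: "mul a t x (c *s y) = c *s mul a t x y"
  by (simp add: mul_def vec_eq_iff algebra_simps sum_distrib_left)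

lemma mul_smult_left: "mul a t (c *s x) y = c *s mul a t x y"
  by (simp add: mul_def vec_eq_iff algebra_simps sum_distrib_left)

lemma mul_zero_left: "mul a t 0 y = 0"
  by (simp add: mul_def vec_eq_iff)

lemma mul_zero_right: "mul a t x 0 = 0"
  by (simp add: mul_def vec_eq_iff)

lemma mul_diff_left: "mul a t (x - y) z = mul a t x z - mul a t y z"
  by (simp add: mul_def vec_eq_iff algebra_simps sum_subtractf)

lemma mul_diff_right: "mul a t x (y - z) = mul a t x y - mul a t x z"
  by (simp add: mul_def vec_eq_iff algebra_simps sum_subtractf)

lemma mul_sum_left: "mul a t (\<Sum>i\<in>I. f i) y = (\<Sum>i\<in>I. mul a t (f i) y)"
  by (induction I rule: infinite_finite_induct) (auto simp: mul_zero_left mul_add_left)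

lemma mul_sum_right: "mul a t y (\<Sum>i\<in>I. f i) = (\<Sum>i\<in>I. mul a t y (f i))"
  by (induction I rule: infinite_finite_induct) (auto simp: mul_zero_right mul_add_right)

lemmas mul_linear = mul_add_right mul_add_left mul_smult_right mul_smult_left mul_zero_left
  mul_zero_right mul_diff_left mul_diff_right mul_sum_left mul_sum_right

lemma mul_axis: "mul a t (axis i 1) (axis j 1) = (\<chi> k. a t i j k)"
proof -
  have "(\<Sum>i'\<in>UNIV. \<Sum>j'\<in>UNIV. a t i' j' k * axis i 1 $ i' * axis j 1 $ j') = a t i j k" for k
    by (simp add: axis_def mult_delta_right mult_delta_left if_distribR cong: if_cong)
  then show ?thesis by (simp add: mul_def)
qed

lemma lmat_mult: "lmat a t x *v y = mul a t x y"
proof -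
  have "(\<Sum>j\<in>UNIV. (\<Sum>i\<in>UNIV. a t i j k * x $ i) * y $ j) = (\<Sum>i\<in>UNIV. \<Sum>j\<in>UNIV. a t i j k * x $ i * y $ j)" for k
    by (subst sum.swap) (simp add: sum_distrib_right)
  then show ?thesis by (simp add: lmat_def matrix_vector_mult_def mul_def)
qed

text \<open>By bilinearity the products of basis vectors suffice. The resulting finitely many
  polynomial equations are the ones that define L in coordinates.\<close>

lemma chars_iff:
  "y \<in> chars a E t \<longleftrightarrow> dot y (E t) = 1 \<and> (\<forall>i j. y $ i * y $ j = (\<Sum>k\<in>UNIV. a t i j k * y $ k))"
proof -
  have d: "dot y (\<chi> k. a t i j k) = (\<Sum>k\<in>UNIV. a t i j k * y $ k)" for i j
    by (simp add: dot_def mult.commute)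
  have "dot y (mul a t v w) = dot y v * dot y w"
    if "\<forall>i j. y $ i * y $ j = (\<Sum>k\<in>UNIV. a t i j k * y $ k)" for v w
  proof -
    have "mul a t v w = mul a t (\<Sum>i\<in>UNIV. v $ i *s axis i 1) (\<Sum>i\<in>UNIV. w $ i *s axis i 1)"
      by (simp only: basis_expansion)
    then have "dot y (mul a t v w) = (\<Sum>i\<in>UNIV. \<Sum>j\<in>UNIV. v $ j * (w $ i * dot y (\<chi> k. a t j i k)))"
      by (simp add: mul_linear dot_linear mul_axis sum_distrib_left mult.left_commute)
    also have "\<dots> = (\<Sum>i\<in>UNIV. \<Sum>j\<in>UNIV. v $ j * (w $ i * (y $ j * y $ i)))"
      by (simp add: d that)
    also have "\<dots> = (\<Sum>j\<in>UNIV. \<Sum>i\<in>UNIV. v $ j * (w $ i * (y $ j * y $ i)))"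
      by (rule sum.swap)
    also have "\<dots> = dot y v * dot y w"
      by (simp add: dot_def sum_product mult_ac)
    finally show ?thesis .
  qed
  moreover have "y $ i * y $ j = (\<Sum>k\<in>UNIV. a t i j k * y $ k)"
    if "\<forall>v w. dot y (mul a t v w) = dot y v * dot y w" for i j
    using that[rule_format, of "axis i 1" "axis j 1"] by (simp add: dot_axis mul_axis d)
  ultimately show ?thesis unfolding chars_def by blast
qed

section \<open>Characters of one algebra\<close>

lemma chars_unit: "y \<in> chars a E t \<Longrightarrow> dot y (E t) = 1"
  and chars_mul: "y \<in> chars a E t \<Longrightarrow> dot y (mul a t v w) = dot y v * dot y w"
  by (auto simp: chars_def)

text \<open>Let l be an index where \<open>cmod (y $ l)\<close> is largest. The relation for
  \<open>y $ l * y $ l\<close> bounds its square by itself times the sum of the moduli of the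
  constants \<open>a t l l k\<close>.\<close>

lemma chars_bound:
  assumes "y \<in> chars a E t"
  shows "cmod (y $ i) \<le> (\<Sum>i\<in>UNIV. \<Sum>j\<in>UNIV. \<Sum>k\<in>UNIV. cmod (a t i j k))"
proof -
  let ?B = "\<Sum>i\<in>UNIV. \<Sum>j\<in>UNIV. \<Sum>k\<in>UNIV. cmod (a t i j k)"
  obtain l where l: "cmod (y $ j) \<le> cmod (y $ l)" for j
  proof -
    have "Max (range (\<lambda>j. cmod (y $ j))) \<in> range (\<lambda>j. cmod (y $ j))" by (rule Max_in) auto
    then obtain l where "Max (range (\<lambda>j. cmod (y $ j))) = cmod (y $ l)" by blast
    then have "cmod (y $ j) \<le> cmod (y $ l)" for j
      using Max_ge[of "range (\<lambda>j. cmod (y $ j))" "cmod (y $ j)"] by simp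
    then show ?thesis using that by blast
  qed
  have "cmod (y $ l) * cmod (y $ l) = cmod (\<Sum>k\<in>UNIV. a t l l k * y $ k)"
    using assms by (simp add: chars_iff norm_mult[symmetric])
  also have "\<dots> \<le> (\<Sum>k\<in>UNIV. cmod (a t l l k) * cmod (y $ l))"
    by (rule order_trans[OF norm_sum]) (auto simp: norm_mult intro!: sum_mono mult_left_mono l)
  also have "\<dots> = (\<Sum>k\<in>UNIV. cmod (a t l l k)) * cmod (y $ l)" by (simp add: sum_distrib_right)
  also have "\<dots> \<le> ?B * cmod (y $ l)"
  proof (rule mult_right_mono)
    have "(\<Sum>k\<in>UNIV. cmod (a t l l k)) \<le> (\<Sum>j\<in>UNIV. \<Sum>k\<in>UNIV. cmod (a t l j k))"
      by (rule member_le_sum[where f="\<lambda>j. \<Sum>k\<in>UNIV. cmod (a t l j k)"]) (auto intro: sum_nonneg)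
    also have "\<dots> \<le> ?B"
      by (rule member_le_sum[where f="\<lambda>i. \<Sum>j\<in>UNIV. \<Sum>k\<in>UNIV. cmod (a t i j k)"])
         (auto intro!: sum_nonneg)
    finally show "(\<Sum>k\<in>UNIV. cmod (a t l l k)) \<le> ?B" .
  qed simp
  finally have "cmod (y $ l) * cmod (y $ l) \<le> ?B * cmod (y $ l)" .
  moreover have "0 \<le> ?B" by (intro sum_nonneg) simp
  ultimately have "cmod (y $ l) \<le> ?B"
    by (cases "cmod (y $ l) = 0") (auto dest: mult_right_le_imp_le)
  then show ?thesis using l[of i] by linarith
qed

lemma chars_separated:
  assumes "\<xi> \<in> chars a E t" "\<mu> \<in> chars a E t" "\<xi> \<noteq> \<mu>"
  obtains v where "dot \<xi> v = 1" "dot \<mu> v = 0"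
proof -
  obtain w where w: "dot \<xi> w \<noteq> dot \<mu> w" using assms(3) dot_vec_eq_iff by blast
  let ?v = "inverse (dot \<xi> w - dot \<mu> w) *s (w - dot \<mu> w *s E t)"
  have "dot \<xi> ?v = 1" "dot \<mu> ?v = 0"
    using w by (simp_all add: dot_linear chars_unit[OF assms(1)] chars_unit[OF assms(2)] right_diff_distrib[symmetric])
  then show ?thesis using that by blast
qed

text \<open>Multiply elements that separate \<xi> from one \<mu> at a time; characters are
  multiplicative, so the product keeps the value 1 at \<xi> and picks up all the zeros. This is the
  linear independence of characters.\<close>

lemma chars_dual:
  assumes "finite F" "F \<subseteq> chars a E t" "\<xi> \<in> chars a E t" "\<xi> \<notin> F"
  shows "\<exists>v. dot \<xi> v = 1 \<and> (\<forall>\<mu>\<in>F. dot \<mu> v = 0)"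
  using assms
proof (induction F rule: finite_induct)
  case empty
  then show ?case using chars_unit[OF empty(2)] by auto
next
  case (insert \<mu> F)
  then obtain v where v: "dot \<xi> v = 1" "\<forall>\<mu>\<in>F. dot \<mu> v = 0" by auto
  obtain w where w: "dot \<xi> w = 1" "dot \<mu> w = 0" using chars_separated[of \<xi> a E t \<mu>] insert by auto
  have "dot \<nu> (mul a t v w) = dot \<nu> v * dot \<nu> w" if "\<nu> \<in> insert \<xi> (insert \<mu> F)" for \<nu>
    using insert.prems that by (intro chars_mul) auto
  then show ?case using v w by (intro exI[of _ "mul a t v w"]) auto
qed

lemma inj_chars_dual:
  fixes \<Lambda> :: "'n::finite \<Rightarrow> complex^'n"
  assumes "inj \<Lambda>" "range \<Lambda> \<subseteq> chars a E t"
  obtains V where "(\<chi> i. \<Lambda> i) ** V = mat 1" "V ** (\<chi> i. \<Lambda> i) = mat 1"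
proof -
  have "\<exists>v. dot (\<Lambda> i) v = 1 \<and> (\<forall>\<mu>\<in>\<Lambda> ` (- {i}). dot \<mu> v = 0)" for i
    by (rule chars_dual) (use assms in \<open>auto dest: injD\<close>)
  then obtain v where v0: "\<And>i. dot (\<Lambda> i) (v i) = 1 \<and> (\<forall>\<mu>\<in>\<Lambda> ` (- {i}). dot \<mu> (v i) = 0)"
    by metis
  then have v: "\<And>i. dot (\<Lambda> i) (v i) = 1" "\<And>i j. j \<noteq> i \<Longrightarrow> dot (\<Lambda> j) (v i) = 0"
    by auto
  have "(\<chi> i. \<Lambda> i) ** (\<chi> k i. v i $ k) = mat 1"
    using v by (auto simp: matrix_matrix_mult_def mat_def vec_eq_iff dot_def)
  then show ?thesis using that matrix_left_right_inverse by blast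
qed

text \<open>A further character would take the value 1 on a vector killed by n linearly independent
  characters, but that vector is 0.\<close>

lemma inj_chars_range:
  fixes \<Lambda> :: "'n::finite \<Rightarrow> complex^'n"
  assumes "inj \<Lambda>" "range \<Lambda> \<subseteq> chars a E t"
  shows "range \<Lambda> = chars a E t"
proof (rule ccontr)
  assume "range \<Lambda> \<noteq> chars a E t"
  then obtain \<mu> where \<mu>: "\<mu> \<in> chars a E t" "\<mu> \<notin> range \<Lambda>" using assms(2) by blast
  obtain v where v: "dot \<mu> v = 1" "\<forall>\<nu>\<in>range \<Lambda>. dot \<nu> v = 0"
    using chars_dual[of "range \<Lambda>" a E t \<mu>] assms \<mu> by auto
  obtain V where V: "V ** (\<chi> i. \<Lambda> i) = mat 1" using inj_chars_dual[OF assms] by blast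
  have "(\<chi> i. \<Lambda> i) *v v = 0" using v(2) by (simp add: matrix_vector_mult_def vec_eq_iff dot_def)
  then have "v = 0" using V matrix_left_invertible_ker by blast
  then show False using v(1) by (simp add: dot_zero)
qed

lemma
  fixes a :: "'t \<Rightarrow> 'n::finite \<Rightarrow> 'n \<Rightarrow> 'n \<Rightarrow> complex"
  shows chars_finite: "finite (chars a E t)"
    and chars_card: "card (chars a E t) \<le> CARD('n)"
    and sem_iff_card: "sem a E t \<longleftrightarrow> card (chars a E t) = CARD('n)"
proof -
  have *: "\<exists>\<Lambda> :: 'n \<Rightarrow> complex^'n. inj \<Lambda> \<and> range \<Lambda> \<subseteq> F" if "finite F" "CARD('n) \<le> card F" for F
    using card_le_inj[OF finite_class.finite_UNIV that] by blast
  have fin: "finite F \<Longrightarrow> F \<subseteq> chars a E t \<Longrightarrow> card F \<le> CARD('n)" for F :: "(complex^'n) set"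
  proof (rule ccontr)
    assume F: "finite F" "F \<subseteq> chars a E t" "\<not> card F \<le> CARD('n)"
    then have "CARD('n) \<le> card F" by linarith
    from *[OF F(1) this] obtain \<Lambda> :: "'n \<Rightarrow> complex^'n" where \<Lambda>: "inj \<Lambda>" "range \<Lambda> \<subseteq> F" by blast
    then have "F \<subseteq> range \<Lambda>" using inj_chars_range[OF \<Lambda>(1) order_trans[OF \<Lambda>(2) F(2)]] F(2) by simp
    then have "card F \<le> card (range \<Lambda>)" by (intro card_mono) auto
    then show False using F(3) card_image[OF \<Lambda>(1)] by simp
  qed
  show f: "finite (chars a E t)"
  proof (rule ccontr)
    assume "infinite (chars a E t)"
    then obtain F where "F \<subseteq> chars a E t" "finite F" "card F = Suc CARD('n)"
      using infinite_arbitrarily_large by blast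
    then show False using fin[of F] by simp
  qed
  show "card (chars a E t) \<le> CARD('n)" using fin[OF f] by simp
  show "sem a E t \<longleftrightarrow> card (chars a E t) = CARD('n)"
  proof
    assume "sem a E t"
    then obtain \<Lambda> :: "'n \<Rightarrow> complex^'n" where "inj \<Lambda>" "range \<Lambda> \<subseteq> chars a E t" unfolding sem_def by blast
    then have "inj \<Lambda>" "range \<Lambda> = chars a E t" using inj_chars_range[of \<Lambda> a E t] by auto
    then show "card (chars a E t) = CARD('n)" using card_image[of \<Lambda> UNIV] by simp
  next
    assume "card (chars a E t) = CARD('n)"
    then show "sem a E t" unfolding sem_def by (intro *[OF f]) simp
  qed
qed

lemma semE:
  assumes "sem a E t"
  obtains \<Lambda> :: "'n::finite \<Rightarrow> complex^'n" and V where "inj \<Lambda>" "range \<Lambda> = chars a E t"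
    "(\<chi> i. \<Lambda> i) ** V = mat 1" "V ** (\<chi> i. \<Lambda> i) = mat 1"
proof -
  obtain \<Lambda> :: "'n \<Rightarrow> complex^'n" where L: "inj \<Lambda>" "range \<Lambda> \<subseteq> chars a E t"
    using assms unfolding sem_def by blast
  obtain V where "(\<chi> i. \<Lambda> i) ** V = mat 1" "V ** (\<chi> i. \<Lambda> i) = mat 1"
    using inj_chars_dual[OF L] by blast
  then show ?thesis using that L inj_chars_range[OF L] by blast
qed

text \<open>At a semisimple point the characters form a basis of the dual space.\<close>

lemma sem_separate:
  fixes a :: "'t \<Rightarrow> 'n::finite \<Rightarrow> 'n \<Rightarrow> 'n \<Rightarrow> complex"
  assumes "sem a E t" "\<And>\<psi>. \<psi> \<in> chars a E t \<Longrightarrow> dot \<psi> x = dot \<psi> y"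
  shows "x = y"
proof -
  obtain \<Lambda> :: "'n \<Rightarrow> complex^'n" and V where L: "range \<Lambda> = chars a E t" "V ** (\<chi> i. \<Lambda> i) = mat 1"
    by (rule semE[OF assms(1)])
  have "dot (\<Lambda> i) (x - y) = 0" for i using assms(2)[of "\<Lambda> i"] L(1) by (auto simp: dot_diff)
  then have "(\<chi> i. \<Lambda> i) *v (x - y) = 0" by (simp add: vec_eq_iff matrix_vector_mult_def dot_def)
  then have "V ** (\<chi> i. \<Lambda> i) *v (x - y) = 0" by (simp add: matrix_vector_mul_assoc[symmetric])
  then show ?thesis by (simp add: L(2))
qed

text \<open>Characters are simultaneous left eigenvectors of all multiplications, with the value at
  x as eigenvalue.\<close>

lemma lmat_diagonal:
  assumes "\<And>i. \<Lambda> i \<in> chars a E t"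
  shows "(\<chi> i. \<Lambda> i) ** lmat a t x = (\<chi> i j. if i = j then dot (\<Lambda> i) x else 0) ** (\<chi> i. \<Lambda> i)"
    (is "?L ** _ = ?D ** _")
proof -
  have "(?L ** lmat a t x) *v v = (?D ** ?L) *v v" for v
  proof -
    have "(?L ** lmat a t x) *v v = ?L *v (mul a t x v)"
      by (simp add: matrix_vector_mul_assoc[symmetric] lmat_mult)
    also have "\<dots> = (\<chi> i. dot (\<Lambda> i) x * dot (\<Lambda> i) v)"
      using chars_mul[OF assms] by (simp add: matrix_vector_mult_def dot_def[symmetric])
    also have "\<dots> = ?D *v (?L *v v)"
      by (simp add: matrix_vector_mult_def dot_def[symmetric] vec_eq_iff if_distrib if_distribR cong: if_cong)
    finally show ?thesis by (simp add: matrix_vector_mul_assoc)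
  qed
  then show ?thesis unfolding matrix_eq by blast
qed

text \<open>The matrix whose rows are the characters is invertible and conjugates multiplication by
  x to a diagonal matrix.\<close>

lemma
  fixes a :: "'t \<Rightarrow> 'n::finite \<Rightarrow> 'n \<Rightarrow> 'n \<Rightarrow> complex"
  shows sem_trace: "sem a E t \<Longrightarrow> trace (lmat a t x) = (\<Sum>\<psi>\<in>chars a E t. dot \<psi> x)"
  and sem_det: "sem a E t \<Longrightarrow> det (lmat a t x) = (\<Prod>\<psi>\<in>chars a E t. dot \<psi> x)"
proof -
  assume s: "sem a E t"
  obtain \<Lambda> :: "'n \<Rightarrow> complex^'n" and V where L: "inj \<Lambda>" "range \<Lambda> = chars a E t"
      "(\<chi> i. \<Lambda> i) ** V = mat 1" "V ** (\<chi> i. \<Lambda> i) = mat 1"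
    by (rule semE[OF s])
  let ?L = "\<chi> i. \<Lambda> i" and ?D = "\<chi> i j. if i = j then dot (\<Lambda> i) x else 0"
  have diag: "?L ** lmat a t x = ?D ** ?L" by (rule lmat_diagonal) (use L in auto)
  have "trace (lmat a t x) = trace (V ** (?L ** lmat a t x))"
    by (simp add: matrix_mul_assoc L)
  also have "\<dots> = trace (?L ** (V ** ?D))"
    unfolding diag by (simp only: matrix_mul_assoc) (rule trace_mul_sym[symmetric, of ?L "V ** ?D", unfolded matrix_mul_assoc, symmetric])
  also have "\<dots> = trace ?D" by (simp add: matrix_mul_assoc L)
  also have "\<dots> = (\<Sum>i\<in>UNIV. dot (\<Lambda> i) x)" by (simp add: trace_def)
  also have "\<dots> = (\<Sum>\<psi>\<in>chars a E t. dot \<psi> x)"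
    using sum.reindex[OF L(1), of "\<lambda>\<psi>. dot \<psi> x"] L(2) by simp
  finally show "trace (lmat a t x) = (\<Sum>\<psi>\<in>chars a E t. dot \<psi> x)" .
  have "det V * det ?L = 1" using arg_cong[OF L(4), of det] by (simp add: det_mul)
  then have "det ?L \<noteq> 0" by auto
  moreover have "det ?L * det (lmat a t x) = det ?D * det ?L" using arg_cong[OF diag, of det] by (simp add: det_mul)
  ultimately have "det (lmat a t x) = det ?D" by simp
  also have "\<dots> = (\<Prod>i\<in>UNIV. dot (\<Lambda> i) x)" by (subst det_diagonal) auto
  also have "\<dots> = (\<Prod>\<psi>\<in>chars a E t. dot \<psi> x)"
    using prod.reindex[OF L(1), of "\<lambda>\<psi>. dot \<psi> x"] L(2) by simp
  finally show "det (lmat a t x) = (\<Prod>\<psi>\<in>chars a E t. dot \<psi> x)" .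
qed

lemma open_shrink:
  assumes "open U" "continuous_on U f" "open B" "x \<in> U" "f x \<in> B"
  obtains V where "open V" "x \<in> V" "V \<subseteq> U" "\<And>y. y \<in> V \<Longrightarrow> f y \<in> B"
proof -
  have "open (U \<inter> f -` B)" by (rule continuous_open_preimage[OF assms(2,1,3)])
  then show ?thesis using that[of "U \<inter> f -` B"] assms(4,5) by blast
qed

lemma hmapI: "(\<And>k. holo (\<lambda>t. F t $ k) S) \<Longrightarrow> hmap F S"
  by (simp add: hmap_def)

lemma holo_dot: "hmap y S \<Longrightarrow> hmap v S \<Longrightarrow> holo (\<lambda>t. dot (y t) (v t)) S"
  unfolding dot_def by (intro holo_intros)

lemma continuous_on_det:
  assumes "\<And>i j. continuous_on S (\<lambda>x. M x $ i $ j)"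
  shows "continuous_on S (\<lambda>x. det (M x :: complex^'n^'n::finite))"
  unfolding det_def by (intro continuous_intros assms)

text \<open>The trace of multiplication is linear in its argument; this is its coefficient vector,
  which makes \<open>dot\<close> and its rules applicable.\<close>

definition trv :: "('t \<Rightarrow> 'n::finite \<Rightarrow> 'n \<Rightarrow> 'n \<Rightarrow> complex) \<Rightarrow> 't \<Rightarrow> complex^'n" where
  "trv a t = (\<chi> i. \<Sum>k\<in>UNIV. a t i k k)"

lemma trace_lmat: "trace (lmat a t x) = dot (trv a t) x"
  unfolding trace_def lmat_def trv_def dot_def vec_lambda_beta
  by (subst sum.swap) (simp add: sum_distrib_right)

lemma sem_trv: "sem a E t \<Longrightarrow> dot (trv a t) x = (\<Sum>\<psi>\<in>chars a E t. dot \<psi> x)"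
  using sem_trace[of a E t x] by (simp add: trace_lmat)

text \<open>The multiplication in one chart: structure constants a and unit field E. The assumption
  \<open>dense\<close> is the massive condition, and through it identities reach the points of the
  caustic.\<close>

locale alg_family =
  fixes Om :: "(complex^'n::finite) set" and a :: "complex^'n \<Rightarrow> 'n \<Rightarrow> 'n \<Rightarrow> 'n \<Rightarrow> complex"
    and E :: "complex^'n \<Rightarrow> complex^'n"
  assumes open_Om: "open Om"
    and holo_a: "\<And>i j k. holo (\<lambda>t. a t i j k) Om"
    and holo_E: "hmap E Om"
    and mul_commute: "\<And>t x y. t \<in> Om \<Longrightarrow> mul a t x y = mul a t y x"
    and mul_assoc: "\<And>t x y z. t \<in> Om \<Longrightarrow> mul a t (mul a t x y) z = mul a t x (mul a t y z)"
    and mul_unit: "\<And>t x. t \<in> Om \<Longrightarrow> mul a t (E t) x = x"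
    and dense: "Om \<subseteq> closure {t \<in> Om. sem a E t}"
begin

abbreviation "Ch \<equiv> chars a E"

lemma holo_a_sub: "S \<subseteq> Om \<Longrightarrow> holo (\<lambda>t. a t i j k) S"
  using holo_subset[OF holo_a] .

lemma hmap_mul: "S \<subseteq> Om \<Longrightarrow> hmap X S \<Longrightarrow> hmap Y S \<Longrightarrow> hmap (\<lambda>t. mul a t (X t) (Y t)) S"
  by (rule hmapI, unfold mul_def vec_lambda_beta, intro holo_intros holo_a_sub)

lemma holo_lmat: "S \<subseteq> Om \<Longrightarrow> hmap X S \<Longrightarrow> holo (\<lambda>t. lmat a t (X t) $ i $ j) S"
  unfolding lmat_def vec_lambda_beta by (intro holo_intros holo_a_sub)

lemma hmap_trv: "S \<subseteq> Om \<Longrightarrow> hmap (trv a) S"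
  unfolding hmap_def trv_def vec_lambda_beta by (intro allI holo_intros holo_a_sub)

lemma dense_closed:
  assumes "open U" "U \<subseteq> Om" "continuous_on U f" "closed C"
    "\<And>t. t \<in> U \<Longrightarrow> sem a E t \<Longrightarrow> f t \<in> C" "t \<in> U"
  shows "f t \<in> C"
proof (rule ccontr)
  assume n: "f t \<notin> C"
  have "open (U \<inter> f -` (- C))"
    by (rule continuous_open_preimage[OF assms(3,1)]) (use assms(4) in auto)
  moreover have "t \<in> (U \<inter> f -` (- C)) \<inter> closure {t \<in> Om. sem a E t}"
    using n assms(2,6) dense by blast
  ultimately have "(U \<inter> f -` (- C)) \<inter> {t \<in> Om. sem a E t} \<noteq> {}"
    using open_Int_closure_eq_empty by blast
  then show False using assms(5) by blast
qed

lemma dense_zero: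
  assumes "open U" "U \<subseteq> Om" "holo f U" "\<And>t. t \<in> U \<Longrightarrow> sem a E t \<Longrightarrow> f t = 0" "t \<in> U"
  shows "f t = 0"
  using dense_closed[OF assms(1,2) holo_continuous_on[OF assms(3)], of "{0}"] assms(4,5) by simp

text \<open>Over the caustic characters cannot tell vectors apart, so two fields are compared where
  characters separate, and density does the rest.\<close>

lemma dense_separate:
  assumes "open U" "U \<subseteq> Om" "hmap X U" "hmap Y U" "t \<in> U"
    "\<And>t \<psi>. t \<in> U \<Longrightarrow> sem a E t \<Longrightarrow> \<psi> \<in> Ch t \<Longrightarrow> dot \<psi> (X t) = dot \<psi> (Y t)"
  shows "X t = Y t"
proof -
  have "X t $ k - Y t $ k = 0" for k
  proof (rule dense_zero[OF assms(1,2) _ _ assms(5)])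
    show "holo (\<lambda>t. X t $ k - Y t $ k) U" using assms(3,4) by (intro holo_intros)
    fix t assume "t \<in> U" "sem a E t"
    then have "X t = Y t" using assms(6)[of t] by (intro sem_separate[of a E t]) auto
    then show "X t $ k - Y t $ k = 0" by simp
  qed
  then show ?thesis by (simp add: vec_eq_iff)
qed

text \<open>Characters are bounded locally uniformly, hence the set of characters is upper semicontinuous.\<close>

lemma chars_tube:
  assumes t0: "t0 \<in> Om" and W: "open W" and in_W: "\<And>y. y \<in> Ch t0 \<Longrightarrow> (t0, y) \<in> W"
  obtains U where "open U" "t0 \<in> U" "U \<subseteq> Om" "\<And>t y. t \<in> U \<Longrightarrow> y \<in> Ch t \<Longrightarrow> (t, y) \<in> W"
proof -
  define B where "B = (\<lambda>t. \<Sum>i\<in>UNIV. \<Sum>j\<in>UNIV. \<Sum>k\<in>UNIV. cmod (a t i j k))"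
  have "continuous_on Om B"
    unfolding B_def by (intro continuous_intros holo_continuous_on[OF holo_a])
  then obtain U1 where U1: "open U1" "t0 \<in> U1" "U1 \<subseteq> Om" "\<And>t. t \<in> U1 \<Longrightarrow> B t \<in> {..<B t0 + 1}"
    by (rule open_shrink[OF open_Om _ open_lessThan[of "B t0 + 1"] t0]) auto
  \<comment> \<open>A compact set containing all characters over the neighbourhood U1, as the tube
    lemma requires; the \<open>+ 1\<close> is the slack for moving the base point.\<close>
  define K where "K = cball (0 :: complex^'n) (real CARD('n) * (B t0 + 1))"
  have inK: "y \<in> K" if "t \<in> U1" "y \<in> Ch t" for t y
  proof -
    have "norm y \<le> (\<Sum>i\<in>UNIV. cmod (y $ i))"
      unfolding norm_vec_def by (rule L2_set_le_sum) simp
    also have "\<dots> \<le> (\<Sum>i\<in>(UNIV :: 'n set). B t0 + 1)"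
      by (rule sum_mono) (use chars_bound[OF that(2)] U1(4)[OF that(1)] in \<open>auto simp: B_def intro: order_trans less_imp_le\<close>)
    finally show ?thesis by (simp add: K_def)
  qed
  \<comment> \<open>The open sets on which one of the equations of a character fails; together with
    W they cover \<open>{t0} \<times> K\<close>.\<close>
  define N0 where "N0 = (Om \<times> UNIV) \<inter> (\<lambda>x. dot (snd x) (E (fst x))) -` (- {1})"
  define N where "N i j = (Om \<times> UNIV) \<inter> (\<lambda>x. snd x $ i * snd x $ j - (\<Sum>k\<in>UNIV. a (fst x) i j k * snd x $ k)) -` (- {0})" for i j
  have ca: "continuous_on (Om \<times> (UNIV :: (complex^'n) set)) (\<lambda>x. a (fst x) i j k)" for i j k
    by (rule continuous_on_compose2[OF holo_continuous_on[OF holo_a] continuous_on_fst[OF continuous_on_id]]) auto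
  have cE: "continuous_on (Om \<times> (UNIV :: (complex^'n) set)) (\<lambda>x. E (fst x) $ k)" for k
    by (rule continuous_on_compose2[OF holo_continuous_on[OF hmap_nth[OF holo_E]] continuous_on_fst[OF continuous_on_id]]) auto
  have "open N0" unfolding N0_def dot_def
    by (rule continuous_open_preimage) (intro continuous_intros cE open_Times open_Om open_UNIV open_Compl closed_singleton)+
  moreover have "open (N i j)" for i j unfolding N_def
    by (rule continuous_open_preimage) (intro continuous_intros ca open_Times open_Om open_UNIV open_Compl closed_singleton)+
  ultimately have oN: "open (W \<union> (N0 \<union> (\<Union>i. \<Union>j. N i j)))" using W by (intro open_Un open_UN) auto
  have Niff: "(t, y) \<in> N0 \<union> (\<Union>i. \<Union>j. N i j) \<longleftrightarrow> y \<notin> Ch t" if "t \<in> Om" for t y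
    using that by (auto simp: N0_def N_def chars_iff)
  have "{t0} \<times> K \<subseteq> W \<union> (N0 \<union> (\<Union>i. \<Union>j. N i j))" using in_W Niff[OF t0] by blast
  then obtain X0 where X0: "open X0" "t0 \<in> X0" "X0 \<times> K \<subseteq> W \<union> (N0 \<union> (\<Union>i. \<Union>j. N i j))"
    using tube_nbhd[OF _ oN] compact_cball unfolding K_def by metis
  show ?thesis
  proof (rule that[of "U1 \<inter> X0"])
    show "(t, y) \<in> W" if "t \<in> U1 \<inter> X0" "y \<in> Ch t" for t y
    proof -
      have "(t, y) \<in> X0 \<times> K" using inK that by blast
      moreover have "(t, y) \<notin> N0 \<union> (\<Union>i. \<Union>j. N i j)" using Niff that U1(3) by blast
      ultimately show ?thesis using X0(3) by blast
    qed
  qed (use U1 X0 in auto)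
qed

text \<open>At t0 the trace need not be the sum over distinct characters. But over nearby semisimple
  points it is, and there all characters are small on x by upper semicontinuity, so the trace at t0
  is a limit of arbitrarily small numbers.\<close>

lemma trace_zero:
  assumes t0: "t0 \<in> Om" and x: "\<And>\<psi>. \<psi> \<in> Ch t0 \<Longrightarrow> dot \<psi> x = 0"
  shows "dot (trv a t0) x = 0"
proof -
  have "cmod (dot (trv a t0) x) \<le> 0 + e" if "0 < e" for e
  proof -
    \<comment> \<open>Over a semisimple point n characters contribute, each less than d.\<close>
    define d where "d = e / real CARD('n)"
    have d: "0 < d" using that by (simp add: d_def)
    have "open {p :: (complex^'n) \<times> (complex^'n). cmod (dot (snd p) x) < d}"
      unfolding dot_def by (intro open_Collect_less continuous_intros)
    then obtain U where U: "open U" "t0 \<in> U" "U \<subseteq> Om"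
      "\<And>t y. t \<in> U \<Longrightarrow> y \<in> Ch t \<Longrightarrow> (t, y) \<in> {p. cmod (dot (snd p) x) < d}"
      by (rule chars_tube[OF t0]) (use x d in auto)
    have "dot (trv a t0) x \<in> cball 0 e"
    proof (rule dense_closed[OF U(1,3) _ closed_cball _ U(2)])
      show "continuous_on U (\<lambda>t. dot (trv a t) x)"
        by (intro holo_continuous_on holo_dot hmap_trv U hmap_const)
      fix t assume t: "t \<in> U" "sem a E t"
      have "cmod (dot (trv a t) x) \<le> (\<Sum>\<psi>\<in>Ch t. cmod (dot \<psi> x))"
        unfolding sem_trv[OF t(2)] by (rule norm_sum)
      also have "\<dots> \<le> (\<Sum>\<psi>\<in>Ch t. d)" by (rule sum_mono) (use U(4)[OF t(1)] in \<open>auto intro: less_imp_le\<close>)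
      also have "\<dots> = e" using t(2) by (simp add: sem_iff_card d_def)
      finally show "dot (trv a t) x \<in> cball 0 e" by simp
    qed
    then show ?thesis by simp
  qed
  then have "cmod (dot (trv a t0) x) \<le> 0" by (rule field_le_epsilon)
  then show ?thesis by simp
qed

definition gram :: "complex^'n \<Rightarrow> complex^'n^'n" where
  "gram t = (\<chi> i j. dot (trv a t) (mul a t (axis i 1) (axis j 1)))"

lemma holo_discriminant: "holo (\<lambda>t. det (gram t)) Om"
  by (intro holo_det) (simp add: gram_def, intro holo_dot hmap_trv hmap_mul hmap_const order_refl)

text \<open>At a semisimple point the Gram matrix is the transpose of the invertible character
  matrix times that matrix. Elsewhere there are fewer than n characters, hence a nonzero v killed by
  all of them; then the trace of every product with v is 0 by \<open>trace_zero\<close>, and v lies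
  in the kernel of the Gram matrix.\<close>

lemma sem_iff_discriminant:
  assumes t: "t \<in> Om"
  shows "sem a E t \<longleftrightarrow> det (gram t) \<noteq> 0"
proof
  assume s: "sem a E t"
  obtain \<Lambda> :: "'n \<Rightarrow> complex^'n" and V where L: "inj \<Lambda>" "range \<Lambda> = Ch t"
      "(\<chi> i. \<Lambda> i) ** V = mat 1" "V ** (\<chi> i. \<Lambda> i) = mat 1"
    by (rule semE[OF s])
  have "gram t $ i $ j = (transpose (\<chi> i. \<Lambda> i) ** (\<chi> i. \<Lambda> i)) $ i $ j" for i j
  proof -
    have "gram t $ i $ j = (\<Sum>\<psi>\<in>range \<Lambda>. dot \<psi> (mul a t (axis i 1) (axis j 1)))"
      using sem_trv[OF s] L(2) by (simp add: gram_def)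
    also have "\<dots> = (\<Sum>\<psi>\<in>range \<Lambda>. \<psi> $ i * \<psi> $ j)"
      by (rule sum.cong) (use L(2) in \<open>auto simp: chars_mul[of _ a E t] dot_axis\<close>)
    also have "\<dots> = (\<Sum>k\<in>UNIV. \<Lambda> k $ i * \<Lambda> k $ j)" by (simp add: sum.reindex[OF L(1)])
    finally show ?thesis by (simp add: matrix_matrix_mult_def transpose_def)
  qed
  then have "gram t = transpose (\<chi> i. \<Lambda> i) ** (\<chi> i. \<Lambda> i)" by (simp add: vec_eq_iff)
  moreover have "det (\<chi> i. \<Lambda> i) \<noteq> 0" using arg_cong[OF L(4), of det] by (auto simp: det_mul)
  ultimately show "det (gram t) \<noteq> 0" by (simp add: det_mul)
next
  assume d: "det (gram t) \<noteq> 0"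
  show "sem a E t"
  proof (rule ccontr)
    assume "\<not> sem a E t"
    then have "card (Ch t) < CARD('n)" using sem_iff_card[of a E t] chars_card[of a E t] by linarith
    then have F: "finite (insert 0 (Ch t))" "card (insert 0 (Ch t)) \<le> CARD('n)"
      using chars_finite[of a E t] by (auto simp: card_insert_if)
    obtain h :: "complex^'n \<Rightarrow> 'n" where h: "inj_on h (insert 0 (Ch t))"
      using card_le_inj[OF F(1) finite_class.finite_UNIV F(2)] by blast
    \<comment> \<open>The vector 0 and the characters, at most n vectors in all, are spread over
      distinct rows. The zero row makes M singular, and a kernel vector is killed by every
      character.\<close>
    define M where "M = (\<chi> i. if i \<in> h ` insert 0 (Ch t) then inv_into (insert 0 (Ch t)) h i else 0)"
    have Mh: "M $ h y = y" if "y \<in> insert 0 (Ch t)" for y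
      using that inv_into_f_f[OF h that] unfolding M_def by auto
    have "\<not> (\<forall>v. M *v v = 0 \<longrightarrow> v = 0)"
    proof
      assume "\<forall>v. M *v v = 0 \<longrightarrow> v = 0"
      then obtain B where "B ** M = mat 1" using matrix_left_invertible_ker[of M] by blast
      then have "M ** B = mat 1" using matrix_left_right_inverse by blast
      then have "(M ** B) $ h 0 $ h 0 = 1" by (simp add: mat_def)
      then show False using Mh[of 0] by (simp add: matrix_matrix_mult_def)
    qed
    then obtain v where v: "M *v v = 0" "v \<noteq> 0" by blast
    have v0: "dot \<psi> v = 0" if "\<psi> \<in> Ch t" for \<psi>
    proof -
      have "(M *v v) $ h \<psi> = dot (M $ h \<psi>) v" by (simp add: matrix_vector_mult_def dot_def)
      then show ?thesis using v(1) Mh[of \<psi>] that by simp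
    qed
    have "(gram t *v v) $ i = 0" for i
    proof -
      have "(gram t *v v) $ i = dot (trv a t) (mul a t (axis i 1) (\<Sum>j\<in>UNIV. v $ j *s axis j 1))"
        by (simp add: matrix_vector_mult_def gram_def mul_linear dot_linear mult.commute)
      also have "\<dots> = dot (trv a t) (mul a t (axis i 1) v)" by (simp only: basis_expansion)
      also have "\<dots> = 0" by (rule trace_zero[OF t]) (simp add: chars_mul[of _ a E t] v0)
      finally show ?thesis .
    qed
    then have "gram t *v v = 0" by (simp add: vec_eq_iff)
    moreover have "\<exists>B. B ** gram t = mat 1"
      using d invertible_det_nz[of "gram t"] invertible_left_inverse[of "gram t"] by simp
    ultimately show False using v(2) matrix_left_invertible_ker[of "gram t"] by simp
  qed
qed

lemma sem_open: "open {t \<in> Om. sem a E t}"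
proof -
  have "open (Om \<inter> (\<lambda>t. det (gram t)) -` (- {0}))"
    by (rule continuous_open_preimage[OF holo_continuous_on[OF holo_discriminant] open_Om]) auto
  moreover have "Om \<inter> (\<lambda>t. det (gram t)) -` (- {0}) = {t \<in> Om. sem a E t}"
    using sem_iff_discriminant by auto
  ultimately show ?thesis by simp
qed

text \<open>The idempotent is the Riesz projection \<open>1/(2\<pi>\<i>) \<integral> (\<zeta> - v)\<^sup>-\<^sup>1 d\<zeta>\<close> over the circle around 1 of
  radius 1/2, where \<open>v\<close> is an element on which \<open>\<xi>\<close> has value 1 and the other characters at
  \<open>t0\<close> have value 0.\<close>

lemma spectral_idempotent:
  assumes t0: "t0 \<in> Om" and \<xi>: "\<xi> \<in> Ch t0" and W: "open W" "(t0, \<xi>) \<in> W"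
  obtains U \<epsilon> where "open U" "t0 \<in> U" "U \<subseteq> Om" "hmap \<epsilon> U" "dot \<xi> (\<epsilon> t0) = 1"
    "\<forall>t\<in>U. mul a t (\<epsilon> t) (\<epsilon> t) = \<epsilon> t"
    "\<forall>t\<in>U. \<forall>\<psi>\<in>Ch t. dot \<psi> (\<epsilon> t) = 0 \<or> dot \<psi> (\<epsilon> t) = 1 \<and> (t, \<psi>) \<in> W"
proof -
  have "\<exists>v. dot \<xi> v = 1 \<and> (\<forall>\<mu>\<in>Ch t0 - {\<xi>}. dot \<mu> v = 0)"
    by (rule chars_dual[of _ a E t0]) (use chars_finite[of a E t0] \<xi> in auto)
  then obtain v where v: "dot \<xi> v = 1" "\<forall>\<mu>\<in>Ch t0 - {\<xi>}. dot \<mu> v = 0" by blast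
  \<comment> \<open>Every character near the fibre over t0 has its value at v within 1/4 of 0, or
    within 1/4 of 1 and is then also in W.\<close>
  define W1 where "W1 = {p :: (complex^'n) \<times> (complex^'n). cmod (dot (snd p) v) < 1/4}
     \<union> (W \<inter> {p. cmod (dot (snd p) v - 1) < 1/4})"
  have t0W1: "(t0, y) \<in> W1" if "y \<in> Ch t0" for y
    by (cases "y = \<xi>") (use v W that in \<open>auto simp: W1_def\<close>)
  have "open W1" unfolding W1_def dot_def
    by (intro open_Un open_Int W open_Collect_less continuous_intros)
  then obtain U where U: "open U" "t0 \<in> U" "U \<subseteq> Om" and
    U4: "\<And>t y. t \<in> U \<Longrightarrow> y \<in> Ch t \<Longrightarrow> (t, y) \<in> W1"
    by (rule chars_tube[OF t0 _ t0W1]) auto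
  let ?S = "sphere (1::complex) (1/2)" and ?\<gamma> = "circlepath 1 (1/2)" and ?c = "1 / (2 * of_real pi * \<i>) :: complex"
  define M where "M = (\<lambda>t \<zeta>. lmat a t (\<zeta> *s E t - v))"
  \<comment> \<open>The circle of radius 1/2 around 1 keeps distance 1/4 from both discs of radius
    1/4, around 0 and around 1.\<close>
  have far: "1/4 \<le> cmod (\<zeta> - dot y v)" if "t \<in> U" "y \<in> Ch t" "\<zeta> \<in> ?S" for t y \<zeta>
  proof -
    have z: "cmod (1 - \<zeta>) = 1/2" using that(3) by (simp add: dist_norm)
    have "cmod (dot y v) < 1/4 \<or> cmod (dot y v - 1) < 1/4" using U4[OF that(1,2)] by (auto simp: W1_def)
    then show ?thesis
    proof
      assume "cmod (dot y v) < 1/4"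
      moreover have "1 \<le> cmod (1 - \<zeta>) + cmod (\<zeta> - dot y v) + cmod (dot y v)"
        using norm_triangle_ineq[of "1 - \<zeta>" "\<zeta>"] norm_triangle_ineq[of "\<zeta> - dot y v" "dot y v"] by simp
      ultimately show ?thesis using z by linarith
    next
      assume "cmod (dot y v - 1) < 1/4"
      moreover have "cmod (1 - \<zeta>) \<le> cmod (\<zeta> - dot y v) + cmod (dot y v - 1)"
        using norm_triangle_ineq[of "\<zeta> - dot y v" "dot y v - 1"] by (simp add: norm_minus_commute)
      ultimately show ?thesis using z by linarith
    qed
  qed
  have holM: "holo (\<lambda>t. M t \<zeta> $ i $ j) U" for \<zeta> i j
    unfolding M_def
    by (intro holo_lmat U) (auto simp: hmap_def intro!: holo_intros holo_subset[OF hmap_nth[OF holo_E] U(3)])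
  \<comment> \<open>At semisimple points the determinant is the product of n factors of modulus at
    least 1/4. This lower bound, unlike mere nonvanishing, is a closed condition and extends to all
    t by density.\<close>
  have detM: "det (M t \<zeta>) \<noteq> 0" if t: "t \<in> U" and z: "\<zeta> \<in> ?S" for t \<zeta>
  proof -
    have "det (M t \<zeta>) \<in> - ball 0 ((1/4) ^ CARD('n))"
    proof (rule dense_closed[OF U(1,3) _ _ _ t])
      show "continuous_on U (\<lambda>t. det (M t \<zeta>))" by (intro holo_continuous_on holo_det holM)
      show "closed (- ball (0::complex) ((1/4) ^ CARD('n)))" by auto
      fix s assume s: "s \<in> U" "sem a E s"
      have "dot \<psi> (\<zeta> *s E s - v) = \<zeta> - dot \<psi> v" if "\<psi> \<in> Ch s" for \<psi>
        using chars_unit[OF that] by (simp add: dot_linear)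
      then have "det (M s \<zeta>) = (\<Prod>\<psi>\<in>Ch s. (\<zeta> - dot \<psi> v))"
        unfolding M_def sem_det[OF s(2)] by (intro prod.cong) auto
      then have "cmod (det (M s \<zeta>)) = (\<Prod>\<psi>\<in>Ch s. cmod (\<zeta> - dot \<psi> v))"
        by (simp add: prod_norm)
      also have "\<dots> \<ge> (\<Prod>\<psi>\<in>Ch s. 1/4)"
        by (rule prod_mono) (use far[OF s(1) _ z] in auto)
      finally show "det (M s \<zeta>) \<in> - ball 0 ((1/4) ^ CARD('n))"
        using s(2) by (simp add: sem_iff_card)
    qed
    then show ?thesis by auto
  qed
  \<comment> \<open>Cramer's rule for the resolvent equation; the explicit quotient of determinants
    shows that its solution is holomorphic in t and continuous in both variables.\<close>
  define r where "r = (\<lambda>t \<zeta>. \<chi> k. det (\<chi> i j. if j = k then E t $ i else M t \<zeta> $ i $ j) / det (M t \<zeta>))"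
  have r: "mul a t (\<zeta> *s E t - v) (r t \<zeta>) = E t" if "t \<in> U" "\<zeta> \<in> ?S" for t \<zeta>
    using cramer[OF detM[OF that], of "r t \<zeta>" "E t"] by (simp add: r_def M_def lmat_mult)
  have chr: "dot \<psi> (r t \<zeta>) = 1 / (\<zeta> - dot \<psi> v)" if "t \<in> U" "\<zeta> \<in> ?S" "\<psi> \<in> Ch t" for t \<zeta> \<psi>
  proof -
    have "(\<zeta> - dot \<psi> v) * dot \<psi> (r t \<zeta>) = 1"
      using arg_cong[OF r[OF that(1,2)], of "dot \<psi>"] chars_unit[OF that(3)]
      by (simp add: chars_mul[OF that(3)] dot_linear)
    moreover have "\<zeta> - dot \<psi> v \<noteq> 0" using far[OF that(1,3,2)] by auto
    ultimately show ?thesis by (simp add: field_simps)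
  qed
  define \<epsilon> where "\<epsilon> = (\<lambda>t. \<chi> k. ?c * contour_integral ?\<gamma> (\<lambda>\<zeta>. r t \<zeta> $ k))"
  have contr: "continuous_on (U \<times> ?S) (\<lambda>(t, \<zeta>). r t \<zeta> $ k)" for k
  proof -
    have ca: "continuous_on (U \<times> ?S) (\<lambda>x. a (fst x) i j k)" for i j k
      by (rule continuous_on_compose2[OF holo_continuous_on[OF holo_a] continuous_on_fst[OF continuous_on_id]])
         (use U in auto)
    have cE: "continuous_on (U \<times> ?S) (\<lambda>x. E (fst x) $ k)" for k
      by (rule continuous_on_compose2[OF holo_continuous_on[OF hmap_nth[OF holo_E]] continuous_on_fst[OF continuous_on_id]])
         (use U in auto)
    have cM: "continuous_on (U \<times> ?S) (\<lambda>x. M (fst x) (snd x) $ i $ j)" for i j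
      unfolding M_def lmat_def vec_lambda_beta by (simp, intro continuous_intros ca cE)
    have "continuous_on (U \<times> ?S) (\<lambda>x. if j = k then E (fst x) $ i else M (fst x) (snd x) $ i $ j)" for i j
      by (cases "j = k") (auto intro: cE cM)
    then show ?thesis unfolding r_def case_prod_beta vec_lambda_beta
      by (intro continuous_on_divide continuous_on_det cM ballI) (use detM in auto)
  qed
  have holr: "holo (\<lambda>t. r t \<zeta> $ k) U" if "\<zeta> \<in> ?S" for \<zeta> k
  proof -
    have "holo (\<lambda>t. if j = k then E t $ i else M t \<zeta> $ i $ j) U" for i j
      by (cases "j = k") (auto intro: holM holo_subset[OF hmap_nth[OF holo_E] U(3)])
    then show ?thesis unfolding r_def vec_lambda_beta
      by (intro holo_divide holo_det holM) (use detM that in auto)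
  qed
  have hole: "hmap \<epsilon> U" unfolding hmap_def \<epsilon>_def vec_lambda_beta
    by (intro allI holo_mult holo_const holo_circle_integral contr holr U) auto
  have che: "dot \<psi> (\<epsilon> t) = ?c * contour_integral ?\<gamma> (\<lambda>\<zeta>. 1 / (\<zeta> - dot \<psi> v))" if "t \<in> U" "\<psi> \<in> Ch t" for t \<psi>
  proof -
    have "contour_integral ?\<gamma> (\<lambda>\<zeta>. 1 / (\<zeta> - dot \<psi> v)) = contour_integral ?\<gamma> (\<lambda>\<zeta>. \<Sum>k\<in>UNIV. \<psi> $ k * r t \<zeta> $ k)"
      by (intro contour_integral_cong refl) (use chr[OF that(1) _ that(2)] in \<open>auto simp: dot_def\<close>)
    also have "\<dots> = (\<Sum>k\<in>UNIV. \<psi> $ k * contour_integral ?\<gamma> (\<lambda>\<zeta>. r t \<zeta> $ k))"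
      by (intro contour_integral_unique has_contour_integral_sum has_contour_integral_lmul
          has_contour_integral_integral circle_param_integrable[OF contr that(1)]) auto
    finally show ?thesis unfolding \<epsilon>_def dot_def vec_lambda_beta by (simp add: sum_distrib_left mult.left_commute)
  qed
  have chin: "dot \<psi> (\<epsilon> t) = 1" if "t \<in> U" "\<psi> \<in> Ch t" "cmod (dot \<psi> v - 1) < 1/4" for t \<psi>
  proof -
    have "((\<lambda>\<zeta>. 1 / (\<zeta> - dot \<psi> v)) has_contour_integral (2 * of_real pi * \<i> * 1)) ?\<gamma>"
      by (rule Cauchy_integral_circlepath[where f="\<lambda>_. 1"]) (use that(3) in auto)
    then show ?thesis using che[OF that(1,2)] contour_integral_unique by fastforce
  qed
  have chout: "dot \<psi> (\<epsilon> t) = 0" if "t \<in> U" "\<psi> \<in> Ch t" "cmod (dot \<psi> v) < 1/4" for t \<psi>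
  proof -
    \<comment> \<open>The disc of radius 3/4 around 1 contains the circle but no point of modulus
      below 1/4, so the integrand has no pole in it.\<close>
    have nb: "\<zeta> - dot \<psi> v \<noteq> 0" if "\<zeta> \<in> ball 1 (3/4)" for \<zeta>
    proof
      assume "\<zeta> - dot \<psi> v = 0"
      then have "cmod (1 - dot \<psi> v) < 3/4" using that by (simp add: dist_norm)
      then show False using \<open>cmod (dot \<psi> v) < 1/4\<close> norm_triangle_ineq[of "1 - dot \<psi> v" "dot \<psi> v"] by simp
    qed
    have "((\<lambda>\<zeta>. 1 / (\<zeta> - dot \<psi> v)) has_contour_integral 0) ?\<gamma>"
      by (rule Cauchy_theorem_convex_simple[where S="ball 1 (3/4)"])
         (use nb in \<open>auto intro!: holomorphic_intros simp: dist_norm\<close>)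
    then show ?thesis using che[OF that(1,2)] contour_integral_unique by fastforce
  qed
  have ch01: "dot \<psi> (\<epsilon> t) = 0 \<or> dot \<psi> (\<epsilon> t) = 1 \<and> (t, \<psi>) \<in> W" if "t \<in> U" "\<psi> \<in> Ch t" for t \<psi>
    using U4[OF that] chin[OF that] chout[OF that] by (auto simp: W1_def)
  have idem: "mul a t (\<epsilon> t) (\<epsilon> t) = \<epsilon> t" if "t \<in> U" for t
  proof (rule dense_separate[OF U(1,3) _ hole that])
    show "hmap (\<lambda>t. mul a t (\<epsilon> t) (\<epsilon> t)) U" by (intro hmap_mul U hole)
    show "dot \<psi> (mul a s (\<epsilon> s) (\<epsilon> s)) = dot \<psi> (\<epsilon> s)" if "s \<in> U" "\<psi> \<in> Ch s" for s \<psi>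
      using ch01[OF that] by (auto simp: chars_mul[OF that(2)])
  qed
  show ?thesis by (rule that[OF U hole]) (use chin[OF U(2) \<xi>] v idem ch01 in auto)
qed

end

context alg_family begin

text \<open>Over a semisimple point the idempotent of a character has trace 1 nearby, so exactly one character
  takes the value 1 on it; that character is \<open>x \<mapsto> tr(\<epsilon> \<circ> x)\<close>.\<close>

lemma local_frame:
  assumes t0: "t0 \<in> Om" and s0: "sem a E t0"
  obtains U \<epsilon> l where "open U" "t0 \<in> U" "U \<subseteq> Om" "\<forall>i :: 'n. hmap (\<epsilon> i) U" "\<forall>i. hmap (l i) U"
    "\<forall>t\<in>U. range (\<lambda>i. l i t) = Ch t"
    "\<forall>t\<in>U. \<forall>i j. dot (l i t) (\<epsilon> j t) = (if i = j then 1 else 0)"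
proof -
  obtain \<Lambda> :: "'n \<Rightarrow> complex^'n" and V where L: "inj \<Lambda>" "range \<Lambda> = Ch t0"
      "(\<chi> i. \<Lambda> i) ** V = mat 1" "V ** (\<chi> i. \<Lambda> i) = mat 1"
    by (rule semE[OF s0])
  define v where "v = (\<lambda>j. column j V)"
  have v: "dot (\<Lambda> i) (v j) = (if i = j then 1 else 0)" for i j
    using arg_cong[OF L(3), of "\<lambda>A. A $ i $ j"]
    by (simp add: matrix_matrix_mult_def mat_def dot_def v_def column_def)
  let ?O = "{t \<in> Om. sem a E t}"
  define Q where "Q = (\<lambda>i U \<epsilon> l. open U \<and> t0 \<in> U \<and> U \<subseteq> Om \<and> hmap \<epsilon> U \<and> hmap l U \<and> l t0 = \<Lambda> i \<and>
     (\<forall>t\<in>U. l t \<in> Ch t \<and> dot (l t) (\<epsilon> t) = 1 \<and> (\<forall>\<psi>\<in>Ch t. dot \<psi> (\<epsilon> t) \<in> {0, 1})) \<and>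
     (\<forall>\<psi>\<in>Ch t0. dot \<psi> (\<epsilon> t0) = (if \<psi> = \<Lambda> i then 1 else 0)))"
  have ex: "\<exists>U \<epsilon> l. Q i U \<epsilon> l" for i
  proof -
    \<comment> \<open>Over t0 the other characters take the value 0 on \<open>v i\<close>, so they
      lie outside this set and the idempotent must vanish on them.\<close>
    let ?W = "{p :: (complex^'n) \<times> (complex^'n). cmod (dot (snd p) (v i) - 1) < 1/2}"
    have W: "open ?W" "(t0, \<Lambda> i) \<in> ?W"
      using v by (auto simp: dot_def intro!: open_Collect_less continuous_intros)
    have Li: "\<Lambda> i \<in> Ch t0" using L(2) by blast
    obtain U \<epsilon> where U: "open U" "t0 \<in> U" "U \<subseteq> Om" and he: "hmap \<epsilon> U" and e1: "dot (\<Lambda> i) (\<epsilon> t0) = 1"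
      and idem: "\<forall>t\<in>U. mul a t (\<epsilon> t) (\<epsilon> t) = \<epsilon> t"
      and c01': "\<forall>t\<in>U. \<forall>\<psi>\<in>Ch t. dot \<psi> (\<epsilon> t) = 0 \<or> dot \<psi> (\<epsilon> t) = 1 \<and> (t, \<psi>) \<in> ?W"
      by (rule spectral_idempotent[OF t0 Li W])
    have c01: "dot \<psi> (\<epsilon> t) = 0 \<or> dot \<psi> (\<epsilon> t) = 1 \<and> (t, \<psi>) \<in> ?W" if "t \<in> U" "\<psi> \<in> Ch t" for t \<psi>
      using c01' that by blast
    have e0: "dot \<psi> (\<epsilon> t0) = (if \<psi> = \<Lambda> i then 1 else 0)" if "\<psi> \<in> Ch t0" for \<psi>
    proof -
      from that have "\<psi> \<in> range \<Lambda>" unfolding L(2) .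
      then obtain k where k: "\<psi> = \<Lambda> k" by (rule rangeE)
      show ?thesis
      proof (cases "k = i")
        case False
        then have "\<Lambda> k \<noteq> \<Lambda> i" "dot (\<Lambda> k) (v i) = 0" using L(1) v[of k i] by (simp_all add: inj_eq)
        then show ?thesis using c01[OF U(2) that] by (simp add: k)
      qed (simp add: k e1)
    qed
    define tr where "tr = (\<lambda>t. dot (trv a t) (\<epsilon> t))"
    have htr: "holo tr U" unfolding tr_def by (intro holo_dot hmap_trv he U)
    have "tr t0 = (\<Sum>\<psi>\<in>Ch t0. if \<psi> = \<Lambda> i then 1 else 0)"
      unfolding tr_def sem_trv[OF s0] by (rule sum.cong) (auto simp: e0)
    also have "\<dots> = 1" using Li chars_finite[of a E t0] by simp
    finally have tr0: "tr t0 = 1" .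
    \<comment> \<open>Over semisimple points the trace counts the characters with value 1, so once
      it is within distance 1 of 1 there is exactly one of them.\<close>
    have "open (U \<inter> ?O)" "continuous_on (U \<inter> ?O) tr"
      using U sem_open holo_continuous_on[OF htr] continuous_on_subset by blast+
    then obtain U' where U': "open U'" "t0 \<in> U'" "U' \<subseteq> U \<inter> ?O" "\<And>t. t \<in> U' \<Longrightarrow> tr t \<in> ball 1 1"
      by (rule open_shrink[of _ _ "ball 1 1" t0]) (use U t0 s0 tr0 in auto)
    define l where "l = (\<lambda>t. \<chi> s. dot (trv a t) (mul a t (\<epsilon> t) (axis s 1)))"
    have hl: "hmap l U"
      by (rule hmapI, unfold l_def vec_lambda_beta, intro holo_dot hmap_trv hmap_mul U he hmap_const)
    have lt: "l t \<in> Ch t \<and> dot (l t) (\<epsilon> t) = 1 \<and> (\<forall>\<psi>\<in>Ch t. dot \<psi> (\<epsilon> t) = 1 \<longrightarrow> \<psi> = l t)" if t: "t \<in> U'" for t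
    proof -
      have tU: "t \<in> U" "sem a E t" using U'(3) t by auto
      define S where "S = {\<psi> \<in> Ch t. dot \<psi> (\<epsilon> t) = 1}"
      have fS: "finite S" using chars_finite[of a E t] by (simp add: S_def)
      have d: "(\<Sum>\<psi>\<in>Ch t. dot \<psi> (\<epsilon> t) * f \<psi>) = (\<Sum>\<psi>\<in>S. f \<psi>)" for f
        by (rule sum.mono_neutral_cong_right) (use chars_finite[of a E t] c01[OF tU(1)] in \<open>auto simp: S_def\<close>)
      have "tr t = of_nat (card S)"
        unfolding tr_def sem_trv[OF tU(2)] using d[of "\<lambda>_. 1"] by simp
      moreover have "tr t \<in> ball 1 1" using U'(4)[OF t] .
      ultimately have "cmod (of_int (1 - int (card S))) < 1" by (simp add: dist_norm)
      then have "card S = 1" unfolding norm_of_int by linarith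
      then obtain \<psi> where \<psi>: "S = {\<psi>}" using card_1_singletonE by blast
      have "l t $ s = \<psi> $ s" for s
      proof -
        have "l t $ s = (\<Sum>\<psi>\<in>Ch t. dot \<psi> (mul a t (\<epsilon> t) (axis s 1)))"
          by (simp add: l_def sem_trv[OF tU(2)])
        also have "\<dots> = (\<Sum>\<psi>\<in>Ch t. dot \<psi> (\<epsilon> t) * \<psi> $ s)"
          by (rule sum.cong) (auto simp: chars_mul[of _ a E t] dot_axis)
        also have "\<dots> = \<psi> $ s" unfolding d \<psi> by simp
        finally show ?thesis .
      qed
      then have "l t = \<psi>" by (simp add: vec_eq_iff)
      then show ?thesis using \<psi> by (auto simp: S_def)
    qed
    have "l t0 = \<Lambda> i" using lt[OF U'(2)] Li e1 by auto
    moreover have "U' \<subseteq> U" "U' \<subseteq> Om" using U'(3) by auto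
    moreover have "dot \<psi> (\<epsilon> t) \<in> {0, 1}" if "t \<in> U'" "\<psi> \<in> Ch t" for t \<psi>
      using c01[of t \<psi>] that \<open>U' \<subseteq> U\<close> by auto
    ultimately show ?thesis
      unfolding Q_def using U'(1,2) lt e0 hmap_subset[OF he] hmap_subset[OF hl]
      by (rule_tac exI[of _ U'], rule_tac exI[of _ \<epsilon>], rule_tac exI[of _ l]) blast
  qed
  then obtain U \<epsilon> l where "\<And>i. Q i (U i) (\<epsilon> i) (l i)" by metis
  then have ul: "open (U i) \<and> t0 \<in> U i \<and> U i \<subseteq> Om \<and> hmap (\<epsilon> i) (U i) \<and> hmap (l i) (U i) \<and> l i t0 = \<Lambda> i \<and>
     (\<forall>t\<in>U i. l i t \<in> Ch t \<and> dot (l i t) (\<epsilon> i t) = 1 \<and> (\<forall>\<psi>\<in>Ch t. dot \<psi> (\<epsilon> i t) \<in> {0, 1})) \<and>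
     (\<forall>\<psi>\<in>Ch t0. dot \<psi> (\<epsilon> i t0) = (if \<psi> = \<Lambda> i then 1 else 0))" for i
    unfolding Q_def by blast
  define V where "V = (\<Inter>i. U i)"
  have U: "open (U i)" "t0 \<in> U i" "U i \<subseteq> Om" "hmap (\<epsilon> i) (U i)" "hmap (l i) (U i)" for i
    using ul[of i] by simp_all
  have VU: "V \<subseteq> U i" for i by (auto simp: V_def)
  have V: "open V" "t0 \<in> V" "V \<subseteq> Om" "\<And>i. V \<subseteq> U i"
    using U(1,2) VU order_trans[OF VU U(3)] by (auto simp: V_def intro: open_INT)
  have hV: "hmap (\<epsilon> i) V" "hmap (l i) V" for i using U(4,5)[of i] VU[of i] by (auto intro: hmap_subset)
  \<comment> \<open>The values are 0 or 1, so where they stay within distance 1 of the Kronecker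
    symbol they are equal to it.\<close>
  define P where "P i j = V \<inter> (\<lambda>t. dot (l i t) (\<epsilon> j t) - (if i = j then 1 else 0)) -` ball 0 1" for i j
  define W where "W = V \<inter> (\<Inter>i. \<Inter>j. P i j)"
  have "open (P i j)" for i j
    unfolding P_def by (rule continuous_open_preimage)
       (auto intro!: V holo_continuous_on holo_diff holo_dot hV holo_const)
  then have oW: "open W" unfolding W_def by (intro open_Int V open_INT finite_class.finite_UNIV ballI)
  have WV: "W \<subseteq> V" by (auto simp: W_def P_def)
  have d0: "dot (l i t0) (\<epsilon> j t0) = (if i = j then 1 else 0)" for i j
  proof -
    have "\<Lambda> i \<in> Ch t0" using L(2) rangeI[of \<Lambda> i] by simp
    then have "dot (\<Lambda> i) (\<epsilon> j t0) = (if \<Lambda> i = \<Lambda> j then 1 else 0)" using ul[of j] by blast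
    then show ?thesis using ul[of i] L(1) by (simp add: inj_eq)
  qed
  have dW: "dot (l i t) (\<epsilon> j t) = (if i = j then 1 else 0)" if t: "t \<in> W" for i j t
  proof -
    have "l i t \<in> Ch t" using ul[of i] V(4)[of i] WV t by blast
    then have "dot (l i t) (\<epsilon> j t) \<in> {0, 1}" using ul[of j] V(4)[of j] WV t by blast
    moreover have "dot (l i t) (\<epsilon> j t) - (if i = j then 1 else 0) \<in> ball 0 1" using t by (auto simp: W_def P_def)
    ultimately show ?thesis by (auto split: if_splits)
  qed
  show ?thesis
  proof (rule that[of W \<epsilon> l])
    show "t0 \<in> W" using V(2) d0 by (auto simp: W_def P_def)
    show "\<forall>t\<in>W. range (\<lambda>i. l i t) = Ch t"
    proof (rule ballI, rule inj_chars_range)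
      fix t assume that: "t \<in> W"
      show "inj (\<lambda>i. l i t)"
      proof (rule injI)
        fix i j assume "l i t = l j t"
        then show "i = j" using dW[OF that, of i j] dW[OF that, of j j] by (metis zero_neq_one)
      qed
      show "range (\<lambda>i. l i t) \<subseteq> Ch t" using ul V(4) WV that by blast
    qed
    show "\<forall>i. hmap (\<epsilon> i) W" "\<forall>i. hmap (l i) W"
      using hmap_subset[OF hV(1) WV] hmap_subset[OF hV(2) WV] by blast+
  qed (use oW WV V dW in auto)
qed

end

subsection \<open>Germs of functions on the cotangent space\<close>

text \<open>Coordinates on the cotangent bundle in the order of \<open>cot_chart\<close>:
  \<open>Inl\<close> for the base, \<open>Inr\<close> for the fibre.\<close>

definition tc :: "complex^('n::finite + 'n) \<Rightarrow> complex^'n" where "tc z = (\<chi> i. z $ Inl i)"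
definition yc :: "complex^('n::finite + 'n) \<Rightarrow> complex^'n" where "yc z = (\<chi> i. z $ Inr i)"
definition join :: "complex^'n::finite \<Rightarrow> complex^'n \<Rightarrow> complex^('n + 'n)" where
  "join t y = (\<chi> s. case s of Inl i \<Rightarrow> t $ i | Inr i \<Rightarrow> y $ i)"

lemma tc_join [simp]: "tc (join t y) = t" and yc_join [simp]: "yc (join t y) = y"
  by (simp_all add: tc_def yc_def join_def vec_eq_iff)

lemma join_tc_yc [simp]: "join (tc z) (yc z) = z"
  by (auto simp: tc_def yc_def join_def vec_eq_iff split: sum.split)

lemma tc_nth: "tc z $ i = z $ Inl i" and yc_nth: "yc z $ i = z $ Inr i"
  by (simp_all add: tc_def yc_def)

lemma hmap_tc: "hmap tc S" and hmap_yc: "hmap yc S"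
  by (simp_all add: hmap_def tc_nth yc_nth holo_coord)

lemma holo_sum_case:
  "(\<And>i. holo (f i) S) \<Longrightarrow> (\<And>i. holo (g i) S) \<Longrightarrow> holo (\<lambda>z. case s of Inl i \<Rightarrow> f i z | Inr i \<Rightarrow> g i z) S"
  by (cases s) auto

lemma hmap_join: "hmap f S \<Longrightarrow> hmap g S \<Longrightarrow> hmap (\<lambda>z. join (f z) (g z)) S"
  by (rule hmapI) (auto simp: join_def hmap_def split: sum.split intro: holo_sum_case)

text \<open>\<open>holo f {x}\<close> is complex differentiability at the single point x, because
  the derivative is taken along all directions of the ambient space. With the filter
  \<open>nhds z\<close> it becomes holomorphy on some neighbourhood, and finitely many such
  statements combine by \<open>eventually_elim\<close>.\<close>

definition holo_near :: "(complex^'k::finite \<Rightarrow> complex) \<Rightarrow> complex^'k \<Rightarrow> bool" where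
  "holo_near f z \<longleftrightarrow> (\<forall>\<^sub>F x in nhds z. holo f {x})"

lemma holo_pointwise: "holo f S \<longleftrightarrow> (\<forall>x\<in>S. holo f {x})"
  by (simp add: holo_def)

lemma holo_nearI: "open N \<Longrightarrow> z \<in> N \<Longrightarrow> holo f N \<Longrightarrow> holo_near f z"
  unfolding holo_near_def eventually_nhds using holo_pointwise[of f N] by blast

lemma holo_nearE:
  assumes "holo_near f z"
  obtains N where "open N" "z \<in> N" "holo f N"
  using assms holo_pointwise[of f] unfolding holo_near_def eventually_nhds by blast

lemma holo_near_const: "holo_near (\<lambda>z. c) z"
  by (rule holo_nearI[of UNIV]) (auto intro: holo_const)

lemma holo_near_coord: "holo_near (\<lambda>z. z $ k) z"
  by (rule holo_nearI[of UNIV]) (auto intro: holo_coord)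

lemma holo_near_add: "holo_near f z \<Longrightarrow> holo_near g z \<Longrightarrow> holo_near (\<lambda>z. f z + g z) z"
  unfolding holo_near_def by (erule (1) eventually_elim2) (rule holo_add)

lemma holo_near_diff: "holo_near f z \<Longrightarrow> holo_near g z \<Longrightarrow> holo_near (\<lambda>z. f z - g z) z"
  unfolding holo_near_def by (erule (1) eventually_elim2) (rule holo_diff)

lemma holo_near_mult: "holo_near f z \<Longrightarrow> holo_near g z \<Longrightarrow> holo_near (\<lambda>z. f z * g z) z"
  unfolding holo_near_def by (erule (1) eventually_elim2) (rule holo_mult)

lemma holo_near_sum: "(\<And>i. i \<in> I \<Longrightarrow> holo_near (f i) z) \<Longrightarrow> holo_near (\<lambda>z. \<Sum>i\<in>I. f i z) z"
  by (induction I rule: infinite_finite_induct) (auto intro: holo_near_const holo_near_add)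

lemma holo_near_prod: "(\<And>i. i \<in> I \<Longrightarrow> holo_near (f i) z) \<Longrightarrow> holo_near (\<lambda>z. \<Prod>i\<in>I. f i z) z"
  by (induction I rule: infinite_finite_induct) (auto intro: holo_near_const holo_near_mult)

lemma holo_near_det:
  "(\<And>i j. holo_near (\<lambda>z. M z $ i $ j) z) \<Longrightarrow> holo_near (\<lambda>z. det (M z :: complex^'l^'l::finite)) z"
  unfolding det_def by (intro holo_near_sum holo_near_mult holo_near_const holo_near_prod)

lemma holo_near_divide:
  assumes "holo_near f z" "holo_near g z" "g z \<noteq> 0"
  shows "holo_near (\<lambda>z. f z / g z) z"
proof -
  obtain N where N: "open N" "z \<in> N" "holo g N" using assms(2) by (rule holo_nearE)
  have "open (N \<inter> g -` (- {0}))"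
    by (rule continuous_open_preimage[OF holo_continuous_on[OF N(3)] N(1)]) auto
  then have "\<forall>\<^sub>F x in nhds z. g x \<noteq> 0"
    using N(2) assms(3) unfolding eventually_nhds by blast
  then show ?thesis using assms(1,2) unfolding holo_near_def
    by eventually_elim (rule holo_divide, auto)
qed

lemma holo_near_cong:
  assumes "holo_near f z" "\<forall>\<^sub>F x in nhds z. g x = f x"
  shows "holo_near g z"
proof -
  have "\<forall>\<^sub>F x in nhds z. holo f {x} \<and> g x = f x" using assms unfolding holo_near_def by eventually_elim auto
  then obtain N where N: "open N" "z \<in> N" "\<forall>x\<in>N. holo f {x} \<and> g x = f x"
    unfolding eventually_nhds by blast
  have "holo g N" by (rule holo_cong[OF N(1), where g=f]) (use N holo_pointwise[of f N] in auto)
  then show ?thesis by (rule holo_nearI[OF N(1,2)])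
qed

definition hmap_near :: "(complex^'k::finite \<Rightarrow> complex^'l::finite) \<Rightarrow> complex^'k \<Rightarrow> bool" where
  "hmap_near F z \<longleftrightarrow> (\<forall>i. holo_near (\<lambda>x. F x $ i) z)"

lemma hmap_nearI: "open N \<Longrightarrow> z \<in> N \<Longrightarrow> hmap F N \<Longrightarrow> hmap_near F z"
  unfolding hmap_near_def hmap_def using holo_nearI by blast

lemma hmap_nearE:
  assumes "hmap_near F z"
  obtains N where "open N" "z \<in> N" "hmap F N"
proof -
  have "\<forall>\<^sub>F x in nhds z. \<forall>i. holo (\<lambda>x. F x $ i) {x}"
    using assms unfolding hmap_near_def holo_near_def by (simp add: eventually_all_finite)
  then obtain N where N: "open N" "z \<in> N" "\<forall>x\<in>N. \<forall>i. holo (\<lambda>x. F x $ i) {x}"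
    unfolding eventually_nhds by blast
  then have "hmap F N" unfolding hmap_def using holo_pointwise[of _ N] by blast
  then show ?thesis using that N by blast
qed

lemma hmap_near_nth: "hmap_near F z \<Longrightarrow> holo_near (\<lambda>x. F x $ i) z"
  by (simp add: hmap_near_def)

lemmas holo_near_intros = holo_near_const holo_near_coord holo_near_add holo_near_diff holo_near_mult
  holo_near_sum holo_near_prod holo_near_det hmap_near_nth

lemma holo_near_compose:
  assumes "hmap_near F z" "holo_near g (F z)"
  shows "holo_near (\<lambda>x. g (F x)) z"
proof -
  obtain N where N: "open N" "z \<in> N" "hmap F N" using assms(1) by (rule hmap_nearE)
  obtain M where M: "open M" "F z \<in> M" "holo g M" using assms(2) by (rule holo_nearE)
  have o: "open (N \<inter> F -` M)" by (rule continuous_open_preimage[OF hmap_continuous_on[OF N(3)] N(1) M(1)])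
  have h: "holo (\<lambda>x. g (F x)) (N \<inter> F -` M)"
    by (rule holo_compose[OF hmap_subset[OF N(3)] M(3)]) auto
  show ?thesis by (rule holo_nearI[OF o _ h]) (use N M in auto)
qed

lemma eventually_tc: "\<forall>\<^sub>F t in nhds (tc z). P t \<Longrightarrow> \<forall>\<^sub>F x in nhds z. P (tc x)"
proof -
  assume "\<forall>\<^sub>F t in nhds (tc z). P t"
  moreover have "filterlim tc (nhds (tc z)) (nhds z)"
    using hmap_continuous_on[OF hmap_tc[of UNIV]] tendsto_at_iff_tendsto_nhds[of tc z]
    by (auto simp: continuous_on_eq_continuous_at isCont_def)
  ultimately show ?thesis unfolding filterlim_iff by blast
qed

lemma holo_near_tc: "holo_near f (tc z) \<Longrightarrow> holo_near (\<lambda>x. f (tc x)) z"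
  by (rule holo_near_compose) (auto intro: hmap_nearI[of UNIV] hmap_tc)

lemma holo_near_yc: "holo_near (\<lambda>x. yc x $ i) z"
  by (simp add: yc_nth holo_near_coord)

lemma holo_near_dot: "hmap_near y z \<Longrightarrow> hmap_near v z \<Longrightarrow> holo_near (\<lambda>x. dot (y x) (v x)) z"
  unfolding dot_def by (intro holo_near_intros)

lemma hmap_near_tc: "hmap_near X (tc z) \<Longrightarrow> hmap_near (\<lambda>x. X (tc x)) z"
  unfolding hmap_near_def by (blast intro: holo_near_tc[where f="\<lambda>t. X t $ i" for i])

lemma holo_near_fibre: "hmap_near X (tc z) \<Longrightarrow> holo_near (\<lambda>x. dot (yc x) (X (tc x))) z"
  by (intro holo_near_dot hmap_near_tc) (auto simp: hmap_near_def holo_near_yc)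

subsection \<open>Normal forms modulo the equations of the spectrum\<close>

lemma holo_near_uminus: "holo_near f z \<Longrightarrow> holo_near (\<lambda>z. - f z) z"
  using holo_near_mult[OF holo_near_const[of "-1"]] by simp

text \<open>\<open>J\<close> stands for the ideal generated by the equations of the spectrum at the point \<open>join t0 y0\<close>;
  only the closure properties needed are assumed.\<close>

locale germ_ideal = alg_family Om a E
  for Om :: "(complex^'n::finite) set" and a E +
  fixes t0 y0 :: "complex^'n" and J :: "(complex^('n + 'n) \<Rightarrow> complex) \<Rightarrow> bool"
  assumes t0: "t0 \<in> Om" and y0: "y0 \<in> Ch t0"
    and J_add: "\<And>f g. J f \<Longrightarrow> J g \<Longrightarrow> J (\<lambda>z. f z + g z)"
    and J_mult: "\<And>f g. holo_near f (join t0 y0) \<Longrightarrow> J g \<Longrightarrow> J (\<lambda>z. f z * g z)"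
    and J_cong: "\<And>f g. J g \<Longrightarrow> \<forall>\<^sub>F z in nhds (join t0 y0). f z = g z \<Longrightarrow> J f"
    and J_unit: "J (\<lambda>z. dot (yc z) (E (tc z)) - 1)"
    and J_rel: "\<And>i j. J (\<lambda>z. yc z $ i * yc z $ j - (\<Sum>k\<in>UNIV. a (tc z) i j k * yc z $ k))"
    and J_vanish: "\<And>g. J g \<Longrightarrow> \<forall>\<^sub>F z in nhds (join t0 y0). yc z \<in> Ch (tc z) \<longrightarrow> g z = 0"
begin

abbreviation "z0 \<equiv> join t0 y0"
abbreviation "fib X z \<equiv> dot (yc z) (X (tc z))"

lemma J_zero: "J (\<lambda>z. 0)"
  using J_mult[OF holo_near_const[of 0] J_unit] by simp

lemma J_sum: "(\<And>i. i \<in> I \<Longrightarrow> J (f i)) \<Longrightarrow> J (\<lambda>z. \<Sum>i\<in>I. f i z)"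
  by (induction I rule: infinite_finite_induct) (auto intro: J_zero J_add)

lemma J_uminus: "J f \<Longrightarrow> J (\<lambda>z. - f z)"
  using J_mult[OF holo_near_const[of "-1"]] by simp

lemma J_diff: "J f \<Longrightarrow> J g \<Longrightarrow> J (\<lambda>z. f z - g z)"
  using J_add[OF _ J_uminus, of f g] by simp

lemma J_eq: "J g \<Longrightarrow> (\<And>z. f z = g z) \<Longrightarrow> J f"
  by (rule J_cong) auto

lemma near_fib: "hmap_near X t0 \<Longrightarrow> holo_near (fib X) z0"
  by (rule holo_near_fibre) simp

lemma near_tc: "holo_near f t0 \<Longrightarrow> holo_near (\<lambda>z. f (tc z)) z0"
  by (rule holo_near_tc) simp

lemma eventually_t: "\<forall>\<^sub>F t in nhds t0. P t \<Longrightarrow> \<forall>\<^sub>F z in nhds z0. P (tc z)"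
  by (rule eventually_tc) simp

lemma eventually_Om: "\<forall>\<^sub>F t in nhds t0. t \<in> Om"
  using open_Om t0 by (rule eventually_nhds_in_open)

lemma near_a: "holo_near (\<lambda>t. a t i j k) t0"
  by (rule holo_nearI[OF open_Om t0 holo_a])

lemma near_E: "hmap_near E t0"
  by (rule hmap_nearI[OF open_Om t0 holo_E])

lemma near_mul: "hmap_near X t0 \<Longrightarrow> hmap_near Y t0 \<Longrightarrow> hmap_near (\<lambda>t. mul a t (X t) (Y t)) t0"
  by (rule hmap_near_def[THEN iffD2], unfold mul_def vec_lambda_beta, intro allI holo_near_intros near_a)

text \<open>The relations between basis vectors, taken with the coefficients of X and Y, add up to
  the relation for arbitrary fields.\<close>

lemma J_fib_mul:
  assumes "hmap_near X t0" "hmap_near Y t0"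
  shows "J (\<lambda>z. fib X z * fib Y z - fib (\<lambda>t. mul a t (X t) (Y t)) z)"
proof (rule J_eq)
  show "J (\<lambda>z. \<Sum>i\<in>UNIV. \<Sum>j\<in>UNIV. (X (tc z) $ i * Y (tc z) $ j) *
     (yc z $ i * yc z $ j - (\<Sum>k\<in>UNIV. a (tc z) i j k * yc z $ k)))"
    by (intro J_sum J_mult J_rel holo_near_mult near_tc hmap_near_nth assms)
  fix z
  have "fib (\<lambda>t. mul a t (X t) (Y t)) z = (\<Sum>i\<in>UNIV. \<Sum>j\<in>UNIV. (X (tc z) $ i * Y (tc z) $ j) *
     (\<Sum>k\<in>UNIV. a (tc z) i j k * yc z $ k))"
  proof -
    have d: "dot (yc z) (\<chi> k. a (tc z) i j k) = (\<Sum>k\<in>UNIV. a (tc z) i j k * yc z $ k)" for i j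
      by (simp add: dot_def mult.commute)
    have "mul a (tc z) (X (tc z)) (Y (tc z)) =
      mul a (tc z) (\<Sum>i\<in>UNIV. X (tc z) $ i *s axis i 1) (\<Sum>j\<in>UNIV. Y (tc z) $ j *s axis j 1)"
      by (simp only: basis_expansion)
    also have "\<dots> = (\<Sum>j\<in>UNIV. \<Sum>i\<in>UNIV. (X (tc z) $ i * Y (tc z) $ j) *s (\<chi> k. a (tc z) i j k))"
      by (simp add: mul_linear mul_axis vec.scale_sum_right mult.commute)
    finally have "fib (\<lambda>t. mul a t (X t) (Y t)) z = (\<Sum>j\<in>UNIV. \<Sum>i\<in>UNIV. (X (tc z) $ i * Y (tc z) $ j) *
       (\<Sum>k\<in>UNIV. a (tc z) i j k * yc z $ k))"
      by (simp add: dot_linear d)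
    also have "\<dots> = (\<Sum>i\<in>UNIV. \<Sum>j\<in>UNIV. (X (tc z) $ i * Y (tc z) $ j) *
       (\<Sum>k\<in>UNIV. a (tc z) i j k * yc z $ k))" by (rule sum.swap)
    finally show ?thesis .
  qed
  moreover have "fib X z * fib Y z = (\<Sum>i\<in>UNIV. \<Sum>j\<in>UNIV. (X (tc z) $ i * Y (tc z) $ j) * (yc z $ i * yc z $ j))"
    unfolding dot_def sum_product by (intro sum.cong refl) (simp add: mult_ac)
  ultimately show "fib X z * fib Y z - fib (\<lambda>t. mul a t (X t) (Y t)) z =
    (\<Sum>i\<in>UNIV. \<Sum>j\<in>UNIV. (X (tc z) $ i * Y (tc z) $ j) *
     (yc z $ i * yc z $ j - (\<Sum>k\<in>UNIV. a (tc z) i j k * yc z $ k)))"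
    by (simp add: right_diff_distrib sum_subtractf)
qed

text \<open>Congruence to a fibrewise linear function. Holomorphy is part of the notion so that a
  reducible germ may multiply members of the ideal.\<close>

definition reducible :: "(complex^('n + 'n) \<Rightarrow> complex) \<Rightarrow> bool" where
  "reducible g \<longleftrightarrow> holo_near g z0 \<and> (\<exists>X. hmap_near X t0 \<and> J (\<lambda>z. g z - fib X z))"

lemma hmap_near_add: "hmap_near X t \<Longrightarrow> hmap_near Y t \<Longrightarrow> hmap_near (\<lambda>t. X t + Y t) t"
  by (simp add: hmap_near_def holo_near_add)

lemma hmap_near_smult: "holo_near f t \<Longrightarrow> hmap_near Y t \<Longrightarrow> hmap_near (\<lambda>t. f t *s Y t) t"
  by (simp add: hmap_near_def holo_near_mult)

lemma hmap_near_const: "hmap_near (\<lambda>t. c) t"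
  by (simp add: hmap_near_def holo_near_const)

lemma reducible_add:
  assumes "reducible f" "reducible g"
  shows "reducible (\<lambda>z. f z + g z)"
proof -
  obtain X Y where X: "hmap_near X t0" "J (\<lambda>z. f z - fib X z)" and Y: "hmap_near Y t0" "J (\<lambda>z. g z - fib Y z)"
    using assms unfolding reducible_def by blast
  have "J (\<lambda>z. f z + g z - fib (\<lambda>t. X t + Y t) z)"
    by (rule J_eq[OF J_add[OF X(2) Y(2)]]) (simp add: dot_add)
  then show ?thesis unfolding reducible_def
    using assms hmap_near_add[OF X(1) Y(1)] by (blast intro: holo_near_add[of f _ g] dest: reducible_def[THEN iffD1])
qed

text \<open>A product of two fibrewise linear functions is again linear modulo the ideal, namely for
  the product of the two fields.\<close>

lemma reducible_mult:
  assumes "reducible f" "reducible g"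
  shows "reducible (\<lambda>z. f z * g z)"
proof -
  obtain X Y where X: "hmap_near X t0" "J (\<lambda>z. f z - fib X z)" and Y: "hmap_near Y t0" "J (\<lambda>z. g z - fib Y z)"
    and h: "holo_near f z0" "holo_near g z0"
    using assms unfolding reducible_def by blast
  have "J (\<lambda>z. f z * (g z - fib Y z) + (fib Y z * (f z - fib X z) +
      (fib X z * fib Y z - fib (\<lambda>t. mul a t (X t) (Y t)) z)))"
    by (intro J_add J_mult X Y J_fib_mul h near_fib)
  then have "J (\<lambda>z. f z * g z - fib (\<lambda>t. mul a t (X t) (Y t)) z)"
    by (rule J_eq) (simp add: algebra_simps)
  then show ?thesis unfolding reducible_def
    using near_mul[OF X(1) Y(1)] holo_near_mult[OF h] by blast
qed

text \<open>A function f of the base is congruent to the linear function of the field f E, because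
  that of E is congruent to 1.\<close>

lemma reducible_tc:
  assumes "holo_near f t0"
  shows "reducible (\<lambda>z. f (tc z))"
proof -
  have "J (\<lambda>z. - f (tc z) * (dot (yc z) (E (tc z)) - 1))"
    by (intro J_mult J_unit holo_near_mult[OF holo_near_const[of "-1"], simplified] near_tc assms)
  then have "J (\<lambda>z. f (tc z) - fib (\<lambda>t. f t *s E t) z)"
    by (rule J_eq) (simp add: dot_smult algebra_simps)
  then show ?thesis unfolding reducible_def
    using near_tc[OF assms] hmap_near_smult[OF assms near_E] by blast
qed

lemma reducible_yc: "reducible (\<lambda>z. yc z $ i)"
proof -
  have "J (\<lambda>z. yc z $ i - fib (\<lambda>t. axis i 1) z)" by (rule J_eq[OF J_zero]) (simp add: dot_axis)
  then show ?thesis unfolding reducible_def using holo_near_yc hmap_near_const by blast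
qed

lemma reducible_J: "holo_near f z0 \<Longrightarrow> J f \<Longrightarrow> reducible f"
  unfolding reducible_def
  by (intro conjI exI[of _ "\<lambda>t. 0"] hmap_near_const) (auto intro: J_eq simp: dot_zero)

lemma reducible_sum: "(\<And>i. i \<in> I \<Longrightarrow> reducible (f i)) \<Longrightarrow> reducible (\<lambda>z. \<Sum>i\<in>I. f i z)"
  by (induction I rule: infinite_finite_induct)
     (auto intro: reducible_add reducible_J J_zero holo_near_const)

lemma reducible_power: "reducible f \<Longrightarrow> reducible (\<lambda>z. f z ^ n)"
  by (induction n) (auto intro: reducible_mult reducible_tc[of "\<lambda>_. 1", simplified] holo_near_const)

lemma reducible_cong:
  assumes "reducible g" "\<forall>\<^sub>F z in nhds z0. f z = g z"
  shows "reducible f"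
proof -
  obtain X where X: "hmap_near X t0" "J (\<lambda>z. g z - fib X z)" "holo_near g z0"
    using assms(1) unfolding reducible_def by blast
  have "\<forall>\<^sub>F z in nhds z0. f z - fib X z = g z - fib X z" using assms(2) by eventually_elim simp
  then have "J (\<lambda>z. f z - fib X z)" by (rule J_cong[OF X(2)])
  then show ?thesis unfolding reducible_def using X(1) holo_near_cong[OF X(3) assms(2)] by blast
qed

text \<open>The characteristic polynomial of multiplication by the \<open>j\<close>-th basis field; it lies in the ideal
  by Cramer's rule, since the vector \<open>y\<close> is an eigenvector modulo the ideal and one of its entries
  may be taken to be 1.\<close>

definition cpoly :: "'n \<Rightarrow> complex^'n \<Rightarrow> complex poly" where
  "cpoly j t = det (\<chi> i k. [:- a t j i k, if i = k then 1 else 0:])"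

lemma poly_cpoly: "poly (cpoly j t) x = det (\<chi> i k. (if i = k then x else 0) - a t j i k)"
  unfolding cpoly_def det_def poly_sum poly_mult poly_prod
  by (intro sum.cong refl arg_cong2[where f="(*)"] prod.cong) (auto simp: of_int_poly)

lemma J_cpoly: "J (\<lambda>z. poly (cpoly j (tc z)) (yc z $ j))"
proof -
  define B where "B = (\<lambda>z. \<chi> i k. (if i = k then yc z $ j else 0) - a (tc z) j i k)"
  have nB: "holo_near (\<lambda>z. B z $ i $ k) z0" for i k
    by (cases "i = k") (auto simp: B_def intro!: holo_near_intros holo_near_uminus holo_near_yc near_tc near_a)
  \<comment> \<open>The cofactors of B, written as determinants of the transpose with one row
    replaced by a unit vector.\<close>
  define C where "C = (\<lambda>k i z. det (\<chi> l. if l = k then axis i 1 else row l (transpose (B z))))"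
  have nC: "holo_near (C k i) z0" for k i
    unfolding C_def
  proof (rule holo_near_det)
    fix l m show "holo_near (\<lambda>z. (\<chi> l. if l = k then axis i 1 else row l (transpose (B z))) $ l $ m) z0"
      by (cases "l = k") (auto simp: row_def transpose_def intro: nB holo_near_const)
  qed
  have wJ: "J (\<lambda>z. (B z *v yc z) $ i)" for i
  proof (rule J_eq[OF J_rel[of j i]])
    fix z
    have "(B z *v yc z) $ i = (\<Sum>k\<in>UNIV. (if i = k then yc z $ j * yc z $ k else 0)) - (\<Sum>k\<in>UNIV. a (tc z) j i k * yc z $ k)"
      by (simp add: B_def matrix_vector_mult_def left_diff_distrib sum_subtractf if_distribR mult_delta_left cong: if_cong)
    then show "(B z *v yc z) $ i = yc z $ j * yc z $ i - (\<Sum>k\<in>UNIV. a (tc z) j i k * yc z $ k)" by simp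
  qed
  have cr: "yc z $ k * det (B z) = (\<Sum>i\<in>UNIV. C k i z * (B z *v yc z) $ i)" for z k
  proof -
    let ?r = "\<lambda>l. row l (transpose (B z))"
    have w: "(\<Sum>i\<in>UNIV. yc z $ i *s ?r i) = (\<Sum>i\<in>UNIV. (B z *v yc z) $ i *s axis i 1)"
      unfolding basis_expansion
      by (simp add: vec_eq_iff row_def transpose_def matrix_vector_mult_def mult.commute)
    have "yc z $ k * det (B z) = det (\<chi> l. if l = k then (\<Sum>i\<in>UNIV. yc z $ i *s ?r i) else ?r l)"
      by (simp add: cramer_lemma_transpose)
    also have "\<dots> = (\<Sum>i\<in>UNIV. det (\<chi> l. if l = k then (B z *v yc z) $ i *s axis i 1 else ?r l))"
      unfolding w by (rule det_linear_row_sum) simp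
    also have "\<dots> = (\<Sum>i\<in>UNIV. (B z *v yc z) $ i * C k i z)"
      unfolding C_def by (intro sum.cong refl det_row_mul)
    finally show ?thesis by (simp add: mult.commute)
  qed
  have yJ: "J (\<lambda>z. yc z $ k * det (B z))" for k
    unfolding cr by (intro J_sum J_mult nC wJ)
  \<comment> \<open>Weighting the memberships by the components of E and using that the function of
    E is 1 modulo the ideal removes the factor \<open>yc z $ k\<close>.\<close>
  have "J (\<lambda>z. (\<Sum>k\<in>UNIV. E (tc z) $ k * (yc z $ k * det (B z))) - det (B z) * (dot (yc z) (E (tc z)) - 1))"
    by (intro J_diff J_sum J_mult J_unit yJ near_tc hmap_near_nth near_E holo_near_det nB)
  then show ?thesis
    by (rule J_eq) (simp add: poly_cpoly B_def dot_def sum_distrib_left sum_distrib_right algebra_simps)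
qed

lemma holo_coeff_cpoly: "holo (\<lambda>t. coeff (cpoly j t) k) Om"
proof -
  have pr: "\<forall>k. holo (\<lambda>t. coeff (\<Prod>i\<in>I. p i t) k) S"
    if "\<And>i k. holo (\<lambda>t. coeff (p i t) k) S" for I :: "'n set" and p :: "'n \<Rightarrow> complex^'n \<Rightarrow> complex poly" and S
  proof (induction I rule: infinite_finite_induct)
    case (insert i I)
    then show ?case by (auto simp: coeff_mult intro!: holo_sum holo_mult that)
  qed (auto intro: holo_const)
  have m: "holo (\<lambda>t. coeff [:- a t j i k, if i = k then 1 else 0:] d) Om" for i k d
    by (cases d rule: nat.exhaust; cases "d - 1") (auto simp: coeff_pCons intro!: holo_uminus holo_a holo_const split: nat.split)
  have "coeff (of_int s * p) k = of_int s * coeff p k" for s k and p :: "complex poly"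
    by (simp add: of_int_poly)
  then show ?thesis unfolding cpoly_def det_def coeff_sum
    by (simp, intro holo_sum holo_mult holo_const pr[rule_format]) (use m in auto)
qed

lemma degree_cpoly: "degree (cpoly j t) \<le> CARD('n)"
  unfolding cpoly_def det_def
proof (rule degree_sum_le)
  fix p assume "p \<in> {p. p permutes (UNIV :: 'n set)}"
  let ?p = "\<lambda>i. [:- a t j i (p i), if i = p i then 1 else 0:]"
  have "degree (\<Prod>i\<in>UNIV. ?p i) \<le> (\<Sum>i\<in>UNIV. degree (?p i))"
    using degree_prod_sum_le[of UNIV ?p] by (simp add: o_def)
  also have "\<dots> \<le> (\<Sum>i\<in>(UNIV :: 'n set). 1)" by (rule sum_mono) simp
  finally have "degree (\<Prod>i\<in>UNIV. ?p i) \<le> CARD('n)" by simp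
  then show "degree (of_int (sign p) * (\<Prod>i\<in>UNIV. (\<chi> i k. [:- a t j i k, if i = k then 1 else 0:]) $ i $ p i)) \<le> CARD('n)"
    by (simp add: of_int_poly)
qed simp

text \<open>At a real number beyond the sum of the moduli of all matrix entries the polynomial
  cannot vanish: a kernel vector would violate the estimate at its entry of largest modulus.\<close>

lemma cpoly_nonzero: "cpoly j t \<noteq> 0"
proof
  assume z: "cpoly j t = 0"
  define b where "b = (\<Sum>i\<in>UNIV. \<Sum>k\<in>UNIV. cmod (a t j i k))"
  have b0: "0 \<le> b" unfolding b_def by (intro sum_nonneg) simp
  define x where "x = complex_of_real (b + 1)"
  define B where "B = (\<chi> i k. (if i = k then x else 0) - a t j i k)"
  have "det B = 0" using poly_cpoly[of j t x] z by (simp add: B_def)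
  then have "\<not> invertible B" by (simp add: invertible_det_nz)
  then have "\<not> (\<forall>v. B *v v = 0 \<longrightarrow> v = 0)"
    using invertible_left_inverse[of B] matrix_left_invertible_ker[of B] by simp
  then obtain v where v: "B *v v = 0" "v \<noteq> 0" by blast
  obtain l where l: "\<And>j. cmod (v $ j) \<le> cmod (v $ l)"
  proof -
    have "Max (range (\<lambda>j. cmod (v $ j))) \<in> range (\<lambda>j. cmod (v $ j))" by (rule Max_in) auto
    then obtain l where "Max (range (\<lambda>j. cmod (v $ j))) = cmod (v $ l)" by blast
    then have "cmod (v $ j) \<le> cmod (v $ l)" for j
      using Max_ge[of "range (\<lambda>j. cmod (v $ j))" "cmod (v $ j)"] by simp
    then show ?thesis using that by blast
  qed
  have "(B *v v) $ l = x * v $ l - (\<Sum>k\<in>UNIV. a t j l k * v $ k)"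
    by (simp add: B_def matrix_vector_mult_def left_diff_distrib sum_subtractf if_distribR mult_delta_left cong: if_cong)
  then have "x * v $ l = (\<Sum>k\<in>UNIV. a t j l k * v $ k)" using v(1) by simp
  then have "(b + 1) * cmod (v $ l) = cmod (\<Sum>k\<in>UNIV. a t j l k * v $ k)"
    using b0 by (metis abs_of_nonneg add_nonneg_nonneg norm_mult norm_of_real x_def zero_le_one)
  also have "\<dots> \<le> (\<Sum>k\<in>UNIV. cmod (a t j l k) * cmod (v $ l))"
    by (rule order_trans[OF norm_sum]) (auto simp: norm_mult intro!: sum_mono mult_left_mono l)
  also have "\<dots> = (\<Sum>k\<in>UNIV. cmod (a t j l k)) * cmod (v $ l)" by (simp add: sum_distrib_right)
  also have "\<dots> \<le> b * cmod (v $ l)"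
    unfolding b_def
    by (intro mult_right_mono member_le_sum[where f="\<lambda>i. \<Sum>k\<in>UNIV. cmod (a t j i k)"]) (auto intro: sum_nonneg)
  finally have "cmod (v $ l) \<le> 0" by (simp add: algebra_simps)
  then have "v $ j = 0" for j using l[of j] by simp
  then show False using v(2) by (simp add: vec_eq_iff)
qed

text \<open>Induction on the set F of fibre coordinates on which g depends. Dividing by the
  characteristic polynomial for j leaves a multiple of it, which is in the ideal, and a polynomial
  in the j-th coordinate whose coefficients depend on one fibre coordinate less.\<close>

lemma reducible_aux:
  assumes "finite F"
  shows "\<forall>r g. 0 < r \<longrightarrow> tc ` polydisc z0 r \<subseteq> Om \<longrightarrow> holo g (polydisc z0 r) \<longrightarrow>
     (\<forall>z\<in>polydisc z0 r. g (pin (Inr ` (- F)) z0 z) = g z) \<longrightarrow> reducible g"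
  using assms
proof (induction F rule: finite_induct)
  case empty
  show ?case
  proof (intro allI impI)
    fix r g assume r: "0 < r" and g: "holo g (polydisc z0 r)"
      and ind: "\<forall>z\<in>polydisc z0 r. g (pin (Inr ` (- {})) z0 z) = g z"
    \<comment> \<open>With F empty all fibre coordinates are frozen at y0, so g is a function of the
      base.\<close>
    have p: "pin (Inr ` (- {})) z0 z = join (tc z) y0" for z
      by (auto simp: pin_def join_def tc_def vec_eq_iff split: sum.split)
    have "hmap_near (\<lambda>t. join t y0) t0"
      by (rule hmap_nearI[of UNIV]) (auto intro: hmap_join hmap_id hmap_const)
    moreover have "holo_near g z0" by (rule holo_nearI[OF open_polydisc polydisc_center[OF r] g])
    ultimately have "holo_near (\<lambda>t. g (join t y0)) t0" by (rule holo_near_compose)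
    then have "reducible (\<lambda>z. g (join (tc z) y0))" by (rule reducible_tc)
    moreover have "\<forall>\<^sub>F z in nhds z0. z \<in> polydisc z0 r"
      using open_polydisc polydisc_center[OF r] by (rule eventually_nhds_in_open)
    then have "\<forall>\<^sub>F z in nhds z0. g z = g (join (tc z) y0)"
      by eventually_elim (use ind p in auto)
    ultimately show "reducible g" by (rule reducible_cong)
  qed
next
  case (insert j F)
  show ?case
  proof (intro allI impI)
    fix r0 g assume r0: "0 < r0" and sub: "tc ` polydisc z0 r0 \<subseteq> Om" and g: "holo g (polydisc z0 r0)"
      and ind: "\<forall>z\<in>polydisc z0 r0. g (pin (Inr ` (- insert j F)) z0 z) = g z"
    let ?K = "Inr ` (- insert j F) :: ('n + 'n) set"
    have K: "insert (Inr j) ?K = Inr ` (- F)" "Inr j \<notin> ?K" using insert.hyps by auto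
    have tcp: "tc (pin (insert (Inr j) ?K) z0 z) = tc z" for z
      by (auto simp: tc_def pin_def vec_eq_iff)
    obtain r Q R where r: "0 < r" "r \<le> r0" and Q: "holo Q (polydisc z0 r)" and R: "\<And>k. holo (R k) (polydisc z0 r)"
      and Ri: "\<And>k z. z \<in> polydisc z0 r \<Longrightarrow> R k (pin (insert (Inr j) ?K) z0 z) = R k z"
      and eq: "\<And>z. z \<in> polydisc z0 r \<Longrightarrow> g z = Q z * poly (cpoly j (tc z)) (z $ Inr j) + (\<Sum>k\<le>CARD('n). R k z * z $ Inr j ^ k)"
    proof (rule polynomial_division[where P="\<lambda>z. cpoly j (tc z)" and s="Inr j" and J="?K" and d="CARD('n)", OF r0 g])
      show "holo (\<lambda>z. coeff (cpoly j (tc z)) k) (polydisc z0 r0)" for k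
        by (rule holo_compose[OF hmap_tc holo_coeff_cpoly]) (use sub in auto)
    qed (use degree_cpoly cpoly_nonzero tcp ind K(2) in auto)
    have sub': "tc ` polydisc z0 r \<subseteq> Om" using sub polydisc_mono[OF r(2)] by blast
    have redR: "reducible (R k)" for k
      using insert.IH[rule_format, OF r(1) sub' R, of k] Ri unfolding K by blast
    have nQ: "holo_near Q z0" by (rule holo_nearI[OF open_polydisc polydisc_center[OF r(1)] Q])
    have nc: "holo_near (\<lambda>z. poly (cpoly j (tc z)) (yc z $ j)) z0"
    proof -
      have "holo_near (\<lambda>z. \<Sum>k\<le>CARD('n). coeff (cpoly j (tc z)) k * yc z $ j ^ k) z0"
        by (intro holo_near_sum holo_near_mult near_tc holo_nearI[OF open_Om t0 holo_coeff_cpoly])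
           (rule holo_nearI[of UNIV], auto simp: yc_nth intro: holo_intros)
      then show ?thesis by (rule holo_near_cong) (simp add: poly_sum_le_degree[OF degree_cpoly])
    qed
    have "reducible (\<lambda>z. Q z * poly (cpoly j (tc z)) (yc z $ j) + (\<Sum>k\<le>CARD('n). R k z * yc z $ j ^ k))"
      by (intro reducible_add reducible_sum reducible_mult redR reducible_power reducible_yc reducible_J
          J_mult J_cpoly nQ holo_near_mult nc)
    moreover have "\<forall>\<^sub>F z in nhds z0. z \<in> polydisc z0 r"
      using open_polydisc polydisc_center[OF r(1)] by (rule eventually_nhds_in_open)
    then have "\<forall>\<^sub>F z in nhds z0. g z = Q z * poly (cpoly j (tc z)) (yc z $ j) + (\<Sum>k\<le>CARD('n). R k z * yc z $ j ^ k)"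
      by eventually_elim (use eq in \<open>auto simp: yc_nth\<close>)
    ultimately show "reducible g" by (rule reducible_cong)
  qed
qed

lemma normal_form:
  assumes "holo_near g z0"
  obtains X where "hmap_near X t0" "J (\<lambda>z. g z - fib X z)"
proof -
  obtain N where N: "open N" "z0 \<in> N" "holo g N" using assms by (rule holo_nearE)
  have "open (N \<inter> tc -` Om)"
    using continuous_open_preimage[OF continuous_on_subset[OF hmap_continuous_on[OF hmap_tc[of UNIV]]] N(1) open_Om] by simp
  then obtain r where r: "0 < r" "polydisc z0 r \<subseteq> N \<inter> tc -` Om"
    using polydisc_in_open[of "N \<inter> tc -` Om" z0] N(2) t0 by auto
  \<comment> \<open>For F = UNIV nothing is frozen and the independence condition is trivially
    true.\<close>
  have "reducible g"
    using reducible_aux[of UNIV, rule_format, OF _ r(1) _ holo_subset[OF N(3)]] r(2) by (auto simp: pin_def)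
  then show ?thesis using that unfolding reducible_def by blast
qed

end

lemma holo_near_nonzero:
  assumes "holo_near g z" "g z \<noteq> 0"
  shows "\<forall>\<^sub>F x in nhds z. g x \<noteq> 0"
proof -
  obtain N where N: "open N" "z \<in> N" "holo g N" using assms(1) by (rule holo_nearE)
  have "open (N \<inter> g -` (- {0}))"
    by (rule continuous_open_preimage[OF holo_continuous_on[OF N(3)] N(1)]) auto
  then show ?thesis using N(2) assms(2) unfolding eventually_nhds by blast
qed

section \<open>The idempotent of a point and the normal form fixed by it\<close>

context germ_ideal
begin

definition eps :: "complex^'n \<Rightarrow> complex^'n" where
  "eps = (SOME \<epsilon>. hmap_near \<epsilon> t0 \<and> (\<forall>\<^sub>F t in nhds t0. mul a t (\<epsilon> t) (\<epsilon> t) = \<epsilon> t) \<and>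
     (\<forall>\<psi>\<in>Ch t0. dot \<psi> (\<epsilon> t0) = (if \<psi> = y0 then 1 else 0)))"

lemma near_eps: "hmap_near eps t0"
  and eps_idem: "\<forall>\<^sub>F t in nhds t0. mul a t (eps t) (eps t) = eps t"
  and dot_eps: "\<psi> \<in> Ch t0 \<Longrightarrow> dot \<psi> (eps t0) = (if \<psi> = y0 then 1 else 0)"
proof -
  \<comment> \<open>The value 1 is allowed only inside this set, which omits the other characters
    over t0; hence they take the value 0.\<close>
  let ?W = "UNIV \<times> - (Ch t0 - {y0}) :: ((complex^'n) \<times> (complex^'n)) set"
  have W: "open ?W" "(t0, y0) \<in> ?W"
    using chars_finite[of a E t0] by (auto intro!: open_Times open_Compl finite_imp_closed simp del: Compl_Diff_eq)
  obtain U \<epsilon> where U: "open U" "t0 \<in> U" "U \<subseteq> Om" "hmap \<epsilon> U" "dot y0 (\<epsilon> t0) = 1"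
    "\<forall>t\<in>U. mul a t (\<epsilon> t) (\<epsilon> t) = \<epsilon> t"
    "\<forall>t\<in>U. \<forall>\<psi>\<in>Ch t. dot \<psi> (\<epsilon> t) = 0 \<or> dot \<psi> (\<epsilon> t) = 1 \<and> (t, \<psi>) \<in> ?W"
    by (rule spectral_idempotent[OF t0 y0 W])
  have "\<forall>\<^sub>F t in nhds t0. mul a t (\<epsilon> t) (\<epsilon> t) = \<epsilon> t"
    using eventually_nhds_in_open[OF U(1,2)] by eventually_elim (use U(6) in auto)
  moreover have "\<forall>\<psi>\<in>Ch t0. dot \<psi> (\<epsilon> t0) = (if \<psi> = y0 then 1 else 0)"
    using U(5) bspec[OF U(7) U(2)] by auto
  ultimately have "\<exists>\<epsilon>. hmap_near \<epsilon> t0 \<and> (\<forall>\<^sub>F t in nhds t0. mul a t (\<epsilon> t) (\<epsilon> t) = \<epsilon> t) \<and>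
     (\<forall>\<psi>\<in>Ch t0. dot \<psi> (\<epsilon> t0) = (if \<psi> = y0 then 1 else 0))"
    using hmap_nearI[OF U(1,2,4)] by blast
  from someI_ex[OF this, folded eps_def]
  show "hmap_near eps t0" "\<forall>\<^sub>F t in nhds t0. mul a t (eps t) (eps t) = eps t"
    "\<psi> \<in> Ch t0 \<Longrightarrow> dot \<psi> (eps t0) = (if \<psi> = y0 then 1 else 0)" by auto
qed

text \<open>A character near the fibre over t0 either lies close to y0, where the function of X
  vanishes by hypothesis, or takes the value 0 on \<open>eps\<close>. In both cases it kills the
  product, and characters over semisimple points decide.\<close>

lemma eps_kill:
  assumes X: "hmap_near X t0" and van: "\<forall>\<^sub>F z in nhds z0. yc z \<in> Ch (tc z) \<longrightarrow> fib X z = 0"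
  shows "\<forall>\<^sub>F t in nhds t0. mul a t (eps t) (X t) = 0"
proof -
  obtain N where N: "open N" "z0 \<in> N" "\<And>z. z \<in> N \<Longrightarrow> yc z \<in> Ch (tc z) \<Longrightarrow> fib X z = 0"
    using van unfolding eventually_nhds by blast
  obtain UX where UX: "open UX" "t0 \<in> UX" "hmap X UX" using X by (rule hmap_nearE)
  obtain UE where UE: "open UE" "t0 \<in> UE" "hmap eps UE" using near_eps by (rule hmap_nearE)
  obtain UI where UI: "open UI" "t0 \<in> UI" "\<And>t. t \<in> UI \<Longrightarrow> mul a t (eps t) (eps t) = eps t"
    using eps_idem unfolding eventually_nhds by blast
  define U1 where "U1 = Om \<inter> UX \<inter> UE \<inter> UI"
  have U1: "open U1" "t0 \<in> U1" "U1 \<subseteq> Om" using UX UE UI open_Om t0 by (auto simp: U1_def)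
  have h: "hmap X U1" "hmap eps U1"
    by (rule hmap_subset[OF UX(3)], force simp: U1_def, rule hmap_subset[OF UE(3)], force simp: U1_def)
  \<comment> \<open>The values on \<open>eps\<close> are 0 or 1, so the ball of radius 1/2 around 0
    singles out the characters with value 0, while those with value 1 must lie in N.\<close>
  define W where "W = ((U1 \<times> UNIV) \<inter> (\<lambda>p. join (fst p) (snd p)) -` N) \<union>
     ((U1 \<times> UNIV) \<inter> (\<lambda>p. dot (snd p) (eps (fst p))) -` ball 0 (1/2))"
  have "continuous_on (U1 \<times> UNIV) (\<lambda>p :: (complex^'n) \<times> (complex^'n). case s of Inl i \<Rightarrow> fst p $ i | Inr i \<Rightarrow> snd p $ i)" for s
    by (cases s) (auto intro!: continuous_intros)
  then have 1: "continuous_on (U1 \<times> UNIV) (\<lambda>p :: (complex^'n) \<times> (complex^'n). join (fst p) (snd p))"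
    unfolding join_def by (rule continuous_on_vec_lambda)
  have ce: "continuous_on (U1 \<times> (UNIV :: (complex^'n) set)) (\<lambda>p. eps (fst p) $ k)" for k
    by (rule continuous_on_compose2[OF holo_continuous_on[OF hmap_nth[OF h(2)]] continuous_on_fst[OF continuous_on_id]]) auto
  have 2: "continuous_on (U1 \<times> (UNIV :: (complex^'n) set)) (\<lambda>p. dot (snd p) (eps (fst p)))"
    unfolding dot_def by (intro continuous_intros ce)
  have oU: "open (U1 \<times> (UNIV :: (complex^'n) set))" using U1 by (intro open_Times) auto
  have oW: "open W" unfolding W_def
    by (intro open_Un continuous_open_preimage[OF 1 oU N(1)] continuous_open_preimage[OF 2 oU open_ball])
  have "(t0, y) \<in> W" if "y \<in> Ch t0" for y
    using dot_eps[OF that] N(2) U1(2) by (cases "y = y0") (auto simp: W_def)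
  then obtain U where U: "open U" "t0 \<in> U" "U \<subseteq> Om" and UW: "\<And>t y. t \<in> U \<Longrightarrow> y \<in> Ch t \<Longrightarrow> (t, y) \<in> W"
    by (rule chars_tube[OF t0 oW]) auto
  have "mul a t (eps t) (X t) = 0" if t: "t \<in> U \<inter> U1" for t
  proof (rule dense_separate[where U="U \<inter> U1" and X="\<lambda>t. mul a t (eps t) (X t)" and Y="\<lambda>t. 0"])
    show "hmap (\<lambda>t. mul a t (eps t) (X t)) (U \<inter> U1)"
      using U1 by (intro hmap_mul hmap_subset[OF h(1)] hmap_subset[OF h(2)]) auto
    fix s \<psi> assume s: "s \<in> U \<inter> U1" and \<psi>: "\<psi> \<in> Ch s"
    have "dot \<psi> (eps s) * dot \<psi> (eps s) = dot \<psi> (eps s)"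
      using arg_cong[OF UI(3), of s "dot \<psi>"] s chars_mul[OF \<psi>] by (auto simp: U1_def)
    then have "dot \<psi> (eps s) = 0 \<or> dot \<psi> (eps s) = 1" by simp
    moreover have "dot \<psi> (X s) = 0" if "dot \<psi> (eps s) = 1"
      using UW[of s \<psi>] s \<psi> that N(3)[of "join s \<psi>"] by (auto simp: W_def)
    ultimately show "dot \<psi> (mul a s (eps s) (X s)) = dot \<psi> 0"
      by (auto simp: chars_mul[OF \<psi>] dot_zero)
  qed (use U U1 t in \<open>auto intro: hmap_const\<close>)
  then show ?thesis unfolding eventually_nhds using U U1 by (intro exI[of _ "U \<inter> U1"]) auto
qed

text \<open>Modulo the ideal the function of \<open>eps\<close> is idempotent, and it is a unit
  because its value at the point is 1; cancelling it leaves 1.\<close>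

lemma J_eps: "J (\<lambda>z. fib eps z - 1)"
proof -
  have n: "holo_near (fib eps) z0" by (rule near_fib[OF near_eps])
  have 1: "fib eps z0 \<noteq> 0" using dot_eps[OF y0] by simp
  have "\<forall>\<^sub>F z in nhds z0. mul a (tc z) (eps (tc z)) (eps (tc z)) = eps (tc z)" by (rule eventually_t[OF eps_idem])
  moreover have "\<forall>\<^sub>F z in nhds z0. fib eps z \<noteq> 0" by (rule holo_near_nonzero[OF n 1])
  ultimately have ev: "\<forall>\<^sub>F z in nhds z0. fib eps z - 1 = 1 / fib eps z *
      (fib eps z * fib eps z - fib (\<lambda>t. mul a t (eps t) (eps t)) z)"
    by eventually_elim (simp add: field_simps)
  show ?thesis
    by (rule J_cong[OF J_mult[OF holo_near_divide[OF holo_near_const n 1] J_fib_mul[OF near_eps near_eps]] ev])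
qed

lemma J_fib_eps:
  assumes "hmap_near X t0"
  shows "J (\<lambda>z. fib X z - fib (\<lambda>t. mul a t (eps t) (X t)) z)"
proof -
  have "J (\<lambda>z. (fib eps z * fib X z - fib (\<lambda>t. mul a t (eps t) (X t)) z) - fib X z * (fib eps z - 1))"
    by (intro J_diff J_mult J_eps J_fib_mul near_eps assms near_fib)
  then show ?thesis by (rule J_eq) (simp add: algebra_simps)
qed

lemma J_iff_vanish:
  assumes g: "holo_near g z0"
  shows "J g \<longleftrightarrow> (\<forall>\<^sub>F z in nhds z0. yc z \<in> Ch (tc z) \<longrightarrow> g z = 0)"
proof
  assume van: "\<forall>\<^sub>F z in nhds z0. yc z \<in> Ch (tc z) \<longrightarrow> g z = 0"
  obtain X where X: "hmap_near X t0" "J (\<lambda>z. g z - fib X z)" using g by (rule normal_form)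
  have "\<forall>\<^sub>F z in nhds z0. yc z \<in> Ch (tc z) \<longrightarrow> fib X z = 0"
    using van J_vanish[OF X(2)] by eventually_elim auto
  then have "\<forall>\<^sub>F t in nhds t0. mul a t (eps t) (X t) = 0" by (rule eps_kill[OF X(1)])
  then have "\<forall>\<^sub>F z in nhds z0. mul a (tc z) (eps (tc z)) (X (tc z)) = 0" by (rule eventually_t)
  then have ev: "\<forall>\<^sub>F z in nhds z0. g z = (g z - fib X z) + (fib X z - fib (\<lambda>t. mul a t (eps t) (X t)) z)"
    by eventually_elim (simp add: dot_zero)
  show "J g" by (rule J_cong[OF J_add[OF X(2) J_fib_eps[OF X(1)]] ev])
qed (rule J_vanish)

text \<open>The coefficients of the normal form that is fixed by multiplication with \<open>eps\<close>; this is the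
  section that makes the local ring of the spectrum a direct summand of a free module.\<close>

definition nf :: "(complex^('n + 'n) \<Rightarrow> complex) \<Rightarrow> complex^'n \<Rightarrow> complex^'n" where
  "nf g = (SOME X. hmap_near X t0 \<and> J (\<lambda>z. g z - fib X z) \<and> (\<forall>\<^sub>F t in nhds t0. mul a t (eps t) (X t) = X t))"

lemma nf:
  assumes "holo_near g z0"
  shows "hmap_near (nf g) t0" "J (\<lambda>z. g z - fib (nf g) z)"
    "\<forall>\<^sub>F t in nhds t0. mul a t (eps t) (nf g t) = nf g t"
proof -
  obtain X where X: "hmap_near X t0" "J (\<lambda>z. g z - fib X z)" using assms by (rule normal_form)
  let ?X = "\<lambda>t. mul a t (eps t) (X t)"
  have "J (\<lambda>z. g z - fib ?X z)"
    by (rule J_eq[OF J_add[OF X(2) J_fib_eps[OF X(1)]]]) simp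
  moreover have "\<forall>\<^sub>F t in nhds t0. mul a t (eps t) (?X t) = ?X t"
    using eps_idem eventually_Om by eventually_elim (simp add: mul_assoc[symmetric])
  ultimately have "\<exists>X. hmap_near X t0 \<and> J (\<lambda>z. g z - fib X z) \<and> (\<forall>\<^sub>F t in nhds t0. mul a t (eps t) (X t) = X t)"
    using near_mul[OF near_eps X(1)] by blast
  from someI_ex[OF this, folded nf_def]
  show "hmap_near (nf g) t0" "J (\<lambda>z. g z - fib (nf g) z)"
    "\<forall>\<^sub>F t in nhds t0. mul a t (eps t) (nf g t) = nf g t" by auto
qed

text \<open>The difference of two such forms vanishes on L, so its product with \<open>eps\<close>
  is 0; but that product is the difference itself.\<close>

lemma nf_eqI:
  assumes g: "holo_near g z0" and X: "hmap_near X t0" "J (\<lambda>z. g z - fib X z)"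
    "\<forall>\<^sub>F t in nhds t0. mul a t (eps t) (X t) = X t"
  shows "\<forall>\<^sub>F t in nhds t0. nf g t = X t"
proof -
  let ?D = "\<lambda>t. nf g t + (- 1) *s X t"
  have "J (\<lambda>z. fib ?D z)"
    by (rule J_eq[OF J_diff[OF X(2) nf(2)[OF g]]]) (simp add: dot_add dot_diff dot_smult)
  then have "\<forall>\<^sub>F z in nhds z0. yc z \<in> Ch (tc z) \<longrightarrow> fib ?D z = 0" by (rule J_vanish)
  then have "\<forall>\<^sub>F t in nhds t0. mul a t (eps t) (?D t) = 0"
    by (rule eps_kill[rotated]) (intro hmap_near_add hmap_near_smult holo_near_const nf g X)
  then show ?thesis using nf(3)[OF g] X(3)
    by eventually_elim (simp add: mul_linear)
qed

lemma nf_cong: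
  assumes "holo_near f z0" "holo_near g z0" "J (\<lambda>z. f z - g z)"
  shows "\<forall>\<^sub>F t in nhds t0. nf f t = nf g t"
proof (rule nf_eqI[OF assms(1) nf(1)[OF assms(2)] _ nf(3)[OF assms(2)]])
  show "J (\<lambda>z. f z - fib (nf g) z)" by (rule J_eq[OF J_add[OF assms(3) nf(2)[OF assms(2)]]]) simp
qed

lemma nf_add:
  assumes "holo_near f z0" "holo_near g z0"
  shows "\<forall>\<^sub>F t in nhds t0. nf (\<lambda>z. f z + g z) t = nf f t + nf g t"
proof (rule nf_eqI)
  show "J (\<lambda>z. f z + g z - fib (\<lambda>t. nf f t + nf g t) z)"
    by (rule J_eq[OF J_add[OF nf(2)[OF assms(1)] nf(2)[OF assms(2)]]]) (simp add: dot_add)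
  show "\<forall>\<^sub>F t in nhds t0. mul a t (eps t) (nf f t + nf g t) = nf f t + nf g t"
    using nf(3)[OF assms(1)] nf(3)[OF assms(2)] by eventually_elim (simp add: mul_linear)
qed (intro holo_near_add assms hmap_near_add nf)+

lemma nf_mult:
  assumes "holo_near f t0" "holo_near g z0"
  shows "\<forall>\<^sub>F t in nhds t0. nf (\<lambda>z. f (tc z) * g z) t = f t *s nf g t"
proof (rule nf_eqI)
  show "J (\<lambda>z. f (tc z) * g z - fib (\<lambda>t. f t *s nf g t) z)"
    by (rule J_eq[OF J_mult[OF near_tc[OF assms(1)] nf(2)[OF assms(2)]]]) (simp add: dot_smult algebra_simps)
  show "\<forall>\<^sub>F t in nhds t0. mul a t (eps t) (f t *s nf g t) = f t *s nf g t"
    using nf(3)[OF assms(2)] by eventually_elim (simp add: mul_linear)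
qed (intro holo_near_mult near_tc assms hmap_near_smult nf)+

end

subsection \<open>Lie brackets in coordinates\<close>

definition der :: "complex^'n::finite \<Rightarrow> (complex^'n \<Rightarrow> complex) \<Rightarrow> complex^'n \<Rightarrow> complex" where
  "der v f t = (\<Sum>i\<in>UNIV. v $ i * pd i f t)"

definition lb :: "(complex^'n::finite \<Rightarrow> complex^'n) \<Rightarrow> (complex^'n \<Rightarrow> complex^'n) \<Rightarrow> complex^'n \<Rightarrow> complex^'n" where
  "lb X Y t = (\<chi> k. der (X t) (\<lambda>s. Y s $ k) t - der (Y t) (\<lambda>s. X s $ k) t)"

text \<open>The exterior derivative of the 1-form with coefficient functions l vanishes at the
  single point t.\<close>

definition closed_at :: "(complex^'n::finite \<Rightarrow> complex^'n) \<Rightarrow> complex^'n \<Rightarrow> bool" where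
  "closed_at l t \<longleftrightarrow> (\<forall>i j. pd i (\<lambda>s. l s $ j) t = pd j (\<lambda>s. l s $ i) t)"

lemma der_mult: "holo f U \<Longrightarrow> holo g U \<Longrightarrow> t \<in> U \<Longrightarrow> der v (\<lambda>s. f s * g s) t = f t * der v g t + der v f t * g t"
  by (simp add: der_def pd_mult sum_distrib_left sum_distrib_right sum.distrib algebra_simps)

lemma hmap_lb:
  assumes "open U" "hmap X U" "hmap Y U"
  shows "hmap (lb X Y) U"
  by (rule hmapI, unfold lb_def der_def vec_lambda_beta)
     (intro holo_intros holo_pd assms)

lemma pd_dot:
  assumes "hmap l U" "hmap X U" "t \<in> U"
  shows "pd i (\<lambda>s. dot (l s) (X s)) t =
    (\<Sum>k\<in>UNIV. l t $ k * pd i (\<lambda>s. X s $ k) t) + (\<Sum>k\<in>UNIV. pd i (\<lambda>s. l s $ k) t * X t $ k)"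
  unfolding dot_def
  using pd_sum[of UNIV "\<lambda>k s. l s $ k * X s $ k" U t i]
    pd_mult[OF hmap_nth[OF assms(1)] hmap_nth[OF assms(2)] assms(3)]
  by (simp add: holo_mult hmap_nth assms sum.distrib)

text \<open>Cartan's formula dl(X, Y) = X(l(Y)) - Y(l(X)) - l([X, Y]), solved for the term with the
  bracket.\<close>

lemma dot_lb:
  assumes "hmap l U" "hmap X U" "hmap Y U" "t \<in> U"
  shows "dot (l t) (lb X Y t) = der (X t) (\<lambda>s. dot (l s) (Y s)) t - der (Y t) (\<lambda>s. dot (l s) (X s)) t
    - (\<Sum>i\<in>UNIV. \<Sum>k\<in>UNIV. X t $ i * Y t $ k * (pd i (\<lambda>s. l s $ k) t - pd k (\<lambda>s. l s $ i) t))"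
proof -
  let ?d = "\<lambda>i k. pd i (\<lambda>s. l s $ k) t"
  have e: "der (V t) (\<lambda>s. dot (l s) (Z s)) t =
      (\<Sum>k\<in>UNIV. l t $ k * der (V t) (\<lambda>s. Z s $ k) t) + (\<Sum>i\<in>UNIV. \<Sum>k\<in>UNIV. V t $ i * Z t $ k * ?d i k)"
    if "hmap Z U" for V Z :: "complex^'a \<Rightarrow> complex^'a"
  proof -
    have "der (V t) (\<lambda>s. dot (l s) (Z s)) t =
       (\<Sum>i\<in>UNIV. \<Sum>k\<in>UNIV. l t $ k * (V t $ i * pd i (\<lambda>s. Z s $ k) t)) + (\<Sum>i\<in>UNIV. \<Sum>k\<in>UNIV. V t $ i * Z t $ k * ?d i k)"
      unfolding der_def pd_dot[OF assms(1) that assms(4)]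
      by (simp add: sum_distrib_left sum.distrib algebra_simps)
    also have "(\<Sum>i\<in>UNIV. \<Sum>k\<in>UNIV. l t $ k * (V t $ i * pd i (\<lambda>s. Z s $ k) t)) =
      (\<Sum>k\<in>UNIV. l t $ k * der (V t) (\<lambda>s. Z s $ k) t)"
      by (subst sum.swap) (simp add: der_def sum_distrib_left)
    finally show ?thesis .
  qed
  have sw: "(\<Sum>i\<in>UNIV. \<Sum>k\<in>UNIV. Y t $ i * X t $ k * ?d i k) = (\<Sum>i\<in>UNIV. \<Sum>k\<in>UNIV. X t $ i * Y t $ k * ?d k i)"
    by (subst sum.swap) (simp add: mult_ac)
  show ?thesis
    unfolding e[OF assms(2)] e[OF assms(3)] sw
    by (simp add: dot_def lb_def right_diff_distrib sum_subtractf)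
qed

lemma dot_lb_closed:
  assumes "hmap l U" "hmap X U" "hmap Y U" "t \<in> U" "closed_at l t"
  shows "dot (l t) (lb X Y t) = der (X t) (\<lambda>s. dot (l s) (Y s)) t - der (Y t) (\<lambda>s. dot (l s) (X s)) t"
  using dot_lb[OF assms(1-4)] assms(5) by (simp add: closed_at_def)

context alg_family
begin

text \<open>The coordinate form of \<open>lie_mult\<close>, the Lie derivative of the multiplication
  along X.\<close>

definition lie :: "(complex^'n \<Rightarrow> complex^'n) \<Rightarrow> (complex^'n \<Rightarrow> complex^'n) \<Rightarrow> (complex^'n \<Rightarrow> complex^'n) \<Rightarrow> complex^'n \<Rightarrow> complex^'n" where
  "lie X Z W t = lb X (\<lambda>s. mul a s (Z s) (W s)) t - mul a t (lb X Z t) (W t) - mul a t (Z t) (lb X W t)"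

text \<open>In the coordinates given by closed characters the field \<open>lie X Z W\<close> has the component
  \<open>- (Z \<circ> W)(x) + w Z(x) + z W(x)\<close>, which is a derivation in \<open>x\<close>.\<close>

lemma lie_closed:
  assumes U: "open U" "U \<subseteq> Om" "t \<in> U" and l: "hmap l U" "\<forall>s\<in>U. l s \<in> Ch s" "closed_at l t"
    and h: "hmap X U" "hmap Z U" "hmap W U"
  shows "dot (l t) (lie X Z W t) = - der (mul a t (Z t) (W t)) (\<lambda>s. dot (l s) (X s)) t
     + dot (l t) (W t) * der (Z t) (\<lambda>s. dot (l s) (X s)) t + dot (l t) (Z t) * der (W t) (\<lambda>s. dot (l s) (X s)) t"
proof -
  let ?p = "\<lambda>X s. dot (l s) (X s)"
  have hp: "holo (?p V) U" if "hmap V U" for V by (intro holo_dot l that)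
  have "der (X t) (?p (\<lambda>s. mul a s (Z s) (W s))) t = der (X t) (\<lambda>s. ?p Z s * ?p W s) t"
    unfolding der_def
    by (intro sum.cong refl arg_cong2[where f="(*)"] pd_cong[OF U(1,3)] chars_mul[where E=E] bspec[OF l(2)] holo_mult hp h)
  also have "\<dots> = ?p Z t * der (X t) (?p W) t + der (X t) (?p Z) t * ?p W t"
    by (rule der_mult[OF hp hp U(3)]) (rule h)+
  finally show ?thesis
    unfolding lie_def dot_diff chars_mul[OF bspec[OF l(2) U(3)]]
      dot_lb_closed[OF l(1) h(1) hmap_mul[OF U(2) h(2,3)] U(3) l(3)]
      dot_lb_closed[OF l(1) h(1,2) U(3) l(3)] dot_lb_closed[OF l(1) h(1,3) U(3) l(3)]
    by (simp add: algebra_simps)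
qed

text \<open>Evaluated on a closed character, X enters only through the derivatives of l(X). For a
  product this function is l(X) l(Y), and the product rule is the claim; the characters at a
  semisimple point separate.\<close>

lemma lie_derivation:
  assumes U: "open U" "U \<subseteq> Om" "t \<in> U" and s: "sem a E t"
    and l: "\<And>i :: 'i. hmap (l i) U" "\<And>i s. s \<in> U \<Longrightarrow> l i s \<in> Ch s" "\<And>i. closed_at (l i) t" "Ch t \<subseteq> range (\<lambda>i. l i t)"
    and h: "hmap X U" "hmap Y U" "hmap Z U" "hmap W U"
  shows "lie (\<lambda>s. mul a s (X s) (Y s)) Z W t = mul a t (X t) (lie Y Z W t) + mul a t (Y t) (lie X Z W t)"
proof (rule sem_separate[OF s])
  fix \<psi> assume "\<psi> \<in> Ch t"
  then obtain i where \<psi>: "\<psi> = l i t" using l(4) by blast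
  let ?p = "\<lambda>X s. dot (l i s) (X s)"
  have hp: "holo (?p V) U" if "hmap V U" for V by (intro holo_dot l that)
  have e: "der v (?p (\<lambda>s. mul a s (X s) (Y s))) t = ?p X t * der v (?p Y) t + der v (?p X) t * ?p Y t" for v
  proof -
    have "der v (?p (\<lambda>s. mul a s (X s) (Y s))) t = der v (\<lambda>s. ?p X s * ?p Y s) t"
      unfolding der_def
      by (intro sum.cong refl arg_cong2[where f="(*)"] pd_cong[OF U(1,3)] chars_mul[where E=E] l holo_mult hp h)
    also have "\<dots> = ?p X t * der v (?p Y) t + der v (?p X) t * ?p Y t"
      by (rule der_mult[OF hp hp U(3)]) (rule h)+
    finally show ?thesis .
  qed
  have l2: "\<forall>s\<in>U. l i s \<in> Ch s" using l(2) by blast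
  note lc = lie_closed[OF U l(1)[of i] l2 l(3)]
  show "dot \<psi> (lie (\<lambda>s. mul a s (X s) (Y s)) Z W t) =
      dot \<psi> (mul a t (X t) (lie Y Z W t) + mul a t (Y t) (lie X Z W t))"
    unfolding \<psi> dot_add chars_mul[OF l(2)[OF U(3)]] lc[OF hmap_mul[OF U(2) h(1,2)] h(3,4)]
      lc[OF h(1,3,4)] lc[OF h(2,3,4)] e
    by (simp add: algebra_simps)
qed

text \<open>Multiplying x = 2 e x by e gives e x = 2 e x, so e x and with it x vanish.\<close>

lemma idempotent_doubling:
  assumes "t \<in> Om" "mul a t e e = e" "x = mul a t e x + mul a t e x"
  shows "x = 0"
proof -
  have "mul a t e x = mul a t e (mul a t e x + mul a t e x)" using assms(3) by simp
  also have "\<dots> = mul a t e x + mul a t e x"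
    by (simp only: mul_add_right mul_assoc[OF assms(1), symmetric] assms(2))
  finally have "mul a t e x = 0" by simp
  then show ?thesis using assms(3) by simp
qed

text \<open>Nonzero orthogonal idempotents are linearly independent: multiplying a relation by one
  of them isolates its coefficient.\<close>

lemma orthogonal_idempotents_inverse:
  assumes e: "\<And>i j. mul a t (e i) (e j) = (if i = j then e i else 0)" and nz: "\<And>i. e i \<noteq> 0"
  obtains B where "B ** (\<chi> i. e i) = mat 1" "(\<chi> i. e i) ** B = (mat 1 :: complex^'n^'n)"
proof -
  have "c = 0" if c: "transpose (\<chi> i. e i) *v c = 0" for c
  proof -
    have s: "(\<Sum>i\<in>UNIV. c $ i *s e i) = 0"
      using c by (simp add: vec_eq_iff matrix_vector_mult_def transpose_def mult.commute)
    have "c $ j *s e j = 0" for j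
    proof -
      have "mul a t (\<Sum>i\<in>UNIV. c $ i *s e i) (e j) = (\<Sum>i\<in>UNIV. if i = j then c $ j *s e j else 0)"
        unfolding mul_sum_left mul_smult_left e by (intro sum.cong) auto
      then show ?thesis by (simp add: s mul_zero_left)
    qed
    then have "c $ j = 0" for j using nz[of j] by (metis vec.scale_eq_0_iff)
    then show ?thesis by (simp add: vec_eq_iff)
  qed
  then obtain B where "B ** transpose (\<chi> i. e i) = mat 1"
    using matrix_left_invertible_ker[of "transpose (\<chi> i. e i)"] by blast
  then have "(\<chi> i. e i) ** transpose B = mat 1"
    by (metis matrix_transpose_mul transpose_mat transpose_transpose)
  then show ?thesis using that matrix_left_right_inverse[of "\<chi> i. e i" "transpose B"] by blast
qed

lemma commuting_idempotents_closed:
  assumes U: "open U" "U \<subseteq> Om" "t \<in> U" and l: "hmap l U" "\<And>s. s \<in> U \<Longrightarrow> l s \<in> Ch s"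
    and e: "\<And>i. hmap (e i) U" "\<And>s i j. s \<in> U \<Longrightarrow> mul a s (e i s) (e j s) = (if i = j then e i s else 0)"
    and nz: "\<And>i :: 'n. e i t \<noteq> 0" and com: "\<And>i j. lb (e i) (e j) t = 0"
  shows "closed_at l t"
proof -
  have pd0: "pd k (\<lambda>s. dot (l s) (e i s)) t = 0" for i k
  proof -
    let ?f = "\<lambda>s. dot (l s) (e i s)"
    have hf: "holo ?f U" by (intro holo_dot l e)
    have sq: "?f s * ?f s = ?f s" if "s \<in> U" for s
      using chars_mul[OF l(2)[OF that], of "e i s" "e i s"] e(2)[OF that, of i i] by simp
    \<comment> \<open>Differentiating f f = f gives (2 f - 1) df = 0, and 2 f - 1 is 1 or
      -1.\<close>
    have "pd k ?f t = pd k (\<lambda>s. ?f s * ?f s) t"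
      by (rule pd_cong[OF U(1,3)]) (auto simp: sq intro: holo_mult hf)
    also have "\<dots> = 2 * ?f t * pd k ?f t" using pd_mult[OF hf hf U(3)] by simp
    finally have "(2 * ?f t - 1) * pd k ?f t = 0" by (simp add: algebra_simps)
    moreover have "?f t = 0 \<or> ?f t = 1" using sq[OF U(3)] by simp
    ultimately show ?thesis by auto
  qed
  \<comment> \<open>The matrix of dl at t; it vanishes because it does so on all pairs from the
    basis \<open>e i t\<close>.\<close>
  define A where "A = (\<chi> i k. pd i (\<lambda>s. l s $ k) t - pd k (\<lambda>s. l s $ i) t)"
  obtain B where B: "B ** (\<chi> i. e i t) = mat 1" "(\<chi> i. e i t) ** B = mat 1"
    using orthogonal_idempotents_inverse[of t "\<lambda>i. e i t"] e(2)[OF U(3)] nz by metis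
  have z: "dot (e i t) (A *v e j t) = 0" for i j
  proof -
    have "dot (e i t) (A *v e j t) = (\<Sum>m\<in>UNIV. \<Sum>k\<in>UNIV. e i t $ m * e j t $ k * (pd m (\<lambda>s. l s $ k) t - pd k (\<lambda>s. l s $ m) t))"
      by (simp add: dot_def matrix_vector_mult_def A_def sum_distrib_left algebra_simps)
    then show ?thesis
      using dot_lb[OF l(1) e(1)[of i] e(1)[of j] U(3)] com[of i j] by (simp add: dot_zero der_def pd0)
  qed
  have "A *v e j t = 0" for j
  proof -
    have "(\<chi> i. e i t) *v (A *v e j t) = 0"
      using z[of _ j] by (simp add: vec_eq_iff matrix_vector_mult_def[of "\<chi> i. e i t"] dot_def)
    then show ?thesis using B(1) matrix_left_invertible_ker by blast
  qed
  then have "A ** transpose (\<chi> i. e i t) = 0"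
    by (simp add: vec_eq_iff matrix_matrix_mult_def matrix_vector_mult_def transpose_def)
  then have "A ** (transpose (\<chi> i. e i t) ** transpose B) = 0" by (simp add: matrix_mul_assoc)
  then have "A = 0" using B(1) by (metis matrix_mul_rid matrix_transpose_mul transpose_mat)
  then show ?thesis by (simp add: A_def closed_at_def vec_eq_iff)
qed

end

section \<open>Flatness of direct summands of free modules\<close>

lemma (in abelian_group) double_zero: "x \<in> carrier G \<Longrightarrow> x \<oplus> x = x \<Longrightarrow> x = \<zero>"
  by (metis add.r_cancel_one')

lemma (in abelian_group) add_right_cancel:
  "x \<in> carrier G \<Longrightarrow> y \<in> carrier G \<Longrightarrow> z \<in> carrier G \<Longrightarrow> x \<oplus> z = y \<oplus> z \<Longrightarrow> x = y"
  using add.right_cancel[of z x y] by simp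

locale module_pair = N: Module.module R N + F: Module.module R F 
  for R :: "('r, 's) ring_scheme" (structure) and N :: "('r, 'x) module" and F :: "('r, 'y) module"
begin

abbreviation "relK \<equiv> tensor_relations R N F"
abbreviation "gens \<equiv> carrier N \<times> carrier F"

lemma rel_generators: "{frag_of (x \<oplus>\<^bsub>N\<^esub> x', y) - frag_of (x, y) - frag_of (x', y) | x x' y.
         x \<in> carrier N \<and> x' \<in> carrier N \<and> y \<in> carrier F} \<union>
      {frag_of (x, y \<oplus>\<^bsub>F\<^esub> y') - frag_of (x, y) - frag_of (x, y') | x y y'.
         x \<in> carrier N \<and> y \<in> carrier F \<and> y' \<in> carrier F} \<union>
      {frag_of (r \<odot>\<^bsub>N\<^esub> x, y) - frag_of (x, r \<odot>\<^bsub>F\<^esub> y) | r x y.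
         r \<in> carrier R \<and> x \<in> carrier N \<and> y \<in> carrier F} \<subseteq> carrier (free_Abelian_group gens)"
  by (auto dest!: subsetD[OF keys_diff])

lemma rel_subgroup: "subgroup relK (free_Abelian_group gens)"
  unfolding tensor_relations_def
  by (rule group.generate_is_subgroup[OF group_free_Abelian_group rel_generators])

lemma rel_keys: "c \<in> relK \<Longrightarrow> Poly_Mapping.keys c \<subseteq> gens"
  using subgroup.mem_carrier[OF rel_subgroup] by simp

lemma rel_zero: "0 \<in> relK"
  using subgroup.one_closed[OF rel_subgroup] by simp

lemma rel_add: "a \<in> relK \<Longrightarrow> b \<in> relK \<Longrightarrow> a + b \<in> relK"
  using subgroup.m_closed[OF rel_subgroup] by simp

lemma rel_minus: "a \<in> relK \<Longrightarrow> - a \<in> relK"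
  using subgroup.m_inv_closed[OF rel_subgroup] rel_keys by simp

lemma rel_diff: "a \<in> relK \<Longrightarrow> b \<in> relK \<Longrightarrow> a - b \<in> relK"
  using rel_add[OF _ rel_minus, of a b] by simp

lemma rel_sum: "(\<And>i. i \<in> I \<Longrightarrow> f i \<in> relK) \<Longrightarrow> sum f I \<in> relK"
  by (induction I rule: infinite_finite_induct) (auto intro: rel_zero rel_add)

lemma rel_left: "x \<in> carrier N \<Longrightarrow> x' \<in> carrier N \<Longrightarrow> y \<in> carrier F \<Longrightarrow>
    frag_of (x \<oplus>\<^bsub>N\<^esub> x', y) - frag_of (x, y) - frag_of (x', y) \<in> relK"
  unfolding tensor_relations_def by (rule generate.incl) blast

lemma rel_right: "x \<in> carrier N \<Longrightarrow> y \<in> carrier F \<Longrightarrow> y' \<in> carrier F \<Longrightarrow>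
    frag_of (x, y \<oplus>\<^bsub>F\<^esub> y') - frag_of (x, y) - frag_of (x, y') \<in> relK"
  unfolding tensor_relations_def by (rule generate.incl) blast

lemma rel_scalar: "r \<in> carrier R \<Longrightarrow> x \<in> carrier N \<Longrightarrow> y \<in> carrier F \<Longrightarrow>
    frag_of (r \<odot>\<^bsub>N\<^esub> x, y) - frag_of (x, r \<odot>\<^bsub>F\<^esub> y) \<in> relK"
  unfolding tensor_relations_def by (rule generate.incl) blast

text \<open>Inverses of generators are absorbed by one closure rule for negatives, so each kind of
  relation has to be treated only once.\<close>

lemma rel_induct [consumes 1, case_names zero left right scalar minus add]:
  assumes c: "c \<in> relK" and zero: "P 0"
    and left: "\<And>x x' y. x \<in> carrier N \<Longrightarrow> x' \<in> carrier N \<Longrightarrow> y \<in> carrier F \<Longrightarrow>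
      P (frag_of (x \<oplus>\<^bsub>N\<^esub> x', y) - frag_of (x, y) - frag_of (x', y))"
    and right: "\<And>x y y'. x \<in> carrier N \<Longrightarrow> y \<in> carrier F \<Longrightarrow> y' \<in> carrier F \<Longrightarrow>
      P (frag_of (x, y \<oplus>\<^bsub>F\<^esub> y') - frag_of (x, y) - frag_of (x, y'))"
    and scalar: "\<And>r x y. r \<in> carrier R \<Longrightarrow> x \<in> carrier N \<Longrightarrow> y \<in> carrier F \<Longrightarrow>
      P (frag_of (r \<odot>\<^bsub>N\<^esub> x, y) - frag_of (x, r \<odot>\<^bsub>F\<^esub> y))"
    and minus: "\<And>a. a \<in> relK \<Longrightarrow> P a \<Longrightarrow> P (- a)"
    and add: "\<And>a b. a \<in> relK \<Longrightarrow> b \<in> relK \<Longrightarrow> P a \<Longrightarrow> P b \<Longrightarrow> P (a + b)"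
  shows "P c"
  using c unfolding tensor_relations_def
proof (induction rule: generate.induct)
  case one
  then show ?case using zero by simp
next
  case (incl h)
  then show ?case by (elim UnE CollectE exE conjE) (simp_all only: left right scalar)
next
  case (inv h)
  have "h \<in> carrier (free_Abelian_group gens)" using inv rel_generators by (rule subsetD[rotated])
  then have "Poly_Mapping.keys h \<subseteq> gens" by simp
  moreover have "P h" using inv by (elim UnE CollectE exE conjE) (simp_all only: left right scalar)
  moreover have "h \<in> relK" unfolding tensor_relations_def using inv by (rule generate.incl)
  ultimately show ?case using minus[of h] by simp
next
  case (eng h1 h2)
  then show ?case using add[of h1 h2] by (simp add: tensor_relations_def)
qed

lemma rel_zero_left: "y \<in> carrier F \<Longrightarrow> frag_of (\<zero>\<^bsub>N\<^esub>, y) \<in> relK"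
  using rel_minus[OF rel_left[of "\<zero>\<^bsub>N\<^esub>" "\<zero>\<^bsub>N\<^esub>" y]] by simp

lemma rel_zero_right: "x \<in> carrier N \<Longrightarrow> frag_of (x, \<zero>\<^bsub>F\<^esub>) \<in> relK"
  using rel_minus[OF rel_right[of x "\<zero>\<^bsub>F\<^esub>" "\<zero>\<^bsub>F\<^esub>"]] by simp

lemma rel_finsum:
  assumes x: "x \<in> carrier N" and "finite I" "g \<in> I \<rightarrow> carrier F"
  shows "frag_of (x, finsum F g I) - (\<Sum>i\<in>I. frag_of (x, g i)) \<in> relK"
  using assms(2,3)
proof (induction I rule: finite_induct)
  case empty
  then show ?case using rel_zero_right[OF x] by simp
next
  case (insert i I)
  then have g: "g i \<in> carrier F" "g \<in> I \<rightarrow> carrier F" by auto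
  have fs: "finsum F g (insert i I) = g i \<oplus>\<^bsub>F\<^esub> finsum F g I"
    using insert g by (intro F.finsum_insert) auto
  have "frag_of (x, g i \<oplus>\<^bsub>F\<^esub> finsum F g I) - frag_of (x, g i) - frag_of (x, finsum F g I) \<in> relK"
    by (rule rel_right[OF x g(1)]) (rule F.finsum_closed[OF g(2)])
  from rel_add[OF this insert.IH[OF g(2)]] show ?case
    using insert.hyps by (simp add: fs algebra_simps)
qed

text \<open>The homomorphism from N \<otimes> F to N that sends x \<otimes> y to \<phi>(y) x, kept
  on the level of formal sums; killing \<open>relK\<close> is its compatibility with the tensor
  relations.\<close>

lemma contraction:
  assumes cl: "\<And>y. y \<in> carrier F \<Longrightarrow> \<phi> y \<in> carrier R"
    and add': "\<And>y y'. y \<in> carrier F \<Longrightarrow> y' \<in> carrier F \<Longrightarrow> \<phi> (y \<oplus>\<^bsub>F\<^esub> y') = \<phi> y \<oplus> \<phi> y'"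
    and sm: "\<And>r y. r \<in> carrier R \<Longrightarrow> y \<in> carrier F \<Longrightarrow> \<phi> (r \<odot>\<^bsub>F\<^esub> y) = r \<otimes> \<phi> y"
  obtains h where "\<And>a. Poly_Mapping.keys a \<subseteq> gens \<Longrightarrow> h a \<in> carrier N"
    "\<And>a b. Poly_Mapping.keys a \<subseteq> gens \<Longrightarrow> Poly_Mapping.keys b \<subseteq> gens \<Longrightarrow> h (a + b) = h a \<oplus>\<^bsub>N\<^esub> h b"
    "\<And>x y. x \<in> carrier N \<Longrightarrow> y \<in> carrier F \<Longrightarrow> h (frag_of (x, y)) = \<phi> y \<odot>\<^bsub>N\<^esub> x"
    "h 0 = \<zero>\<^bsub>N\<^esub>" "\<And>c. c \<in> relK \<Longrightarrow> h c = \<zero>\<^bsub>N\<^esub>"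
proof -
  have "(\<lambda>(x, y). \<phi> y \<odot>\<^bsub>N\<^esub> x) ` gens \<subseteq> carrier (add_monoid N)" using cl by auto
  then obtain h where h: "h \<in> hom (free_Abelian_group gens) (add_monoid N)"
    and hf: "\<And>p. p \<in> gens \<Longrightarrow> h (frag_of p) = (\<lambda>(x, y). \<phi> y \<odot>\<^bsub>N\<^esub> x) p"
    by (rule comm_group.free_Abelian_group_universal[OF N.a_comm_group]) auto
  have hc: "h a \<in> carrier N" if "Poly_Mapping.keys a \<subseteq> gens" for a
    using hom_in_carrier[OF h] that by simp
  have ha: "h (a + b) = h a \<oplus>\<^bsub>N\<^esub> h b"
    if "Poly_Mapping.keys a \<subseteq> gens" "Poly_Mapping.keys b \<subseteq> gens" for a b
    using hom_mult[OF h] that by simp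
  have h0: "h 0 = \<zero>\<^bsub>N\<^esub>"
  proof -
    have "h (0 + 0) = h 0 \<oplus>\<^bsub>N\<^esub> h 0" by (rule ha) auto
    then have "h 0 \<oplus>\<^bsub>N\<^esub> h 0 = h 0" by (simp only: add_0_left)
    then show ?thesis by (rule abelian_group.double_zero[OF N.abelian_group_axioms hc[of 0], rotated]) simp
  qed
  have hm: "h (- a) = \<ominus>\<^bsub>N\<^esub> h a" if k: "Poly_Mapping.keys a \<subseteq> gens" for a
  proof -
    have "h (- a + a) = h (- a) \<oplus>\<^bsub>N\<^esub> h a" by (rule ha) (use k in auto)
    then have "h (- a) \<oplus>\<^bsub>N\<^esub> h a = \<zero>\<^bsub>N\<^esub>" by (simp add: h0)
    then show ?thesis using hc[of "- a"] hc[OF k] k by (intro N.minus_equality[symmetric]) auto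
  qed
  have hd: "h (a - b) = h a \<ominus>\<^bsub>N\<^esub> h b" if "Poly_Mapping.keys a \<subseteq> gens" "Poly_Mapping.keys b \<subseteq> gens" for a b
    using ha[of a "- b"] hm[of b] that by (simp add: a_minus_def)
  have kf: "Poly_Mapping.keys (frag_of p) \<subseteq> gens" if "p \<in> gens" for p :: "'x \<times> 'y" using that by simp
  have kd: "Poly_Mapping.keys (a - b) \<subseteq> gens"
    if "Poly_Mapping.keys a \<subseteq> gens" "Poly_Mapping.keys b \<subseteq> gens" for a b :: "'x \<times> 'y \<Rightarrow>\<^sub>0 int"
    using that keys_diff[of a b] by blast
  have "h c = \<zero>\<^bsub>N\<^esub>" if "c \<in> relK" for c
    using that
  proof (induction rule: rel_induct)
    case (left x x' y)
    then have p: "(x \<oplus>\<^bsub>N\<^esub> x', y) \<in> gens" "(x, y) \<in> gens" "(x', y) \<in> gens" by auto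
    note k = kf[OF p(1)] kf[OF p(2)] kf[OF p(3)]
    have m: "\<phi> y \<odot>\<^bsub>N\<^esub> x \<in> carrier N" "\<phi> y \<odot>\<^bsub>N\<^esub> x' \<in> carrier N" using left cl by auto
    show ?case
      unfolding hd[OF kd[OF k(1,2)] k(3)] hd[OF k(1,2)] hf[OF p(1)] hf[OF p(2)] hf[OF p(3)]
      using left cl m by (simp add: N.smult_r_distr a_minus_def N.a_ac N.r_neg N.r_neg1 N.r_neg2)
  next
    case (right x y y')
    then have p: "(x, y \<oplus>\<^bsub>F\<^esub> y') \<in> gens" "(x, y) \<in> gens" "(x, y') \<in> gens" by auto
    note k = kf[OF p(1)] kf[OF p(2)] kf[OF p(3)]
    have m: "\<phi> y \<odot>\<^bsub>N\<^esub> x \<in> carrier N" "\<phi> y' \<odot>\<^bsub>N\<^esub> x \<in> carrier N" using right cl by auto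
    show ?case
      unfolding hd[OF kd[OF k(1,2)] k(3)] hd[OF k(1,2)] hf[OF p(1)] hf[OF p(2)] hf[OF p(3)]
      using right cl m by (simp add: add' N.smult_l_distr a_minus_def N.a_ac N.r_neg N.r_neg1 N.r_neg2)
  next
    case (scalar r x y)
    then have p: "(r \<odot>\<^bsub>N\<^esub> x, y) \<in> gens" "(x, r \<odot>\<^bsub>F\<^esub> y) \<in> gens" by auto
    note k = kf[OF p(1)] kf[OF p(2)]
    have "\<phi> y \<odot>\<^bsub>N\<^esub> (r \<odot>\<^bsub>N\<^esub> x) = (r \<otimes> \<phi> y) \<odot>\<^bsub>N\<^esub> x"
      using scalar cl by (simp add: N.smult_assoc1[symmetric] N.m_comm)
    then show ?case
      unfolding hd[OF k] hf[OF p(1)] hf[OF p(2)]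
      using scalar cl by (simp add: sm a_minus_def N.r_neg)
  next
    case (minus a)
    then show ?case using hm[OF rel_keys[OF minus(1)]] by simp
  next
    case (add a b)
    then show ?case using ha[OF rel_keys[OF add(1)] rel_keys[OF add(2)]] by simp
  qed (rule h0)
  then show ?thesis using that[of h] hc ha hf h0 by auto
qed

lemma tensor_coset: "relK #>\<^bsub>free_Abelian_group gens\<^esub> c = (\<lambda>k. k + c) ` relK"
  by (auto simp: r_coset_def)

lemma tensor_coset_eq: "(\<lambda>k. k + c) ` relK = (\<lambda>k. k + d) ` relK \<longleftrightarrow> c - d \<in> relK"
proof
  assume "(\<lambda>k. k + c) ` relK = (\<lambda>k. k + d) ` relK"
  moreover have "0 + c \<in> (\<lambda>k. k + c) ` relK" using rel_zero by blast
  ultimately obtain k where "c = k + d" "k \<in> relK" by auto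
  then show "c - d \<in> relK" by simp
next
  assume cd: "c - d \<in> relK"
  have "k + c \<in> (\<lambda>k. k + d) ` relK" if "k \<in> relK" for k
    by (rule image_eqI[of _ _ "k + (c - d)"]) (use rel_add that cd in auto)
  moreover have "k + d \<in> (\<lambda>k. k + c) ` relK" if "k \<in> relK" for k
    by (rule image_eqI[of _ _ "k - (c - d)"]) (use rel_diff that cd in auto)
  ultimately show "(\<lambda>k. k + c) ` relK = (\<lambda>k. k + d) ` relK" by blast
qed

end

text \<open>A module with a finite dual basis is a direct summand of a free module.\<close>

lemma flat_dual_basis:
  fixes R :: "('r, 's) ring_scheme" and F :: "('r, 'y) module" and b :: "'i::finite \<Rightarrow> 'y"
  assumes F: "Module.module R F" and b: "\<And>k. b k \<in> carrier F"
    and cl: "\<And>k y. y \<in> carrier F \<Longrightarrow> \<phi> k y \<in> carrier R"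
    and add: "\<And>k y y'. y \<in> carrier F \<Longrightarrow> y' \<in> carrier F \<Longrightarrow> \<phi> k (y \<oplus>\<^bsub>F\<^esub> y') = \<phi> k y \<oplus>\<^bsub>R\<^esub> \<phi> k y'"
    and sm: "\<And>k r y. r \<in> carrier R \<Longrightarrow> y \<in> carrier F \<Longrightarrow> \<phi> k (r \<odot>\<^bsub>F\<^esub> y) = r \<otimes>\<^bsub>R\<^esub> \<phi> k y"
    and expand: "\<And>y. y \<in> carrier F \<Longrightarrow> y = finsum F (\<lambda>k. \<phi> k y \<odot>\<^bsub>F\<^esub> b k) UNIV"
  shows "flat_module TYPE('x) TYPE('z) R F"
  unfolding flat_module_def
proof (intro conjI allI impI, rule F, elim conjE)
  fix N :: "('r, 'x) module" and N' :: "('r, 'z) module" and f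
  assume N: "Module.module R N" and N': "Module.module R N'" and f: "f \<in> carrier N \<rightarrow> carrier N'"
    and inj: "inj_on f (carrier N)"
    and fadd: "\<forall>x\<in>carrier N. \<forall>y\<in>carrier N. f (x \<oplus>\<^bsub>N\<^esub> y) = f x \<oplus>\<^bsub>N'\<^esub> f y"
    and fsm: "\<forall>r\<in>carrier R. \<forall>x\<in>carrier N. f (r \<odot>\<^bsub>N\<^esub> x) = r \<odot>\<^bsub>N'\<^esub> f x"
  interpret P: module_pair R N F by (rule module_pair.intro[OF N F])
  interpret P': module_pair R N' F by (rule module_pair.intro[OF N' F])
  let ?f = "frag_extend (\<lambda>(x, y). frag_of (f x, y))"
  have f0: "f \<zero>\<^bsub>N\<^esub> = \<zero>\<^bsub>N'\<^esub>"
  proof -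
    have "f \<zero>\<^bsub>N\<^esub> \<oplus>\<^bsub>N'\<^esub> f \<zero>\<^bsub>N\<^esub> = f \<zero>\<^bsub>N\<^esub>"
      using fadd[rule_format, of "\<zero>\<^bsub>N\<^esub>" "\<zero>\<^bsub>N\<^esub>"] by simp
    then show ?thesis
      using f by (intro abelian_group.double_zero[OF P'.N.abelian_group_axioms]) auto
  qed
  have fK: "?f c \<in> P'.relK" if "c \<in> P.relK" for c
    using that
  proof (induction rule: P.rel_induct)
    case (left x x' y)
    then show ?case using P'.rel_left[of "f x" "f x'" y] f fadd by (auto simp: frag_extend_diff Pi_iff)
  next
    case (right x y y')
    then show ?case using P'.rel_right[of "f x" y y'] f by (auto simp: frag_extend_diff Pi_iff)
  next
    case (scalar r x y)
    then show ?case using P'.rel_scalar[of r "f x" y] f fsm by (auto simp: frag_extend_diff Pi_iff)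
  qed (auto simp: frag_extend_minus frag_extend_add P'.rel_zero P'.rel_minus P'.rel_add)
  have keysf: "Poly_Mapping.keys (?f c) \<subseteq> P'.gens" if "Poly_Mapping.keys c \<subseteq> P.gens" for c
    using keys_frag_extend[of "\<lambda>(x, y). frag_of (f x, y)" c] that f by (fastforce simp: Pi_iff)
  \<comment> \<open>With h_k the contraction along \<phi>_k, a formal sum c is congruent to \<Sum>
    h_k(c) \<otimes> b_k. Contractions commute with f, so f(h_k(c)) = 0, and injectivity of f makes
    every summand zero.\<close>
  have kernel: "c \<in> P.relK" if c: "Poly_Mapping.keys c \<subseteq> P.gens" and fc: "?f c \<in> P'.relK" for c
  proof -
    define Q where "Q = (\<lambda>k h. (\<forall>a. Poly_Mapping.keys a \<subseteq> P.gens \<longrightarrow> h a \<in> carrier N) \<and>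
      (\<forall>a b. Poly_Mapping.keys a \<subseteq> P.gens \<longrightarrow> Poly_Mapping.keys b \<subseteq> P.gens \<longrightarrow> h (a + b) = h a \<oplus>\<^bsub>N\<^esub> h b) \<and>
      (\<forall>x\<in>carrier N. \<forall>y\<in>carrier F. h (frag_of (x, y)) = \<phi> k y \<odot>\<^bsub>N\<^esub> x) \<and> h 0 = \<zero>\<^bsub>N\<^esub> \<and> h c = \<zero>\<^bsub>N\<^esub>)"
    have "\<exists>h. Q k h" for k
    proof -
      obtain h where h: "\<And>a. Poly_Mapping.keys a \<subseteq> P.gens \<Longrightarrow> h a \<in> carrier N"
        "\<And>a b. Poly_Mapping.keys a \<subseteq> P.gens \<Longrightarrow> Poly_Mapping.keys b \<subseteq> P.gens \<Longrightarrow> h (a + b) = h a \<oplus>\<^bsub>N\<^esub> h b"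
        "\<And>x y. x \<in> carrier N \<Longrightarrow> y \<in> carrier F \<Longrightarrow> h (frag_of (x, y)) = \<phi> k y \<odot>\<^bsub>N\<^esub> x" "h 0 = \<zero>\<^bsub>N\<^esub>"
        by (rule P.contraction[of "\<phi> k"]) (use cl add sm in auto)
      obtain h' where h': "\<And>a. Poly_Mapping.keys a \<subseteq> P'.gens \<Longrightarrow> h' a \<in> carrier N'"
        "\<And>a b. Poly_Mapping.keys a \<subseteq> P'.gens \<Longrightarrow> Poly_Mapping.keys b \<subseteq> P'.gens \<Longrightarrow> h' (a + b) = h' a \<oplus>\<^bsub>N'\<^esub> h' b"
        "\<And>x y. x \<in> carrier N' \<Longrightarrow> y \<in> carrier F \<Longrightarrow> h' (frag_of (x, y)) = \<phi> k y \<odot>\<^bsub>N'\<^esub> x" "h' 0 = \<zero>\<^bsub>N'\<^esub>"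
        "\<And>c. c \<in> P'.relK \<Longrightarrow> h' c = \<zero>\<^bsub>N'\<^esub>"
        by (rule P'.contraction[of "\<phi> k"]) (use cl add sm in auto)
      have "Poly_Mapping.keys a \<subseteq> P.gens \<and> f (h a) = h' (?f a)" if "Poly_Mapping.keys a \<subseteq> P.gens" for a
        using that
      proof (induction a rule: frag_induction)
        case zero
        then show ?case by (simp add: h h' f0)
      next
        case (one p)
        then obtain x y where p: "p = (x, y)" "x \<in> carrier N" "y \<in> carrier F" by auto
        then show ?case using f fsm cl by (auto simp: h h' Pi_iff)
      next
        case (diff a b)
        then have ka: "Poly_Mapping.keys a \<subseteq> P.gens" and kb: "Poly_Mapping.keys b \<subseteq> P.gens"
          and ea: "f (h a) = h' (?f a)" and eb: "f (h b) = h' (?f b)" by auto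
        have kd: "Poly_Mapping.keys (a - b) \<subseteq> P.gens" using ka kb keys_diff[of a b] by blast
        have "h a = h (a - b) \<oplus>\<^bsub>N\<^esub> h b" using h(2)[OF kd kb] by simp
        then have "f (h (a - b)) \<oplus>\<^bsub>N'\<^esub> f (h b) = f (h a)" using fadd h(1)[OF kd] h(1)[OF kb] by simp
        also have "\<dots> = h' (?f (a - b)) \<oplus>\<^bsub>N'\<^esub> h' (?f b)"
          unfolding ea using h'(2)[OF keysf[OF kd] keysf[OF kb]] by (simp add: frag_extend_diff)
        finally have "f (h (a - b)) = h' (?f (a - b))"
          unfolding eb
          by (rule abelian_group.add_right_cancel[OF P'.N.abelian_group_axioms
                funcset_mem[OF f h(1)[OF kd]] h'(1)[OF keysf[OF kd]] h'(1)[OF keysf[OF kb]]])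
        then show ?case using kd by blast
      qed
      then have "f (h c) = h' (?f c)" using c by blast
      then have "f (h c) = f \<zero>\<^bsub>N\<^esub>" by (simp only: h'(5)[OF fc] f0)
      then have "h c = \<zero>\<^bsub>N\<^esub>" by (rule inj_onD[OF inj _ h(1)[OF c] P.N.zero_closed])
      then show ?thesis using h unfolding Q_def by (intro exI[of _ h]) auto
    qed
    then obtain h where "\<And>k. Q k (h k)" by metis
    then have h: "Poly_Mapping.keys a \<subseteq> P.gens \<Longrightarrow> h k a \<in> carrier N"
      "Poly_Mapping.keys a \<subseteq> P.gens \<Longrightarrow> Poly_Mapping.keys a' \<subseteq> P.gens \<Longrightarrow> h k (a + a') = h k a \<oplus>\<^bsub>N\<^esub> h k a'"
      "x \<in> carrier N \<Longrightarrow> y \<in> carrier F \<Longrightarrow> h k (frag_of (x, y)) = \<phi> k y \<odot>\<^bsub>N\<^esub> x"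
      "h k 0 = \<zero>\<^bsub>N\<^esub>" "h k c = \<zero>\<^bsub>N\<^esub>" for k a a' x y
      unfolding Q_def by blast+
    \<comment> \<open>For a generator x \<otimes> y this expands y in the b_k and moves the
      coefficients to the left factor; differences follow by additivity of the contractions.\<close>
    have "Poly_Mapping.keys a \<subseteq> P.gens \<and> a - (\<Sum>k\<in>UNIV. frag_of (h k a, b k)) \<in> P.relK"
      if "Poly_Mapping.keys a \<subseteq> P.gens" for a
      using that
    proof (induction a rule: frag_induction)
      case zero
      have "(\<Sum>k\<in>UNIV. frag_of (h k 0, b k)) \<in> P.relK"
        by (rule P.rel_sum) (simp add: h P.rel_zero_left b)
      then show ?case using P.rel_minus by simp
    next
      case (one p)
      then obtain x y where p: "p = (x, y)" "x \<in> carrier N" "y \<in> carrier F" by auto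
      have "frag_of (x, finsum F (\<lambda>k. \<phi> k y \<odot>\<^bsub>F\<^esub> b k) UNIV) - (\<Sum>k\<in>UNIV. frag_of (x, \<phi> k y \<odot>\<^bsub>F\<^esub> b k)) \<in> P.relK"
        by (rule P.rel_finsum) (use p b cl in auto)
      then have 1: "frag_of (x, y) - (\<Sum>k\<in>UNIV. frag_of (x, \<phi> k y \<odot>\<^bsub>F\<^esub> b k)) \<in> P.relK"
        using expand[OF p(3)] by simp
      have "(\<Sum>k\<in>UNIV. frag_of (\<phi> k y \<odot>\<^bsub>N\<^esub> x, b k) - frag_of (x, \<phi> k y \<odot>\<^bsub>F\<^esub> b k)) \<in> P.relK"
        by (intro P.rel_sum P.rel_scalar) (use p b cl in auto)
      from P.rel_diff[OF 1 this] show ?case using p by (simp add: h sum_subtractf)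
    next
      case (diff a a')
      then have ka: "Poly_Mapping.keys a \<subseteq> P.gens" and kb: "Poly_Mapping.keys a' \<subseteq> P.gens"
        and ea: "a - (\<Sum>k\<in>UNIV. frag_of (h k a, b k)) \<in> P.relK"
        and eb: "a' - (\<Sum>k\<in>UNIV. frag_of (h k a', b k)) \<in> P.relK" by auto
      have kd: "Poly_Mapping.keys (a - a') \<subseteq> P.gens" using ka kb keys_diff[of a a'] by blast
      have hk: "h k a = h k (a - a') \<oplus>\<^bsub>N\<^esub> h k a'" for k using h(2)[OF kd kb] by simp
      have "(\<Sum>k\<in>UNIV. frag_of (h k a, b k) - frag_of (h k (a - a'), b k) - frag_of (h k a', b k)) \<in> P.relK"
        unfolding hk by (intro P.rel_sum P.rel_left h(1)[OF kd] h(1)[OF kb] b)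
      from P.rel_add[OF P.rel_diff[OF ea eb] this] show ?case
        using kd by (simp add: sum_subtractf sum.distrib algebra_simps)
    qed
    then have "c - (\<Sum>k\<in>UNIV. frag_of (h k c, b k)) \<in> P.relK" using c by blast
    moreover have "(\<Sum>k\<in>UNIV. frag_of (h k c, b k)) \<in> P.relK"
      by (rule P.rel_sum) (simp add: h P.rel_zero_left b)
    ultimately have "(c - (\<Sum>k\<in>UNIV. frag_of (h k c, b k))) + (\<Sum>k\<in>UNIV. frag_of (h k c, b k)) \<in> P.relK"
      by (rule P.rel_add)
    then show ?thesis by simp
  qed
  have tm: "tensor_map R N' F f ((\<lambda>k. k + c) ` P.relK) = (\<lambda>k. k + ?f c) ` P'.relK" for c
  proof -
    have "(\<lambda>k. k + ?f (k' + c)) ` P'.relK = (\<lambda>k. k + ?f c) ` P'.relK" if "k' \<in> P.relK" for k'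
      unfolding P'.tensor_coset_eq using fK[OF that] by (simp add: frag_extend_add)
    then show ?thesis unfolding tensor_map_def P'.tensor_coset using P.rel_zero by blast
  qed
  show "inj_on (tensor_map R N' F f) (carrier (tensor_product R N F))"
  proof (rule inj_onI)
    fix C D assume C: "C \<in> carrier (tensor_product R N F)" and D: "D \<in> carrier (tensor_product R N F)"
      and eq: "tensor_map R N' F f C = tensor_map R N' F f D"
    obtain c d where c: "Poly_Mapping.keys c \<subseteq> P.gens" "C = (\<lambda>k. k + c) ` P.relK"
      and d: "Poly_Mapping.keys d \<subseteq> P.gens" "D = (\<lambda>k. k + d) ` P.relK"
      using C D by (auto simp: tensor_product_def FactGroup_def RCOSETS_def P.tensor_coset)
    have "?f (c - d) \<in> P'.relK"
      using eq unfolding c d tm P'.tensor_coset_eq by (simp add: frag_extend_diff)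
    moreover have "Poly_Mapping.keys (c - d) \<subseteq> P.gens" using c d keys_diff[of c d] by blast
    ultimately have "c - d \<in> P.relK" by (rule kernel[rotated])
    then show "C = D" unfolding c d P.tensor_coset_eq .
  qed
qed

section \<open>Manifolds, tangent vectors and vector fields in charts\<close>

text \<open>Cartan's formula for the form df, which is closed by symmetry of the second partial
  derivatives.\<close>

lemma der_lb:
  assumes U: "open U" "t \<in> U" and h: "hmap X U" "hmap Y U" "holo f U"
  shows "der (lb X Y t) f t = der (X t) (\<lambda>s. der (Y s) f s) t - der (Y t) (\<lambda>s. der (X s) f s) t"
proof -
  let ?g = "\<lambda>s. \<chi> k. pd k f s"
  have d: "der v f s = dot (?g s) v" for v s by (simp add: der_def dot_def mult.commute)
  have g: "hmap ?g U" by (rule hmapI) (simp add: holo_pd[OF h(3) U(1)])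
  have "closed_at ?g t" using pd_commute[OF h(3) U] by (simp add: closed_at_def)
  then show ?thesis unfolding d by (rule dot_lb_closed[OF g h(1,2) U(2)])
qed

locale atlas =
  fixes A :: "('a, 'k::finite) chart set"
  assumes atlas: "complex_atlas A"
begin

lemma chart_inj: "c \<in> A \<Longrightarrow> inj_on (snd c) (fst c)"
  using atlas unfolding complex_atlas_def by blast

lemma chart_inv1 [simp]: "c \<in> A \<Longrightarrow> p \<in> fst c \<Longrightarrow> chart_inv c (snd c p) = p"
  unfolding chart_inv_def using chart_inj inv_into_f_f by metis

lemma chart_inv2 [simp]: "z \<in> snd c ` fst c \<Longrightarrow> snd c (chart_inv c z) = z"
  unfolding chart_inv_def by (rule f_inv_into_f)

lemma chart_inv3: "z \<in> snd c ` fst c \<Longrightarrow> chart_inv c z \<in> fst c"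
  unfolding chart_inv_def by (rule inv_into_into)

lemma open_overlap: "c \<in> A \<Longrightarrow> d \<in> A \<Longrightarrow> open (snd c ` (fst c \<inter> fst d))"
  using atlas unfolding complex_atlas_def by blast

lemma hmap_trans: "c \<in> A \<Longrightarrow> d \<in> A \<Longrightarrow> hmap (\<lambda>z. snd d (chart_inv c z)) (snd c ` (fst c \<inter> fst d))"
  using atlas unfolding complex_atlas_def hmap_def by blast

text \<open>\<open>topology\<close> yields the intended open sets only for an
  \<open>istopology\<close> predicate; in the intersection property the injectivity of the charts
  enters.\<close>

lemma openin_iff: "openin (mtop A) S \<longleftrightarrow> S \<subseteq> mspace A \<and> (\<forall>c\<in>A. open (snd c ` (S \<inter> fst c)))"
proof -
  have "istopology (\<lambda>S. S \<subseteq> mspace A \<and> (\<forall>c\<in>A. open (snd c ` (S \<inter> fst c))))"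
    unfolding istopology_def
  proof (intro conjI allI impI)
    fix S T assume S: "S \<subseteq> mspace A \<and> (\<forall>c\<in>A. open (snd c ` (S \<inter> fst c)))"
      and T: "T \<subseteq> mspace A \<and> (\<forall>c\<in>A. open (snd c ` (T \<inter> fst c)))"
    show "S \<inter> T \<subseteq> mspace A" using S by blast
    show "\<forall>c\<in>A. open (snd c ` (S \<inter> T \<inter> fst c))"
    proof
      fix c assume c: "c \<in> A"
      have "snd c ` (S \<inter> T \<inter> fst c) = snd c ` (S \<inter> fst c) \<inter> snd c ` (T \<inter> fst c)"
        using chart_inj[OF c] by (auto dest: inj_onD)
      then show "open (snd c ` (S \<inter> T \<inter> fst c))" using S T c by auto
    qed
  next
    fix K assume K: "\<forall>S\<in>K. S \<subseteq> mspace A \<and> (\<forall>c\<in>A. open (snd c ` (S \<inter> fst c)))"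
    show "\<Union> K \<subseteq> mspace A" using K by blast
    show "\<forall>c\<in>A. open (snd c ` (\<Union> K \<inter> fst c))"
    proof
      fix c assume c: "c \<in> A"
      have "snd c ` (\<Union> K \<inter> fst c) = (\<Union>S\<in>K. snd c ` (S \<inter> fst c))" by blast
      then show "open (snd c ` (\<Union> K \<inter> fst c))" using K c by auto
    qed
  qed
  then show ?thesis unfolding mtop_def by (simp add: topology_inverse')
qed

lemma openin_chart: "c \<in> A \<Longrightarrow> openin (mtop A) (fst c)"
  unfolding openin_iff using open_overlap by (auto simp: mspace_def Int_commute)

lemma chart_mspace: "c \<in> A \<Longrightarrow> fst c \<subseteq> mspace A"
  by (auto simp: mspace_def)

lemma openin_mspace: "openin (mtop A) (mspace A)"
proof -
  have "mspace A \<inter> fst c = fst c \<inter> fst c" if "c \<in> A" for c using chart_mspace[OF that] by blast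
  then show ?thesis unfolding openin_iff using open_overlap by (metis inf.idem order_refl)
qed

lemma topspace_mtop: "topspace (mtop A) = mspace A"
  using openin_mspace openin_subset[of "mtop A"] openin_topspace[of "mtop A"] openin_iff by blast

lemma open_image: "openin (mtop A) S \<Longrightarrow> c \<in> A \<Longrightarrow> open (snd c ` (S \<inter> fst c))"
  using openin_iff by blast

lemma open_image_sub: "openin (mtop A) S \<Longrightarrow> c \<in> A \<Longrightarrow> S \<subseteq> fst c \<Longrightarrow> open (snd c ` S)"
  using open_image[of S c] by (simp add: Int_absorb2)

lemma open_chart_image: "c \<in> A \<Longrightarrow> open (snd c ` fst c)"
  using open_overlap[of c c] by simp

lemma openin_preimage:
  assumes "c \<in> A" "open N"
  shows "openin (mtop A) {p \<in> fst c. snd c p \<in> N}"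
  unfolding openin_iff
proof (intro conjI ballI)
  show "{p \<in> fst c. snd c p \<in> N} \<subseteq> mspace A" using chart_mspace[OF assms(1)] by blast
  fix d assume d: "d \<in> A"
  have "snd d ` ({p \<in> fst c. snd c p \<in> N} \<inter> fst d) =
      snd d ` (fst d \<inter> fst c) \<inter> (\<lambda>w. snd c (chart_inv d w)) -` N"
    using d by (auto simp: image_iff)
  moreover have "open (snd d ` (fst d \<inter> fst c) \<inter> (\<lambda>w. snd c (chart_inv d w)) -` N)"
    by (rule continuous_open_preimage[OF hmap_continuous_on[OF hmap_trans[OF d assms(1)]] open_overlap[OF d assms(1)] assms(2)])
  ultimately show "open (snd d ` ({p \<in> fst c. snd c p \<in> N} \<inter> fst d))" by simp
qed

lemma mspaceE:
  assumes "p \<in> mspace A"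
  obtains c where "c \<in> A" "p \<in> fst c"
  using assms unfolding mspace_def by blast

lemma mholoD: "mholo A U f \<Longrightarrow> c \<in> A \<Longrightarrow> holo (\<lambda>z. f (chart_inv c z)) (snd c ` (U \<inter> fst c))"
  unfolding mholo_def by blast

lemma mholo_chartI:
  assumes c: "c \<in> A" and U: "openin (mtop A) U" "U \<subseteq> fst c" and f: "holo (\<lambda>z. f (chart_inv c z)) (snd c ` U)"
  shows "mholo A U f"
  unfolding mholo_def
proof
  fix d assume d: "d \<in> A"
  have hm: "hmap (\<lambda>w. snd c (chart_inv d w)) (snd d ` (U \<inter> fst d))"
    by (rule hmap_subset[OF hmap_trans[OF d c]]) (use U(2) in blast)
  have "holo (\<lambda>w. f (chart_inv c (snd c (chart_inv d w)))) (snd d ` (U \<inter> fst d))"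
    by (rule holo_compose[OF hm f]) (use d in auto)
  then show "holo (\<lambda>z. f (chart_inv d z)) (snd d ` (U \<inter> fst d))"
    by (rule holo_cong[OF open_image[OF U(1) d], rotated]) (use c d U(2) in auto)
qed

text \<open>Moves statements about some neighbourhood to a filter on the coordinate space, where
  they can be combined without naming the neighbourhoods.\<close>

lemma eventually_chart_iff:
  assumes c: "c \<in> A" and p: "p \<in> fst c"
  shows "(\<exists>U. openin (mtop A) U \<and> p \<in> U \<and> (\<forall>x\<in>U. P x)) \<longleftrightarrow> (\<forall>\<^sub>F z in nhds (snd c p). P (chart_inv c z))"
proof
  assume "\<exists>U. openin (mtop A) U \<and> p \<in> U \<and> (\<forall>x\<in>U. P x)"
  then obtain U where U: "openin (mtop A) U" "p \<in> U" "\<forall>x\<in>U. P x" by blast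
  have "\<forall>z\<in>snd c ` (U \<inter> fst c). P (chart_inv c z)" using U(3) c by auto
  then show "\<forall>\<^sub>F z in nhds (snd c p). P (chart_inv c z)"
    unfolding eventually_nhds using open_image[OF U(1) c] U(2) p by blast
next
  assume "\<forall>\<^sub>F z in nhds (snd c p). P (chart_inv c z)"
  then obtain S where S: "open S" "snd c p \<in> S" "\<forall>z\<in>S. P (chart_inv c z)"
    unfolding eventually_nhds by blast
  have "P x" if "x \<in> {p \<in> fst c. snd c p \<in> S}" for x
    using that S(3) c by (metis (mono_tags, lifting) chart_inv1 mem_Collect_eq)
  then show "\<exists>U. openin (mtop A) U \<and> p \<in> U \<and> (\<forall>x\<in>U. P x)"
    using openin_preimage[OF c S(1)] S(2) p by (intro exI[of _ "{p \<in> fst c. snd c p \<in> S}"]) auto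
qed

lemma holo_near_chart_iff:
  assumes c: "c \<in> A" and p: "p \<in> fst c"
  shows "(\<exists>U. openin (mtop A) U \<and> p \<in> U \<and> mholo A U f) \<longleftrightarrow> holo_near (\<lambda>z. f (chart_inv c z)) (snd c p)"
proof
  assume "\<exists>U. openin (mtop A) U \<and> p \<in> U \<and> mholo A U f"
  then obtain U where U: "openin (mtop A) U" "p \<in> U" "mholo A U f" by blast
  show "holo_near (\<lambda>z. f (chart_inv c z)) (snd c p)"
    by (rule holo_nearI[OF open_image[OF U(1) c] _ mholoD[OF U(3) c]]) (use U(2) p in blast)
next
  assume "holo_near (\<lambda>z. f (chart_inv c z)) (snd c p)"
  then obtain N where N: "open N" "snd c p \<in> N" "holo (\<lambda>z. f (chart_inv c z)) N" by (rule holo_nearE)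
  let ?U = "{q \<in> fst c. snd c q \<in> N}"
  have "mholo A ?U f"
    by (rule mholo_chartI[OF c openin_preimage[OF c N(1)]]) (auto intro: holo_subset[OF N(3)])
  then show "\<exists>U. openin (mtop A) U \<and> p \<in> U \<and> mholo A U f"
    using openin_preimage[OF c N(1)] N(2) p by blast
qed

section \<open>Jacobians and tangent vectors in charts\<close>

abbreviation "jac c d p \<equiv> frechet_derivative (\<lambda>z. snd d (chart_inv c z)) (at (snd c p))"

lemma jac_nth:
  assumes "c \<in> A" "d \<in> A" "p \<in> fst c" "p \<in> fst d"
  shows "jac c d p v $ j = der v (\<lambda>z. snd d (chart_inv c z) $ j) (snd c p)"
  unfolding der_def by (rule hmap_frechet[OF hmap_trans[OF assms(1,2)]]) (use assms in blast)

lemma jac_add: "c \<in> A \<Longrightarrow> d \<in> A \<Longrightarrow> p \<in> fst c \<Longrightarrow> p \<in> fst d \<Longrightarrow> jac c d p (v + w) = jac c d p v + jac c d p w"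
  by (simp add: vec_eq_iff jac_nth der_def algebra_simps sum.distrib)

lemma jac_smult: "c \<in> A \<Longrightarrow> d \<in> A \<Longrightarrow> p \<in> fst c \<Longrightarrow> p \<in> fst d \<Longrightarrow> jac c d p (s *s v) = s *s jac c d p v"
  by (simp add: vec_eq_iff jac_nth der_def sum_distrib_left mult.assoc)

lemma jac_self: "c \<in> A \<Longrightarrow> p \<in> fst c \<Longrightarrow> jac c c p v = v"
proof -
  assume c: "c \<in> A" "p \<in> fst c"
  have "pd i (\<lambda>z. snd c (chart_inv c z) $ j) (snd c p) = pd i (\<lambda>z. z $ j) (snd c p)" for i j
    by (rule pd_cong[OF open_chart_image[OF c(1)]]) (use c in \<open>auto intro: holo_coord\<close>)
  then have "pd i (\<lambda>z. snd c (chart_inv c z) $ j) (snd c p) = (if i = j then 1 else 0)" for i j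
    unfolding pd_coord by simp
  note * = this
  show ?thesis using c unfolding vec_eq_iff jac_nth[OF c(1,1) c(2,2)] der_def * by (simp add: mult_delta_right)
qed

lemma der_compose:
  assumes "hmap F S" "holo g T" "x \<in> S" "F x \<in> T"
  shows "der v (\<lambda>z. g (F z)) x = der (\<chi> j. der v (\<lambda>z. F z $ j) x) g (F x)"
proof -
  have "der v (\<lambda>z. g (F z)) x = (\<Sum>i\<in>UNIV. \<Sum>j\<in>UNIV. v $ i * (pd j g (F x) * pd i (\<lambda>z. F z $ j) x))"
    by (simp add: der_def pd_compose[OF assms] sum_distrib_left)
  also have "\<dots> = (\<Sum>j\<in>UNIV. \<Sum>i\<in>UNIV. v $ i * (pd j g (F x) * pd i (\<lambda>z. F z $ j) x))" by (rule sum.swap)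
  also have "\<dots> = der (\<chi> j. der v (\<lambda>z. F z $ j) x) g (F x)"
    by (simp add: der_def sum_distrib_right sum_distrib_left mult.commute mult.left_commute)
  finally show ?thesis .
qed

lemma jac_chain:
  assumes "c \<in> A" "d \<in> A" "e \<in> A" "p \<in> fst c" "p \<in> fst d" "p \<in> fst e"
  shows "jac d e p (jac c d p v) = jac c e p v"
proof -
  let ?S = "snd c ` (fst c \<inter> fst d \<inter> fst e)"
  have oS: "open ?S" using open_image[of "fst d \<inter> fst e" c] openin_chart assms(1-3)
    by (simp add: Int_commute Int_left_commute openin_Int)
  have p: "snd c p \<in> ?S" using assms by blast
  have h1: "hmap (\<lambda>z. snd d (chart_inv c z)) ?S" by (rule hmap_subset[OF hmap_trans[OF assms(1,2)]]) blast
  have "jac c e p v $ j = jac d e p (jac c d p v) $ j" for j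
  proof -
    have h2: "holo (\<lambda>z. snd e (chart_inv d z) $ j) (snd d ` (fst d \<inter> fst e))"
      by (rule hmap_nth[OF hmap_trans[OF assms(2,3)]])
    have sub: "snd d (chart_inv c z) \<in> snd d ` (fst d \<inter> fst e)" if "z \<in> ?S" for z
      using that assms(1) by auto
    have "der v (\<lambda>z. snd e (chart_inv c z) $ j) (snd c p) =
        der v (\<lambda>z. snd e (chart_inv d (snd d (chart_inv c z))) $ j) (snd c p)"
    proof -
      have "pd i (\<lambda>z. snd e (chart_inv c z) $ j) (snd c p) =
          pd i (\<lambda>z. snd e (chart_inv d (snd d (chart_inv c z))) $ j) (snd c p)" for i
      proof (rule pd_cong[OF oS p])
        fix z assume "z \<in> ?S"
        then show "snd e (chart_inv c z) $ j = snd e (chart_inv d (snd d (chart_inv c z))) $ j" using assms by auto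
      qed (rule holo_compose[OF h1 h2 sub])
      then show ?thesis by (simp add: der_def)
    qed
    also have "\<dots> = der (\<chi> i. der v (\<lambda>z. snd d (chart_inv c z) $ i) (snd c p))
        (\<lambda>z. snd e (chart_inv d z) $ j) (snd d (chart_inv c (snd c p)))"
      by (rule der_compose[OF h1 h2 p sub[OF p]])
    also have "(\<chi> i. der v (\<lambda>z. snd d (chart_inv c z) $ i) (snd c p)) = jac c d p v"
      using assms by (simp add: vec_eq_iff jac_nth)
    finally show ?thesis using assms by (simp add: jac_nth)
  qed
  then show ?thesis by (simp add: vec_eq_iff)
qed

text \<open>The tangent vector with components x in chart c. It inverts evaluation at c, so equality
  of tangent vectors can be tested in one chart.\<close>

definition tv :: "('a, 'k) chart \<Rightarrow> 'a \<Rightarrow> complex^'k \<Rightarrow> ('a, 'k) tvec" where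
  "tv c p x = (\<lambda>d. if d \<in> A \<and> p \<in> fst d then jac c d p x else 0)"

lemma coord_vector_tv: "coord_vector A c i p = tv c p (axis i 1)"
  by (simp add: coord_vector_def tv_def)

lemma tv_tangent: "c \<in> A \<Longrightarrow> p \<in> fst c \<Longrightarrow> tv c p x \<in> tangent_space A p"
  unfolding tangent_space_def tv_def by (auto simp: jac_chain)

lemma tv_self [simp]: "c \<in> A \<Longrightarrow> p \<in> fst c \<Longrightarrow> tv c p x c = x"
  by (simp add: tv_def jac_self)

lemma tangent_tv:
  assumes "c \<in> A" "p \<in> fst c" "v \<in> tangent_space A p"
  shows "tv c p (v c) = v"
proof
  fix d
  show "tv c p (v c) d = v d"
  proof (cases "d \<in> A \<and> p \<in> fst d")
    case True
    then have "v d = jac c d p (v c)" using assms unfolding tangent_space_def by blast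
    then show ?thesis using True by (simp only: tv_def simp_thms if_True)
  next
    case False
    then have "v d = 0" using assms(3) unfolding tangent_space_def by blast
    then show ?thesis using False by (simp only: tv_def simp_thms if_False)
  qed
qed

lemma tangent_eqI:
  "c \<in> A \<Longrightarrow> p \<in> fst c \<Longrightarrow> v \<in> tangent_space A p \<Longrightarrow> w \<in> tangent_space A p \<Longrightarrow> v c = w c \<Longrightarrow> v = w"
  by (subst tangent_tv[symmetric, of c p v], assumption+, subst tangent_tv[symmetric, of c p w], assumption+, simp)

lemma tv_add: "c \<in> A \<Longrightarrow> p \<in> fst c \<Longrightarrow> tv c p (x + y) = tv c p x + tv c p y"
  unfolding tv_def by (rule ext) (simp add: jac_add)

lemma tv_smult: "c \<in> A \<Longrightarrow> p \<in> fst c \<Longrightarrow> tv c p (s *s x) = cscale s (tv c p x)"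
  unfolding tv_def cscale_def by (rule ext) (simp add: jac_smult)

lemma tv_zero: "c \<in> A \<Longrightarrow> p \<in> fst c \<Longrightarrow> tv c p 0 = 0"
  using tv_smult[of c p 0 0] by (simp add: cscale_def fun_eq_iff)

lemma tangent_add: "p \<in> mspace A \<Longrightarrow> v \<in> tangent_space A p \<Longrightarrow> w \<in> tangent_space A p \<Longrightarrow> v + w \<in> tangent_space A p"
proof -
  assume a: "p \<in> mspace A" "v \<in> tangent_space A p" "w \<in> tangent_space A p"
  obtain c where c: "c \<in> A" "p \<in> fst c" using a(1) by (rule mspaceE)
  show ?thesis using tv_tangent[OF c, of "v c + w c"] by (simp only: tv_add[OF c] tangent_tv[OF c a(2)] tangent_tv[OF c a(3)])
qed

lemma tangent_cscale: "p \<in> mspace A \<Longrightarrow> v \<in> tangent_space A p \<Longrightarrow> cscale s v \<in> tangent_space A p"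
proof -
  assume a: "p \<in> mspace A" "v \<in> tangent_space A p"
  obtain c where c: "c \<in> A" "p \<in> fst c" using a(1) by (rule mspaceE)
  show ?thesis using tv_tangent[OF c, of "s *s v c"] by (simp only: tv_smult[OF c] tangent_tv[OF c a(2)])
qed

lemma tangent_zero: "p \<in> mspace A \<Longrightarrow> 0 \<in> tangent_space A p"
proof -
  assume a: "p \<in> mspace A"
  obtain c where c: "c \<in> A" "p \<in> fst c" using a(1) by (rule mspaceE)
  show ?thesis using tv_tangent[OF c, of 0] by (simp only: tv_zero[OF c])
qed

lemma tangent_diff: "p \<in> mspace A \<Longrightarrow> v \<in> tangent_space A p \<Longrightarrow> w \<in> tangent_space A p \<Longrightarrow> v - w \<in> tangent_space A p"
proof -
  assume a: "p \<in> mspace A" "v \<in> tangent_space A p" "w \<in> tangent_space A p"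
  have e: "v - w = v + cscale (- 1) w" by (simp add: fun_eq_iff cscale_def)
  show ?thesis unfolding e by (rule tangent_add[OF a(1,2) tangent_cscale[OF a(1,3)]])
qed

lemma cscale_zero: "cscale s 0 = 0" "cscale s (\<lambda>d. 0) = 0" by (simp_all add: cscale_def fun_eq_iff)

lemma cscale_apply: "cscale s v c = s *s v c" by (simp add: cscale_def)

lemma tangent_sum: "p \<in> mspace A \<Longrightarrow> (\<And>i. i \<in> I \<Longrightarrow> f i \<in> tangent_space A p) \<Longrightarrow> sum f I \<in> tangent_space A p"
  by (induction I rule: infinite_finite_induct) (auto intro: tangent_zero tangent_add)

section \<open>Vector fields in charts\<close>

definition loc :: "('a, 'k) chart \<Rightarrow> ('a, 'k) vfield \<Rightarrow> complex^'k \<Rightarrow> complex^'k" where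
  "loc c X z = X (chart_inv c z) c"

lemma vfields_tangent: "X \<in> vfields A U \<Longrightarrow> p \<in> U \<Longrightarrow> X p \<in> tangent_space A p"
  and vfields_outside: "X \<in> vfields A U \<Longrightarrow> p \<notin> U \<Longrightarrow> X p = 0"
  and vfields_hmap: "X \<in> vfields A U \<Longrightarrow> c \<in> A \<Longrightarrow> hmap (loc c X) (snd c ` (U \<inter> fst c))"
  by (auto simp: vfields_def hmap_def loc_def)

lemma vfieldsI:
  assumes "\<And>p. p \<in> U \<Longrightarrow> X p \<in> tangent_space A p" "\<And>p. p \<notin> U \<Longrightarrow> X p = 0"
    "\<And>c. c \<in> A \<Longrightarrow> hmap (loc c X) (snd c ` (U \<inter> fst c))"
  shows "X \<in> vfields A U"
  using assms by (auto simp: vfields_def hmap_def loc_def)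

lemma vfields_eqI:
  assumes "U \<subseteq> mspace A" "X \<in> vfields A U" "Y \<in> vfields A U"
    "\<And>p c. p \<in> U \<Longrightarrow> c \<in> A \<Longrightarrow> p \<in> fst c \<Longrightarrow> X p c = Y p c"
  shows "X = Y"
proof
  fix p show "X p = Y p"
  proof (cases "p \<in> U")
    case True
    then obtain c where c: "c \<in> A" "p \<in> fst c" using assms(1) mspaceE by blast
    show ?thesis
      by (rule tangent_eqI[OF c vfields_tangent[OF assms(2) True] vfields_tangent[OF assms(3) True] assms(4)[OF True c]])
  next
    case False
    then show ?thesis using vfields_outside[OF assms(2)] vfields_outside[OF assms(3)] by simp
  qed
qed

lemma vfields_add:
  assumes "U \<subseteq> mspace A" "X \<in> vfields A U" "Y \<in> vfields A U"
  shows "X + Y \<in> vfields A U"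
proof (rule vfieldsI)
  show "hmap (loc c (X + Y)) (snd c ` (U \<inter> fst c))" if "c \<in> A" for c
    using vfields_hmap[OF assms(2) that] vfields_hmap[OF assms(3) that] unfolding hmap_def loc_def
    by (auto intro: holo_add)
qed (use assms in \<open>auto intro!: tangent_add simp: vfields_tangent vfields_outside\<close>)

lemma vfields_diff:
  assumes "U \<subseteq> mspace A" "X \<in> vfields A U" "Y \<in> vfields A U"
  shows "X - Y \<in> vfields A U"
proof (rule vfieldsI)
  show "hmap (loc c (X - Y)) (snd c ` (U \<inter> fst c))" if "c \<in> A" for c
    using vfields_hmap[OF assms(2) that] vfields_hmap[OF assms(3) that] unfolding hmap_def loc_def
    by (auto intro: holo_diff)
qed (use assms in \<open>auto intro!: tangent_diff simp: vfields_tangent vfields_outside\<close>)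

lemma vfields_zero: "U \<subseteq> mspace A \<Longrightarrow> 0 \<in> vfields A U"
  by (rule vfieldsI) (auto intro!: tangent_zero hmapI holo_const simp: loc_def)

lemma vfields_fscale:
  assumes "U \<subseteq> mspace A" "mholo A U f" "X \<in> vfields A U"
  shows "fscale f X \<in> vfields A U"
proof (rule vfieldsI)
  show "hmap (loc c (fscale f X)) (snd c ` (U \<inter> fst c))" if "c \<in> A" for c
    using vfields_hmap[OF assms(3) that] mholoD[OF assms(2) that] unfolding hmap_def loc_def
    by (auto intro: holo_mult simp: fscale_def cscale_def)
qed (use assms in \<open>auto intro!: tangent_cscale simp: vfields_tangent vfields_outside fscale_def cscale_zero\<close>)

lemma vfields_sum: "U \<subseteq> mspace A \<Longrightarrow> (\<And>i. i \<in> I \<Longrightarrow> f i \<in> vfields A U) \<Longrightarrow> sum f I \<in> vfields A U"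
  by (induction I rule: infinite_finite_induct) (auto intro: vfields_zero vfields_add)

lemma vfields_restrict: "X \<in> vfields A U \<Longrightarrow> openin (mtop A) V \<Longrightarrow> V \<subseteq> U \<Longrightarrow> vrestrict V X \<in> vfields A V"
proof (rule vfieldsI)
  fix c assume a: "X \<in> vfields A U" "openin (mtop A) V" "V \<subseteq> U" "c \<in> A"
  have "hmap (loc c X) (snd c ` (V \<inter> fst c))"
    by (rule hmap_subset[OF vfields_hmap[OF a(1,4)]]) (use a in blast)
  then show "hmap (loc c (vrestrict V X)) (snd c ` (V \<inter> fst c))"
    by (rule hmap_cong[OF open_image[OF a(2,4)], rotated]) (use a in \<open>auto simp: loc_def vrestrict_def\<close>)
qed (auto simp: vrestrict_def vfields_tangent)

definition mkf :: "('a, 'k) chart \<Rightarrow> 'a set \<Rightarrow> (complex^'k \<Rightarrow> complex^'k) \<Rightarrow> ('a, 'k) vfield" where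
  "mkf c U F = (\<lambda>p. if p \<in> U then tv c p (F (snd c p)) else 0)"

lemma mkf_apply: "c \<in> A \<Longrightarrow> U \<subseteq> fst c \<Longrightarrow> p \<in> U \<Longrightarrow> mkf c U F p c = F (snd c p)"
  by (auto simp: mkf_def)

lemma mkf_vfields:
  assumes c: "c \<in> A" and U: "openin (mtop A) U" "U \<subseteq> fst c" and F: "hmap F (snd c ` U)"
  shows "mkf c U F \<in> vfields A U"
proof (rule vfieldsI)
  fix d assume d: "d \<in> A"
  have h: "hmap (\<lambda>w. snd c (chart_inv d w)) (snd d ` (U \<inter> fst d))"
    by (rule hmap_subset[OF hmap_trans[OF d c]]) (use U(2) in blast)
  show "hmap (loc d (mkf c U F)) (snd d ` (U \<inter> fst d))"
  proof (rule hmapI)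
    fix j
    have "holo (\<lambda>w. \<Sum>i\<in>UNIV. F (snd c (chart_inv d w)) $ i *
       pd i (\<lambda>z. snd d (chart_inv c z) $ j) (snd c (chart_inv d w))) (snd d ` (U \<inter> fst d))"
    proof (intro holo_sum holo_mult)
      fix i
      show "holo (\<lambda>w. F (snd c (chart_inv d w)) $ i) (snd d ` (U \<inter> fst d))"
        by (rule holo_compose[OF h hmap_nth[OF F]]) (use d in auto)
      show "holo (\<lambda>w. pd i (\<lambda>z. snd d (chart_inv c z) $ j) (snd c (chart_inv d w))) (snd d ` (U \<inter> fst d))"
        by (rule holo_compose[OF h holo_pd[OF hmap_nth[OF hmap_trans[OF c d]] open_overlap[OF c d]]]) (use d U(2) in auto)
    qed
    then show "holo (\<lambda>w. loc d (mkf c U F) w $ j) (snd d ` (U \<inter> fst d))"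
    proof (rule holo_cong[OF open_image[OF U(1) d], rotated])
      fix w assume "w \<in> snd d ` (U \<inter> fst d)"
      then obtain p where p: "p \<in> U" "p \<in> fst d" "w = snd d p" by blast
      then have "p \<in> fst c" using U(2) by blast
      then show "loc d (mkf c U F) w $ j = (\<Sum>i\<in>UNIV. F (snd c (chart_inv d w)) $ i *
         pd i (\<lambda>z. snd d (chart_inv c z) $ j) (snd c (chart_inv d w)))"
        using p c d by (simp add: loc_def mkf_def tv_def jac_nth der_def)
    qed
  qed
qed (use U c in \<open>auto simp: mkf_def intro: tv_tangent\<close>)

lemma loc_chart [simp]: "c \<in> A \<Longrightarrow> p \<in> fst c \<Longrightarrow> loc c X (snd c p) = X p c"
  by (simp add: loc_def)

lemma bracket_loc:
  assumes U: "openin (mtop A) U" and X: "X \<in> vfields A U" and Y: "Y \<in> vfields A U"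
    and c: "c \<in> A" "p \<in> U" "p \<in> fst c"
  shows "bracket A U X Y p c = lb (loc c X) (loc c Y) (snd c p)"
proof -
  have p: "snd c p \<in> snd c ` (U \<inter> fst c)" using c by blast
  note h = vfields_hmap[OF X c(1)] vfields_hmap[OF Y c(1)]
  show ?thesis
    using c by (simp add: vec_eq_iff bracket_def lb_def der_def hmap_frechet[OF h(1) p, unfolded loc_def]
        hmap_frechet[OF h(2) p, unfolded loc_def] loc_def)
qed

lemma vfields_transition:
  assumes X: "X \<in> vfields A U" and c: "c \<in> A" "d \<in> A" "p \<in> U" "p \<in> fst c" "p \<in> fst d"
  shows "X p d $ j = der (X p c) (\<lambda>z. snd d (chart_inv c z) $ j) (snd c p)"
proof -
  have "X p d = jac c d p (X p c)"
    using vfields_tangent[OF X c(3)] c unfolding tangent_space_def by blast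
  then show ?thesis using c by (simp add: jac_nth)
qed

text \<open>Applied to a coordinate function of d, fields give their components in d; the commutator
  rule \<open>der_lb\<close> therefore turns the bracket computed in c into the bracket computed in
  d.\<close>

lemma bracket_vfields:
  assumes U: "openin (mtop A) U" and X: "X \<in> vfields A U" and Y: "Y \<in> vfields A U"
  shows "bracket A U X Y \<in> vfields A U"
proof (rule vfieldsI)
  fix c assume c: "c \<in> A"
  have "hmap (lb (loc c X) (loc c Y)) (snd c ` (U \<inter> fst c))"
    by (intro hmap_lb open_image U c vfields_hmap X Y)
  then show "hmap (loc c (bracket A U X Y)) (snd c ` (U \<inter> fst c))"
    by (rule hmap_cong[OF open_image[OF U c], rotated]) (use c in \<open>auto simp: loc_def bracket_loc[OF U X Y]\<close>)
next
  fix p assume p: "p \<in> U"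
  have "bracket A U X Y p d = jac c d p (bracket A U X Y p c)"
    if c: "c \<in> A" "d \<in> A" "p \<in> fst c" "p \<in> fst d" for c d
  proof -
    let ?S = "snd c ` (U \<inter> fst c \<inter> fst d)"
    let ?\<phi> = "\<lambda>z. snd d (chart_inv c z)"
    have oS: "open ?S"
      using open_image[OF openin_Int[OF U openin_chart[OF c(2)]] c(1)] by (simp add: Int_commute Int_left_commute)
    have pS: "snd c p \<in> ?S" using p c by blast
    have h\<phi>: "hmap ?\<phi> ?S" by (rule hmap_subset[OF hmap_trans[OF c(1,2)]]) blast
    have hX: "hmap (loc c Z) ?S" if "Z \<in> vfields A U" for Z
      by (rule hmap_subset[OF vfields_hmap[OF that c(1)]]) blast
    have sub: "?\<phi> z \<in> snd d ` (U \<inter> fst d)" if "z \<in> ?S" for z using that c by auto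
    \<comment> \<open>The j-th component of a field in d is its derivative of the j-th coordinate
      function of d.\<close>
    have tr: "der (loc c Z z) (\<lambda>z. ?\<phi> z $ j) z = loc d Z (?\<phi> z) $ j" if "Z \<in> vfields A U" "z \<in> ?S" for Z z j
      using that c vfields_transition[OF that(1) c(1,2), of "chart_inv c z" j] by (auto simp: loc_def)
    have dd: "der (loc c V (snd c p)) (\<lambda>s. der (loc c Z s) (\<lambda>z. ?\<phi> z $ j) s) (snd c p)
        = der (loc d V (snd d p)) (\<lambda>w. loc d Z w $ j) (snd d p)" if V: "V \<in> vfields A U" and Z: "Z \<in> vfields A U" for V Z j
    proof -
      have hz: "holo (\<lambda>w. loc d Z w $ j) (snd d ` (U \<inter> fst d))" by (rule hmap_nth[OF vfields_hmap[OF Z c(2)]])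
      have "der (loc c V (snd c p)) (\<lambda>s. der (loc c Z s) (\<lambda>z. ?\<phi> z $ j) s) (snd c p)
        = der (loc c V (snd c p)) (\<lambda>s. loc d Z (?\<phi> s) $ j) (snd c p)"
        unfolding der_def[of _ _ "snd c p"]
        by (intro sum.cong refl arg_cong2[where f="(*)"] pd_cong[OF oS pS] tr[OF Z] holo_compose[OF h\<phi> hz sub])
      also have "\<dots> = der (\<chi> i. der (loc c V (snd c p)) (\<lambda>z. ?\<phi> z $ i) (snd c p)) (\<lambda>w. loc d Z w $ j) (?\<phi> (snd c p))"
        by (rule der_compose[OF h\<phi> hz pS sub[OF pS]])
      also have "(\<chi> i. der (loc c V (snd c p)) (\<lambda>z. ?\<phi> z $ i) (snd c p)) = loc d V (?\<phi> (snd c p))"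
        by (simp add: vec_eq_iff tr[OF V pS])
      finally show ?thesis using c by simp
    qed
    have "jac c d p (lb (loc c X) (loc c Y) (snd c p)) $ j = lb (loc d X) (loc d Y) (snd d p) $ j" for j
      unfolding jac_nth[OF c] der_lb[OF oS pS hX[OF X] hX[OF Y] hmap_nth[OF h\<phi>]] dd[OF X Y] dd[OF Y X]
      by (simp add: lb_def)
    then show ?thesis using c p by (simp add: vec_eq_iff bracket_loc[OF U X Y])
  qed
  moreover have "bracket A U X Y p c = 0" if "\<not> (c \<in> A \<and> p \<in> fst c)" for c
    using that by (auto simp: bracket_def)
  ultimately show "bracket A U X Y p \<in> tangent_space A p" unfolding tangent_space_def by blast
qed (auto simp: bracket_def fun_eq_iff)

end

section \<open>Multiplications in charts\<close>

lemma sum_fun_apply: "(\<Sum>i\<in>I. f i) x = (\<Sum>i\<in>I. f i x)"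
  by (induction I rule: infinite_finite_induct) auto

locale mult_manifold = atlas A for A :: "('a, 'k::finite) chart set" +
  fixes m :: "('a, 'k) tmult" and e :: "('a, 'k) vfield"
  assumes unital: "unital_mult A m e"
begin

lemma e_vfield: "e \<in> vfields A (mspace A)"
  using unital unfolding unital_mult_def by blast

lemma
  assumes "openin (mtop A) U" "X \<in> vfields A U" "Y \<in> vfields A U"
  shows m_closed: "m U X Y \<in> vfields A U"
    and m_commute: "m U X Y = m U Y X"
    and m_unit: "m U (vrestrict U e) X = X"
    and m_assoc: "Z \<in> vfields A U \<Longrightarrow> m U (m U X Y) Z = m U X (m U Y Z)"
    and m_add: "Z \<in> vfields A U \<Longrightarrow> m U (X + Z) Y = m U X Y + m U Z Y"
    and m_scale: "mholo A U f \<Longrightarrow> m U (fscale f X) Y = fscale f (m U X Y)"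
    and m_restrict: "openin (mtop A) V \<Longrightarrow> V \<subseteq> U \<Longrightarrow> m V (vrestrict V X) (vrestrict V Y) = vrestrict V (m U X Y)"
proof -
  note q = unital[unfolded unital_mult_def, THEN conjunct2, THEN spec, THEN mp, OF assms(1),
      THEN bspec, OF assms(2), THEN bspec, OF assms(3)]
  note q1 = q[THEN conjunct2] note q2 = q1[THEN conjunct2] note q3 = q2[THEN conjunct2]
  note q4 = q3[THEN conjunct2] note q5 = q4[THEN conjunct2] note q6 = q5[THEN conjunct2]
  show "m U X Y \<in> vfields A U" by (rule q[THEN conjunct1])
  show "m U X Y = m U Y X" by (rule q1[THEN conjunct1])
  show "m U (vrestrict U e) X = X" by (rule q6)
  show "m U (m U X Y) Z = m U X (m U Y Z)" if "Z \<in> vfields A U" by (rule q2[THEN conjunct1, THEN bspec, OF that])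
  show "m U (X + Z) Y = m U X Y + m U Z Y" if "Z \<in> vfields A U" by (rule q3[THEN conjunct1, THEN bspec, OF that])
  show "m U (fscale f X) Y = fscale f (m U X Y)" if "mholo A U f"
    by (rule q4[THEN conjunct1, THEN spec, THEN mp, OF that])
  show "m V (vrestrict V X) (vrestrict V Y) = vrestrict V (m U X Y)" if "openin (mtop A) V" "V \<subseteq> U"
    by (rule q5[THEN conjunct1, THEN spec, THEN mp, OF conjI[OF that]])
qed

lemma m_sum:
  assumes U: "openin (mtop A) U" and X: "\<And>i. i \<in> I \<Longrightarrow> X i \<in> vfields A U" and Y: "Y \<in> vfields A U"
  shows "m U (\<Sum>i\<in>I. X i) Y = (\<Sum>i\<in>I. m U (X i) Y)"
proof -
  have sub: "U \<subseteq> mspace A" using openin_subset[OF U] topspace_mtop by simp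
  have z: "m U 0 Y = 0"
  proof -
    have "m U (0 + 0) Y = m U 0 Y + m U 0 Y"
      by (rule m_add[OF U vfields_zero[OF sub] Y vfields_zero[OF sub]])
    then have "m U 0 Y = m U 0 Y + m U 0 Y" by (simp only: add_0_left)
    then show ?thesis by (simp only: add_cancel_right_right)
  qed
  show ?thesis using X
  proof (induction I rule: infinite_finite_induct)
    case (insert i I)
    then have "m U (X i + sum X I) Y = m U (X i) Y + m U (sum X I) Y"
      by (intro m_add U Y vfields_sum sub) auto
    moreover have "m U (sum X I) Y = (\<Sum>i\<in>I. m U (X i) Y)" by (rule insert.IH) (simp add: insert.prems)
    ultimately show ?case by (simp only: sum.insert[OF insert.hyps])
  qed (simp_all add: z)
qed

definition basisf :: "('a, 'k) chart \<Rightarrow> 'a set \<Rightarrow> 'k \<Rightarrow> ('a, 'k) vfield" where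
  "basisf c U i = mkf c U (\<lambda>z. axis i 1)"

text \<open>Structure constants with respect to the coordinate fields of c, as functions of the
  coordinates.\<close>

definition St :: "('a, 'k) chart \<Rightarrow> complex^'k \<Rightarrow> 'k \<Rightarrow> 'k \<Rightarrow> 'k \<Rightarrow> complex" where
  "St c z i j k = loc c (m (fst c) (basisf c (fst c) i) (basisf c (fst c) j)) z $ k"

lemma open_sub: "openin (mtop A) U \<Longrightarrow> U \<subseteq> mspace A"
  using openin_subset topspace_mtop by blast

lemma basisf_vfields: "c \<in> A \<Longrightarrow> openin (mtop A) U \<Longrightarrow> U \<subseteq> fst c \<Longrightarrow> basisf c U i \<in> vfields A U"
  unfolding basisf_def by (rule mkf_vfields) (auto intro: hmap_const)

lemma chart_coeff_mholo:
  assumes c: "c \<in> A" and U: "openin (mtop A) U" "U \<subseteq> fst c" and X: "X \<in> vfields A U"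
  shows "mholo A U (\<lambda>p. X p c $ i)"
proof (rule mholo_chartI[OF c U])
  have "U \<inter> fst c = U" using U by blast
  then show "holo (\<lambda>z. X (chart_inv c z) c $ i) (snd c ` U)"
    using hmap_nth[OF vfields_hmap[OF X c], of i] by (simp add: loc_def)
qed

lemma vfield_expand:
  assumes c: "c \<in> A" and U: "openin (mtop A) U" "U \<subseteq> fst c" and X: "X \<in> vfields A U"
  shows "X = (\<Sum>i\<in>UNIV. fscale (\<lambda>p. X p c $ i) (basisf c U i))"
proof (rule vfields_eqI[OF open_sub[OF U(1)] X])
  show sv: "(\<Sum>i\<in>UNIV. fscale (\<lambda>p. X p c $ i) (basisf c U i)) \<in> vfields A U"
    by (intro vfields_sum vfields_fscale open_sub U chart_coeff_mholo[OF c U X] basisf_vfields c)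
  fix p d assume p: "p \<in> U" and d: "d \<in> A" "p \<in> fst d"
  have pc: "p \<in> fst c" using p U by blast
  have "(\<Sum>i\<in>UNIV. fscale (\<lambda>p. X p c $ i) (basisf c U i)) p c = (\<Sum>i\<in>UNIV. X p c $ i *s axis i 1)"
    using p pc c U by (simp add: sum_fun_apply fscale_def cscale_def basisf_def mkf_apply)
  also have "\<dots> = X p c" by (rule basis_expansion)
  finally have "(\<Sum>i\<in>UNIV. fscale (\<lambda>p. X p c $ i) (basisf c U i)) p = X p"
    by (rule tangent_eqI[OF c pc vfields_tangent[OF sv p] vfields_tangent[OF X p]])
  then show "X p d = (\<Sum>i\<in>UNIV. fscale (\<lambda>p. X p c $ i) (basisf c U i)) p d" by simp
qed

text \<open>Compatibility with restriction makes the product local, and bilinearity over functions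
  makes it pointwise: both factors are expanded in the coordinate frame near p, the second one after
  commuting.\<close>

lemma mult_loc:
  assumes U: "openin (mtop A) U" and X: "X \<in> vfields A U" and Y: "Y \<in> vfields A U"
    and c: "c \<in> A" "p \<in> U" "p \<in> fst c"
  shows "m U X Y p c = mul (St c) (snd c p) (X p c) (Y p c)"
proof -
  let ?V = "U \<inter> fst c"
  have V: "openin (mtop A) ?V" "?V \<subseteq> fst c" "?V \<subseteq> U" using U openin_chart[OF c(1)] by (auto intro: openin_Int)
  let ?b = "basisf c ?V"
  have bV: "?b i \<in> vfields A ?V" for i by (rule basisf_vfields[OF c(1) V(1,2)])
  let ?X = "vrestrict ?V X" and ?Y = "vrestrict ?V Y"
  have X': "?X \<in> vfields A ?V" and Y': "?Y \<in> vfields A ?V"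
    using vfields_restrict[OF X V(1,3)] vfields_restrict[OF Y V(1,3)] by auto
  have pV: "p \<in> ?V" using c by blast
  have bm: "m ?V (?b i) (?b j) p c = (\<chi> k. St c (snd c p) i j k)" for i j
  proof -
    have res: "vrestrict ?V (basisf c (fst c) l) = ?b l" for l
      by (auto simp: vrestrict_def basisf_def mkf_def fun_eq_iff)
    have "m ?V (?b i) (?b j) = vrestrict ?V (m (fst c) (basisf c (fst c) i) (basisf c (fst c) j))"
      using m_restrict[OF openin_chart[OF c(1)] basisf_vfields[OF c(1) openin_chart[OF c(1)] order_refl]
          basisf_vfields[OF c(1) openin_chart[OF c(1)] order_refl] V(1,2), of i j] by (simp only: res)
    then show ?thesis using pV c by (simp add: vrestrict_def St_def vec_eq_iff)
  qed
  have sm: "m ?V (\<Sum>i\<in>UNIV. fscale (f i) (?b i)) Z p c = (\<Sum>i\<in>UNIV. f i p *s m ?V (?b i) Z p c)"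
    if f: "\<And>i. mholo A ?V (f i)" and Z: "Z \<in> vfields A ?V" for f Z
  proof -
    have "m ?V (\<Sum>i\<in>UNIV. fscale (f i) (?b i)) Z = (\<Sum>i\<in>UNIV. m ?V (fscale (f i) (?b i)) Z)"
      by (intro m_sum V vfields_fscale open_sub f bV Z)
    also have "\<dots> = (\<Sum>i\<in>UNIV. fscale (f i) (m ?V (?b i) Z))"
      by (intro sum.cong refl m_scale V bV Z f)
    finally show ?thesis by (simp add: sum_fun_apply fscale_def cscale_def)
  qed
  have "m ?V ?X ?Y p c = (\<Sum>i\<in>UNIV. ?X p c $ i *s m ?V (?b i) ?Y p c)"
    by (subst (1) vfield_expand[OF c(1) V(1,2) X'])
       (rule sm[OF chart_coeff_mholo[OF c(1) V(1,2) X'] Y'])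
  also have "\<dots> = (\<Sum>i\<in>UNIV. ?X p c $ i *s (\<Sum>j\<in>UNIV. ?Y p c $ j *s m ?V (?b j) (?b i) p c))"
  proof (intro sum.cong refl arg_cong2[where f="(*s)"])
    fix i
    have "m ?V (?b i) ?Y p c = m ?V ?Y (?b i) p c" using m_commute[OF V(1) bV Y'] by simp
    also have "\<dots> = (\<Sum>j\<in>UNIV. ?Y p c $ j *s m ?V (?b j) (?b i) p c)"
      by (subst (1) vfield_expand[OF c(1) V(1,2) Y'])
         (rule sm[OF chart_coeff_mholo[OF c(1) V(1,2) Y'] bV])
    finally show "m ?V (?b i) ?Y p c = (\<Sum>j\<in>UNIV. ?Y p c $ j *s m ?V (?b j) (?b i) p c)" .
  qed
  also have "\<dots> = (\<Sum>i\<in>UNIV. \<Sum>j\<in>UNIV. (?X p c $ i * ?Y p c $ j) *s (\<chi> k. St c (snd c p) i j k))"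
    using m_commute[OF V(1) bV bV] by (simp add: bm[symmetric] vec.scale_sum_right)
  also have "\<dots> = mul (St c) (snd c p) (?X p c) (?Y p c)"
    by (simp add: vec_eq_iff mul_def mult_ac)
  finally have "m ?V ?X ?Y p c = mul (St c) (snd c p) (?X p c) (?Y p c)" .
  then show ?thesis
    unfolding m_restrict[OF U X Y V(1,3)] using pV by (simp add: vrestrict_def)
qed

text \<open>Fields with constant coefficients realise arbitrary vectors at a point; testing the laws
  of the sheaf multiplication on them yields the algebra laws of \<open>St c\<close>.\<close>

lemma constf: "c \<in> A \<Longrightarrow> mkf c (fst c) (\<lambda>z. x) \<in> vfields A (fst c)"
  by (intro mkf_vfields openin_chart) (auto intro: hmap_const)

lemma mult_const:
  assumes c: "c \<in> A" "p \<in> fst c"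
  shows "m (fst c) (mkf c (fst c) (\<lambda>z. x)) (mkf c (fst c) (\<lambda>z. y)) p c = mul (St c) (snd c p) x y"
  using mult_loc[OF openin_chart[OF c(1)] constf[OF c(1)] constf[OF c(1)] c(1,2,2)] c by (simp add: mkf_apply)

lemma holo_St: "c \<in> A \<Longrightarrow> holo (\<lambda>t. St c t i j k) (snd c ` fst c)"
proof -
  assume c: "c \<in> A"
  have "m (fst c) (basisf c (fst c) i) (basisf c (fst c) j) \<in> vfields A (fst c)"
    by (intro m_closed openin_chart basisf_vfields c order_refl)
  from hmap_nth[OF vfields_hmap[OF this c]] show ?thesis by (simp add: St_def)
qed

lemma hmap_En: "c \<in> A \<Longrightarrow> hmap (loc c e) (snd c ` fst c)"
  using vfields_hmap[OF e_vfield] chart_mspace by (metis Int_absorb1)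

lemma St_commute: "c \<in> A \<Longrightarrow> t \<in> snd c ` fst c \<Longrightarrow> mul (St c) t x y = mul (St c) t y x"
proof -
  assume c: "c \<in> A" and "t \<in> snd c ` fst c"
  then obtain p where p: "p \<in> fst c" "t = snd c p" by blast
  have "mul (St c) t x y = m (fst c) (mkf c (fst c) (\<lambda>z. x)) (mkf c (fst c) (\<lambda>z. y)) p c"
    unfolding p(2) by (rule mult_const[OF c p(1), symmetric])
  also have "\<dots> = mul (St c) t y x"
    unfolding m_commute[OF openin_chart[OF c] constf[OF c] constf[OF c], of x y] p(2)
    by (rule mult_const[OF c p(1)])
  finally show ?thesis .
qed

lemma St_assoc: "c \<in> A \<Longrightarrow> t \<in> snd c ` fst c \<Longrightarrow>
  mul (St c) t (mul (St c) t x y) z = mul (St c) t x (mul (St c) t y z)"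
proof -
  assume c: "c \<in> A" and "t \<in> snd c ` fst c"
  then obtain p where p: "p \<in> fst c" "t = snd c p" by blast
  let ?f = "\<lambda>x. mkf c (fst c) (\<lambda>z. x)"
  note cf = constf[OF c] and oc = openin_chart[OF c]
  have mc: "m (fst c) (?f x) (?f y) \<in> vfields A (fst c)" for x y by (rule m_closed[OF oc cf cf])
  have fa: "?f x p c = x" for x using c p by (simp add: mkf_apply)
  have "m (fst c) (m (fst c) (?f x) (?f y)) (?f z) p c = m (fst c) (?f x) (m (fst c) (?f y) (?f z)) p c"
    by (simp only: m_assoc[OF oc cf cf cf])
  then show ?thesis
    unfolding mult_loc[OF oc mc cf c p(1,1)] mult_loc[OF oc cf mc c p(1,1)] mult_const[OF c p(1)] fa p(2) .
qed

lemma St_unit: "c \<in> A \<Longrightarrow> t \<in> snd c ` fst c \<Longrightarrow> mul (St c) t (loc c e t) x = x"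
proof -
  assume c: "c \<in> A" and "t \<in> snd c ` fst c"
  then obtain p where p: "p \<in> fst c" "t = snd c p" by blast
  have er: "vrestrict (fst c) e \<in> vfields A (fst c)"
    by (rule vfields_restrict[OF e_vfield openin_chart[OF c] chart_mspace[OF c]])
  have "m (fst c) (vrestrict (fst c) e) (mkf c (fst c) (\<lambda>z. x)) p c = x"
    unfolding m_unit[OF openin_chart[OF c] constf[OF c] constf[OF c]] using c p by (simp add: mkf_apply)
  then show ?thesis
    unfolding mult_loc[OF openin_chart[OF c] er constf[OF c] c p(1,1)]
    using c p by (simp add: vrestrict_def mkf_apply)
qed

text \<open>The description by \<open>THE\<close> is justified by constant extensions for existence
  and by \<open>mult_loc\<close> for uniqueness, as the product at p depends only on the values at
  p.\<close>

lemma fibre_mult_loc: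
  assumes c: "c \<in> A" "p \<in> fst c" and v: "v \<in> tangent_space A p" "w \<in> tangent_space A p"
  shows "fibre_mult A m p v w = tv c p (mul (St c) (snd c p) (v c) (w c))"
  unfolding fibre_mult_def
proof (rule the_equality)
  let ?f = "\<lambda>x. mkf c (fst c) (\<lambda>z. x)"
  note cf = constf[OF c(1)] and oc = openin_chart[OF c(1)]
  have f: "?f (u c) p = u" if "u \<in> tangent_space A p" for u using tangent_tv[OF c that] c by (simp add: mkf_def)
  have "m (fst c) (?f (v c)) (?f (w c)) p = tv c p (mul (St c) (snd c p) (v c) (w c))"
    by (rule tangent_eqI[OF c vfields_tangent[OF m_closed[OF oc cf cf] c(2)] tv_tangent[OF c]])
       (simp add: mult_const c)
  then show "\<exists>U X Y. openin (mtop A) U \<and> p \<in> U \<and> X \<in> vfields A U \<and> Y \<in> vfields A U \<and> X p = v \<and> Y p = w \<and>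
      m U X Y p = tv c p (mul (St c) (snd c p) (v c) (w c))"
    using oc c(2) cf f[OF v(1)] f[OF v(2)] by blast
next
  fix u assume "\<exists>U X Y. openin (mtop A) U \<and> p \<in> U \<and> X \<in> vfields A U \<and> Y \<in> vfields A U \<and> X p = v \<and> Y p = w \<and> m U X Y p = u"
  then obtain U X Y where U: "openin (mtop A) U" "p \<in> U" "X \<in> vfields A U" "Y \<in> vfields A U"
    "X p = v" "Y p = w" "m U X Y p = u" by blast
  have "u c = mul (St c) (snd c p) (v c) (w c)"
    using mult_loc[OF U(1,3,4) c(1) U(2) c(2)] U by simp
  moreover have "u \<in> tangent_space A p" using vfields_tangent[OF m_closed[OF U(1,3,4)] U(2)] U(7) by simp
  ultimately show "u = tv c p (mul (St c) (snd c p) (v c) (w c))"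
    using tangent_tv[OF c] by metis
qed

text \<open>The components of an isomorphism with \<complex>^n are n distinct characters; conversely
  the matrix of n distinct characters is such an isomorphism.\<close>

lemma semisimple_iff:
  assumes c: "c \<in> A" "p \<in> fst c"
  shows "semisimple_at A m p \<longleftrightarrow> sem (St c) (loc c e) (snd c p)"
proof
  let ?t = "snd c p"
  have t: "?t \<in> snd c ` fst c" using c by blast
  assume "semisimple_at A m p"
  then obtain f :: "('a, 'k) tvec \<Rightarrow> complex^'k" where bij: "bij_betw f (tangent_space A p) UNIV"
    and fa: "\<And>v w. v \<in> tangent_space A p \<Longrightarrow> w \<in> tangent_space A p \<Longrightarrow> f (v + w) = f v + f w"
    and fs: "\<And>a v. v \<in> tangent_space A p \<Longrightarrow> f (cscale a v) = a *s f v"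
    and fm: "\<And>v w. v \<in> tangent_space A p \<Longrightarrow> w \<in> tangent_space A p \<Longrightarrow> f (fibre_mult A m p v w) = f v * f w"
    unfolding semisimple_at_def by blast
  define g where "g = (\<lambda>x. f (tv c p x))"
  have tt: "tv c p x \<in> tangent_space A p" for x by (rule tv_tangent[OF c])
  have ga: "g (x + y) = g x + g y" for x y by (simp add: g_def tv_add[OF c] fa tt)
  have gs: "g (s *s x) = s *s g x" for s x by (simp add: g_def tv_smult[OF c] fs tt)
  have gm: "g (mul (St c) ?t x y) = g x * g y" for x y
    using fm[OF tt tt, of x y] fibre_mult_loc[OF c tt tt, of x y] c by (simp add: g_def)
  have gsurj: "\<exists>x. g x = y" for y
  proof -
    obtain v where v: "v \<in> tangent_space A p" "f v = y" using bij by (metis UNIV_I bij_betw_iff_bijections)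
    then have "g (v c) = y" using tangent_tv[OF c v(1)] by (simp add: g_def)
    then show ?thesis by blast
  qed
  define \<Lambda> where "\<Lambda> = (\<lambda>i. \<chi> j. g (axis j 1) $ i)"
  have g0: "g 0 = 0" using gs[of 0 0] by simp
  have gsum: "g (\<Sum>j\<in>I. h j) = (\<Sum>j\<in>I. g (h j))" for I and h :: "'k \<Rightarrow> complex^'k"
    by (induction I rule: infinite_finite_induct) (simp_all add: g0 ga)
  have dot: "dot (\<Lambda> i) x = g x $ i" for i x
  proof -
    have "g x = g (\<Sum>j\<in>UNIV. x $ j *s axis j 1)" by (simp only: basis_expansion)
    also have "\<dots> = (\<Sum>j\<in>UNIV. x $ j *s g (axis j 1))" unfolding gsum gs ..
    finally have "g x $ i = (\<Sum>j\<in>UNIV. x $ j * g (axis j 1) $ i)" by simp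
    then show ?thesis by (simp add: \<Lambda>_def dot_def mult.commute)
  qed
  \<comment> \<open>Surjectivity sends the unit to 1 in every component: its image acts as the
    identity on a preimage of each axis vector.\<close>
  have g1: "g (loc c e ?t) $ i = 1" for i
  proof -
    obtain x where x: "g x = axis i 1" using gsurj by blast
    have "g (loc c e ?t) * g x = g x" using gm[of "loc c e ?t" x] St_unit[OF c(1) t] by simp
    then have "g (loc c e ?t) $ i * g x $ i = g x $ i" by (metis vector_mult_component)
    then show ?thesis by (simp add: x)
  qed
  have "\<Lambda> i \<in> chars (St c) (loc c e) ?t" for i
    unfolding chars_def by (simp add: dot g1 gm)
  moreover have "inj \<Lambda>"
  proof (rule injI, rule ccontr)
    fix i j assume ij: "\<Lambda> i = \<Lambda> j" "i \<noteq> j"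
    obtain x where x: "g x = axis i 1" using gsurj by blast
    have "g x $ i = g x $ j" using ij(1) by (metis dot)
    then show False using ij(2) by (simp add: x axis_def)
  qed
  ultimately show "sem (St c) (loc c e) ?t" unfolding sem_def by blast
next
  let ?t = "snd c p"
  assume s: "sem (St c) (loc c e) ?t"
  obtain \<Lambda> :: "'k \<Rightarrow> complex^'k" and V where L: "inj \<Lambda>" "range \<Lambda> = chars (St c) (loc c e) ?t"
      "(\<chi> i. \<Lambda> i) ** V = mat 1" "V ** (\<chi> i. \<Lambda> i) = mat 1"
    by (rule semE[OF s])
  have Lc: "\<Lambda> i \<in> chars (St c) (loc c e) ?t" for i using L(2) by blast
  define f where "f = (\<lambda>v. (\<chi> i. \<Lambda> i) *v (v c))"
  have fn: "f v $ i = dot (\<Lambda> i) (v c)" for v i by (simp add: f_def matrix_vector_mult_def dot_def)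
  have "bij_betw f (tangent_space A p) UNIV"
  proof (rule bij_betwI[where g="\<lambda>y. tv c p (V *v y)"])
    show "(\<lambda>y. tv c p (V *v y)) \<in> UNIV \<rightarrow> tangent_space A p" using tv_tangent[OF c] by blast
    show "tv c p (V *v f v) = v" if "v \<in> tangent_space A p" for v
      using tangent_tv[OF c that] by (simp add: f_def matrix_vector_mul_assoc L)
    show "f (tv c p (V *v y)) = y" for y
      using c by (simp add: f_def matrix_vector_mul_assoc L)
  qed simp
  moreover have "f (v + w) = f v + f w" for v w by (simp add: vec_eq_iff fn dot_add)
  moreover have "f (cscale a v) = a *s f v" for a v by (simp add: vec_eq_iff fn dot_smult cscale_def)
  moreover have "f (fibre_mult A m p v w) = f v * f w"
    if "v \<in> tangent_space A p" "w \<in> tangent_space A p" for v w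
    using c by (simp add: vec_eq_iff fn fibre_mult_loc[OF c that] chars_mul[OF Lc])
  ultimately show "semisimple_at A m p" unfolding semisimple_at_def by blast
qed

end

locale massive_manifold = mult_manifold A m e for A :: "('a, 'k::finite) chart set" and m e +
  assumes massive: "massive A m"
begin

text \<open>The algebra laws are those of \<open>St c\<close>; the closure in the manifold topology
  becomes density in coordinates by pulling back open sets.\<close>

lemma alg_family: "c \<in> A \<Longrightarrow> alg_family (snd c ` fst c) (St c) (loc c e)"
proof (unfold_locales, goal_cases)
  case 1 then show ?case by (rule open_chart_image)
next
  case (2 i j k) then show ?case by (rule holo_St)
next
  case 3 then show ?case by (rule hmap_En)
next
  case (4 t x y) then show ?case by (rule St_commute)
next
  case (5 t x y z) then show ?case by (rule St_assoc)
next
  case (6 t x) then show ?case by (rule St_unit)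
next
  case 7
  then have c: "c \<in> A" .
  show ?case
  proof
    fix t assume "t \<in> snd c ` fst c"
    then obtain p where p: "p \<in> fst c" "t = snd c p" by blast
    show "t \<in> closure {t \<in> snd c ` fst c. sem (St c) (loc c e) t}"
      unfolding closure_iff_nhds_not_empty
    proof (intro allI impI)
      fix N V assume N: "V \<subseteq> N" "open V" "t \<in> V"
      have "p \<in> mtop A closure_of (mspace A - caustic A m)"
        using subsetD[OF chart_mspace[OF c] p(1)] massive unfolding massive_def by simp
      then have "\<forall>T. p \<in> T \<and> openin (mtop A) T \<longrightarrow> (\<exists>y. y \<in> mspace A - caustic A m \<and> y \<in> T)"
        unfolding in_closure_of by (rule conjunct2)
      moreover have "p \<in> {q \<in> fst c. snd c q \<in> V} \<and> openin (mtop A) {q \<in> fst c. snd c q \<in> V}"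
        using openin_preimage[OF c N(2)] p N(3) by simp
      ultimately obtain q where q: "q \<in> mspace A - caustic A m" "q \<in> {q \<in> fst c. snd c q \<in> V}"
        by meson
      then have q: "q \<in> mspace A - caustic A m" "q \<in> fst c" "snd c q \<in> V" by simp_all
      then have "sem (St c) (loc c e) (snd c q)"
        using semisimple_iff[OF c q(2)] by (simp add: caustic_def)
      then show "{t \<in> snd c ` fst c. sem (St c) (loc c e) t} \<inter> N \<noteq> {}" using q N(1) by blast
    qed
  qed
qed

end

section \<open>The cotangent bundle and the spectrum in charts\<close>

context alg_family
begin

text \<open>Otherwise the idempotent of \<xi> would be killed by all characters over nearby
  semisimple points and so vanish at t0 by density, although \<xi> takes the value 1 on it.\<close>

lemma chars_limit:
  assumes t0: "t0 \<in> Om" and \<xi>: "\<xi> \<in> Ch t0" and W: "open W" "(t0, \<xi>) \<in> W"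
  obtains t y where "t \<in> Om" "sem a E t" "y \<in> Ch t" "(t, y) \<in> W"
proof -
  obtain U \<epsilon> where U: "open U" "t0 \<in> U" "U \<subseteq> Om" "hmap \<epsilon> U" "dot \<xi> (\<epsilon> t0) = 1"
    "\<forall>t\<in>U. mul a t (\<epsilon> t) (\<epsilon> t) = \<epsilon> t"
    "\<forall>t\<in>U. \<forall>\<psi>\<in>Ch t. dot \<psi> (\<epsilon> t) = 0 \<or> dot \<psi> (\<epsilon> t) = 1 \<and> (t, \<psi>) \<in> W"
    by (rule spectral_idempotent[OF t0 \<xi> W])
  have "\<exists>t\<in>U. sem a E t \<and> (\<exists>\<psi>\<in>Ch t. dot \<psi> (\<epsilon> t) \<noteq> 0)"
  proof (rule ccontr)
    assume n: "\<not> (\<exists>t\<in>U. sem a E t \<and> (\<exists>\<psi>\<in>Ch t. dot \<psi> (\<epsilon> t) \<noteq> 0))"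
    have "\<epsilon> t0 = 0"
      by (rule dense_separate[OF U(1,3,4) hmap_const U(2)]) (use n in \<open>auto simp: dot_zero\<close>)
    then show False using U(5) by (simp add: dot_zero)
  qed
  then obtain t \<psi> where t: "t \<in> U" "sem a E t" "\<psi> \<in> Ch t" "dot \<psi> (\<epsilon> t) \<noteq> 0" by blast
  then have "(t, \<psi>) \<in> W" using bspec[OF bspec[OF U(7) t(1)] t(3)] by simp
  then show ?thesis using that[of t \<psi>] t U(3) by blast
qed

end

lemma continuous_on_join: "continuous_on S (\<lambda>p :: (complex^'n::finite) \<times> (complex^'n). join (fst p) (snd p))"
proof -
  have "continuous_on S (\<lambda>p :: (complex^'n) \<times> (complex^'n). case s of Inl i \<Rightarrow> fst p $ i | Inr i \<Rightarrow> snd p $ i)" for s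
    by (cases s) (auto intro!: continuous_intros)
  then show ?thesis unfolding join_def by (rule continuous_on_vec_lambda)
qed

lemma open_join: "open N \<Longrightarrow> open {p :: (complex^'n::finite) \<times> (complex^'n). join (fst p) (snd p) \<in> N}"
  using continuous_open_preimage[OF continuous_on_join open_UNIV, of N] by (simp add: vimage_def)

lemma open_tc: "open N \<Longrightarrow> open {z. tc z \<in> N}"
  using continuous_open_preimage[OF hmap_continuous_on[OF hmap_tc] open_UNIV, of N] by (simp add: vimage_def)

section \<open>Coordinates on the cotangent bundle\<close>

context atlas
begin

definition cf :: "('a, 'k) chart \<Rightarrow> ('a, 'k) cotpoint \<Rightarrow> complex^'k" where
  "cf c q = (\<chi> i. snd q (tv c (fst q) (axis i 1)))"

definition ct :: "('a, 'k) chart \<Rightarrow> 'a \<Rightarrow> complex^'k \<Rightarrow> ('a, 'k) tvec \<Rightarrow> complex" where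
  "ct c p y = (\<lambda>v. if v \<in> tangent_space A p then dot y (v c) else 0)"

lemma fst_cot_chart: "q \<in> fst (cot_chart A c) \<longleftrightarrow> fst q \<in> fst c \<and> snd q \<in> cotangent_space A (fst q)"
  by (simp add: cot_chart_def)

lemma snd_cot_chart: "snd (cot_chart A c) q = join (snd c (fst q)) (cf c q)"
  by (simp add: cot_chart_def join_def cf_def coord_vector_tv vec_eq_iff split: sum.split)

lemma ct_cotangent: "p \<in> mspace A \<Longrightarrow> ct c p y \<in> cotangent_space A p"
  by (auto simp: cotangent_space_def ct_def dot_add dot_smult cscale_def tangent_add
      tangent_cscale[unfolded cscale_def])

lemma cf_ct [simp]: "c \<in> A \<Longrightarrow> p \<in> fst c \<Longrightarrow> cf c (p, ct c p y) = y"
  by (simp add: cf_def ct_def tv_tangent dot_axis vec_eq_iff)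

lemma cotangent_dot:
  assumes c: "c \<in> A" "p \<in> fst c" and l: "l \<in> cotangent_space A p" and v: "v \<in> tangent_space A p"
  shows "l v = dot (cf c (p, l)) (v c)"
proof -
  have p: "p \<in> mspace A" using c chart_mspace by blast
  have la: "l (u + w) = l u + l w" if "u \<in> tangent_space A p" "w \<in> tangent_space A p" for u w
    using l that unfolding cotangent_space_def by blast
  have ls: "l (cscale s u) = s * l u" if "u \<in> tangent_space A p" for s u
    using l that unfolding cotangent_space_def by blast
  have l0: "l 0 = 0" using ls[OF tangent_zero[OF p], of 0] by (simp add: cscale_zero)
  have "l (tv c p (\<Sum>i\<in>I. x i *s axis i 1)) = (\<Sum>i\<in>I. x i * l (tv c p (axis i 1)))" for I and x :: "'k \<Rightarrow> complex"
  proof (induction I rule: infinite_finite_induct)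
    case (insert i I)
    have "l (tv c p (x i *s axis i 1 + (\<Sum>i\<in>I. x i *s axis i 1))) =
        l (cscale (x i) (tv c p (axis i 1))) + l (tv c p (\<Sum>i\<in>I. x i *s axis i 1))"
      unfolding tv_add[OF c] tv_smult[OF c] by (intro la tangent_cscale p tv_tangent c)
    then show ?case using insert by (simp add: ls tv_tangent c)
  qed (simp_all add: tv_zero[OF c] l0 l0[unfolded zero_fun_def])
  from this[of "\<lambda>i. v c $ i" UNIV] have "l (tv c p (v c)) = (\<Sum>i\<in>UNIV. v c $ i * l (tv c p (axis i 1)))"
    unfolding basis_expansion .
  then show ?thesis by (simp add: tangent_tv[OF c v] dot_def cf_def mult.commute)
qed

lemma cotangent_ct: "c \<in> A \<Longrightarrow> p \<in> fst c \<Longrightarrow> l \<in> cotangent_space A p \<Longrightarrow> ct c p (cf c (p, l)) = l"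
proof
  fix v assume a: "c \<in> A" "p \<in> fst c" "l \<in> cotangent_space A p"
  show "ct c p (cf c (p, l)) v = l v"
  proof (cases "v \<in> tangent_space A p")
    case True
    then show ?thesis using cotangent_dot[OF a] by (simp add: ct_def)
  next
    case False
    then show ?thesis using a(3) by (simp add: ct_def cotangent_space_def)
  qed
qed

text \<open>The inverse of the bundle chart over c in closed form; \<open>cot_chart_inv\<close>
  identifies it with \<open>chart_inv\<close>.\<close>

definition pt :: "('a, 'k) chart \<Rightarrow> complex^('k + 'k) \<Rightarrow> ('a, 'k) cotpoint" where
  "pt c z = (chart_inv c (tc z), ct c (chart_inv c (tc z)) (yc z))"

lemma pt_in:
  assumes "c \<in> A" "tc z \<in> snd c ` fst c"
  shows "pt c z \<in> fst (cot_chart A c)" "snd (cot_chart A c) (pt c z) = z"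
proof -
  have p: "chart_inv c (tc z) \<in> fst c" by (rule chart_inv3[OF assms(2)])
  then have pm: "chart_inv c (tc z) \<in> mspace A" using chart_mspace[OF assms(1)] by blast
  show "pt c z \<in> fst (cot_chart A c)" using p ct_cotangent[OF pm] by (simp add: fst_cot_chart pt_def)
  show "snd (cot_chart A c) (pt c z) = z" using p assms by (simp add: snd_cot_chart pt_def)
qed

lemma pt_cot_chart:
  assumes "c \<in> A" "q \<in> fst (cot_chart A c)"
  shows "pt c (snd (cot_chart A c) q) = q"
  using assms cotangent_ct[OF assms(1), of "fst q" "snd q"] by (simp add: fst_cot_chart snd_cot_chart pt_def)

lemma cot_chart_inj: "c \<in> A \<Longrightarrow> inj_on (snd (cot_chart A c)) (fst (cot_chart A c))"
  by (rule inj_on_inverseI[of _ "pt c"]) (rule pt_cot_chart)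

lemma cot_chart_image:
  assumes "c \<in> A"
  shows "snd (cot_chart A c) ` {q \<in> fst (cot_chart A c). fst q \<in> U} = {z. tc z \<in> snd c ` (U \<inter> fst c)}" (is "?l = ?r")
proof
  show "?l \<subseteq> ?r" by (auto simp: fst_cot_chart snd_cot_chart)
  show "?r \<subseteq> ?l"
  proof
    fix z assume "z \<in> ?r"
    then obtain p where p: "p \<in> U" "p \<in> fst c" "tc z = snd c p" by blast
    then have "tc z \<in> snd c ` fst c" by blast
    note q = pt_in[OF assms this]
    have "fst (pt c z) = p" using p assms by (simp add: pt_def)
    then show "z \<in> ?l" using q p(1) by (intro image_eqI[of _ _ "pt c z"]) auto
  qed
qed

lemma cot_chart_image_full: "c \<in> A \<Longrightarrow> snd (cot_chart A c) ` fst (cot_chart A c) = {z. tc z \<in> snd c ` fst c}"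
proof -
  assume c: "c \<in> A"
  have "{q \<in> fst (cot_chart A c). fst q \<in> fst c} = fst (cot_chart A c)" by (auto simp: fst_cot_chart)
  then show ?thesis using cot_chart_image[OF c, of "fst c"] by (simp only: Int_absorb)
qed

lemma cot_chart_inv: "c \<in> A \<Longrightarrow> tc z \<in> snd c ` fst c \<Longrightarrow> chart_inv (cot_chart A c) z = pt c z"
  using pt_in[of c z] cot_chart_inj[of c] unfolding chart_inv_def by (metis inv_into_f_f)

text \<open>Fibre coordinates are values on coordinate vectors, so they transform with the Jacobi
  matrix of the inverse coordinate change.\<close>

lemma cot_trans:
  assumes cd: "c \<in> A" "d \<in> A" and z: "tc z \<in> snd c ` (fst c \<inter> fst d)"
  shows "snd (cot_chart A d) (pt c z) = join (snd d (chart_inv c (tc z)))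
    (\<chi> j. \<Sum>i\<in>UNIV. yc z $ i * pd j (\<lambda>w. snd c (chart_inv d w) $ i) (snd d (chart_inv c (tc z))))"
proof -
  obtain p where p: "p \<in> fst c" "p \<in> fst d" "tc z = snd c p" using z by blast
  have "dot (yc z) (tv d p (axis j 1) c) = (\<Sum>i\<in>UNIV. yc z $ i * pd j (\<lambda>w. snd c (chart_inv d w) $ i) (snd d p))" for j
  proof -
    have "der (axis j 1) f x = pd j f x" for f :: "complex^'k \<Rightarrow> complex" and x
      unfolding der_def by (simp add: axis_def mult_delta_left)
    then show ?thesis using p cd by (simp add: tv_def dot_def jac_nth)
  qed
  then show ?thesis using p cd by (simp add: snd_cot_chart pt_def cf_def ct_def tv_tangent)
qed

lemma cot_atlas: "atlas (cot_atlas A)"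
proof
  have inter: "{q \<in> fst (cot_chart A c). fst q \<in> fst d} = fst (cot_chart A c) \<inter> fst (cot_chart A d)" for c d
    by (auto simp: fst_cot_chart)
  show "complex_atlas (cot_atlas A)"
    unfolding complex_atlas_def cot_atlas_def ball_simps
  proof (intro conjI ballI allI)
    show "inj_on (snd (cot_chart A c)) (fst (cot_chart A c))" if "c \<in> A" for c by (rule cot_chart_inj[OF that])
    fix c d assume cd: "c \<in> A" "d \<in> A"
    let ?S = "snd (cot_chart A c) ` (fst (cot_chart A c) \<inter> fst (cot_chart A d))"
    have im: "?S = {z. tc z \<in> snd c ` (fst d \<inter> fst c)}"
      using cot_chart_image[OF cd(1), of "fst d"] unfolding inter .
    show oS: "open ?S" unfolding im using open_tc[OF open_overlap[OF cd]] by (simp add: Int_commute)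
    have sub: "tc z \<in> snd c ` (fst c \<inter> fst d)" if "z \<in> ?S" for z using that unfolding im by blast
    have h1: "hmap (\<lambda>z. snd d (chart_inv c (tc z))) ?S"
      by (rule hmap_compose[OF hmap_tc hmap_trans[OF cd] sub])
    have sub2: "snd d (chart_inv c (tc z)) \<in> snd d ` (fst d \<inter> fst c)" if "z \<in> ?S" for z
      using sub[OF that] cd by auto
    have "hmap (\<lambda>z. join (snd d (chart_inv c (tc z)))
      (\<chi> j. \<Sum>i\<in>UNIV. yc z $ i * pd j (\<lambda>w. snd c (chart_inv d w) $ i) (snd d (chart_inv c (tc z))))) ?S"
      by (rule hmap_join[OF h1], rule hmapI, unfold vec_lambda_beta, intro holo_sum holo_mult hmap_nth[OF hmap_yc]
          holo_compose[OF h1 holo_pd[OF hmap_nth[OF hmap_trans[OF cd(2,1)]] open_overlap[OF cd(2,1)]] sub2])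
    then have "hmap (\<lambda>z. snd (cot_chart A d) (chart_inv (cot_chart A c) z)) ?S"
    proof (rule hmap_cong[OF oS, rotated])
      fix z assume z: "z \<in> ?S"
      then have "tc z \<in> snd c ` fst c" using sub by blast
      then show "snd (cot_chart A d) (chart_inv (cot_chart A c) z) = join (snd d (chart_inv c (tc z)))
        (\<chi> j. \<Sum>i\<in>UNIV. yc z $ i * pd j (\<lambda>w. snd c (chart_inv d w) $ i) (snd d (chart_inv c (tc z))))"
        using cot_chart_inv[OF cd(1)] cot_trans[OF cd sub[OF z]] by simp
    qed
    then show "holo (\<lambda>z. snd (cot_chart A d) (chart_inv (cot_chart A c) z) $ i) ?S" for i by (rule hmap_nth)
  qed
qed

lemma mspace_cot: "q \<in> mspace (cot_atlas A) \<longleftrightarrow> fst q \<in> mspace A \<and> snd q \<in> cotangent_space A (fst q)"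
  by (auto simp: mspace_def cot_atlas_def fst_cot_chart)

lemma cot_chart_in: "c \<in> A \<Longrightarrow> cot_chart A c \<in> cot_atlas A"
  by (simp add: cot_atlas_def)

end

section \<open>The spectrum as an analytic subset\<close>

context mult_manifold
begin

sublocale cot: atlas "cot_atlas A" by (rule cot_atlas)

abbreviation "L \<equiv> spectrum A m e"
abbreviation "ch c \<equiv> chars (St c) (loc c e)"

lemma spectrum_iff:
  assumes c: "c \<in> A" and q: "q \<in> fst (cot_chart A c)"
  shows "q \<in> L \<longleftrightarrow> cf c q \<in> ch c (snd c (fst q))"
proof -
  obtain p l where pl: "q = (p, l)" by (cases q)
  have p: "p \<in> fst c" "p \<in> mspace A" and l: "l \<in> cotangent_space A p"
    using q chart_mspace[OF c] by (auto simp: pl fst_cot_chart)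
  let ?y = "cf c (p, l)"
  note d = cotangent_dot[OF c p(1) l]
  have "e p \<in> tangent_space A p" by (rule vfields_tangent[OF e_vfield p(2)])
  then have 1: "l (e p) = dot ?y (loc c e (snd c p))" using d c p by simp
  have 2: "(\<forall>v\<in>tangent_space A p. \<forall>w\<in>tangent_space A p. l (fibre_mult A m p v w) = l v * l w) \<longleftrightarrow>
      (\<forall>v w. dot ?y (mul (St c) (snd c p) v w) = dot ?y v * dot ?y w)"
  proof
    assume a: "\<forall>v\<in>tangent_space A p. \<forall>w\<in>tangent_space A p. l (fibre_mult A m p v w) = l v * l w"
    show "\<forall>v w. dot ?y (mul (St c) (snd c p) v w) = dot ?y v * dot ?y w"
    proof (intro allI)
      fix v w
      note tt = tv_tangent[OF c p(1)]
      show "dot ?y (mul (St c) (snd c p) v w) = dot ?y v * dot ?y w"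
        using a[rule_format, OF tt tt, of v w] c p(1)
        by (simp only: fibre_mult_loc[OF c p(1) tt tt] d[OF tt] tv_self)
    qed
  next
    assume a: "\<forall>v w. dot ?y (mul (St c) (snd c p) v w) = dot ?y v * dot ?y w"
    show "\<forall>v\<in>tangent_space A p. \<forall>w\<in>tangent_space A p. l (fibre_mult A m p v w) = l v * l w"
      using a c p(1) by (simp add: fibre_mult_loc[OF c p(1)] d tv_tangent)
  qed
  show ?thesis using p l unfolding spectrum_def pl chars_def by (simp add: 1 2)
qed

lemma spectrum_mspace: "q \<in> L \<Longrightarrow> q \<in> mspace (cot_atlas A)"
  by (auto simp: spectrum_def mspace_cot)

lemma spectrum_chart: "q \<in> L \<Longrightarrow> fst q \<in> fst c \<Longrightarrow> q \<in> fst (cot_chart A c)"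
  by (auto simp: spectrum_def fst_cot_chart)

lemma pt_spectrum:
  assumes "c \<in> A" "tc z \<in> snd c ` fst c"
  shows "pt c z \<in> L \<longleftrightarrow> yc z \<in> ch c (tc z)"
proof -
  have "chart_inv c (tc z) \<in> fst c" by (rule chart_inv3[OF assms(2)])
  then show ?thesis
    using spectrum_iff[OF assms(1) pt_in(1)[OF assms]] assms by (simp add: pt_def)
qed

lemma spectrum_fibre:
  assumes c: "c \<in> A" "p \<in> fst c"
  shows "{q \<in> L. fst q = p} = (\<lambda>y. (p, ct c p y)) ` ch c (snd c p)"
    and "inj (\<lambda>y. (p, ct c p y))"
proof -
  have p: "p \<in> mspace A" using c chart_mspace by blast
  have i: "cf c (p, ct c p y) = y" for y using c by simp
  show "inj (\<lambda>y. (p, ct c p y))" by (rule inj_on_inverseI[of _ "cf c"]) (rule i)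
  have in_c: "(p, l) \<in> fst (cot_chart A c)" if "l \<in> cotangent_space A p" for l
    using that c by (simp add: fst_cot_chart)
  show "{q \<in> L. fst q = p} = (\<lambda>y. (p, ct c p y)) ` ch c (snd c p)"
  proof (rule Set.set_eqI, rule iffI)
    fix q assume "q \<in> {q \<in> L. fst q = p}"
    then obtain l where l: "q = (p, l)" "(p, l) \<in> L" by (cases q) auto
    then have lc: "l \<in> cotangent_space A p" by (simp add: spectrum_def)
    then have "cf c (p, l) \<in> ch c (snd c p)" using spectrum_iff[OF c(1) in_c] l(2) by simp
    then show "q \<in> (\<lambda>y. (p, ct c p y)) ` ch c (snd c p)"
      using cotangent_ct[OF c lc] l(1) by (intro image_eqI[of _ _ "cf c (p, l)"]) auto
  next
    fix q assume "q \<in> (\<lambda>y. (p, ct c p y)) ` ch c (snd c p)"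
    then obtain y where y: "q = (p, ct c p y)" "y \<in> ch c (snd c p)" by blast
    then show "q \<in> {q \<in> L. fst q = p}"
      using spectrum_iff[OF c(1) in_c[OF ct_cotangent[OF p]]] i by simp
  qed
qed

text \<open>The unit equation and the finitely many relations between coordinate fields cut out L
  over a whole chart, so a bundle chart serves as the neighbourhood.\<close>

lemma spectrum_analytic: "analytic_subset (cot_atlas A) L"
  unfolding analytic_subset_def
proof (intro conjI ballI)
  show "L \<subseteq> mspace (cot_atlas A)" using spectrum_mspace by blast
  fix q assume "q \<in> mspace (cot_atlas A)"
  then obtain c where c: "c \<in> A" "fst q \<in> fst c" and qc: "snd q \<in> cotangent_space A (fst q)"
    using mspace_cot mspaceE by blast
  let ?K = "cot_chart A c"
  define g where "g = (\<lambda>r. dot (cf c r) (loc c e (snd c (fst r))) - 1)"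
  define h where "h = (\<lambda>i j r. cf c r $ i * cf c r $ j - (\<Sum>k\<in>UNIV. St c (snd c (fst r)) i j k * cf c r $ k))"
  let ?F = "insert g (\<Union>i. \<Union>j. {h i j})"
  have K: "?K \<in> cot_atlas A" by (rule cot_chart_in[OF c(1)])
  have im: "snd ?K ` fst ?K = {z. tc z \<in> snd c ` fst c}" by (rule cot_chart_image_full[OF c(1)])
  have oK: "open (snd ?K ` fst ?K)" by (rule cot.open_chart_image[OF K])
  have hol: "mholo (cot_atlas A) (fst ?K) f"
    if f: "\<And>r. f r = F (snd c (fst r)) (cf c r)" and F: "holo (\<lambda>z. F (tc z) (yc z)) {z. tc z \<in> snd c ` fst c}" for f F
  proof (rule cot.mholo_chartI[OF K cot.openin_chart[OF K] order_refl])
    show "holo (\<lambda>z. f (chart_inv ?K z)) (snd ?K ` fst ?K)"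
    proof (rule holo_cong[OF oK])
      show "holo (\<lambda>z. F (tc z) (yc z)) (snd ?K ` fst ?K)" using F im by simp
      fix z assume "z \<in> snd ?K ` fst ?K"
      then have z: "tc z \<in> snd c ` fst c" using im by simp
      then show "f (chart_inv ?K z) = F (tc z) (yc z)"
        using c(1) chart_inv3[OF z] by (simp add: cot_chart_inv f pt_def)
    qed
  qed
  have "mholo (cot_atlas A) (fst ?K) g"
    by (rule hol[where F="\<lambda>t y. dot y (loc c e t) - 1"])
       (auto simp: g_def intro!: holo_diff holo_const holo_dot hmap_yc hmap_compose[OF hmap_tc hmap_En[OF c(1)]])
  moreover have "mholo (cot_atlas A) (fst ?K) (h i j)" for i j
    by (rule hol[where F="\<lambda>t y. y $ i * y $ j - (\<Sum>k\<in>UNIV. St c t i j k * y $ k)"])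
       (auto simp: h_def intro!: holo_diff holo_sum holo_mult hmap_nth[OF hmap_yc] holo_compose[OF hmap_tc holo_St[OF c(1)]])
  moreover have "finite ?F" by simp
  moreover have "L \<inter> fst ?K = {x \<in> fst ?K. \<forall>f\<in>?F. f x = 0}"
    using spectrum_iff[OF c(1)] by (auto simp: chars_iff g_def h_def)
  moreover have "q \<in> fst ?K" using c qc by (simp add: fst_cot_chart)
  ultimately show "\<exists>U F. openin (mtop (cot_atlas A)) U \<and> q \<in> U \<and> finite F \<and> (\<forall>f\<in>F. mholo (cot_atlas A) U f) \<and>
      L \<inter> U = {x \<in> U. \<forall>f\<in>F. f x = 0}"
    using cot.openin_chart[OF K] by (intro exI[of _ "fst ?K"] exI[of _ ?F]) blast
qed

lemma openin_fst: "openin (mtop A) U \<Longrightarrow> openin (mtop (cot_atlas A)) {q \<in> mspace (cot_atlas A). fst q \<in> U}"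
  unfolding cot.openin_iff
proof (intro conjI ballI)
  assume U: "openin (mtop A) U"
  fix K assume "K \<in> cot_atlas A"
  then obtain c where c: "c \<in> A" "K = cot_chart A c" by (auto simp: cot_atlas_def)
  have "{q \<in> mspace (cot_atlas A). fst q \<in> U} \<inter> fst K = {q \<in> fst (cot_chart A c). fst q \<in> U}"
    using c chart_mspace[OF c(1)] by (auto simp: mspace_cot fst_cot_chart)
  then show "open (snd K ` ({q \<in> mspace (cot_atlas A). fst q \<in> U} \<inter> fst K))"
    using cot_chart_image[OF c(1), of U] open_tc[OF open_image[OF U c(1)]] c(2) by simp
qed blast

lemma continuous_fst: "continuous_map (mtop (cot_atlas A)) (mtop A) fst"
  unfolding continuous_map_def topspace_mtop cot.topspace_mtop
  using openin_fst mspace_cot by auto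

lemma holo_map_fst: "holo_map (cot_atlas A) A (mspace (cot_atlas A)) fst"
  unfolding holo_map_def
proof (intro conjI ballI allI)
  show "continuous_map (subtopology (mtop (cot_atlas A)) (mspace (cot_atlas A))) (mtop A) fst"
    by (rule continuous_map_from_subtopology[OF continuous_fst])
  fix d i assume d: "d \<in> A"
  let ?K = "cot_chart A d"
  have K: "?K \<in> cot_atlas A" by (rule cot_chart_in[OF d])
  have "{x \<in> mspace (cot_atlas A). fst x \<in> fst d} = fst ?K"
    using chart_mspace[OF d] by (auto simp: mspace_cot fst_cot_chart)
  moreover have "mholo (cot_atlas A) (fst ?K) (\<lambda>x. snd d (fst x) $ i)"
  proof (rule cot.mholo_chartI[OF K cot.openin_chart[OF K] order_refl], rule holo_cong[OF cot.open_chart_image[OF K]])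
    show "holo (\<lambda>z. tc z $ i) (snd ?K ` fst ?K)" by (rule hmap_nth[OF hmap_tc])
    fix z assume "z \<in> snd ?K ` fst ?K"
    then have "tc z \<in> snd d ` fst d" using cot_chart_image_full[OF d] by simp
    then show "snd d (fst (chart_inv ?K z)) $ i = tc z $ i"
      using d by (simp add: cot_chart_inv pt_def)
  qed
  ultimately show "mholo (cot_atlas A) {x \<in> mspace (cot_atlas A). fst x \<in> fst d} (\<lambda>x. snd d (fst x) $ i)" by simp
qed

end

section \<open>The spectrum as a branched covering\<close>

context mult_manifold
begin

lemma section_holo_map:
  assumes c: "c \<in> A" and N: "open N" "N \<subseteq> snd c ` fst c" and l: "hmap l N"
    and U: "U = {p \<in> fst c. snd c p \<in> N}" and g: "\<And>p. p \<in> U \<Longrightarrow> g p = (p, ct c p (l (snd c p)))"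
  shows "holo_map A (cot_atlas A) U g"
proof -
  have oU: "openin (mtop A) U" unfolding U by (rule openin_preimage[OF c N(1)])
  have g_in: "g p \<in> fst (cot_chart A d)" if "p \<in> U" "p \<in> fst d" for p d
    using that chart_mspace[OF c] g[OF that(1)] by (auto simp: fst_cot_chart U intro: ct_cotangent)
  have g_pt: "g p = pt c (join (snd c p) (l (snd c p)))" if "p \<in> U" for p
    using that c by (simp add: g pt_def U)
  have hj: "hmap (\<lambda>t. join t (l t)) N" by (rule hmap_join[OF hmap_id l])
  have tcN: "tc (join t (l t)) \<in> snd c ` fst c" if "t \<in> N" for t using that N(2) by auto
  show ?thesis
    unfolding holo_map_def
  proof (intro conjI ballI allI)
    show "continuous_map (subtopology (mtop A) U) (mtop (cot_atlas A)) g"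
      unfolding continuous_map_def
    proof (intro conjI allI impI)
      show "g \<in> topspace (subtopology (mtop A) U) \<rightarrow> topspace (mtop (cot_atlas A))"
        using g_in[of _ c] U cot.chart_mspace[OF cot_chart_in[OF c]]
        by (auto simp: topspace_subtopology cot.topspace_mtop)
      fix W assume W: "openin (mtop (cot_atlas A)) W"
      let ?W = "snd (cot_chart A c) ` (W \<inter> fst (cot_chart A c))"
      have "open ?W" by (rule cot.open_image[OF W cot_chart_in[OF c]])
      then have oN: "open (N \<inter> (\<lambda>t. join t (l t)) -` ?W)"
        by (rule continuous_open_preimage[OF hmap_continuous_on[OF hj] N(1)])
      have "{p \<in> U. g p \<in> W} = {p \<in> fst c. snd c p \<in> N \<inter> (\<lambda>t. join t (l t)) -` ?W}"
      proof -
        have "g p \<in> W \<longleftrightarrow> join (snd c p) (l (snd c p)) \<in> ?W" if p: "p \<in> U" for p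
        proof -
          have pN: "tc (join (snd c p) (l (snd c p))) \<in> snd c ` fst c" using p U by (intro tcN) auto
          note q = pt_in[OF c pN]
          show ?thesis
          proof
            assume "g p \<in> W"
            then show "join (snd c p) (l (snd c p)) \<in> ?W"
              using q g_pt[OF p] by (intro image_eqI[of _ _ "g p"]) auto
          next
            assume "join (snd c p) (l (snd c p)) \<in> ?W"
            then obtain r where r: "r \<in> W" "r \<in> fst (cot_chart A c)" "join (snd c p) (l (snd c p)) = snd (cot_chart A c) r" by blast
            then have "pt c (join (snd c p) (l (snd c p))) = r" using pt_cot_chart[OF c r(2)] by simp
            then show "g p \<in> W" using r(1) g_pt[OF p] by simp
          qed
        qed
        then show ?thesis using U by auto
      qed
      moreover have "openin (mtop A) {p \<in> fst c. snd c p \<in> N \<inter> (\<lambda>t. join t (l t)) -` ?W}"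
        by (rule openin_preimage[OF c oN])
      ultimately have "openin (mtop A) {p \<in> U. g p \<in> W}" by simp
      then have "openin (subtopology (mtop A) U) {p \<in> U. g p \<in> W}"
        unfolding openin_subtopology by (intro exI[of _ "{p \<in> U. g p \<in> W}"]) blast
      moreover have "{x \<in> topspace (subtopology (mtop A) U). g x \<in> W} = {p \<in> U. g p \<in> W}"
        using open_sub[OF oU] by (auto simp: topspace_subtopology topspace_mtop)
      ultimately show "openin (subtopology (mtop A) U) {x \<in> topspace (subtopology (mtop A) U). g x \<in> W}" by simp
    qed
    fix K s assume "K \<in> cot_atlas A"
    then obtain d where d: "d \<in> A" "K = cot_chart A d" by (auto simp: cot_atlas_def)
    have S: "{x \<in> U. g x \<in> fst K} = U \<inter> fst d"
    proof -
      have "g x \<in> fst K \<longleftrightarrow> x \<in> fst d" if "x \<in> U" for x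
        using g_in[OF that, of d] g[OF that] d(2) by (auto simp: fst_cot_chart)
      then show ?thesis by blast
    qed
    have oS: "openin (mtop A) (U \<inter> fst d)" by (rule openin_Int[OF oU openin_chart[OF d(1)]])
    show "mholo A {x \<in> U. g x \<in> fst K} (\<lambda>x. snd K (g x) $ s)"
      unfolding S
    proof (rule mholo_chartI[OF c oS])
      show "U \<inter> fst d \<subseteq> fst c" using U by blast
      let ?S = "snd c ` (U \<inter> fst d)"
      have oS': "open ?S" by (rule open_image_sub[OF oS c]) (use U in blast)
      have SN: "?S \<subseteq> N" using U by auto
      have "holo (\<lambda>t. snd K (chart_inv (cot_chart A c) (join t (l t))) $ s) ?S"
      proof (rule holo_compose[OF hmap_subset[OF hj SN] hmap_nth[OF cot.hmap_trans[OF cot_chart_in[OF c] cot_chart_in[OF d(1)]], folded d(2)]])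
        fix t assume "t \<in> ?S"
        then obtain p where p: "p \<in> U" "p \<in> fst d" "t = snd c p" by blast
        have tN: "tc (join t (l t)) \<in> snd c ` fst c" using p U by (intro tcN) auto
        have "pt c (join t (l t)) \<in> fst (cot_chart A c) \<inter> fst (cot_chart A d)"
          using g_in[OF p(1,2)] g_pt[OF p(1)] pt_in(1)[OF c tN] p(3) by simp
        then show "join t (l t) \<in> snd (cot_chart A c) ` (fst (cot_chart A c) \<inter> fst K)"
          using pt_in(2)[OF c tN] d(2) by (intro image_eqI[of _ _ "pt c (join t (l t))"]) auto
      qed
      then show "holo (\<lambda>z. snd K (g (chart_inv c z)) $ s) ?S"
      proof (rule holo_cong[OF oS', rotated])
        fix t assume "t \<in> ?S"
        then obtain p where p: "p \<in> U" "p \<in> fst d" "t = snd c p" by blast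
        have tN: "tc (join t (l t)) \<in> snd c ` fst c" using p U by (intro tcN) auto
        have "p \<in> fst c" using p(1) U by blast
        then have "chart_inv c (snd c p) = p" using c by simp
        then show "snd K (g (chart_inv c t)) $ s = snd K (chart_inv (cot_chart A c) (join t (l t))) $ s"
          unfolding cot_chart_inv[OF c tN] unfolding p(3) by (simp only: g_pt[OF p(1)])
      qed
    qed
  qed
qed

end

section \<open>Properness, surjectivity and sheets of the projection\<close>

context massive_manifold
begin

text \<open>Upper semicontinuity of the characters, carried over from a chart; it is the reason why
  the projection of L is a closed map.\<close>

lemma spectrum_tube:
  assumes p: "p \<in> mspace A" and W: "openin (mtop (cot_atlas A)) W" and sub: "\<And>q. q \<in> L \<Longrightarrow> fst q = p \<Longrightarrow> q \<in> W"
  obtains U where "openin (mtop A) U" "p \<in> U" "\<And>q. q \<in> L \<Longrightarrow> fst q \<in> U \<Longrightarrow> q \<in> W"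
proof -
  obtain c where c: "c \<in> A" "p \<in> fst c" using p by (rule mspaceE)
  interpret F: alg_family "snd c ` fst c" "St c" "loc c e" by (rule alg_family[OF c(1)])
  let ?K = "cot_chart A c"
  let ?W = "snd ?K ` (W \<inter> fst ?K)"
  have oW: "open {p :: (complex^'k) \<times> (complex^'k). join (fst p) (snd p) \<in> ?W}"
    by (rule open_join[OF cot.open_image[OF W cot_chart_in[OF c(1)]]])
  have inW: "q \<in> W \<longleftrightarrow> snd ?K q \<in> ?W" if "q \<in> fst ?K" for q
    using that cot_chart_inj[OF c(1)] by (auto dest: inj_onD)
  have inW': "(snd c p, y) \<in> {p. join (fst p) (snd p) \<in> ?W}" if y: "y \<in> ch c (snd c p)" for y
  proof -
    let ?q = "(p, ct c p y)"
    have q: "?q \<in> L" using spectrum_fibre(1)[OF c] y by blast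
    then have "?q \<in> W" by (rule sub) simp
    then show ?thesis using inW[OF spectrum_chart[OF q]] c by (simp add: snd_cot_chart)
  qed
  have t: "snd c p \<in> snd c ` fst c" using c by blast
  obtain N where N: "open N" "snd c p \<in> N" "N \<subseteq> snd c ` fst c"
    "\<forall>t\<in>N. \<forall>y\<in>ch c t. (t, y) \<in> {p. join (fst p) (snd p) \<in> ?W}"
    by (rule F.chars_tube[OF t oW inW']) blast+
  show ?thesis
  proof (rule that[OF openin_preimage[OF c(1) N(1)]])
    show "p \<in> {q \<in> fst c. snd c q \<in> N}" using c N(2) by simp
    fix q assume q: "q \<in> L" "fst q \<in> {q \<in> fst c. snd c q \<in> N}"
    then have qK: "q \<in> fst ?K" using spectrum_chart by blast
    then have "cf c q \<in> ch c (snd c (fst q))" using spectrum_iff[OF c(1) qK] q(1) by simp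
    then have "join (snd c (fst q)) (cf c q) \<in> ?W" using N(4) q(2) by auto
    then show "q \<in> W" using inW[OF qK] by (simp add: snd_cot_chart)
  qed
qed

lemma spectrum_fibre_finite:
  assumes "p \<in> mspace A"
  shows "finite {q \<in> L. fst q = p}"
proof -
  obtain c where c: "c \<in> A" "p \<in> fst c" using assms by (rule mspaceE)
  show ?thesis unfolding spectrum_fibre(1)[OF c] by (rule finite_imageI[OF chars_finite])
qed

lemma spectrum_fibre_card:
  assumes "c \<in> A" "p \<in> fst c"
  shows "card {q \<in> L. fst q = p} = card (ch c (snd c p))"
  unfolding spectrum_fibre(1)[OF assms]
  by (rule card_image, rule inj_on_subset[OF spectrum_fibre(2)[OF assms]]) simp

lemma topspace_L: "topspace (subtopology (mtop (cot_atlas A)) L) = L"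
  using spectrum_mspace by (auto simp: topspace_subtopology cot.topspace_mtop)

lemma spectrum_finite_map: "finite_map (subtopology (mtop (cot_atlas A)) L) (mtop A) fst"
  unfolding finite_map_def
proof (intro conjI ballI)
  show "continuous_map (subtopology (mtop (cot_atlas A)) L) (mtop A) fst"
    by (rule continuous_map_from_subtopology[OF continuous_fst])
  show fin: "finite {x \<in> topspace (subtopology (mtop (cot_atlas A)) L). fst x = y}" if "y \<in> topspace (mtop A)" for y
    using spectrum_fibre_finite that unfolding topspace_L topspace_mtop by blast
  show "proper_map (subtopology (mtop (cot_atlas A)) L) (mtop A) fst"
    unfolding proper_map_def
  proof (intro conjI ballI)
    show "compactin (subtopology (mtop (cot_atlas A)) L) {x \<in> topspace (subtopology (mtop (cot_atlas A)) L). fst x = y}"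
      if "y \<in> topspace (mtop A)" for y
      by (rule finite_imp_compactin[OF _ fin[OF that]]) blast
    show "closed_map (subtopology (mtop (cot_atlas A)) L) (mtop A) fst"
      unfolding closed_map_def
    proof (intro allI impI)
      fix C assume "closedin (subtopology (mtop (cot_atlas A)) L) C"
      then obtain D where D: "closedin (mtop (cot_atlas A)) D" "C = D \<inter> L"
        unfolding closedin_subtopology by blast
      have oD: "openin (mtop (cot_atlas A)) (mspace (cot_atlas A) - D)"
        using D(1) unfolding closedin_def cot.topspace_mtop by blast
      \<comment> \<open>If the fibre over p misses C, it lies in the complement of D, and so do all
        nearby fibres.\<close>
      have "openin (mtop A) (mspace A - fst ` C)"
        unfolding openin_subopen[of _ "mspace A - fst ` C"]
      proof
        fix p assume p: "p \<in> mspace A - fst ` C"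
        obtain U where U: "openin (mtop A) U" "p \<in> U" "\<And>q. q \<in> L \<Longrightarrow> fst q \<in> U \<Longrightarrow> q \<in> mspace (cot_atlas A) - D"
        proof (rule spectrum_tube[OF _ oD])
          show "q \<in> mspace (cot_atlas A) - D" if "q \<in> L" "fst q = p" for q
            using that p D(2) spectrum_mspace by blast
        qed (use p in auto)
        then have "U \<subseteq> mspace A - fst ` C" using open_sub[OF U(1)] D(2) by blast
        then show "\<exists>T. openin (mtop A) T \<and> p \<in> T \<and> T \<subseteq> mspace A - fst ` C" using U by blast
      qed
      moreover have "fst ` C \<subseteq> mspace A" using D(2) spectrum_mspace mspace_cot by blast
      ultimately show "closedin (mtop A) (fst ` C)" unfolding closedin_def topspace_mtop by blast
    qed
  qed
qed

text \<open>The image is closed because the projection is proper, and it contains the dense set of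
  semisimple points, over each of which there are n > 0 characters.\<close>

lemma spectrum_surj: "fst ` L = mspace A"
proof
  show "fst ` L \<subseteq> mspace A" using spectrum_mspace mspace_cot by blast
  have "closed_map (subtopology (mtop (cot_atlas A)) L) (mtop A) fst"
    using spectrum_finite_map unfolding finite_map_def proper_map_def by blast
  then have "closedin (mtop A) (fst ` L)"
    using closedin_topspace[of "subtopology (mtop (cot_atlas A)) L"] unfolding closed_map_def topspace_L by blast
  moreover have "mspace A - caustic A m \<subseteq> fst ` L"
  proof
    fix p assume p: "p \<in> mspace A - caustic A m"
    then have "p \<in> mspace A" by simp
    then obtain c where c: "c \<in> A" "p \<in> fst c" by (rule mspaceE)
    have "sem (St c) (loc c e) (snd c p)" using p semisimple_iff[OF c] by (simp add: caustic_def)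
    then have "card {q \<in> L. fst q = p} = CARD('k)" by (simp add: spectrum_fibre_card[OF c] sem_iff_card)
    then have "{q \<in> L. fst q = p} \<noteq> {}" by (metis card.empty zero_less_card_finite less_irrefl)
    then show "p \<in> fst ` L" by blast
  qed
  ultimately have "mtop A closure_of (mspace A - caustic A m) \<subseteq> fst ` L" by (rule closure_of_minimal[rotated])
  then show "mspace A \<subseteq> fst ` L" using massive unfolding massive_def by simp
qed

text \<open>In a chart the discriminant is a single holomorphic equation.\<close>

lemma caustic_analytic: "analytic_subset A (caustic A m)"
  unfolding analytic_subset_def
proof (intro conjI ballI)
  show "caustic A m \<subseteq> mspace A" by (auto simp: caustic_def)
  fix p assume "p \<in> mspace A"
  then obtain c where c: "c \<in> A" "p \<in> fst c" by (rule mspaceE)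
  interpret F: alg_family "snd c ` fst c" "St c" "loc c e" by (rule alg_family[OF c(1)])
  let ?f = "\<lambda>x. det (F.gram (snd c x))"
  have "mholo A (fst c) ?f"
    by (rule mholo_chartI[OF c(1) openin_chart[OF c(1)] order_refl],
        rule holo_cong[OF open_chart_image[OF c(1)] _ F.holo_discriminant]) simp
  moreover have "x \<in> caustic A m \<longleftrightarrow> ?f x = 0" if "x \<in> fst c" for x
    using F.sem_iff_discriminant[of "snd c x"] semisimple_iff[OF c(1) that] that chart_mspace[OF c(1)]
    by (auto simp: caustic_def)
  ultimately show "\<exists>U F. openin (mtop A) U \<and> p \<in> U \<and> finite F \<and> (\<forall>f\<in>F. mholo A U f) \<and>
      caustic A m \<inter> U = {x \<in> U. \<forall>f\<in>F. f x = 0}"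
    using openin_chart[OF c(1)] c(2) by (intro exI[of _ "fst c"] exI[of _ "{?f}"]) auto
qed

lemma caustic_thin: "mtop A interior_of caustic A m = {}"
proof -
  have "mtop A interior_of caustic A m = mspace A - mtop A closure_of (mspace A - caustic A m)"
    using interior_of_closure_of[of "mtop A" "caustic A m"] by (simp add: topspace_mtop)
  then show ?thesis using massive unfolding massive_def by simp
qed

text \<open>By \<open>chars_limit\<close> no open piece of L lies over the caustic; this serves the
  thin branch locus and the extension of identities along L by continuity.\<close>

lemma spectrum_semisimple_dense:
  assumes q: "q \<in> L" "q \<in> W" and W: "openin (mtop (cot_atlas A)) W"
  obtains q' where "q' \<in> L" "q' \<in> W" "fst q' \<in> mspace A - caustic A m"
proof -
  have "fst q \<in> mspace A" using q spectrum_mspace mspace_cot by blast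
  then obtain c where c: "c \<in> A" "fst q \<in> fst c" by (rule mspaceE)
  interpret F: alg_family "snd c ` fst c" "St c" "loc c e" by (rule alg_family[OF c(1)])
  let ?K = "cot_chart A c"
  let ?W = "snd ?K ` (W \<inter> fst ?K)"
  have qK: "q \<in> fst ?K" by (rule spectrum_chart[OF q(1) c(2)])
  have oW: "open {p :: (complex^'k) \<times> (complex^'k). join (fst p) (snd p) \<in> ?W}"
    by (rule open_join[OF cot.open_image[OF W cot_chart_in[OF c(1)]]])
  have "cf c q \<in> ch c (snd c (fst q))" using spectrum_iff[OF c(1) qK] q(1) by simp
  moreover have "(snd c (fst q), cf c q) \<in> {p. join (fst p) (snd p) \<in> ?W}"
    using q(2) qK by (auto simp: snd_cot_chart intro!: image_eqI[of _ _ q])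
  ultimately obtain t y where t: "t \<in> snd c ` fst c" "sem (St c) (loc c e) t" "y \<in> ch c t" "join t y \<in> ?W"
    using F.chars_limit[OF _ _ oW, of "snd c (fst q)" "cf c q"] c(2) by auto
  obtain r where r: "r \<in> W" "r \<in> fst ?K" "join t y = snd ?K r" using t(4) by blast
  have tr: "t = snd c (fst r)" "y = cf c r"
    using arg_cong[OF r(3), of tc] arg_cong[OF r(3), of yc] by (simp_all add: snd_cot_chart)
  have rL: "r \<in> L" using spectrum_iff[OF c(1) r(2)] t(3) tr by simp
  have "fst r \<in> fst c" using r(2) by (simp add: fst_cot_chart)
  then have "fst r \<in> mspace A - caustic A m"
    using semisimple_iff[OF c(1)] t(2) tr chart_mspace[OF c(1)] by (auto simp: caustic_def)
  then show ?thesis using that rL r(1) by blast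
qed

lemma spectrum_sheets:
  assumes p: "p \<in> mspace A - caustic A m"
  obtains U c N \<epsilon> l where "c \<in> A" "p \<in> fst c" "open N" "snd c p \<in> N" "N \<subseteq> snd c ` fst c"
    "U = {q \<in> fst c. snd c q \<in> N}" "\<forall>i :: 'k. hmap (\<epsilon> i) N" "\<forall>i :: 'k. hmap (l i) N"
    "\<forall>t\<in>N. range (\<lambda>i. l i t) = ch c t" "\<forall>t\<in>N. \<forall>i j. dot (l i t) (\<epsilon> j t) = (if i = j then 1 else 0)"
proof -
  have "p \<in> mspace A" using p by simp
  then obtain c where c: "c \<in> A" "p \<in> fst c" by (rule mspaceE)
  interpret F: alg_family "snd c ` fst c" "St c" "loc c e" by (rule alg_family[OF c(1)])
  have s: "sem (St c) (loc c e) (snd c p)" using p semisimple_iff[OF c] by (simp add: caustic_def)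
  have t: "snd c p \<in> snd c ` fst c" using c by blast
  obtain N \<epsilon> l where "open N" "snd c p \<in> N" "N \<subseteq> snd c ` fst c" "\<forall>i :: 'k. hmap (\<epsilon> i) N" "\<forall>i :: 'k. hmap (l i) N"
    "\<forall>t\<in>N. range (\<lambda>i. l i t) = ch c t" "\<forall>t\<in>N. \<forall>i j. dot (l i t) (\<epsilon> j t) = (if i = j then 1 else 0)"
    by (rule F.local_frame[OF t s])
  then show ?thesis by (rule that[OF c _ _ _ refl])
qed

lemma spectrum_covering: "branched_covering (cot_atlas A) L A fst CARD('k) (caustic A m)"
  unfolding branched_covering_def
proof (intro conjI ballI)
  show "subtopology (mtop (cot_atlas A)) L interior_of {x \<in> L. fst x \<in> caustic A m} = {}"
  proof (rule ccontr)
    assume "subtopology (mtop (cot_atlas A)) L interior_of {x \<in> L. fst x \<in> caustic A m} \<noteq> {}"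
    then obtain q T where q: "q \<in> T" "openin (subtopology (mtop (cot_atlas A)) L) T" "T \<subseteq> {x \<in> L. fst x \<in> caustic A m}"
      unfolding interior_of_def by blast
    obtain W where W: "openin (mtop (cot_atlas A)) W" "T = W \<inter> L" using q(2) unfolding openin_subtopology by blast
    have "q \<in> L" "q \<in> W" using q(1) W(2) by auto
    then obtain q' where "q' \<in> L" "q' \<in> W" "fst q' \<in> mspace A - caustic A m"
      by (rule spectrum_semisimple_dense[OF _ _ W(1)])
    then show False using q(3) W(2) by blast
  qed
  fix p
  show "card {x \<in> L. fst x = p} < CARD('k)" if "p \<in> caustic A m"
  proof -
    have "p \<in> mspace A" using that unfolding caustic_def by simp
    then obtain c where c: "c \<in> A" "p \<in> fst c" by (rule mspaceE)
    have "\<not> sem (St c) (loc c e) (snd c p)" using that semisimple_iff[OF c] by (simp add: caustic_def)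
    then show ?thesis
      using chars_card[of "St c" "loc c e" "snd c p"] sem_iff_card[of "St c" "loc c e" "snd c p"]
      by (simp add: spectrum_fibre_card[OF c])
  qed
  assume p: "p \<in> mspace A - caustic A m"
  obtain U c N \<epsilon> l where c: "c \<in> A" "p \<in> fst c" and N: "open N" "snd c p \<in> N" "N \<subseteq> snd c ` fst c"
    and U: "U = {q \<in> fst c. snd c q \<in> N}" and h\<epsilon>: "\<forall>i :: 'k. hmap (\<epsilon> i) N" and hl: "\<forall>i :: 'k. hmap (l i) N"
    and rl: "\<forall>t\<in>N. range (\<lambda>i. l i t) = ch c t" and le: "\<forall>t\<in>N. \<forall>i j. dot (l i t) (\<epsilon> j t) = (if i = j then 1 else 0)"
    by (rule spectrum_sheets[OF p])
  have oU: "openin (mtop A) U" unfolding U by (rule openin_preimage[OF c(1) N(1)])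
  \<comment> \<open>\<open>branched_covering\<close> numbers the sheets from 0, whereas the frame is
    indexed by the type \<open>'k\<close>.\<close>
  obtain h where h: "bij_betw h {0..<CARD('k)} (UNIV :: 'k set)"
    using ex_bij_betw_nat_finite[of "UNIV :: 'k set"] by auto
  define \<sigma> where "\<sigma> = (\<lambda>i q. (q, ct c q (l i (snd c q))))"
  define V where "V = (\<lambda>i. \<sigma> (h i) ` U)"
  have UN: "q \<in> fst c" "snd c q \<in> N" if "q \<in> U" for q using that U by auto
  have lch: "l i (snd c q) \<in> ch c (snd c q)" if "q \<in> U" for i q using rl UN(2)[OF that] by blast
  have \<sigma>L: "\<sigma> i q \<in> L" if "q \<in> U" for i q
    using spectrum_fibre(1)[OF c(1) UN(1)[OF that]] lch[OF that] unfolding \<sigma>_def by blast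
  have linj: "i = j" if "q \<in> U" "l i (snd c q) = l j (snd c q)" for i j q
    using le UN(2)[OF that(1)] that(2) by (metis zero_neq_one)
  have cover: "\<exists>i. q = \<sigma> i (fst q)" if q: "q \<in> L" "fst q \<in> U" for q
  proof -
    have "q \<in> (\<lambda>y. (fst q, ct c (fst q) y)) ` ch c (snd c (fst q))"
      using spectrum_fibre(1)[OF c(1) UN(1)[OF q(2)]] q(1) by blast
    then obtain y where y: "q = (fst q, ct c (fst q) y)" "y \<in> ch c (snd c (fst q))" by blast
    then have "y \<in> range (\<lambda>i. l i (snd c (fst q)))" using rl UN(2)[OF q(2)] by simp
    then obtain i where "y = l i (snd c (fst q))" by blast
    then show ?thesis using y(1) unfolding \<sigma>_def by metis
  qed
  have bij: "bij_betw fst (V i) U" for i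
    by (rule bij_betwI[where g="\<sigma> (h i)"]) (auto simp: V_def \<sigma>_def)
  have openV: "openin (subtopology (mtop (cot_atlas A)) L) (V i)" for i
  proof -
    let ?K = "cot_chart A c"
    \<comment> \<open>On the sheets the function of this idempotent field is 0 or 1, so the open
      condition \<open>ball 1 1\<close> selects the one sheet on which it is 1.\<close>
    let ?N = "{z. tc z \<in> N} \<inter> (\<lambda>z. dot (yc z) (\<epsilon> (h i) (tc z))) -` ball 1 1"
    have oN: "open ?N"
    proof (rule continuous_open_preimage[OF _ open_tc[OF N(1)] open_ball])
      have "hmap (\<lambda>z. \<epsilon> (h i) (tc z)) {z. tc z \<in> N}" by (rule hmap_compose[OF hmap_tc]) (use h\<epsilon> in auto)
      then show "continuous_on {z. tc z \<in> N} (\<lambda>z. dot (yc z) (\<epsilon> (h i) (tc z)))"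
        by (intro holo_continuous_on holo_dot hmap_yc)
    qed
    have "V i = {q \<in> fst ?K. snd ?K q \<in> ?N} \<inter> L"
    proof (rule Set.set_eqI, rule iffI)
      fix q assume "q \<in> V i"
      then obtain r where r: "r \<in> U" "q = \<sigma> (h i) r" unfolding V_def by blast
      have "q \<in> fst ?K" using spectrum_chart[OF \<sigma>L[OF r(1), of "h i"], of c] UN[OF r(1)] r(2) by (simp add: \<sigma>_def)
      then show "q \<in> {q \<in> fst ?K. snd ?K q \<in> ?N} \<inter> L"
        using r \<sigma>L[OF r(1)] UN[OF r(1)] c(1) le by (simp add: snd_cot_chart \<sigma>_def)
    next
      fix q assume q: "q \<in> {q \<in> fst ?K. snd ?K q \<in> ?N} \<inter> L"
      then have fU: "fst q \<in> U" using U by (auto simp: snd_cot_chart fst_cot_chart)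
      then obtain j where j: "q = \<sigma> j (fst q)" using cover q by blast
      have "cf c q = l j (snd c (fst q))" by (subst j) (use c(1) UN[OF fU] in \<open>simp add: \<sigma>_def\<close>)
      then have "dot (l j (snd c (fst q))) (\<epsilon> (h i) (snd c (fst q))) \<in> ball 1 1"
        using q by (simp add: snd_cot_chart)
      then have "j = h i" using le UN(2)[OF fU] by (auto split: if_splits)
      then show "q \<in> V i" using j fU unfolding V_def by blast
    qed
    then show ?thesis
      using cot.openin_preimage[OF cot_chart_in[OF c(1)] oN] unfolding openin_subtopology by blast
  qed
  show "\<exists>U V. openin (mtop A) U \<and> p \<in> U \<and> U \<inter> caustic A m = {} \<and>
      (\<forall>i<CARD('k). openin (subtopology (mtop (cot_atlas A)) L) (V i) \<and> bij_betw fst (V i) U \<and>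
          holo_map A (cot_atlas A) U (inv_into (V i) fst)) \<and>
      disjoint_family_on V {..<CARD('k)} \<and> {x \<in> L. fst x \<in> U} = (\<Union>i<CARD('k). V i)"
  proof (intro exI[of _ U] exI[of _ V] conjI allI impI oU openV bij)
    show "p \<in> U" using c N U by simp
    show "U \<inter> caustic A m = {}"
    proof -
      have "q \<notin> caustic A m" if q: "q \<in> U" for q
      proof -
        have "inj (\<lambda>i. l i (snd c q))" using linj[OF q] by (rule injI)
        then have "sem (St c) (loc c e) (snd c q)" unfolding sem_def using lch[OF q] by blast
        then show ?thesis using semisimple_iff[OF c(1) UN(1)[OF q]] by (simp add: caustic_def)
      qed
      then show ?thesis by blast
    qed
    show "holo_map A (cot_atlas A) U (inv_into (V i) fst)" for i
    proof (rule section_holo_map[OF c(1) N(1,3) _ U])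
      show "hmap (l (h i)) N" using hl by blast
      fix q assume q: "q \<in> U"
      have "inv_into (V i) fst (fst (\<sigma> (h i) q)) = \<sigma> (h i) q"
        by (rule inv_into_f_f[OF bij_betw_imp_inj_on[OF bij]]) (use q in \<open>auto simp: V_def\<close>)
      then show "inv_into (V i) fst q = (q, ct c q (l (h i) (snd c q)))" by (simp add: \<sigma>_def)
    qed
    show "disjoint_family_on V {..<CARD('k)}"
      unfolding disjoint_family_on_def
    proof (intro ballI impI)
      fix i j assume ij: "i \<in> {..<CARD('k)}" "j \<in> {..<CARD('k)}" "i \<noteq> j"
      have "False" if "q \<in> V i" "q \<in> V j" for q
      proof -
        obtain r where r: "r \<in> U" "q = \<sigma> (h i) r" using \<open>q \<in> V i\<close> unfolding V_def by blast
        obtain s where s: "s \<in> U" "q = \<sigma> (h j) s" using \<open>q \<in> V j\<close> unfolding V_def by blast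
        have "r = s" using r s by (simp add: \<sigma>_def)
        then have "cf c (r, ct c r (l (h i) (snd c r))) = cf c (r, ct c r (l (h j) (snd c r)))" using r s by (simp add: \<sigma>_def)
        then have "l (h i) (snd c r) = l (h j) (snd c r)" using c(1) UN[OF r(1)] by simp
        then have "h i = h j" by (rule linj[OF r(1)])
        then show False using h ij by (auto simp: bij_betw_def inj_on_def)
      qed
      then show "V i \<inter> V j = {}" by blast
    qed
    show "{x \<in> L. fst x \<in> U} = (\<Union>i<CARD('k). V i)"
    proof (rule Set.set_eqI, rule iffI)
      fix q assume "q \<in> {x \<in> L. fst x \<in> U}"
      then have q: "q \<in> L" "fst q \<in> U" by auto
      then obtain j where j: "q = \<sigma> j (fst q)" using cover by blast
      have "j \<in> h ` {0..<CARD('k)}" using h by (simp add: bij_betw_def)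
      then obtain i where "i < CARD('k)" "h i = j" by auto
      then show "q \<in> (\<Union>i<CARD('k). V i)" using j q(2) unfolding V_def by blast
    next
      fix q assume "q \<in> (\<Union>i<CARD('k). V i)"
      then obtain i r where "r \<in> U" "q = \<sigma> (h i) r" unfolding V_def by blast
      then show "q \<in> {x \<in> L. fst x \<in> U}" using \<sigma>L by (auto simp: \<sigma>_def)
    qed
  qed
qed (intro holo_map_fst spectrum_finite_map spectrum_surj caustic_analytic caustic_thin)+

end

section \<open>Local rings\<close>

lemma near_ring_simps [simp]:
  "f \<otimes>\<^bsub>near_ring A p\<^esub> g = (\<lambda>x. f x * g x)" "\<one>\<^bsub>near_ring A p\<^esub> = (\<lambda>x. 1)"
  "f \<oplus>\<^bsub>near_ring A p\<^esub> g = (\<lambda>x. f x + g x)" "\<zero>\<^bsub>near_ring A p\<^esub> = (\<lambda>x. 0)"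
  by (simp_all add: near_ring_def)

lemma module_restrict_scalars:
  assumes R: "cring R" and S: "cring S" and h: "h \<in> ring_hom R S"
  shows "Module.module R (restrict_scalars h S)"
proof -
  interpret R: cring R by (rule R)
  interpret S: cring S by (rule S)
  note hh = ring_hom_closed[OF h] ring_hom_add[OF h] ring_hom_mult[OF h] ring_hom_one[OF h]
  show ?thesis
  proof (rule moduleI[OF R])
    show "abelian_group (restrict_scalars h S)"
      by (rule abelian_groupI) (auto simp: restrict_scalars_def S.a_ac intro: S.l_neg)
  qed (auto simp: restrict_scalars_def hh S.l_distr S.r_distr S.m_assoc)
qed

context atlas
begin

lemma near_carrier:
  assumes "c \<in> A" "p \<in> fst c"
  shows "f \<in> carrier (near_ring A p) \<longleftrightarrow> holo_near (\<lambda>z. f (chart_inv c z)) (snd c p)"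
  unfolding holo_near_chart_iff[OF assms, symmetric] by (simp add: near_ring_def)

lemma near_cring:
  assumes "p \<in> mspace A"
  shows "cring (near_ring A p)"
proof -
  obtain c where c: "c \<in> A" "p \<in> fst c" using assms by (rule mspaceE)
  note nc = near_carrier[OF c]
  show ?thesis
  proof (rule cringI)
    show "abelian_group (near_ring A p)"
    proof (rule abelian_groupI)
      fix f assume f: "f \<in> carrier (near_ring A p)"
      show "\<exists>g\<in>carrier (near_ring A p). g \<oplus>\<^bsub>near_ring A p\<^esub> f = \<zero>\<^bsub>near_ring A p\<^esub>"
        by (rule bexI[of _ "\<lambda>x. - f x"]) (use f in \<open>auto simp: nc intro: holo_near_uminus\<close>)
    qed (auto simp: nc add_ac intro: holo_near_add holo_near_const)
    show "comm_monoid (near_ring A p)"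
      by (rule comm_monoidI) (auto simp: nc mult_ac intro: holo_near_mult holo_near_const)
  qed (simp add: distrib_right)
qed

lemma near_minus:
  assumes "p \<in> mspace A" "f \<in> carrier (near_ring A p)" "g \<in> carrier (near_ring A p)"
  shows "f \<ominus>\<^bsub>near_ring A p\<^esub> g = (\<lambda>x. f x - g x)" "\<ominus>\<^bsub>near_ring A p\<^esub> g = (\<lambda>x. - g x)"
proof -
  interpret R: cring "near_ring A p" by (rule near_cring[OF assms(1)])
  obtain c where c: "c \<in> A" "p \<in> fst c" using assms(1) by (rule mspaceE)
  show n: "\<ominus>\<^bsub>near_ring A p\<^esub> g = (\<lambda>x. - g x)"
    by (rule R.minus_equality) (use assms(3) in \<open>auto simp: near_carrier[OF c] intro: holo_near_uminus\<close>)
  show "f \<ominus>\<^bsub>near_ring A p\<^esub> g = (\<lambda>x. f x - g x)" by (simp add: a_minus_def n)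
qed

text \<open>For S = UNIV this is the ideal by which germs are formed; for S = L it belongs to the
  reduced structure on L and bounds the ideal of the equations from above.\<close>

definition vanish_on :: "'a set \<Rightarrow> 'a \<Rightarrow> ('a \<Rightarrow> complex) set" where
  "vanish_on S p = {f \<in> carrier (near_ring A p). \<exists>U. openin (mtop A) U \<and> p \<in> U \<and> (\<forall>x\<in>U. x \<in> S \<longrightarrow> f x = 0)}"

lemma vanish_on_iff:
  assumes "c \<in> A" "p \<in> fst c"
  shows "f \<in> vanish_on S p \<longleftrightarrow> f \<in> carrier (near_ring A p) \<and>
    (\<forall>\<^sub>F z in nhds (snd c p). chart_inv c z \<in> S \<longrightarrow> f (chart_inv c z) = 0)"
  unfolding vanish_on_def using eventually_chart_iff[OF assms, of "\<lambda>x. x \<in> S \<longrightarrow> f x = 0"] by simp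

text \<open>A function that vanishes near p is holomorphic there, hence belongs to the ring.\<close>

lemma vanish_near: "p \<in> mspace A \<Longrightarrow> vanish_near A p = vanish_on UNIV p"
proof -
  assume "p \<in> mspace A"
  then obtain c where c: "c \<in> A" "p \<in> fst c" by (rule mspaceE)
  have v: "f \<in> vanish_near A p \<longleftrightarrow> (\<forall>\<^sub>F z in nhds (snd c p). f (chart_inv c z) = 0)" for f
    unfolding vanish_near_def using eventually_chart_iff[OF c, of "\<lambda>x. f x = 0"] by simp
  have "f \<in> carrier (near_ring A p)" if "f \<in> vanish_near A p" for f
    unfolding near_carrier[OF c] by (rule holo_near_cong[OF holo_near_const[of 0]]) (use that v in simp)
  then show ?thesis using v by (auto simp: vanish_on_iff[OF c])
qed

lemma vanish_on_ideal:
  assumes p: "p \<in> mspace A"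
  shows "ideal (vanish_on S p) (near_ring A p)"
proof -
  interpret R: cring "near_ring A p" by (rule near_cring[OF p])
  obtain c where c: "c \<in> A" "p \<in> fst c" using p by (rule mspaceE)
  note v = vanish_on_iff[OF c, of _ S]
  have cl: "f \<oplus>\<^bsub>near_ring A p\<^esub> g \<in> vanish_on S p" if "f \<in> vanish_on S p" "g \<in> vanish_on S p" for f g
  proof -
    have "\<forall>\<^sub>F z in nhds (snd c p). chart_inv c z \<in> S \<longrightarrow> f (chart_inv c z) + g (chart_inv c z) = 0"
      using that[unfolded v, THEN conjunct2] by eventually_elim auto
    then show ?thesis using that R.a_closed[of f g] unfolding v by simp
  qed
  have ml: "f \<otimes>\<^bsub>near_ring A p\<^esub> g \<in> vanish_on S p" if "f \<in> carrier (near_ring A p)" "g \<in> vanish_on S p" for f g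
  proof -
    have "\<forall>\<^sub>F z in nhds (snd c p). chart_inv c z \<in> S \<longrightarrow> f (chart_inv c z) * g (chart_inv c z) = 0"
      using that(2)[unfolded v, THEN conjunct2] by eventually_elim auto
    then show ?thesis using that R.m_closed[of f g] unfolding v by simp
  qed
  have sub: "vanish_on S p \<subseteq> carrier (near_ring A p)" by (auto simp: vanish_on_def)
  show ?thesis
  proof (rule idealI[OF R.ring_axioms])
    show "subgroup (vanish_on S p) (add_monoid (near_ring A p))"
    proof (rule group.subgroupI[OF R.add.group_axioms])
      show "vanish_on S p \<subseteq> carrier (add_monoid (near_ring A p))" using sub by simp
      have "\<zero>\<^bsub>near_ring A p\<^esub> \<in> vanish_on S p" unfolding v by (simp add: R.zero_closed[simplified])
      then show "vanish_on S p \<noteq> {}" by blast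
      fix f assume f: "f \<in> vanish_on S p"
      have "inv\<^bsub>add_monoid (near_ring A p)\<^esub> f = (\<ominus>\<^bsub>near_ring A p\<^esub> \<one>\<^bsub>near_ring A p\<^esub>) \<otimes>\<^bsub>near_ring A p\<^esub> f"
        using f sub R.l_minus[of "\<one>\<^bsub>near_ring A p\<^esub>" f] R.one_closed by (auto simp: a_inv_def simp del: near_ring_simps)
      then show "inv\<^bsub>add_monoid (near_ring A p)\<^esub> f \<in> vanish_on S p"
        using ml[OF R.a_inv_closed[OF R.one_closed] f] by (simp only:)
      fix g assume "g \<in> vanish_on S p"
      then show "f \<otimes>\<^bsub>add_monoid (near_ring A p)\<^esub> g \<in> vanish_on S p" using cl[OF f] by simp
    qed
    fix f g assume fg: "f \<in> vanish_on S p" "g \<in> carrier (near_ring A p)"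
    show "g \<otimes>\<^bsub>near_ring A p\<^esub> f \<in> vanish_on S p" by (rule ml[OF fg(2,1)])
    then show "f \<otimes>\<^bsub>near_ring A p\<^esub> g \<in> vanish_on S p" using R.m_comm[of f g] fg sub by (auto simp del: near_ring_simps)
  qed
qed

lemma vanish_near_ideal: "p \<in> mspace A \<Longrightarrow> ideal (vanish_near A p) (near_ring A p)"
  using vanish_on_ideal vanish_near by simp

lemma local_cring: "p \<in> mspace A \<Longrightarrow> cring (local_ring A p)"
  unfolding local_ring_def by (rule ideal.quotient_is_cring[OF vanish_near_ideal near_cring])

lemma germ_hom: "p \<in> mspace A \<Longrightarrow> germ A p \<in> ring_hom (near_ring A p) (local_ring A p)"
  unfolding local_ring_def germ_def[abs_def] by (rule ideal.rcos_ring_hom[OF vanish_near_ideal])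

lemma local_carrier: "carrier (local_ring A p) = germ A p ` carrier (near_ring A p)"
  unfolding local_ring_def FactRing_def A_RCOSETS_def' germ_def by auto

lemma germ_eq_iff:
  assumes c: "c \<in> A" "p \<in> fst c" and fg: "f \<in> carrier (near_ring A p)" "g \<in> carrier (near_ring A p)"
  shows "germ A p f = germ A p g \<longleftrightarrow> (\<forall>\<^sub>F z in nhds (snd c p). f (chart_inv c z) = g (chart_inv c z))"
proof -
  have p: "p \<in> mspace A" using c chart_mspace by blast
  interpret R: cring "near_ring A p" by (rule near_cring[OF p])
  have "germ A p f = germ A p g \<longleftrightarrow> f \<ominus>\<^bsub>near_ring A p\<^esub> g \<in> vanish_on UNIV p"
    unfolding germ_def vanish_near[OF p] by (rule R.quotient_eq_iff_same_a_r_cos[OF vanish_on_ideal[OF p] fg, symmetric])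
  also have "\<dots> \<longleftrightarrow> (\<forall>\<^sub>F z in nhds (snd c p). f (chart_inv c z) - g (chart_inv c z) = 0)"
    using R.minus_closed[OF fg] unfolding vanish_on_iff[OF c] near_minus(1)[OF p fg] by simp
  finally show ?thesis by simp
qed

text \<open>The pullback of germs is defined by a union over representatives, so each member of a
  germ has to be recognised as a representative of it.\<close>

lemma germ_member:
  assumes p: "p \<in> mspace A" and f: "f \<in> carrier (near_ring A p)" and f': "f' \<in> germ A p f"
  shows "f' \<in> carrier (near_ring A p)" "germ A p f' = germ A p f"
proof -
  interpret R: cring "near_ring A p" by (rule near_cring[OF p])
  interpret I: ideal "vanish_near A p" "near_ring A p" by (rule vanish_near_ideal[OF p])
  show "f' \<in> carrier (near_ring A p)" using I.a_elemrcos_carrier[OF f] f' unfolding germ_def by blast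
  show "germ A p f' = germ A p f"
    using R.a_repr_independence[OF _ f I.a_subgroup] f' unfolding germ_def by blast
qed

lemma germ_self:
  assumes p: "p \<in> mspace A" and f: "f \<in> carrier (near_ring A p)"
  shows "f \<in> germ A p f"
proof -
  interpret R: cring "near_ring A p" by (rule near_cring[OF p])
  interpret I: ideal "vanish_near A p" "near_ring A p" by (rule vanish_near_ideal[OF p])
  show ?thesis unfolding germ_def by (rule I.a_rcos_self[OF f])
qed

end

subsection \<open>Frames containing the unit field\<close>

text \<open>The coordinate basis after exchanging one vector for u; \<open>adc\<close> gives the
  coefficients in it and is meaningful for \<open>u $ i1 \<noteq> 0\<close>.\<close>

definition adv :: "'n \<Rightarrow> complex^'n::finite \<Rightarrow> 'n \<Rightarrow> complex^'n" where
  "adv i1 u k = (if k = i1 then u else axis k 1)"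

definition adc :: "'n \<Rightarrow> complex^'n::finite \<Rightarrow> complex^'n \<Rightarrow> 'n \<Rightarrow> complex" where
  "adc i1 u x k = (if k = i1 then x $ i1 / u $ i1 else x $ k - x $ i1 / u $ i1 * u $ k)"

lemma adv_sum: "(\<Sum>k\<in>UNIV. s k *s adv i1 u k) $ j = s i1 * u $ j + (if j = i1 then 0 else s j)"
proof -
  have "(\<Sum>k\<in>UNIV. s k *s adv i1 u k) $ j = s i1 * u $ j + (\<Sum>k\<in>UNIV - {i1}. s k * axis k 1 $ j)"
    by (simp add: sum.remove[of UNIV i1] adv_def)
  also have "(\<Sum>k\<in>UNIV - {i1}. s k * axis k 1 $ j) = (\<Sum>k\<in>UNIV - {i1}. if k = j then s k else 0)"
    by (intro sum.cong) (auto simp: axis_def)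
  finally show ?thesis by (simp add: sum.delta')
qed

lemma adv_expand: "u $ i1 \<noteq> 0 \<Longrightarrow> (\<Sum>k\<in>UNIV. adc i1 u x k *s adv i1 u k) = x"
  unfolding vec_eq_iff adv_sum by (simp add: adc_def)

lemma adv_unique:
  assumes "u $ i1 \<noteq> 0" "x = (\<Sum>k\<in>UNIV. s k *s adv i1 u k)"
  shows "s k = adc i1 u x k"
proof -
  have "x $ j = s i1 * u $ j + (if j = i1 then 0 else s j)" for j
    unfolding assms(2) adv_sum ..
  then show ?thesis using assms(1) by (simp add: adc_def)
qed

context mult_manifold
begin

text \<open>An exchange argument: near p, where the i1-th component of e does not vanish, e can
  replace the i1-th coordinate field. The equations of L refer to frames that contain e.\<close>

lemma adapted_frame:
  assumes c: "c \<in> A" "p \<in> fst c" and nz: "e p c $ i1 \<noteq> 0"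
  obtains U \<delta> a where "openin (mtop A) U" "p \<in> U" "U \<subseteq> fst c" "frame A U \<delta>" "\<delta> i1 = vrestrict U e"
    "\<forall>i j k. mholo A U (a i j k)" "\<forall>i j. m U (\<delta> i) (\<delta> j) = (\<Sum>k\<in>UNIV. fscale (a i j k) (\<delta> k))"
    "\<forall>x\<in>U. \<forall>k. \<delta> k x c = adv i1 (e x c) k"
proof -
  define U where "U = {x \<in> fst c. snd c x \<in> snd c ` fst c \<inter> (\<lambda>t. loc c e t $ i1) -` (- {0})}"
  have oN: "open (snd c ` fst c \<inter> (\<lambda>t. loc c e t $ i1) -` (- {0}))"
    by (rule continuous_open_preimage[OF holo_continuous_on[OF hmap_nth[OF hmap_En[OF c(1)]]] open_chart_image[OF c(1)]]) auto
  have oU: "openin (mtop A) U" unfolding U_def by (rule openin_preimage[OF c(1) oN])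
  have Uc: "U \<subseteq> fst c" by (auto simp: U_def)
  have nzU: "e x c $ i1 \<noteq> 0" if x: "x \<in> U" for x
  proof -
    have "loc c e (snd c x) $ i1 \<noteq> 0" using x unfolding U_def by blast
    then show ?thesis using loc_chart[OF c(1)] subsetD[OF Uc x] by simp
  qed
  define \<delta> where "\<delta> = (\<lambda>k. if k = i1 then vrestrict U e else basisf c U k)"
  have \<delta>v: "\<delta> k \<in> vfields A U" for k
    using vfields_restrict[OF e_vfield oU open_sub[OF oU]] basisf_vfields[OF c(1) oU Uc] by (simp add: \<delta>_def)
  have \<delta>c: "\<delta> k x c = adv i1 (e x c) k" if "x \<in> U" for k x
    using that Uc by (auto simp: \<delta>_def adv_def vrestrict_def basisf_def mkf_apply[OF c(1) Uc])
  have tU: "v = (\<Sum>k\<in>UNIV. cscale (s k) (\<delta> k x)) \<longleftrightarrow> v c = (\<Sum>k\<in>UNIV. s k *s adv i1 (e x c) k)"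
    if x: "x \<in> U" and v: "v \<in> tangent_space A x" for x v s
  proof -
    have xc: "x \<in> fst c" using x Uc by blast
    have xm: "x \<in> mspace A" using chart_mspace[OF c(1)] xc by blast
    have st: "(\<Sum>k\<in>UNIV. cscale (s k) (\<delta> k x)) \<in> tangent_space A x"
      by (intro tangent_sum tangent_cscale xm vfields_tangent[OF \<delta>v x])
    have sc: "(\<Sum>k\<in>UNIV. cscale (s k) (\<delta> k x)) c = (\<Sum>k\<in>UNIV. s k *s adv i1 (e x c) k)"
      by (simp add: sum_fun_apply cscale_apply \<delta>c[OF x])
    show ?thesis
      by (rule iffI, simp only: sc, rule tangent_eqI[OF c(1) xc v st], simp only: sc)
  qed
  have fr: "frame A U \<delta>"
    unfolding frame_def
  proof (intro conjI allI ballI \<delta>v)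
    fix x v assume x: "x \<in> U" and v: "v \<in> tangent_space A x"
    show "\<exists>!a :: complex^'k. v = (\<Sum>i\<in>UNIV. cscale (a $ i) (\<delta> i x))"
    proof (rule ex1I)
      show "v = (\<Sum>i\<in>UNIV. cscale ((\<chi> k. adc i1 (e x c) (v c) k) $ i) (\<delta> i x))"
        unfolding tU[OF x v] vec_lambda_beta by (rule adv_expand[OF nzU[OF x], symmetric])
      fix a :: "complex^'k" assume "v = (\<Sum>i\<in>UNIV. cscale (a $ i) (\<delta> i x))"
      then have "v c = (\<Sum>k\<in>UNIV. a $ k *s adv i1 (e x c) k)" by (rule tU[OF x v, THEN iffD1])
      then have "a $ k = adc i1 (e x c) (v c) k" for k by (rule adv_unique[OF nzU[OF x]])
      then show "a = (\<chi> k. adc i1 (e x c) (v c) k)" by (simp add: vec_eq_iff)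
    qed
  qed
  have coef: "mholo A U (\<lambda>x. adc i1 (e x c) (X x c) k)" if X: "X \<in> vfields A U" for X k
  proof (rule mholo_chartI[OF c(1) oU Uc])
    have hX: "hmap (loc c X) (snd c ` U)" using vfields_hmap[OF X c(1)] Uc by (simp add: Int_absorb2)
    have he: "hmap (loc c e) (snd c ` U)" by (rule hmap_subset[OF hmap_En[OF c(1)]]) (use Uc in blast)
    have nz': "loc c e t $ i1 \<noteq> 0" if "t \<in> snd c ` U" for t using that nzU c(1) Uc by auto
    have "holo (\<lambda>z. adc i1 (loc c e z) (loc c X z) k) (snd c ` U)"
      unfolding adc_def by (cases "k = i1") (auto intro!: holo_diff holo_mult holo_divide hmap_nth hX he nz')
    then show "holo (\<lambda>z. adc i1 (e (chart_inv c z) c) (X (chart_inv c z) c) k) (snd c ` U)" by (simp add: loc_def)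
  qed
  define a where "a = (\<lambda>i j k x. adc i1 (e x c) (m U (\<delta> i) (\<delta> j) x c) k)"
  have mv: "m U (\<delta> i) (\<delta> j) \<in> vfields A U" for i j by (rule m_closed[OF oU \<delta>v \<delta>v])
  have ha: "mholo A U (a i j k)" for i j k unfolding a_def by (rule coef[OF mv])
  have me: "m U (\<delta> i) (\<delta> j) = (\<Sum>k\<in>UNIV. fscale (a i j k) (\<delta> k))" for i j
  proof
    fix x
    show "m U (\<delta> i) (\<delta> j) x = (\<Sum>k\<in>UNIV. fscale (a i j k) (\<delta> k)) x"
    proof (cases "x \<in> U")
      case True
      have "m U (\<delta> i) (\<delta> j) x = (\<Sum>k\<in>UNIV. cscale (a i j k x) (\<delta> k x))"
        unfolding tU[OF True vfields_tangent[OF mv True]] a_def by (rule adv_expand[OF nzU[OF True], symmetric])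
      then show ?thesis by (simp add: sum_fun_apply fscale_def)
    next
      case False
      then show ?thesis by (simp add: sum_fun_apply fscale_def vfields_outside[OF mv] vfields_outside[OF \<delta>v] cscale_zero)
    qed
  qed
  show ?thesis
  proof (rule that[OF oU _ Uc fr])
    show "p \<in> U" using c nz by (simp add: U_def)
    show "\<delta> i1 = vrestrict U e" by (simp add: \<delta>_def)
  qed (use ha me \<delta>c in auto)
qed

end

subsection \<open>The local rings of the spectrum\<close>

text \<open>A point q of L with a chart around its base point; germs at q are studied as functions
  of the coordinates (t, y) near z0.\<close>

locale spectrum_point = massive_manifold A m e for A :: "('a, 'k::finite) chart set" and m e +
  fixes q c
  assumes qL: "q \<in> L" and c: "c \<in> A" and qc: "fst q \<in> fst c"
begin

abbreviation "K \<equiv> cot_chart A c"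
abbreviation "t0 \<equiv> snd c (fst q)"
abbreviation "z0 \<equiv> join t0 (cf c q)"
abbreviation "Q \<equiv> near_ring (cot_atlas A) q"
abbreviation "SId \<equiv> spectrum_ideal A m e q"
abbreviation "Loc \<equiv> local_ring (cot_atlas A) q"
abbreviation "SL \<equiv> spectrum_local_ring A m e q"

lemma K: "K \<in> cot_atlas A" "q \<in> fst K" "snd K q = z0"
  using cot_chart_in[OF c] spectrum_chart[OF qL qc] by (simp_all add: snd_cot_chart)

lemma qm: "q \<in> mspace (cot_atlas A)"
  by (rule spectrum_mspace[OF qL])

sublocale F: alg_family "snd c ` fst c" "St c" "loc c e"
  by (rule alg_family[OF c])

lemma near_Q: "f \<in> carrier Q \<longleftrightarrow> holo_near (\<lambda>z. f (chart_inv K z)) z0"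
  using cot.near_carrier[OF K(1,2)] K(3) by simp

lemma germ_iff: "f \<in> carrier Q \<Longrightarrow> g \<in> carrier Q \<Longrightarrow>
    germ (cot_atlas A) q f = germ (cot_atlas A) q g \<longleftrightarrow> (\<forall>\<^sub>F z in nhds z0. f (chart_inv K z) = g (chart_inv K z))"
  using cot.germ_eq_iff[OF K(1,2)] K(3) by simp

lemma vanish_iff: "f \<in> cot.vanish_on L q \<longleftrightarrow> f \<in> carrier Q \<and>
    (\<forall>\<^sub>F z in nhds z0. yc z \<in> ch c (tc z) \<longrightarrow> f (chart_inv K z) = 0)"
proof -
  have "\<forall>\<^sub>F z in nhds z0. tc z \<in> snd c ` fst c"
    by (rule eventually_tc) (use c qc in \<open>auto intro: eventually_nhds_in_open open_chart_image\<close>)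
  then have "\<forall>\<^sub>F z in nhds z0. (chart_inv K z \<in> L \<longrightarrow> f (chart_inv K z) = 0) = (yc z \<in> ch c (tc z) \<longrightarrow> f (chart_inv K z) = 0)"
    by eventually_elim (use pt_spectrum[OF c] cot_chart_inv[OF c] in auto)
  then show ?thesis unfolding cot.vanish_on_iff[OF K(1,2)] K(3) by (simp add: eventually_subst)
qed

lemma eventually_base:
  assumes "openin (mtop A) U" "fst q \<in> U"
  shows "\<forall>\<^sub>F z in nhds z0. tc z \<in> snd c ` fst c \<and> chart_inv c (tc z) \<in> U"
proof -
  have "\<forall>\<^sub>F z in nhds z0. tc z \<in> snd c ` (U \<inter> fst c)"
    by (rule eventually_tc) (use assms c qc in \<open>auto intro: eventually_nhds_in_open open_image\<close>)
  then show ?thesis by eventually_elim (use c in auto)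
qed

lemma inv_K: "tc z \<in> snd c ` fst c \<Longrightarrow> snd K (chart_inv K z) = z \<and> fst (chart_inv K z) = chart_inv c (tc z)"
  using pt_in[OF c] cot_chart_inv[OF c] by (simp add: pt_def)

lemma fibre_pt:
  assumes "tc z \<in> snd c ` fst c" "X (chart_inv c (tc z)) \<in> tangent_space A (chart_inv c (tc z))"
  shows "fibre_fun X (chart_inv K z) = dot (yc z) (loc c X (tc z))"
  using assms cot_chart_inv[OF c assms(1)] by (simp add: fibre_fun_def pt_def ct_def loc_def)

lemma near_loc: "openin (mtop A) U \<Longrightarrow> fst q \<in> U \<Longrightarrow> X \<in> vfields A U \<Longrightarrow> hmap_near (loc c X) t0"
  by (rule hmap_nearI[OF open_image[of U c] _ vfields_hmap]) (use c qc in auto)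

lemma fibre_near:
  assumes "openin (mtop A) U" "fst q \<in> U" "X \<in> vfields A U"
  shows "\<forall>\<^sub>F z in nhds z0. fibre_fun X (chart_inv K z) = dot (yc z) (loc c X (tc z))"
    and "fibre_fun X \<in> carrier Q"
proof -
  show ev: "\<forall>\<^sub>F z in nhds z0. fibre_fun X (chart_inv K z) = dot (yc z) (loc c X (tc z))"
    using eventually_base[OF assms(1,2)] by eventually_elim (use fibre_pt vfields_tangent[OF assms(3)] in blast)
  show "fibre_fun X \<in> carrier Q"
    unfolding near_Q by (rule holo_near_cong[OF holo_near_fibre ev]) (use near_loc[OF assms] in simp)
qed

lemma base_near:
  assumes "f \<in> carrier (near_ring A (fst q))"
  shows "(\<lambda>r. f (fst r)) \<in> carrier Q"
    and "\<forall>\<^sub>F z in nhds z0. f (fst (chart_inv K z)) = f (chart_inv c (tc z))"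
proof -
  show ev: "\<forall>\<^sub>F z in nhds z0. f (fst (chart_inv K z)) = f (chart_inv c (tc z))"
    using eventually_base[OF openin_chart[OF c] qc] by eventually_elim (use inv_K in auto)
  have "holo_near (\<lambda>z. f (chart_inv c (tc z))) z0"
    by (rule holo_near_tc) (use assms near_carrier[OF c qc] in simp)
  then show "(\<lambda>r. f (fst r)) \<in> carrier Q" unfolding near_Q by (rule holo_near_cong[OF _ ev])
qed

lemma Q_cring: "cring Q"
  by (rule cot.near_cring[OF qm])

text \<open>The coefficients a expand the product of the two fields. In coordinates the equation
  thus compares a product of two linear functions with the linear function of the product, and the
  frame disappears into its fields.\<close>

lemma equation_near:
  assumes U: "openin (mtop A) U" "fst q \<in> U" and \<delta>: "\<And>i. \<delta> i \<in> vfields A U"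
    and a: "\<And>k. mholo A U (a k)" and ma: "m U (\<delta> i) (\<delta> j) = (\<Sum>k\<in>UNIV. fscale (a k) (\<delta> k))"
  shows "\<forall>\<^sub>F z in nhds z0. fibre_fun (\<delta> i) (chart_inv K z) * fibre_fun (\<delta> j) (chart_inv K z)
        - (\<Sum>k\<in>UNIV. a k (fst (chart_inv K z)) * fibre_fun (\<delta> k) (chart_inv K z))
      = dot (yc z) (loc c (\<delta> i) (tc z)) * dot (yc z) (loc c (\<delta> j) (tc z))
        - dot (yc z) (mul (St c) (tc z) (loc c (\<delta> i) (tc z)) (loc c (\<delta> j) (tc z)))"
    and "(\<lambda>r. fibre_fun (\<delta> i) r * fibre_fun (\<delta> j) r - (\<Sum>k\<in>UNIV. a k (fst r) * fibre_fun (\<delta> k) r)) \<in> carrier Q"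
proof -
  show "\<forall>\<^sub>F z in nhds z0. fibre_fun (\<delta> i) (chart_inv K z) * fibre_fun (\<delta> j) (chart_inv K z)
        - (\<Sum>k\<in>UNIV. a k (fst (chart_inv K z)) * fibre_fun (\<delta> k) (chart_inv K z))
      = dot (yc z) (loc c (\<delta> i) (tc z)) * dot (yc z) (loc c (\<delta> j) (tc z))
        - dot (yc z) (mul (St c) (tc z) (loc c (\<delta> i) (tc z)) (loc c (\<delta> j) (tc z)))"
    using eventually_base[OF U]
  proof eventually_elim
    case (elim z)
    then have z: "tc z \<in> snd c ` fst c" and x: "chart_inv c (tc z) \<in> U" by auto
    let ?x = "chart_inv c (tc z)"
    have xc: "?x \<in> fst c" "snd c ?x = tc z" using chart_inv3[OF z] chart_inv2[OF z] by auto
    have f: "fibre_fun (\<delta> k) (chart_inv K z) = dot (yc z) (loc c (\<delta> k) (tc z))" for k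
      by (rule fibre_pt[where X="\<delta> k", OF z vfields_tangent[OF \<delta> x]])
    have "(\<Sum>k\<in>UNIV. a k ?x *s loc c (\<delta> k) (tc z)) = m U (\<delta> i) (\<delta> j) ?x c"
      unfolding ma by (simp add: sum_fun_apply fscale_def cscale_apply loc_def)
    also have "\<dots> = mul (St c) (tc z) (loc c (\<delta> i) (tc z)) (loc c (\<delta> j) (tc z))"
      using mult_loc[OF U(1) \<delta> \<delta> c x xc(1)] xc(2) by (simp add: loc_def)
    finally have "dot (yc z) (\<Sum>k\<in>UNIV. a k ?x *s loc c (\<delta> k) (tc z)) =
        dot (yc z) (mul (St c) (tc z) (loc c (\<delta> i) (tc z)) (loc c (\<delta> j) (tc z)))" by (rule arg_cong)
    then have "(\<Sum>k\<in>UNIV. a k ?x * dot (yc z) (loc c (\<delta> k) (tc z))) =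
        dot (yc z) (mul (St c) (tc z) (loc c (\<delta> i) (tc z)) (loc c (\<delta> j) (tc z)))"
      unfolding dot_sum dot_smult .
    then show ?case using inv_K[OF z] by (simp add: f)
  qed
  have aQ: "(\<lambda>r. a k (fst r)) \<in> carrier Q" for k
    by (rule base_near(1)) (use U a[of k] in \<open>auto simp: near_ring_def\<close>)
  show "(\<lambda>r. fibre_fun (\<delta> i) r * fibre_fun (\<delta> j) r - (\<Sum>k\<in>UNIV. a k (fst r) * fibre_fun (\<delta> k) r)) \<in> carrier Q"
    unfolding near_Q
    by (intro holo_near_diff holo_near_mult holo_near_sum fibre_near(2)[OF U \<delta>, unfolded near_Q] aQ[unfolded near_Q])
qed

lemma unit_near:
  "\<forall>\<^sub>F z in nhds z0. fibre_fun (vrestrict U e) (chart_inv K z) - 1 = dot (yc z) (loc c e (tc z)) - 1"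
  "(\<lambda>r. fibre_fun (vrestrict U e) r - 1) \<in> carrier Q" if U: "openin (mtop A) U" "fst q \<in> U"
proof -
  have v: "vrestrict U e \<in> vfields A U" by (rule vfields_restrict[OF e_vfield U(1) open_sub[OF U(1)]])
  show "\<forall>\<^sub>F z in nhds z0. fibre_fun (vrestrict U e) (chart_inv K z) - 1 = dot (yc z) (loc c e (tc z)) - 1"
    using fibre_near(1)[OF U v] eventually_base[OF U]
    by eventually_elim (simp add: loc_def vrestrict_def)
  show "(\<lambda>r. fibre_fun (vrestrict U e) r - 1) \<in> carrier Q"
    unfolding near_Q by (intro holo_near_diff holo_near_const fibre_near(2)[OF U v, unfolded near_Q])
qed

lemma equations_vanish: "spectrum_equations A m e q \<subseteq> cot.vanish_on L q"
proof
  fix g assume "g \<in> spectrum_equations A m e q"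
  then obtain U \<delta> i1 a where U: "openin (mtop A) U" "fst q \<in> U" and fr: "frame A U \<delta>" and i1: "\<delta> i1 = vrestrict U e"
    and a: "\<And>i j k. mholo A U (a i j k)" and ma: "\<And>i j. m U (\<delta> i) (\<delta> j) = (\<Sum>k\<in>UNIV. fscale (a i j k) (\<delta> k))"
    and g: "g = (\<lambda>r. fibre_fun (\<delta> i1) r - 1) \<or>
      (\<exists>i j. g = (\<lambda>r. fibre_fun (\<delta> i) r * fibre_fun (\<delta> j) r - (\<Sum>k\<in>UNIV. a i j k (fst r) * fibre_fun (\<delta> k) r)))"
    unfolding spectrum_equations_def by blast
  have \<delta>: "\<delta> i \<in> vfields A U" for i using fr unfolding frame_def by blast
  show "g \<in> cot.vanish_on L q"
    using g
  proof (elim disjE exE)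
    assume g: "g = (\<lambda>r. fibre_fun (\<delta> i1) r - 1)"
    have "\<forall>\<^sub>F z in nhds z0. yc z \<in> ch c (tc z) \<longrightarrow> g (chart_inv K z) = 0"
      using unit_near(1)[OF U] by eventually_elim (simp add: g i1 chars_unit)
    then show ?thesis using unit_near(2)[OF U] by (simp add: vanish_iff g i1)
  next
    fix i j assume g: "g = (\<lambda>r. fibre_fun (\<delta> i) r * fibre_fun (\<delta> j) r - (\<Sum>k\<in>UNIV. a i j k (fst r) * fibre_fun (\<delta> k) r))"
    note eq = equation_near[where \<delta>=\<delta> and a="a i j", OF U \<delta> a ma]
    have "\<forall>\<^sub>F z in nhds z0. yc z \<in> ch c (tc z) \<longrightarrow> g (chart_inv K z) = 0"
      using eq(1) unfolding g by eventually_elim (auto simp: chars_mul)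
    then show ?thesis using eq(2) by (simp only: vanish_iff g simp_thms)
  qed
qed

text \<open>Taking the germ and then its class modulo the ideal of L in one map, a ring homomorphism
  defined on functions.\<close>

definition cls :: "(('a, 'k) cotpoint \<Rightarrow> complex) \<Rightarrow> (('a, 'k) cotpoint \<Rightarrow> complex) set set" where
  "cls g = SId +>\<^bsub>Loc\<^esub> germ (cot_atlas A) q g"

lemma Loc_cring: "cring Loc"
  by (rule cot.local_cring[OF qm])

lemma gens_carrier: "germ (cot_atlas A) q ` spectrum_equations A m e q \<subseteq> carrier Loc"
  unfolding cot.local_carrier using equations_vanish by (auto simp: cot.vanish_on_def)

lemma Id_ideal: "ideal SId Loc"
  unfolding spectrum_ideal_def by (rule ring.genideal_ideal[OF cring.axioms(1)[OF Loc_cring] gens_carrier])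

lemma SL_cring: "cring SL"
  unfolding spectrum_local_ring_def by (rule ideal.quotient_is_cring[OF Id_ideal Loc_cring])

lemma cls_hom: "cls \<in> ring_hom Q SL"
  using ring_hom_trans[OF cot.germ_hom[OF qm] ideal.rcos_ring_hom[OF Id_ideal]]
  unfolding spectrum_local_ring_def cls_def[abs_def] comp_def .

lemma SL_carrier: "carrier SL = cls ` carrier Q"
  unfolding spectrum_local_ring_def FactRing_def A_RCOSETS_def' cls_def cot.local_carrier by auto

lemma cls_zero: "g \<in> carrier Q \<Longrightarrow> cls g = \<zero>\<^bsub>SL\<^esub> \<longleftrightarrow> germ (cot_atlas A) q g \<in> SId"
proof -
  assume "g \<in> carrier Q"
  then have "germ (cot_atlas A) q g \<in> carrier Loc" unfolding cot.local_carrier by blast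
  then have "cls g = SId \<longleftrightarrow> germ (cot_atlas A) q g \<in> SId"
    unfolding cls_def using ideal.rcos_const_imp_mem[OF Id_ideal]
      ring.a_rcos_zero[OF cring.axioms(1)[OF Loc_cring] Id_ideal] by blast
  then show ?thesis by (simp add: spectrum_local_ring_def FactRing_def)
qed

lemma cls_cong:
  assumes "f \<in> carrier Q" "g \<in> carrier Q" "\<forall>\<^sub>F z in nhds z0. f (chart_inv K z) = g (chart_inv K z)"
  shows "cls f = cls g"
  unfolding cls_def using germ_iff[OF assms(1,2)] assms(3) by simp

text \<open>Germs vanishing on L form an ideal that contains all generators, hence it contains the
  ideal they generate.\<close>

lemma cls_vanish:
  assumes g: "g \<in> carrier Q" "cls g = \<zero>\<^bsub>SL\<^esub>"
  shows "g \<in> cot.vanish_on L q"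
proof -
  interpret Q: cring Q by (rule Q_cring)
  interpret Lc: cring Loc by (rule Loc_cring)
  let ?G = "germ (cot_atlas A) q"
  have "ideal (?G ` cot.vanish_on L q) Loc"
    unfolding local_ring_def germ_def[abs_def]
    by (rule Q.ring_ideal_imp_quot_ideal[OF cot.vanish_near_ideal[OF qm] cot.vanish_on_ideal[OF qm]])
  then have "SId \<subseteq> ?G ` cot.vanish_on L q"
    unfolding spectrum_ideal_def by (rule Lc.genideal_minimal) (use equations_vanish in blast)
  then obtain g' where g': "g' \<in> cot.vanish_on L q" "?G g = ?G g'"
    using cls_zero[OF g(1)] g(2) by blast
  have "\<forall>\<^sub>F z in nhds z0. g (chart_inv K z) = g' (chart_inv K z)"
    using germ_iff[OF g(1)] g' unfolding vanish_iff by blast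
  moreover have "\<forall>\<^sub>F z in nhds z0. yc z \<in> ch c (tc z) \<longrightarrow> g' (chart_inv K z) = 0"
    using g'(1) unfolding vanish_iff by blast
  ultimately have "\<forall>\<^sub>F z in nhds z0. yc z \<in> ch c (tc z) \<longrightarrow> g (chart_inv K z) = 0"
    by eventually_elim simp
  then show ?thesis using g(1) unfolding vanish_iff by blast
qed

text \<open>Transports functions of the coordinates to the bundle. Values off the domain of K are
  arbitrary, which does no harm because only germs at q are taken.\<close>

definition pull :: "(complex^('k + 'k) \<Rightarrow> complex) \<Rightarrow> ('a, 'k) cotpoint \<Rightarrow> complex" where
  "pull g r = g (snd K r)"

lemma pull_near: "\<forall>\<^sub>F z in nhds z0. pull g (chart_inv K z) = g z"
  using eventually_base[OF openin_chart[OF c] qc] by eventually_elim (simp add: pull_def inv_K)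

lemma pull_Q: "pull g \<in> carrier Q \<longleftrightarrow> holo_near g z0"
proof -
  have ev: "\<forall>\<^sub>F z in nhds z0. g z = pull g (chart_inv K z)" using pull_near[of g] by eventually_elim simp
  show ?thesis unfolding near_Q
    using holo_near_cong[OF _ ev] holo_near_cong[OF _ pull_near] by blast
qed

lemma pull_local: "f \<in> carrier Q \<Longrightarrow> pull (\<lambda>z. f (chart_inv K z)) \<in> carrier Q"
  using near_Q[of f] pull_Q[of "\<lambda>z. f (chart_inv K z)"] by blast

lemma cls_pull_local: "f \<in> carrier Q \<Longrightarrow> cls (pull (\<lambda>z. f (chart_inv K z))) = cls f"
  by (rule cls_cong[OF pull_local _ pull_near])

text \<open>The ideal of the equations as a predicate on functions of (t, y). It satisfies the
  assumptions of \<open>germ_ideal\<close>, which brings in the local algebra proved there.\<close>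

definition J :: "(complex^('k + 'k) \<Rightarrow> complex) \<Rightarrow> bool" where
  "J g \<longleftrightarrow> holo_near g z0 \<and> cls (pull g) = \<zero>\<^bsub>SL\<^esub>"

lemma pull_simps: "pull (\<lambda>z. f z + g z) = (\<lambda>r. pull f r + pull g r)" "pull (\<lambda>z. f z * g z) = (\<lambda>r. pull f r * pull g r)"
    "pull (\<lambda>z. s) = (\<lambda>r. s)"
  by (simp_all add: pull_def fun_eq_iff)

lemma cls_pull_add: "holo_near f z0 \<Longrightarrow> holo_near g z0 \<Longrightarrow> cls (pull (\<lambda>z. f z + g z)) = cls (pull f) \<oplus>\<^bsub>SL\<^esub> cls (pull g)"
  using ring_hom_add[OF cls_hom, of "pull f" "pull g"] by (simp add: pull_Q pull_simps)

lemma cls_pull_mult: "holo_near f z0 \<Longrightarrow> holo_near g z0 \<Longrightarrow> cls (pull (\<lambda>z. f z * g z)) = cls (pull f) \<otimes>\<^bsub>SL\<^esub> cls (pull g)"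
  using ring_hom_mult[OF cls_hom, of "pull f" "pull g"] by (simp add: pull_Q pull_simps)

lemma cls_pull_carrier: "holo_near f z0 \<Longrightarrow> cls (pull f) \<in> carrier SL"
  by (rule ring_hom_closed[OF cls_hom]) (simp add: pull_Q)

lemma J_add: "J f \<Longrightarrow> J g \<Longrightarrow> J (\<lambda>z. f z + g z)"
  using cring.cring_simprules(2,8)[OF SL_cring] unfolding J_def by (simp add: cls_pull_add holo_near_add)

lemma J_mult: "holo_near f z0 \<Longrightarrow> J g \<Longrightarrow> J (\<lambda>z. f z * g z)"
  using cring.cring_simprules(27)[OF SL_cring cls_pull_carrier] unfolding J_def
  by (simp add: cls_pull_mult holo_near_mult)

lemma J_cong: "J g \<Longrightarrow> \<forall>\<^sub>F z in nhds z0. f z = g z \<Longrightarrow> J f"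
proof -
  assume g: "J g" and ev: "\<forall>\<^sub>F z in nhds z0. f z = g z"
  have f: "holo_near f z0" by (rule holo_near_cong[OF _ ev]) (use g in \<open>simp add: J_def\<close>)
  have "\<forall>\<^sub>F z in nhds z0. pull f (chart_inv K z) = pull g (chart_inv K z)"
    using ev pull_near[of f] pull_near[of g] by eventually_elim simp
  then have "cls (pull f) = cls (pull g)" using f g by (intro cls_cong) (simp_all add: pull_Q J_def)
  then show "J f" using f g by (simp add: J_def)
qed

lemma J_equation:
  assumes g: "g \<in> spectrum_equations A m e q" and ev: "\<forall>\<^sub>F z in nhds z0. g (chart_inv K z) = f z"
  shows "J f"
proof -
  have gQ: "g \<in> carrier Q" using equations_vanish g by (auto simp: cot.vanish_on_def)
  have "germ (cot_atlas A) q g \<in> SId"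
    unfolding spectrum_ideal_def using ring.genideal_self[OF cring.axioms(1)[OF Loc_cring] gens_carrier] g by blast
  then have "J (\<lambda>z. g (chart_inv K z))"
    using cls_zero[OF gQ] cls_pull_local[OF gQ] gQ by (simp add: J_def near_Q)
  then show ?thesis by (rule J_cong) (use ev in \<open>eventually_elim, simp\<close>)
qed

lemma J_sum': "finite I \<Longrightarrow> I \<noteq> {} \<Longrightarrow> (\<And>i. i \<in> I \<Longrightarrow> J (f i)) \<Longrightarrow> J (\<lambda>z. \<Sum>i\<in>I. f i z)"
  by (induction I rule: finite_ne_induct) (auto intro: J_add)

text \<open>The generators refer to frames containing e, and the coordinate frame need not be one.
  Coordinate vectors are holomorphic combinations of an adapted frame, so the coordinate relations
  are combinations of its equations.\<close>

lemma J_relations: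
  shows "J (\<lambda>z. dot (yc z) (loc c e (tc z)) - 1)"
    and "J (\<lambda>z. yc z $ i * yc z $ j - (\<Sum>k\<in>UNIV. St c (tc z) i j k * yc z $ k))"
proof -
  have y0: "cf c q \<in> ch c t0" using spectrum_iff[OF c K(2)] qL by simp
  have "\<exists>i1. e (fst q) c $ i1 \<noteq> 0"
  proof (rule ccontr)
    assume "\<not> (\<exists>i1. e (fst q) c $ i1 \<noteq> 0)"
    then have "loc c e t0 = 0" using c qc by (simp add: vec_eq_iff)
    then show False using chars_unit[OF y0] by (simp add: dot_zero)
  qed
  then obtain i1 where i1: "e (fst q) c $ i1 \<noteq> 0" by blast
  obtain U \<delta> a where U: "openin (mtop A) U" "fst q \<in> U" "U \<subseteq> fst c" and fr: "frame A U \<delta>" and \<delta>1: "\<delta> i1 = vrestrict U e"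
    and a: "\<forall>i j k. mholo A U (a i j k)" and ma: "\<forall>i j. m U (\<delta> i) (\<delta> j) = (\<Sum>k\<in>UNIV. fscale (a i j k) (\<delta> k))"
    and \<delta>c: "\<forall>x\<in>U. \<forall>k. \<delta> k x c = adv i1 (e x c) k"
    by (rule adapted_frame[OF c qc i1])
  have \<delta>: "\<delta> i \<in> vfields A U" for i using fr unfolding frame_def by blast
  have "(\<lambda>r. fibre_fun (\<delta> i1) r - 1) \<in> spectrum_equations A m e q"
    unfolding spectrum_equations_def using U(1,2) fr \<delta>1 a ma by blast
  then show "J (\<lambda>z. dot (yc z) (loc c e (tc z)) - 1)"
    by (rule J_equation) (use unit_near(1)[OF U(1,2)] \<delta>1 in simp)
  let ?d = "\<lambda>k z. loc c (\<delta> k) (tc z)" and ?a = "\<lambda>i z. adc i1 (loc c e (tc z)) (axis i 1)"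
  have r: "J (\<lambda>z. dot (yc z) (?d k z) * dot (yc z) (?d l z) - dot (yc z) (mul (St c) (tc z) (?d k z) (?d l z)))" for k l
  proof (rule J_equation[OF _ equation_near(1)[where \<delta>=\<delta> and a="a k l", OF U(1,2) \<delta>]])
    show "(\<lambda>r. fibre_fun (\<delta> k) r * fibre_fun (\<delta> l) r - (\<Sum>j\<in>UNIV. a k l j (fst r) * fibre_fun (\<delta> j) r)) \<in> spectrum_equations A m e q"
      unfolding spectrum_equations_def using U(1,2) fr \<delta>1 a ma by blast
  qed (use a ma in auto)
  have En: "hmap_near (loc c e) t0" by (rule near_loc[OF openin_mspace _ e_vfield]) (use c qc chart_mspace in blast)
  have E1: "loc c e t0 $ i1 \<noteq> 0" using i1 c qc by simp
  have hn: "holo_near (\<lambda>z. ?a i z k) z0" for i k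
    by (rule holo_near_tc[where f="\<lambda>t. adc i1 (loc c e t) (axis i 1) k"], unfold adc_def tc_join, cases "k = i1")
       (auto intro!: holo_near_diff holo_near_mult holo_near_divide holo_near_const hmap_near_nth En E1)
  have "J (\<lambda>z. \<Sum>k\<in>UNIV. \<Sum>l\<in>UNIV. ?a i z k * ?a j z l *
      (dot (yc z) (?d k z) * dot (yc z) (?d l z) - dot (yc z) (mul (St c) (tc z) (?d k z) (?d l z))))"
    by (intro J_sum' J_mult holo_near_mult hn r) auto
  then show "J (\<lambda>z. yc z $ i * yc z $ j - (\<Sum>k\<in>UNIV. St c (tc z) i j k * yc z $ k))"
  proof (rule J_cong)
    show "\<forall>\<^sub>F z in nhds z0. yc z $ i * yc z $ j - (\<Sum>k\<in>UNIV. St c (tc z) i j k * yc z $ k) =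
      (\<Sum>k\<in>UNIV. \<Sum>l\<in>UNIV. ?a i z k * ?a j z l *
      (dot (yc z) (?d k z) * dot (yc z) (?d l z) - dot (yc z) (mul (St c) (tc z) (?d k z) (?d l z))))"
      using eventually_base[OF U(1,2)] eventually_tc[where z=z0, unfolded tc_join, OF holo_near_nonzero[OF hmap_near_nth[OF En] E1]]
    proof eventually_elim
      case (elim z)
      have d: "?d k z = adv i1 (loc c e (tc z)) k" for k
        unfolding loc_def by (rule bspec[OF \<delta>c, THEN spec]) (rule conjunct2[OF elim(1)])
      have ex: "axis i 1 = (\<Sum>k\<in>UNIV. ?a i z k *s ?d k z)" for i
        unfolding d by (rule adv_expand[OF elim(2), symmetric])
      have y: "yc z $ i = (\<Sum>k\<in>UNIV. ?a i z k * dot (yc z) (?d k z))" for i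
      proof -
        have "dot (yc z) (axis i 1) = dot (yc z) (\<Sum>k\<in>UNIV. ?a i z k *s ?d k z)" by (rule arg_cong[OF ex])
        then show ?thesis unfolding dot_sum dot_smult dot_axis .
      qed
      have "dot (yc z) (mul (St c) (tc z) (axis i 1) (axis j 1)) =
          dot (yc z) (mul (St c) (tc z) (\<Sum>k\<in>UNIV. ?a i z k *s ?d k z) (\<Sum>k\<in>UNIV. ?a j z k *s ?d k z))"
        by (rule arg_cong[where f="dot (yc z)"], rule arg_cong2[OF ex ex])
      also have "\<dots> = (\<Sum>l\<in>UNIV. \<Sum>k\<in>UNIV. ?a i z k * ?a j z l * dot (yc z) (mul (St c) (tc z) (?d k z) (?d l z)))"
        by (simp add: mul_linear dot_sum dot_smult sum_distrib_left mult_ac)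
      also have "\<dots> = (\<Sum>k\<in>UNIV. \<Sum>l\<in>UNIV. ?a i z k * ?a j z l * dot (yc z) (mul (St c) (tc z) (?d k z) (?d l z)))"
        by (rule sum.swap)
      finally have "(\<Sum>k\<in>UNIV. St c (tc z) i j k * yc z $ k) =
          (\<Sum>k\<in>UNIV. \<Sum>l\<in>UNIV. ?a i z k * ?a j z l * dot (yc z) (mul (St c) (tc z) (?d k z) (?d l z)))"
        by (simp add: mul_axis dot_def mult.commute)
      then show ?case
        by (simp add: y sum_product right_diff_distrib sum_subtractf mult_ac)
    qed
  qed
qed

sublocale G: germ_ideal "snd c ` fst c" "St c" "loc c e" t0 "cf c q" J
proof
  show "t0 \<in> snd c ` fst c" using qc by blast
  show "cf c q \<in> ch c t0" using spectrum_iff[OF c K(2)] qL by simp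
  fix g assume g: "J g"
  have "pull g \<in> cot.vanish_on L q" by (rule cls_vanish) (use g in \<open>simp_all add: J_def pull_Q\<close>)
  then have "\<forall>\<^sub>F z in nhds z0. yc z \<in> ch c (tc z) \<longrightarrow> pull g (chart_inv K z) = 0" unfolding vanish_iff by blast
  then show "\<forall>\<^sub>F z in nhds z0. yc z \<in> ch c (tc z) \<longrightarrow> g z = 0"
    using pull_near[of g] by eventually_elim simp
qed (rule J_add J_mult J_cong J_relations; assumption)+

text \<open>If a power of a representative vanishes on L near q, so does the representative itself,
  and the ideal contains all such germs by \<open>J_iff_vanish\<close>.\<close>

lemma spectrum_reduced: "reduced_ring SL"
  unfolding reduced_ring_def
proof (intro ballI allI impI)
  interpret S: cring SL by (rule SL_cring)
  fix s and n :: nat assume s: "s \<in> carrier SL" "s [^]\<^bsub>SL\<^esub> n = \<zero>\<^bsub>SL\<^esub>"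
  obtain f where f: "f \<in> carrier Q" "s = cls f" using s(1) unfolding SL_carrier by blast
  define g where "g = (\<lambda>z. f (chart_inv K z))"
  have g: "holo_near g z0" "cls (pull g) = s" using f cls_pull_local by (simp_all add: g_def near_Q)
  have pw: "holo_near (\<lambda>z. g z ^ k) z0 \<and> cls (pull (\<lambda>z. g z ^ k)) = s [^]\<^bsub>SL\<^esub> k" for k :: nat
  proof (induction k)
    case 0
    then show ?case using ring_hom_one[OF cls_hom] by (simp add: holo_near_const pull_simps)
  next
    case (Suc k)
    then show ?case using cls_pull_mult[of "\<lambda>z. g z ^ k" g] g
      by (simp add: holo_near_mult mult.commute)
  qed
  have "J (\<lambda>z. g z ^ n)" using pw s(2) by (simp add: J_def)
  then have "\<forall>\<^sub>F z in nhds z0. yc z \<in> ch c (tc z) \<longrightarrow> g z ^ n = 0" by (rule G.J_vanish)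
  then have "\<forall>\<^sub>F z in nhds z0. yc z \<in> ch c (tc z) \<longrightarrow> g z = 0" by eventually_elim auto
  then have "J g" using G.J_iff_vanish[OF g(1)] by blast
  then show "s = \<zero>\<^bsub>SL\<^esub>" using g(2) by (simp add: J_def)
qed

end

subsection \<open>Flatness of the spectrum\<close>

context spectrum_point
begin

abbreviation "R0 \<equiv> local_ring A (fst q)"
abbreviation "B0 \<equiv> near_ring A (fst q)"
abbreviation "h \<equiv> spectrum_pullback A m e q"

lemma fqm: "fst q \<in> mspace A"
  using chart_mspace[OF c] qc by blast

definition sg :: "(complex^'k \<Rightarrow> complex) \<Rightarrow> ('a \<Rightarrow> complex) set" where
  "sg f = germ A (fst q) (\<lambda>x. f (snd c x))"

lemma sg_near: "\<forall>\<^sub>F t in nhds t0. f (snd c (chart_inv c t)) = f t"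
proof -
  have "\<forall>\<^sub>F t in nhds t0. t \<in> snd c ` fst c"
    using c qc by (intro eventually_nhds_in_open open_chart_image) auto
  then show ?thesis by eventually_elim simp
qed

lemma sg_in: "holo_near f t0 \<Longrightarrow> (\<lambda>x. f (snd c x)) \<in> carrier B0"
  unfolding near_carrier[OF c qc] by (rule holo_near_cong[OF _ sg_near])

lemma sg_cong:
  assumes "holo_near f t0" "holo_near g t0" "\<forall>\<^sub>F t in nhds t0. f t = g t"
  shows "sg f = sg g"
  unfolding sg_def germ_eq_iff[OF c qc sg_in[OF assms(1)] sg_in[OF assms(2)]]
  using sg_near[of f] sg_near[of g] assms(3) by eventually_elim simp

lemma sg_add: "holo_near f t0 \<Longrightarrow> holo_near g t0 \<Longrightarrow> sg (\<lambda>t. f t + g t) = sg f \<oplus>\<^bsub>R0\<^esub> sg g"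
  using ring_hom_add[OF germ_hom[OF fqm] sg_in sg_in, of f g] by (simp add: sg_def)

lemma sg_mult: "holo_near f t0 \<Longrightarrow> holo_near g t0 \<Longrightarrow> sg (\<lambda>t. f t * g t) = sg f \<otimes>\<^bsub>R0\<^esub> sg g"
  using ring_hom_mult[OF germ_hom[OF fqm] sg_in sg_in, of f g] by (simp add: sg_def)

lemma sg_one: "\<one>\<^bsub>R0\<^esub> = sg (\<lambda>t. 1)"
  using ring_hom_one[OF germ_hom[OF fqm]] by (simp add: sg_def)

lemma sg_carrier: "holo_near f t0 \<Longrightarrow> sg f \<in> carrier R0"
  unfolding sg_def local_carrier by (rule imageI[OF sg_in])

lemma R0_rep:
  assumes "r \<in> carrier R0"
  obtains f where "holo_near f t0" "r = sg f"
proof -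
  obtain f where f: "f \<in> carrier B0" "r = germ A (fst q) f" using assms unfolding local_carrier by blast
  let ?g = "\<lambda>t. f (chart_inv c t)"
  have g: "holo_near ?g t0" using f(1) unfolding near_carrier[OF c qc] .
  have "r = sg ?g"
    unfolding f(2) sg_def germ_eq_iff[OF c qc f(1) sg_in[OF g]]
    using sg_near[of ?g] by eventually_elim simp
  then show ?thesis using that g by blast
qed

lemma SL_rep:
  assumes "s \<in> carrier SL"
  obtains g where "holo_near g z0" "s = cls (pull g)"
proof -
  obtain f where f: "f \<in> carrier Q" "s = cls f" using assms unfolding SL_carrier by blast
  have "holo_near (\<lambda>z. f (chart_inv K z)) z0" using f(1) unfolding near_Q .
  then show ?thesis using that cls_pull_local[OF f(1)] f(2) by metis
qed

text \<open>The pullback is a union over all representatives of a germ; they agree near the base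
  point, so the union is one germ.\<close>

lemma h_sg:
  assumes f: "holo_near f t0"
  shows "h (sg f) = cls (pull (\<lambda>z. f (tc z)))"
proof -
  let ?f = "\<lambda>x. f (snd c x)"
  let ?P = "pull (\<lambda>z. f (tc z))"
  have fB: "?f \<in> carrier B0" by (rule sg_in[OF f])
  have P: "?P \<in> carrier Q" unfolding pull_Q by (rule holo_near_tc) (use f in simp)
  have g: "germ (cot_atlas A) q (\<lambda>r. f' (fst r)) = germ (cot_atlas A) q ?P" if "f' \<in> sg f" for f'
  proof -
    have f': "f' \<in> carrier B0" "germ A (fst q) f' = germ A (fst q) ?f"
      using germ_member[OF fqm fB] that unfolding sg_def by auto
    have "\<forall>\<^sub>F t in nhds t0. f' (chart_inv c t) = f (snd c (chart_inv c t))"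
      using f'(2) unfolding germ_eq_iff[OF c qc f'(1) fB] .
    then have ev: "\<forall>\<^sub>F t in nhds t0. f' (chart_inv c t) = f t"
      using sg_near[of f] by eventually_elim simp
    show ?thesis
      unfolding germ_iff[OF base_near(1)[OF f'(1)] P]
      using eventually_tc[where z=z0, unfolded tc_join, OF ev] base_near(2)[OF f'(1)] pull_near[of "\<lambda>z. f (tc z)"]
      by eventually_elim simp
  qed
  have "sg f \<noteq> {}" using germ_self[OF fqm fB] unfolding sg_def by blast
  then have "(\<Union>f'\<in>sg f. germ (cot_atlas A) q (\<lambda>r. f' (fst r))) = germ (cot_atlas A) q ?P"
    using g by auto
  then show ?thesis unfolding spectrum_pullback_def cls_def by simp
qed

lemma tc_near: "holo_near f t0 \<Longrightarrow> holo_near (\<lambda>z. f (tc z)) z0"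
  by (rule holo_near_tc) simp

lemma pullback_hom: "h \<in> ring_hom R0 SL"
proof (rule ring_hom_memI)
  fix x assume "x \<in> carrier R0"
  then obtain f where f: "holo_near f t0" "x = sg f" by (rule R0_rep)
  show "h x \<in> carrier SL" unfolding f(2) h_sg[OF f(1)] by (rule cls_pull_carrier[OF tc_near[OF f(1)]])
  fix y assume "y \<in> carrier R0"
  then obtain g where g: "holo_near g t0" "y = sg g" by (rule R0_rep)
  note fg = f(1) g(1)
  show "h (x \<otimes>\<^bsub>R0\<^esub> y) = h x \<otimes>\<^bsub>SL\<^esub> h y"
    unfolding f(2) g(2) sg_mult[OF fg, symmetric] h_sg[OF holo_near_mult[OF fg]] h_sg[OF f(1)] h_sg[OF g(1)]
    by (rule cls_pull_mult[OF tc_near[OF f(1)] tc_near[OF g(1)]])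
  show "h (x \<oplus>\<^bsub>R0\<^esub> y) = h x \<oplus>\<^bsub>SL\<^esub> h y"
    unfolding f(2) g(2) sg_add[OF fg, symmetric] h_sg[OF holo_near_add[OF fg]] h_sg[OF f(1)] h_sg[OF g(1)]
    by (rule cls_pull_add[OF tc_near[OF f(1)] tc_near[OF g(1)]])
next
  show "h \<one>\<^bsub>R0\<^esub> = \<one>\<^bsub>SL\<^esub>"
    unfolding sg_one h_sg[OF holo_near_const] using ring_hom_one[OF cls_hom] by (simp add: pull_simps)
qed

lemma cls_eq_iff:
  assumes "holo_near f z0" "holo_near g z0"
  shows "cls (pull f) = cls (pull g) \<longleftrightarrow> J (\<lambda>z. f z - g z)"
proof -
  interpret S: cring SL by (rule SL_cring)
  have d: "holo_near (\<lambda>z. f z - g z) z0" by (intro holo_near_diff assms)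
  have "cls (pull f) = cls (pull (\<lambda>z. f z - g z)) \<oplus>\<^bsub>SL\<^esub> cls (pull g)"
    using cls_pull_add[OF d assms(2)] by simp
  then have "cls (pull f) = cls (pull g) \<longleftrightarrow> cls (pull (\<lambda>z. f z - g z)) = \<zero>\<^bsub>SL\<^esub>"
    using cls_pull_carrier[OF d] cls_pull_carrier[OF assms(2)] S.add_right_cancel[of "cls (pull (\<lambda>z. f z - g z))" "\<zero>\<^bsub>SL\<^esub>" "cls (pull g)"]
    by auto
  then show ?thesis using d by (simp add: J_def)
qed

text \<open>The k-th coefficient of the normal form of a class. By \<open>\<phi>_cls\<close> the
  chosen representative does not matter, since near t0 the normal form is determined by the
  class.\<close>

definition \<phi> :: "'k \<Rightarrow> (('a, 'k) cotpoint \<Rightarrow> complex) set set \<Rightarrow> ('a \<Rightarrow> complex) set" where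
  "\<phi> k s = sg (\<lambda>t. G.nf (SOME g. holo_near g z0 \<and> s = cls (pull g)) t $ k)"

lemma nf_near: "holo_near g z0 \<Longrightarrow> holo_near (\<lambda>t. G.nf g t $ k) t0"
  by (rule hmap_near_nth[OF G.nf(1)])

lemma \<phi>_cls:
  assumes g: "holo_near g z0"
  shows "\<phi> k (cls (pull g)) = sg (\<lambda>t. G.nf g t $ k)"
proof -
  let ?g = "SOME f. holo_near f z0 \<and> cls (pull g) = cls (pull f)"
  have g': "holo_near ?g z0 \<and> cls (pull g) = cls (pull ?g)" by (rule someI[of _ g]) (use g in simp)
  have "J (\<lambda>z. ?g z - g z)"
    by (rule iffD1[OF cls_eq_iff[OF conjunct1[OF g'] g] conjunct2[OF g', symmetric]])
  then have ev: "\<forall>\<^sub>F t in nhds t0. G.nf ?g t = G.nf g t" by (rule G.nf_cong[OF conjunct1[OF g'] g])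
  show ?thesis unfolding \<phi>_def
    by (rule sg_cong[OF nf_near[OF conjunct1[OF g']] nf_near[OF g]]) (use ev in \<open>eventually_elim, simp\<close>)
qed

text \<open>A germ is congruent to the sum of its normal form coefficients times the fibre
  coordinates, so the classes of the fibre coordinates and the functionals \<phi> form a finite dual
  basis over the local ring of the base.\<close>

lemma spectrum_flat_module: "flat_module TYPE('x) TYPE('z) R0 (restrict_scalars h SL)"
proof -
  interpret S: cring SL by (rule SL_cring)
  let ?M = "restrict_scalars h SL"
  have M: "Module.module R0 ?M"
    by (rule module_restrict_scalars[OF local_cring[OF fqm] SL_cring pullback_hom])
  interpret M: Module.module R0 ?M by (rule M)
  have Mc: "carrier ?M = carrier SL" and Ma: "x \<oplus>\<^bsub>?M\<^esub> y = x \<oplus>\<^bsub>SL\<^esub> y" and Mz: "\<zero>\<^bsub>?M\<^esub> = \<zero>\<^bsub>SL\<^esub>"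
    and Ms: "r \<odot>\<^bsub>?M\<^esub> y = h r \<otimes>\<^bsub>SL\<^esub> y" for r x y
    by (simp_all add: restrict_scalars_def)
  have yn: "holo_near (\<lambda>z. yc z $ k) z0" for k by (rule holo_near_yc)
  show ?thesis
  proof (rule flat_dual_basis[where b="\<lambda>k. cls (pull (\<lambda>z. yc z $ k))" and \<phi>=\<phi>, OF M], unfold Mc Ma Ms)
    show "cls (pull (\<lambda>z. yc z $ k)) \<in> carrier SL" for k by (rule cls_pull_carrier[OF yn])
    fix k y assume "y \<in> carrier SL"
    then obtain g where g: "holo_near g z0" "y = cls (pull g)" by (rule SL_rep)
    show "\<phi> k y \<in> carrier R0" unfolding g(2) \<phi>_cls[OF g(1)] by (rule sg_carrier[OF nf_near[OF g(1)]])
    show "\<phi> k (y \<oplus>\<^bsub>SL\<^esub> y') = \<phi> k y \<oplus>\<^bsub>R0\<^esub> \<phi> k y'" if "y' \<in> carrier SL" for y'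
    proof -
      obtain g' where g': "holo_near g' z0" "y' = cls (pull g')" using \<open>y' \<in> carrier SL\<close> by (rule SL_rep)
      note gg = holo_near_add[OF g(1) g'(1)]
      show ?thesis
        unfolding g(2) g'(2) cls_pull_add[OF g(1) g'(1), symmetric] \<phi>_cls[OF g(1)] \<phi>_cls[OF g'(1)] \<phi>_cls[OF gg]
          sg_add[OF nf_near[OF g(1)] nf_near[OF g'(1)], symmetric]
        by (rule sg_cong[OF nf_near[OF gg] holo_near_add[OF nf_near[OF g(1)] nf_near[OF g'(1)]]])
           (use G.nf_add[OF g(1) g'(1)] in \<open>eventually_elim, simp\<close>)
    qed
    show "\<phi> k (h r \<otimes>\<^bsub>SL\<^esub> y) = r \<otimes>\<^bsub>R0\<^esub> \<phi> k y" if "r \<in> carrier R0" for r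
    proof -
      obtain f where f: "holo_near f t0" "r = sg f" using \<open>r \<in> carrier R0\<close> by (rule R0_rep)
      note fg = holo_near_mult[OF tc_near[OF f(1)] g(1)]
      show ?thesis
        unfolding g(2) f(2) h_sg[OF f(1)] cls_pull_mult[OF tc_near[OF f(1)] g(1), symmetric] \<phi>_cls[OF g(1)] \<phi>_cls[OF fg]
          sg_mult[OF f(1) nf_near[OF g(1)], symmetric]
        by (rule sg_cong[OF nf_near[OF fg] holo_near_mult[OF f(1) nf_near[OF g(1)]]])
           (use G.nf_mult[OF f(1) g(1)] in \<open>eventually_elim, simp\<close>)
    qed
  next
    fix y assume "y \<in> carrier SL"
    then obtain g where g: "holo_near g z0" "y = cls (pull g)" by (rule SL_rep)
    have t: "h (\<phi> k y) \<otimes>\<^bsub>SL\<^esub> cls (pull (\<lambda>z. yc z $ k)) = cls (pull (\<lambda>z. G.nf g (tc z) $ k * yc z $ k))"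
      and n: "holo_near (\<lambda>z. G.nf g (tc z) $ k * yc z $ k) z0" for k
      unfolding g(2) \<phi>_cls[OF g(1)] h_sg[OF nf_near[OF g(1)]] cls_pull_mult[OF tc_near[OF nf_near[OF g(1)]] yn]
      by (rule refl, rule holo_near_mult[OF tc_near[OF nf_near[OF g(1)]] yn])
    have fs: "finsum ?M (\<lambda>k. cls (pull (\<lambda>z. G.nf g (tc z) $ k * yc z $ k))) I =
        cls (pull (\<lambda>z. \<Sum>k\<in>I. G.nf g (tc z) $ k * yc z $ k))" if "finite I" for I
      using that
    proof (induction I rule: finite_induct)
      case empty
      have "cls (pull (\<lambda>z. 0)) = \<zero>\<^bsub>SL\<^esub>" using G.J_zero by (simp add: J_def)
      then show ?case by (simp add: M.finsum_empty Mz)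
    next
      case (insert k I)
      have "finsum ?M (\<lambda>k. cls (pull (\<lambda>z. G.nf g (tc z) $ k * yc z $ k))) (insert k I) =
          cls (pull (\<lambda>z. G.nf g (tc z) $ k * yc z $ k)) \<oplus>\<^bsub>SL\<^esub> cls (pull (\<lambda>z. \<Sum>k\<in>I. G.nf g (tc z) $ k * yc z $ k))"
        by (subst M.finsum_insert[OF insert.hyps]) (auto simp: Mc Ma insert.IH intro!: cls_pull_carrier n)
      also have "\<dots> = cls (pull (\<lambda>z. G.nf g (tc z) $ k * yc z $ k + (\<Sum>k\<in>I. G.nf g (tc z) $ k * yc z $ k)))"
        by (rule cls_pull_add[symmetric]) (intro n holo_near_sum)+
      finally show ?case using insert.hyps by simp
    qed
    have "holo_near (\<lambda>z. dot (yc z) (G.nf g (tc z))) z0" by (rule G.near_fib[OF G.nf(1)[OF g(1)]])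
    then have "y = cls (pull (\<lambda>z. dot (yc z) (G.nf g (tc z))))"
      unfolding g(2) cls_eq_iff[OF g(1)] using G.nf(2)[OF g(1)] by (simp add: cls_eq_iff[OF g(1)])
    then show "y = finsum ?M (\<lambda>k. h (\<phi> k y) \<otimes>\<^bsub>SL\<^esub> cls (pull (\<lambda>z. yc z $ k))) UNIV"
      unfolding t fs[OF finite] by (simp add: dot_def mult.commute)
  qed
qed

end

context massive_manifold
begin

lemma spectrum_pointI:
  assumes "q \<in> L"
  obtains c where "spectrum_point A m e q c"
proof -
  have "fst q \<in> mspace A" using spectrum_mspace[OF assms] mspace_cot by blast
  then obtain c where "c \<in> A" "fst q \<in> fst c" by (rule mspaceE)
  then have "spectrum_point A m e q c" by unfold_locales (rule assms)
  then show ?thesis by (rule that)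
qed

lemma reduced: "q \<in> L \<Longrightarrow> reduced_ring (spectrum_local_ring A m e q)"
  by (erule spectrum_pointI) (rule spectrum_point.spectrum_reduced)

lemma flat: "spectrum_flat TYPE('x) TYPE('z) A m e"
  unfolding spectrum_flat_def
  by (auto elim!: spectrum_pointI intro: spectrum_point.pullback_hom spectrum_point.spectrum_flat_module)

end

section \<open>F-manifolds and commuting idempotents\<close>

lemma lb_cong:
  assumes S: "open S" "t \<in> S" and h: "hmap X' S" "hmap Y' S" and eq: "\<And>s. s \<in> S \<Longrightarrow> X s = X' s" "\<And>s. s \<in> S \<Longrightarrow> Y s = Y' s"
  shows "lb X Y t = lb X' Y' t"
proof -
  have "pd i (\<lambda>s. X s $ k) t = pd i (\<lambda>s. X' s $ k) t" "pd i (\<lambda>s. Y s $ k) t = pd i (\<lambda>s. Y' s $ k) t" for i k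
    by (rule pd_cong[OF S _ hmap_nth[OF h(1)]], simp add: eq, rule pd_cong[OF S _ hmap_nth[OF h(2)]], simp add: eq)
  then show ?thesis using eq[OF S(2)] by (simp add: lb_def der_def)
qed

lemma sheets_sem:
  fixes l :: "'n::finite \<Rightarrow> complex^'n"
  assumes "range l = chars a E t" "\<forall>i j. dot (l i) (\<epsilon> j) = (if i = j then 1 else 0)"
  shows "sem a E t"
proof -
  have "inj l" by (rule injI) (metis assms(2) zero_neq_one)
  then show ?thesis unfolding sem_def using assms(1) by (intro exI[of _ l]) simp
qed

context massive_manifold
begin

lemma vfields_eq_chart:
  assumes c: "c \<in> A" "U \<subseteq> fst c" and X: "X \<in> vfields A U" "Y \<in> vfields A U" and eq: "\<And>p. p \<in> U \<Longrightarrow> X p c = Y p c"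
  shows "X = Y"
proof
  fix p
  show "X p = Y p"
  proof (cases "p \<in> U")
    case True
    then show ?thesis
      using tangent_eqI[OF c(1) _ vfields_tangent[OF X(1) True] vfields_tangent[OF X(2) True] eq[OF True]] c(2) by blast
  qed (simp add: vfields_outside[OF X(1)] vfields_outside[OF X(2)])
qed

text \<open>The idempotents are the frame dual to the sheets; their multiplication table and their
  sum are checked on the characters, which separate here.\<close>

lemma idempotents_exist:
  assumes p: "p \<in> mspace A - caustic A m"
  obtains U \<epsilon> where "idempotents_at A m e p U \<epsilon>"
proof -
  obtain U c N \<epsilon> l where c: "c \<in> A" "p \<in> fst c" and N: "open N" "snd c p \<in> N" "N \<subseteq> snd c ` fst c"
    and U: "U = {q \<in> fst c. snd c q \<in> N}" and h\<epsilon>: "\<forall>i :: 'k. hmap (\<epsilon> i) N" and hl: "\<forall>i :: 'k. hmap (l i) N"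
    and rl: "\<forall>t\<in>N. range (\<lambda>i. l i t) = ch c t" and le: "\<forall>t\<in>N. \<forall>i j. dot (l i t) (\<epsilon> j t) = (if i = j then 1 else 0)"
    by (rule spectrum_sheets[OF p])
  have oU: "openin (mtop A) U" unfolding U by (rule openin_preimage[OF c(1) N(1)])
  have Uc: "U \<subseteq> fst c" using U by blast
  have UN: "snd c q \<in> N" if "q \<in> U" for q using that U by blast
  let ?\<epsilon> = "\<lambda>i. mkf c U (\<epsilon> i)"
  have v: "?\<epsilon> i \<in> vfields A U" for i
    by (rule mkf_vfields[OF c(1) oU Uc hmap_subset[OF spec[OF h\<epsilon>]]]) (use UN in blast)
  have \<epsilon>c: "?\<epsilon> i q c = \<epsilon> i (snd c q)" if "q \<in> U" for i q by (rule mkf_apply[OF c(1) Uc that])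
  have sem: "sem (St c) (loc c e) t" if t: "t \<in> N" for t
    by (rule sheets_sem[OF bspec[OF rl t] bspec[OF le t]])
  have eqI: "x = y" if t: "t \<in> N" and xy: "\<And>k. dot (l k t) x = dot (l k t) y" for t x y
  proof (rule sem_separate[OF sem[OF t]])
    fix \<psi> assume "\<psi> \<in> ch c t"
    then obtain k where "\<psi> = l k t" using bspec[OF rl t] by blast
    then show "dot \<psi> x = dot \<psi> y" using xy by simp
  qed
  have lc: "l k t \<in> ch c t" if "t \<in> N" for k t using bspec[OF rl that] by blast
  have pU: "p \<in> U" using U c N by blast
  have "idempotents_at A m e p U ?\<epsilon>"
    unfolding idempotents_at_def
  proof (intro conjI allI oU pU v)
    show "?\<epsilon> i p \<noteq> 0" for i
    proof
      assume "?\<epsilon> i p = 0"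
      then have "\<epsilon> i (snd c p) = 0" using \<epsilon>c[OF pU, of i] by simp
      then show False using le N(2) dot_zero[of "l i (snd c p)"] by (metis zero_neq_one)
    qed
    show "m U (?\<epsilon> i) (?\<epsilon> j) = (if i = j then ?\<epsilon> i else 0)" for i j
    proof (rule vfields_eq_chart[OF c(1) Uc m_closed[OF oU v v]])
      show "(if i = j then ?\<epsilon> i else 0) \<in> vfields A U" using v vfields_zero[OF open_sub[OF oU]] by simp
      fix q assume q: "q \<in> U"
      show "m U (?\<epsilon> i) (?\<epsilon> j) q c = (if i = j then ?\<epsilon> i else 0) q c"
        unfolding mult_loc[OF oU v v c(1) q subsetD[OF Uc q]] \<epsilon>c[OF q]
        by (rule eqI[OF UN[OF q]]) (use le UN[OF q] in \<open>simp add: chars_mul[OF lc[OF UN[OF q]]] \<epsilon>c[OF q] dot_zero\<close>)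
    qed
    show "(\<Sum>i\<in>UNIV. ?\<epsilon> i) = vrestrict U e"
    proof (rule vfields_eq_chart[OF c(1) Uc vfields_sum[OF open_sub[OF oU] v] vfields_restrict[OF e_vfield oU open_sub[OF oU]]])
      fix q assume q: "q \<in> U"
      have "(\<Sum>i\<in>UNIV. \<epsilon> i (snd c q)) = loc c e (snd c q)"
        by (rule eqI[OF UN[OF q]]) (use le UN[OF q] in \<open>simp add: dot_sum chars_unit[OF lc[OF UN[OF q]]]\<close>)
      then show "(\<Sum>i\<in>UNIV. ?\<epsilon> i) q c = vrestrict U e q c"
        using q Uc c(1) by (auto simp: sum_fun_apply \<epsilon>c vrestrict_def)
    qed
  qed
  then show ?thesis by (rule that)
qed

lemma vfields_doubling:
  assumes U: "openin (mtop A) U" and E: "E \<in> vfields A U" "m U E E = E" and X: "X \<in> vfields A U" "X = m U E X + m U E X"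
  shows "X = 0"
proof
  fix p
  show "X p = 0 p"
  proof (cases "p \<in> U")
    case True
    then have p: "p \<in> mspace A" using open_sub[OF U] by blast
    then obtain c where c: "c \<in> A" "p \<in> fst c" by (rule mspaceE)
    interpret F: alg_family "snd c ` fst c" "St c" "loc c e" by (rule alg_family[OF c(1)])
    have "X p c = 0"
    proof (rule F.idempotent_doubling)
      show "snd c p \<in> snd c ` fst c" using c by blast
      show "mul (St c) (snd c p) (E p c) (E p c) = E p c"
        using mult_loc[OF U E(1,1) c(1) True c(2)] E(2) by simp
      have "X p c = (m U E X + m U E X) p c" by (rule arg_cong[OF X(2)])
      then show "X p c = mul (St c) (snd c p) (E p c) (X p c) + mul (St c) (snd c p) (E p c) (X p c)"
        using mult_loc[OF U E(1) X(1) c(1) True c(2)] by simp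
    qed
    then show ?thesis
      using tangent_eqI[OF c vfields_tangent[OF X(1) True] tangent_zero[OF p]] by simp
  qed (simp add: vfields_outside[OF X(1)])
qed

lemma lie_mult_vfields:
  assumes "openin (mtop A) U" "X \<in> vfields A U" "Z \<in> vfields A U" "W \<in> vfields A U"
  shows "lie_mult A m U X Z W \<in> vfields A U"
  unfolding lie_mult_def by (intro vfields_diff open_sub bracket_vfields m_closed assms)

lemma F_manifold_idempotents:
  assumes "F_manifold A m e"
  shows "idempotents_commute A m e"
  unfolding idempotents_commute_def
proof (intro ballI conjI allI impI)
  fix p assume p: "p \<in> mspace A - caustic A m"
  show "\<exists>U \<epsilon>. idempotents_at A m e p U \<epsilon>" using idempotents_exist[OF p] by blast
  fix U \<epsilon> assume "idempotents_at A m e p U \<epsilon>"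
  then have U: "openin (mtop A) U" "p \<in> U" and v: "\<And>i. \<epsilon> i \<in> vfields A U"
    and id: "\<And>i. m U (\<epsilon> i) (\<epsilon> i) = \<epsilon> i"
    unfolding idempotents_at_def by auto
  have F: "lie_mult A m U (m U X Y) Z W = m U X (lie_mult A m U Y Z W) + m U Y (lie_mult A m U X Z W)"
    if "X \<in> vfields A U" "Y \<in> vfields A U" "Z \<in> vfields A U" "W \<in> vfields A U" for X Y Z W
    using assms U(1) that unfolding F_manifold_def by blast
  have "bracket A U (\<epsilon> i) (\<epsilon> j) = 0" for i j
  proof -
    \<comment> \<open>The F-manifold identity with both fields equal to \<open>\<epsilon> i\<close>
      says that this Lie derivative is twice its own product with
      \<open>\<epsilon> i\<close>.\<close>
    have "lie_mult A m U (\<epsilon> i) (\<epsilon> j) (\<epsilon> j) = 0"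
      by (rule vfields_doubling[OF U(1) v id lie_mult_vfields[OF U(1) v v v]])
         (use F[OF v v v v, of i i j j] in \<open>simp only: id\<close>)
    moreover have "m U (bracket A U (\<epsilon> i) (\<epsilon> j)) (\<epsilon> j) = m U (\<epsilon> j) (bracket A U (\<epsilon> i) (\<epsilon> j))"
      by (rule m_commute[OF U(1) bracket_vfields[OF U(1) v v] v])
    ultimately have "bracket A U (\<epsilon> i) (\<epsilon> j) = m U (\<epsilon> j) (bracket A U (\<epsilon> i) (\<epsilon> j)) + m U (\<epsilon> j) (bracket A U (\<epsilon> i) (\<epsilon> j))"
      unfolding lie_mult_def id by (simp add: algebra_simps)
    then show ?thesis by (rule vfields_doubling[OF U(1) v id bracket_vfields[OF U(1) v v]])
  qed
  then show "germs_commute_at A p U \<epsilon>"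
    unfolding germs_commute_at_def using U by (auto simp: vrestrict_def fun_eq_iff)
qed

text \<open>The pivot of the equivalences. Quantifying over all local holomorphic choices of a
  character, instead of one fixed frame, lets each condition be tested with whatever sections it
  provides or demands.\<close>

definition sheets_closed :: bool where
  "sheets_closed \<longleftrightarrow> (\<forall>c\<in>A. \<forall>N l t. open N \<longrightarrow> N \<subseteq> snd c ` fst c \<longrightarrow> hmap l N \<longrightarrow>
     (\<forall>s\<in>N. l s \<in> ch c s) \<longrightarrow> t \<in> N \<longrightarrow> sem (St c) (loc c e) t \<longrightarrow> closed_at l t)"

lemma idempotents_sheets_closed:
  assumes "idempotents_commute A m e"
  shows "sheets_closed"
  unfolding sheets_closed_def
proof (intro ballI allI impI)
  fix c N l t
  assume c: "c \<in> A" and N: "open N" "N \<subseteq> snd c ` fst c" and l: "hmap l N" "\<forall>s\<in>N. l s \<in> ch c s"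
    and t: "t \<in> N" "sem (St c) (loc c e) t"
  interpret F: alg_family "snd c ` fst c" "St c" "loc c e" by (rule alg_family[OF c])
  obtain p where p: "p \<in> fst c" "snd c p = t" using N(2) t(1) by blast
  have pm: "p \<in> mspace A" using chart_mspace[OF c] p(1) by blast
  have pk: "p \<in> mspace A - caustic A m" using semisimple_iff[OF c p(1)] t(2) p(2) pm by (simp add: caustic_def)
  obtain U \<epsilon> where id: "idempotents_at A m e p U \<epsilon>" using idempotents_exist[OF pk] .
  then have com: "germs_commute_at A p U \<epsilon>" using assms pk unfolding idempotents_commute_def by blast
  have U: "openin (mtop A) U" "p \<in> U" and v: "\<And>i. \<epsilon> i \<in> vfields A U" and nz: "\<And>i. \<epsilon> i p \<noteq> 0"
    and mm: "\<And>i j. m U (\<epsilon> i) (\<epsilon> j) = (if i = j then \<epsilon> i else 0)"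
    using id unfolding idempotents_at_def by blast+
  let ?M = "N \<inter> snd c ` (U \<inter> fst c)"
  have oM: "open ?M" by (intro open_Int N open_image U c)
  have tM: "t \<in> ?M" using t(1) p U(2) by blast
  show "closed_at l t"
  proof (rule F.commuting_idempotents_closed[OF oM _ tM, where e="\<lambda>i. loc c (\<epsilon> i)"])
    show "?M \<subseteq> snd c ` fst c" using N(2) by blast
    show "hmap l ?M" by (rule hmap_subset[OF l(1)]) blast
    show "l s \<in> ch c s" if "s \<in> ?M" for s using l(2) that by blast
    show "hmap (loc c (\<epsilon> i)) ?M" for i by (rule hmap_subset[OF vfields_hmap[OF v c]]) blast
    show "mul (St c) s (loc c (\<epsilon> i) s) (loc c (\<epsilon> j) s) = (if i = j then loc c (\<epsilon> i) s else 0)" if s: "s \<in> ?M" for s i j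
    proof -
      obtain x where x: "x \<in> U" "x \<in> fst c" "s = snd c x" using s by blast
      have "mul (St c) s (loc c (\<epsilon> i) s) (loc c (\<epsilon> j) s) = m U (\<epsilon> i) (\<epsilon> j) x c"
        using mult_loc[OF U(1) v v c x(1,2)] x c by simp
      then show ?thesis using x c by (simp add: mm)
    qed
    show "loc c (\<epsilon> i) t \<noteq> 0" for i
    proof
      assume "loc c (\<epsilon> i) t = 0"
      then have "\<epsilon> i p c = 0 c" using p c by auto
      then have "\<epsilon> i p = 0" by (rule tangent_eqI[OF c p(1) vfields_tangent[OF v U(2)] tangent_zero[OF pm]])
      then show False using nz by blast
    qed
    show "lb (loc c (\<epsilon> i)) (loc c (\<epsilon> j)) t = 0" for i j
    proof -
      obtain V where V: "p \<in> V" "vrestrict V (bracket A U (\<epsilon> i) (\<epsilon> j)) = 0"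
        using com unfolding germs_commute_at_def by blast
      have "bracket A U (\<epsilon> i) (\<epsilon> j) p = 0" using fun_cong[OF V(2), of p] V(1) by (simp add: vrestrict_def)
      then show ?thesis using bracket_loc[OF U(1) v v c U(2) p(1), of i j] p(2) by simp
    qed
  qed
qed

text \<open>Both sides are holomorphic fields, so they may be compared over semisimple points, where
  the sheets give a full set of closed characters.\<close>

lemma sheets_closed_F:
  assumes C: sheets_closed
    and U: "openin (mtop A) U" and X: "X \<in> vfields A U" and Y: "Y \<in> vfields A U" and Z: "Z \<in> vfields A U" and W: "W \<in> vfields A U"
  shows "lie_mult A m U (m U X Y) Z W = m U X (lie_mult A m U Y Z W) + m U Y (lie_mult A m U X Z W)"
    (is "?L = ?R")
proof (rule vfields_eqI[OF open_sub[OF U]])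
  note Lv = lie_mult_vfields[OF U]
  show Lf: "?L \<in> vfields A U" by (intro Lv m_closed U X Y Z W)
  show Rf: "?R \<in> vfields A U" by (intro vfields_add open_sub m_closed Lv U X Y Z W)
  fix x c assume x: "x \<in> U" and c: "c \<in> A" "x \<in> fst c"
  interpret F: alg_family "snd c ` fst c" "St c" "loc c e" by (rule alg_family[OF c(1)])
  let ?S = "snd c ` (U \<inter> fst c)"
  have oS: "open ?S" by (rule open_image[OF U c(1)])
  have SO: "?S \<subseteq> snd c ` fst c" by blast
  note h = vfields_hmap[OF _ c(1)]
  have ml: "loc c (m U V T) s = mul (St c) s (loc c V s) (loc c T s)"
    if "V \<in> vfields A U" "T \<in> vfields A U" "s \<in> ?S" for V T s
    using that mult_loc[OF U that(1,2) c(1)] c(1) by auto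
  have bl: "loc c (bracket A U V T) s = lb (loc c V) (loc c T) s"
    if "V \<in> vfields A U" "T \<in> vfields A U" "s \<in> ?S" for V T s
    using that bracket_loc[OF U that(1,2) c(1)] c(1) by auto
  have ll: "loc c (lie_mult A m U V S T) s = F.lie (loc c V) (loc c S) (loc c T) s"
    if V: "V \<in> vfields A U" and S: "S \<in> vfields A U" and T: "T \<in> vfields A U" and s: "s \<in> ?S" for V S T s
  proof -
    have "lb (loc c V) (loc c (m U S T)) s = lb (loc c V) (\<lambda>s. mul (St c) s (loc c S s) (loc c T s)) s"
      by (rule lb_cong[OF oS s h[OF V] F.hmap_mul[OF SO h[OF S] h[OF T]] refl]) (rule ml[OF S T])
    moreover have "loc c (lie_mult A m U V S T) s = loc c (bracket A U V (m U S T)) s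
        - loc c (m U (bracket A U V S) T) s - loc c (m U S (bracket A U V T)) s"
      by (simp add: lie_mult_def loc_def)
    ultimately show ?thesis
      by (simp add: F.lie_def ml bl s V S T m_closed bracket_vfields U)
  qed
  have hmul: "F.lie (loc c (m U X Y)) (loc c Z) (loc c W) s = F.lie (\<lambda>s. mul (St c) s (loc c X s) (loc c Y s)) (loc c Z) (loc c W) s"
    if s: "s \<in> ?S" for s
  proof -
    have hm: "hmap (\<lambda>s. mul (St c) s (loc c X s) (loc c Y s)) ?S" by (rule F.hmap_mul[OF SO h[OF X] h[OF Y]])
    have "lb (loc c (m U X Y)) T s = lb (\<lambda>s. mul (St c) s (loc c X s) (loc c Y s)) T s" if "hmap T ?S" for T
      by (rule lb_cong[OF oS s hm that ml[OF X Y] refl])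
    then show ?thesis by (simp add: F.lie_def h[OF Z] h[OF W] F.hmap_mul[OF SO])
  qed
  have "loc c ?L (snd c x) = loc c ?R (snd c x)"
  proof (rule F.dense_separate[OF oS SO h[OF Lf] h[OF Rf]])
    show "snd c x \<in> ?S" using x c by blast
    fix s \<psi> assume s: "s \<in> ?S" and sm: "sem (St c) (loc c e) s"
    obtain N \<epsilon> l where N: "open N" "s \<in> N" "N \<subseteq> snd c ` fst c" and hl: "\<forall>i :: 'k. hmap (l i) N"
      and rl: "\<forall>t\<in>N. range (\<lambda>i. l i t) = ch c t"
      by (rule F.local_frame[OF subsetD[OF SO s] sm])
    let ?N = "N \<inter> ?S"
    have lc: "l i t \<in> ch c t" if "t \<in> N" for i t using bspec[OF rl that] by blast
    have hN: "hmap (loc c V) ?N" if "V \<in> vfields A U" for V by (rule hmap_subset[OF h[OF that]]) blast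
    have "F.lie (\<lambda>s. mul (St c) s (loc c X s) (loc c Y s)) (loc c Z) (loc c W) s =
        mul (St c) s (loc c X s) (F.lie (loc c Y) (loc c Z) (loc c W) s) + mul (St c) s (loc c Y s) (F.lie (loc c X) (loc c Z) (loc c W) s)"
    proof (rule F.lie_derivation[where U="?N" and l=l])
      show "closed_at (l i) s" for i
        using C c(1) N hl lc sm unfolding sheets_closed_def by blast
      show "ch c s \<subseteq> range (\<lambda>i. l i s)" using bspec[OF rl N(2)] by simp
      show "hmap (l i) ?N" for i by (rule hmap_subset[OF spec[OF hl]]) blast
    qed (use N oS s sm lc hN X Y Z W in auto)
    moreover have "loc c ?R s = loc c (m U X (lie_mult A m U Y Z W)) s + loc c (m U Y (lie_mult A m U X Z W)) s"
      by (simp add: loc_def)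
    ultimately have "loc c ?L s = loc c ?R s"
      by (simp only: ll[OF m_closed[OF U X Y] Z W s] hmul[OF s] ml[OF X Lv[OF Y Z W] s] ml[OF Y Lv[OF X Z W] s]
          ll[OF Y Z W s] ll[OF X Z W s])
    then show "dot \<psi> (loc c ?L s) = dot \<psi> (loc c ?R s)" by simp
  qed
  then show "?L x c = ?R x c" using c by simp
qed

end

section \<open>The canonical form on the spectrum\<close>

text \<open>Only values along the coordinate line through z matter; this allows comparing functions
  that agree on a coordinate plane and not on an open set.\<close>

lemma pd_along:
  assumes f: "holo f S" "holo g S" "z \<in> S" and eq: "\<forall>\<^sub>F u in nhds 0. f (z + u *s axis j 1) = g (z + u *s axis j 1)"
  shows "pd j f z = pd j g z"
proof -
  have d: "((\<lambda>u. h (z + u *s axis j 1)) has_field_derivative pd j h z) (at 0)" if "holo h S" for h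
    using holo_line[OF that, of z 0 "axis j 1"] f(3) by (simp add: axis_def mult_delta_left)
  have "((\<lambda>u. f (z + u *s axis j 1)) has_field_derivative pd j g z) (at 0)"
    using DERIV_cong_ev[OF refl eq refl] d[OF f(2)] by blast
  then show ?thesis using DERIV_unique[OF d[OF f(1)]] by blast
qed

context atlas
begin

text \<open>Used to straighten a sheet of L. Overlaps with the charts of the atlas factor through K,
  so only \<Phi>, \<Psi> and transition maps of K occur.\<close>

lemma compatible_chart_compose:
  assumes K: "K \<in> A" and N: "open N" "N \<subseteq> snd K ` fst K" and \<Phi>: "hmap \<Phi> N" "open (\<Phi> ` N)" "hmap \<Psi> (\<Phi> ` N)" "\<And>z. z \<in> N \<Longrightarrow> \<Psi> (\<Phi> z) = z"
  shows "compatible_chart A ({r \<in> fst K. snd K r \<in> N}, \<lambda>r. \<Phi> (snd K r))" (is "compatible_chart A ?c")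
proof -
  let ?D = "{r \<in> fst K. snd K r \<in> N}"
  have Dm: "?D \<subseteq> mspace A" using chart_mspace[OF K] by blast
  have inj: "inj_on (snd ?c) (fst ?c)"
    by (rule inj_on_inverseI[of _ "\<lambda>w. chart_inv K (\<Psi> w)"]) (use K \<Phi>(4) in auto)
  have inv: "chart_inv ?c (\<Phi> (snd K r)) = r" if "r \<in> ?D" for r
    using inv_into_f_f[OF inj, of r] that unfolding chart_inv_def by simp
  have inv': "chart_inv ?c w = chart_inv K (\<Psi> w)" if w: "w \<in> \<Phi> ` N" for w
  proof -
    obtain z where z: "z \<in> N" "w = \<Phi> z" using w by blast
    obtain r where r: "r \<in> fst K" "z = snd K r" using z(1) N(2) by blast
    then show ?thesis using inv[of r] z K \<Phi>(4) by simp
  qed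
  \<comment> \<open>Images under \<Phi> become preimages under \<Psi>, and those of open sets are
    open by continuity.\<close>
  have im: "\<Phi> ` M = \<Phi> ` N \<inter> \<Psi> -` M" if "M \<subseteq> N" for M
  proof (rule Set.set_eqI, rule iffI)
    fix w assume "w \<in> \<Phi> ` M"
    then obtain z where "z \<in> M" "w = \<Phi> z" by blast
    then show "w \<in> \<Phi> ` N \<inter> \<Psi> -` M" using \<Phi>(4)[of z] that by auto
  next
    fix w assume w: "w \<in> \<Phi> ` N \<inter> \<Psi> -` M"
    then obtain z where "z \<in> N" "w = \<Phi> z" by blast
    then show "w \<in> \<Phi> ` M" using w \<Phi>(4)[of z] by auto
  qed
  have oim: "open (\<Phi> ` M)" if "open M" "M \<subseteq> N" for M
    unfolding im[OF that(2)]
    by (rule continuous_open_preimage[OF hmap_continuous_on[OF \<Phi>(3)] \<Phi>(2) that(1)])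
  have simg: "snd ?c ` (?D \<inter> S) = \<Phi> ` (snd K ` (?D \<inter> S))" for S by (auto simp: image_image)
  have oD: "openin (mtop A) ?D" by (rule openin_preimage[OF K N(1)])
  have ov: "open (snd ?c ` (?D \<inter> fst d))" and h1: "hmap (\<lambda>w. snd d (chart_inv ?c w)) (snd ?c ` (?D \<inter> fst d))"
    and ov': "open (snd d ` (fst d \<inter> ?D))" and h2: "hmap (\<lambda>w. snd ?c (chart_inv d w)) (snd d ` (fst d \<inter> ?D))" if d: "d \<in> A" for d
  proof -
    have oM: "open (snd K ` (?D \<inter> fst d))"
      by (rule open_image_sub[OF openin_Int[OF oD openin_chart[OF d]] K]) blast
    show ov: "open (snd ?c ` (?D \<inter> fst d))" unfolding simg by (rule oim[OF oM]) auto
    have sub: "snd ?c ` (?D \<inter> fst d) \<subseteq> \<Phi> ` N" by auto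
    have "hmap (\<lambda>w. snd d (chart_inv K (\<Psi> w))) (snd ?c ` (?D \<inter> fst d))"
      by (rule hmap_compose[OF hmap_subset[OF \<Phi>(3) sub] hmap_trans[OF K d]]) (auto simp: \<Phi>(4))
    then show "hmap (\<lambda>w. snd d (chart_inv ?c w)) (snd ?c ` (?D \<inter> fst d))"
      by (rule hmap_cong[OF ov, rotated]) (use inv' sub in auto)
    show ov': "open (snd d ` (fst d \<inter> ?D))" using open_image[OF oD d] by (simp only: Int_commute)
    have "hmap (\<lambda>w. \<Phi> (snd K (chart_inv d w))) (snd d ` (fst d \<inter> ?D))"
      by (rule hmap_compose[OF hmap_subset[OF hmap_trans[OF d K]] \<Phi>(1)]) (use d in auto)
    then show "hmap (\<lambda>w. snd ?c (chart_inv d w)) (snd d ` (fst d \<inter> ?D))" by simp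
  qed
  have ovc: "open (snd ?c ` (?D \<inter> ?D))"
  proof -
    have "snd ?c ` (?D \<inter> ?D) = \<Phi> ` N" using N(2) by (auto simp: image_iff)
    then show ?thesis using \<Phi>(2) by simp
  qed
  have hc: "hmap (\<lambda>w. snd ?c (chart_inv ?c w)) (snd ?c ` (?D \<inter> ?D))"
    by (rule hmap_cong[OF ovc _ hmap_id]) (use inv in auto)
  show ?thesis
    unfolding compatible_chart_def complex_atlas_def
  proof (intro conjI ballI)
    show "fst ?c \<subseteq> mspace A" using Dm by simp
    show "inj_on (snd c) (fst c)" if "c \<in> insert ?c A" for c using that inj chart_inj by blast
    have "open (snd c ` (fst c \<inter> fst d)) \<and> hmap (\<lambda>z. snd d (chart_inv c z)) (snd c ` (fst c \<inter> fst d))"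
      if cd: "c \<in> insert ?c A" "d \<in> insert ?c A" for c d
    proof (cases "c \<in> A")
      case True
      show ?thesis
      proof (cases "d \<in> A")
        case False
        then have "d = ?c" using cd by blast
        then show ?thesis using ov'[OF True] h2[OF True] by simp
      qed (use True open_overlap hmap_trans in blast)
    next
      case False
      then have c: "c = ?c" using cd by blast
      show ?thesis
      proof (cases "d \<in> A")
        case True
        then show ?thesis using ov[OF True] h1[OF True] unfolding c by simp
      next
        case False
        then have "d = ?c" using cd by blast
        then show ?thesis using ovc hc unfolding c by simp
      qed
    qed
    then show "open (snd c ` (fst c \<inter> fst d))" "\<forall>i. holo (\<lambda>z. snd d (chart_inv c z) $ i) (snd c ` (fst c \<inter> fst d))"
      if "c \<in> insert ?c A" "d \<in> insert ?c A" for c d using that unfolding hmap_def by blast+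
  qed
qed

end

context mult_manifold
begin

text \<open>In bundle charts the projection is the map \<open>tc\<close>, so its differential keeps
  the base components of a tangent vector.\<close>

lemma canonical_form_cot:
  assumes d: "d \<in> A" and q: "q \<in> fst (cot_chart A d)" and \<xi>: "\<xi> \<in> tangent_space (cot_atlas A) q"
  shows "canonical_form A q \<xi> = dot (cf d q) (tc (\<xi> (cot_chart A d)))"
proof -
  define v where "v = tangent_map (cot_atlas A) A fst q \<xi>"
  have qd: "fst q \<in> fst d" "snd q \<in> cotangent_space A (fst q)" using q by (auto simp: fst_cot_chart)
  have \<xi>j: "\<xi> L' = cot.jac K L' q (\<xi> K)" if "K \<in> cot_atlas A" "L' \<in> cot_atlas A" "q \<in> fst K" "q \<in> fst L'" for K L'
    using \<xi> that unfolding tangent_space_def by blast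
  have qc: "q \<in> fst (cot_chart A c)" if "fst q \<in> fst c" for c using that qd(2) by (simp add: fst_cot_chart)
  have vd: "v c = tc (\<xi> (cot_chart A c))" if c: "c \<in> A" "fst q \<in> fst c" for c
  proof -
    \<comment> \<open>The chart picked inside \<open>tangent_map\<close>; the transformation rule
      for \<xi> makes the result independent of it.\<close>
    define C where "C = (SOME C. C \<in> cot_atlas A \<and> q \<in> fst C)"
    have C: "C \<in> cot_atlas A" "q \<in> fst C"
      using someI[of "\<lambda>C. C \<in> cot_atlas A \<and> q \<in> fst C" "cot_chart A d"] cot_chart_in[OF d] q unfolding C_def by blast+
    let ?F = "\<lambda>z. tc (snd (cot_chart A c) (chart_inv C z))"
    let ?S = "snd C ` (fst C \<inter> fst (cot_chart A c))"
    have zS: "snd C q \<in> ?S" using C(2) qc[OF c(2)] by blast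
    have hF: "hmap ?F ?S"
      by (rule hmapI, unfold tc_nth) (rule hmap_nth[OF cot.hmap_trans[OF C(1) cot_chart_in[OF c(1)]]])
    have "v c = frechet_derivative ?F (at (snd C q)) (\<xi> C)"
      using c by (simp add: v_def tangent_map_def C_def[symmetric] Let_def snd_cot_chart)
    moreover have "frechet_derivative ?F (at (snd C q)) (\<xi> C) $ i = \<xi> (cot_chart A c) $ Inl i" for i
      unfolding hmap_frechet[OF hF zS] tc_nth \<xi>j[OF C(1) cot_chart_in[OF c(1)] C(2) qc[OF c(2)]]
        cot.jac_nth[OF C(1) cot_chart_in[OF c(1)] C(2) qc[OF c(2)]] der_def ..
    ultimately show ?thesis by (simp add: vec_eq_iff tc_nth)
  qed
  have "v \<in> tangent_space A (fst q)"
    unfolding tangent_space_def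
  proof (rule CollectI, intro conjI ballI impI allI)
    show "v c = 0" if "\<not> (c \<in> A \<and> fst q \<in> fst c)" for c using that by (auto simp: v_def tangent_map_def)
    fix c c2 assume c: "c \<in> A" "c2 \<in> A" "fst q \<in> fst c" "fst q \<in> fst c2"
    let ?K = "cot_chart A c" and ?K2 = "cot_chart A c2"
    note k = cot_chart_in[OF c(1)] cot_chart_in[OF c(2)] qc[OF c(3)] qc[OF c(4)]
    let ?S = "snd ?K ` (fst ?K \<inter> fst ?K2)"
    have S: "open ?S" "snd ?K q \<in> ?S" using cot.open_overlap[OF k(1,2)] k(3,4) by auto
    have tS: "tc z \<in> snd c ` (fst c \<inter> fst c2)" if "z \<in> ?S" for z
      using that by (auto simp: fst_cot_chart snd_cot_chart)
    have "v c2 $ i = jac c c2 (fst q) (v c) $ i" for i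
    proof -
      let ?g = "\<lambda>t. snd c2 (chart_inv c t) $ i"
      have hg: "holo ?g (snd c ` (fst c \<inter> fst c2))" by (rule hmap_nth[OF hmap_trans[OF c(1,2)]])
      have pdt: "pd s (\<lambda>z. snd ?K2 (chart_inv ?K z) $ Inl i) (snd ?K q) = pd s (\<lambda>z. ?g (tc z)) (snd ?K q)" for s
      proof (rule pd_cong[OF S])
        show "holo (\<lambda>z. ?g (tc z)) ?S" by (rule holo_compose[OF hmap_tc hg tS])
        fix z assume z: "z \<in> ?S"
        have "tc z \<in> snd c ` fst c" using tS[OF z] by blast
        then show "snd ?K2 (chart_inv ?K z) $ Inl i = ?g (tc z)"
          using cot_chart_inv[OF c(1)] by (simp add: snd_cot_chart pt_def join_def)
      qed
      have dt: "der w (\<lambda>z. tc z $ j) x = w $ Inl j" for w :: "complex^('k + 'k)" and j x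
        by (simp add: der_def tc_nth pd_coord mult_delta_right)
      have "v c2 $ i = der (\<xi> ?K) (\<lambda>z. snd ?K2 (chart_inv ?K z) $ Inl i) (snd ?K q)"
        unfolding vd[OF c(2,4)] tc_nth \<xi>j[OF k] cot.jac_nth[OF k] ..
      also have "\<dots> = der (\<xi> ?K) (\<lambda>z. ?g (tc z)) (snd ?K q)" by (simp add: der_def pdt)
      also have "\<dots> = der (\<chi> j. der (\<xi> ?K) (\<lambda>z. tc z $ j) (snd ?K q)) ?g (tc (snd ?K q))"
        by (rule der_compose[OF hmap_tc hg S(2) tS[OF S(2)]])
      also have "(\<chi> j. der (\<xi> ?K) (\<lambda>z. tc z $ j) (snd ?K q)) = v c"
        unfolding vd[OF c(1,3)] dt by (simp add: vec_eq_iff tc_nth)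
      finally show ?thesis unfolding jac_nth[OF c] by (simp add: snd_cot_chart)
    qed
    then show "v c2 = jac c c2 (fst q) (v c)" by (simp add: vec_eq_iff)
  qed
  then show ?thesis
    using cotangent_dot[OF d qd] vd[OF d qd(1)] unfolding canonical_form_def v_def[symmetric] by simp
qed

text \<open>In coordinates \<open>(t, y)\<close> of the cotangent bundle the form is \<open>\<Sum>\<^sub>i y\<^sub>i dt\<^sub>i\<close>, so its exterior derivative is
  \<open>\<Sum>\<^sub>i dy\<^sub>i \<and> dt\<^sub>i\<close>.\<close>

lemma form_partial_diff:
  assumes c': "compatible_chart (cot_atlas A) c'" and d: "d \<in> A" and x: "x \<in> fst c'" "x \<in> fst (cot_chart A d)"
  defines "T \<equiv> \<lambda>z. snd (cot_chart A d) (chart_inv c' z)"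
  shows "form_partial (cot_atlas A) (canonical_form A) c' j k x - form_partial (cot_atlas A) (canonical_form A) c' k j x =
    (\<Sum>i\<in>UNIV. pd j (\<lambda>z. T z $ Inr i) (snd c' x) * pd k (\<lambda>z. T z $ Inl i) (snd c' x)
       - pd k (\<lambda>z. T z $ Inr i) (snd c' x) * pd j (\<lambda>z. T z $ Inl i) (snd c' x))"
proof -
  interpret I: atlas "insert c' (cot_atlas A)" by unfold_locales (use c' in \<open>simp add: compatible_chart_def\<close>)
  let ?K = "cot_chart A d"
  note K = cot_chart_in[OF d]
  have cI: "c' \<in> insert c' (cot_atlas A)" and KI: "?K \<in> insert c' (cot_atlas A)" using K by auto
  let ?S = "snd c' ` (fst c' \<inter> fst ?K)"
  have oS: "open ?S" by (rule I.open_overlap[OF cI KI])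
  have hT: "hmap T ?S" unfolding T_def by (rule I.hmap_trans[OF cI KI])
  have xS: "snd c' x \<in> ?S" using x by blast
  have cv: "coord_vector (cot_atlas A) c' k q \<in> tangent_space (cot_atlas A) q" if q: "q \<in> fst c'" for q k
    unfolding tangent_space_def coord_vector_def
    using I.jac_chain[OF cI _ _ q, of _ _ "axis k 1"] by auto
  have form: "canonical_form A (chart_inv c' z) (coord_vector (cot_atlas A) c' k (chart_inv c' z)) =
      (\<Sum>i\<in>UNIV. T z $ Inr i * pd k (\<lambda>z. T z $ Inl i) z)" if z: "z \<in> ?S" for z k
  proof -
    obtain q where q: "q \<in> fst c'" "q \<in> fst ?K" "z = snd c' q" using z by blast
    have qz: "chart_inv c' z = q" using q(1,3) by simp
    have "coord_vector (cot_atlas A) c' k q ?K $ Inl i = pd k (\<lambda>z. T z $ Inl i) z" for i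
      using q K by (simp add: coord_vector_def I.jac_nth[OF cI KI] der_def T_def axis_def mult_delta_left)
    moreover have "cf d q $ i = T z $ Inr i" for i by (simp add: T_def qz snd_cot_chart join_def)
    ultimately show ?thesis unfolding qz canonical_form_cot[OF d q(2) cv[OF q(1)]] dot_def tc_nth by simp
  qed
  have hp: "holo (\<lambda>z. pd k (\<lambda>z. T z $ s) z) ?S" for k s by (rule holo_pd[OF hmap_nth[OF hT] oS])
  have fp: "form_partial (cot_atlas A) (canonical_form A) c' j k x =
      (\<Sum>i\<in>UNIV. T (snd c' x) $ Inr i * pd j (\<lambda>z. pd k (\<lambda>z. T z $ Inl i) z) (snd c' x)
        + pd j (\<lambda>z. T z $ Inr i) (snd c' x) * pd k (\<lambda>z. T z $ Inl i) (snd c' x))" for j k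
  proof -
    have h: "holo (\<lambda>z. T z $ Inr i * pd k (\<lambda>z. T z $ Inl i) z) ?S" for i
      by (rule holo_mult[OF hmap_nth[OF hT] hp])
    have "form_partial (cot_atlas A) (canonical_form A) c' j k x =
        pd j (\<lambda>z. canonical_form A (chart_inv c' z) (coord_vector (cot_atlas A) c' k (chart_inv c' z))) (snd c' x)"
      by (simp add: form_partial_def pd_def)
    also have "\<dots> = pd j (\<lambda>z. \<Sum>i\<in>UNIV. T z $ Inr i * pd k (\<lambda>z. T z $ Inl i) z) (snd c' x)"
      by (rule pd_cong[OF oS xS form holo_sum[OF h]])
    also have "\<dots> = (\<Sum>i\<in>UNIV. pd j (\<lambda>z. T z $ Inr i * pd k (\<lambda>z. T z $ Inl i) z) (snd c' x))"
      by (rule pd_sum[OF h xS])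
    finally show ?thesis by (simp only: pd_mult[OF hmap_nth[OF hT] hp xS])
  qed
  \<comment> \<open>The terms with second derivatives are symmetric and cancel in the
    difference.\<close>
  have "pd j (\<lambda>z. pd k (\<lambda>z. T z $ Inl i) z) (snd c' x) = pd k (\<lambda>z. pd j (\<lambda>z. T z $ Inl i) z) (snd c' x)" for i
    by (rule pd_commute[OF hmap_nth[OF hT] oS xS])
  then show ?thesis unfolding fp sum_subtractf[symmetric] by (intro sum.cong) simp_all
qed

end

context massive_manifold
begin

text \<open>One sheet through a given character with a field \<epsilon> that recognises it:
  \<epsilon> takes the values 0 and 1 on characters, so the open condition \<open>ball 1 1\<close>
  picks out the sheet.\<close>

lemma sheet_at:
  assumes c: "c \<in> A" and t: "t \<in> snd c ` fst c" "sem (St c) (loc c e) t" and y: "y \<in> ch c t"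
  obtains N l \<epsilon> where "open N" "t \<in> N" "N \<subseteq> snd c ` fst c" "hmap l N" "\<forall>s\<in>N. l s \<in> ch c s" "l t = y" "hmap \<epsilon> N"
    "\<forall>s\<in>N. dot (l s) (\<epsilon> s) = 1" "\<forall>s\<in>N. \<forall>\<psi>\<in>ch c s. dot \<psi> (\<epsilon> s) \<in> ball 1 1 \<longrightarrow> \<psi> = l s"
proof -
  interpret F: alg_family "snd c ` fst c" "St c" "loc c e" by (rule alg_family[OF c])
  obtain N \<epsilon> l where N: "open N" "t \<in> N" "N \<subseteq> snd c ` fst c" and h\<epsilon>: "\<forall>i :: 'k. hmap (\<epsilon> i) N" and hl: "\<forall>i :: 'k. hmap (l i) N"
    and rl: "\<forall>t\<in>N. range (\<lambda>i. l i t) = ch c t" and le: "\<forall>t\<in>N. \<forall>i j. dot (l i t) (\<epsilon> j t) = (if i = j then 1 else 0)"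
    by (rule F.local_frame[OF t])
  obtain i where i: "y = l i t" using bspec[OF rl N(2)] y by blast
  show ?thesis
  proof (rule that[OF N spec[OF hl] _ i[symmetric] spec[OF h\<epsilon>]])
    show "\<forall>s\<in>N. l i s \<in> ch c s" using rl by blast
    show "\<forall>s\<in>N. dot (l i s) (\<epsilon> i s) = 1" using le by simp
    show "\<forall>s\<in>N. \<forall>\<psi>\<in>ch c s. dot \<psi> (\<epsilon> i s) \<in> ball 1 1 \<longrightarrow> \<psi> = l i s"
    proof (intro ballI impI)
      fix s \<psi> assume s: "s \<in> N" and \<psi>: "\<psi> \<in> ch c s" and b: "dot \<psi> (\<epsilon> i s) \<in> ball 1 1"
      obtain j where j: "\<psi> = l j s" using bspec[OF rl s] \<psi> by blast
      then have "j = i" using b bspec[OF le s] by (auto split: if_splits)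
      then show "\<psi> = l i s" using j by simp
    qed
  qed
qed

text \<open>The regular locus may reach over the caustic, where sheets are not at hand. The
  coefficient of the differential is shown to vanish over semisimple points, whose preimage is dense
  in L, and then everywhere on L by continuity.\<close>

lemma sheets_closed_lagrange:
  assumes C: sheets_closed
  shows "lagrange_variety A L"
  unfolding lagrange_variety_def closed_on_regular_locus_def
proof (intro allI impI ballI)
  fix c' J x j k
  assume sub: "submanifold_chart (cot_atlas A) L c' J" and x: "x \<in> regular_locus (cot_atlas A) L \<inter> fst c'"
    and j: "j \<in> J" and k: "k \<in> J"
  have c': "compatible_chart (cot_atlas A) c'" and plane: "L \<inter> fst c' = {x \<in> fst c'. \<forall>k. k \<notin> J \<longrightarrow> snd c' x $ k = 0}"
    using sub unfolding submanifold_chart_def by auto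
  have xL: "x \<in> L" "x \<in> fst c'" using x by (auto simp: regular_locus_def)
  have "fst x \<in> mspace A" using spectrum_mspace[OF xL(1)] mspace_cot by blast
  then obtain d where d: "d \<in> A" "fst x \<in> fst d" by (rule mspaceE)
  let ?K = "cot_chart A d"
  note K = cot_chart_in[OF d(1)]
  have xK: "x \<in> fst ?K" by (rule spectrum_chart[OF xL(1) d(2)])
  interpret I: atlas "insert c' (cot_atlas A)" by unfold_locales (use c' in \<open>simp add: compatible_chart_def\<close>)
  interpret F: alg_family "snd d ` fst d" "St d" "loc d e" by (rule alg_family[OF d(1)])
  have cI: "c' \<in> insert c' (cot_atlas A)" and KI: "?K \<in> insert c' (cot_atlas A)" using K by auto
  define T where "T = (\<lambda>z. snd ?K (chart_inv c' z))"
  let ?S = "snd c' ` (fst c' \<inter> fst ?K)"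
  let ?R = "snd ?K ` (fst ?K \<inter> fst c')"
  have oS: "open ?S" by (rule I.open_overlap[OF cI KI])
  have oR: "open ?R" by (rule I.open_overlap[OF KI cI])
  have hT: "hmap T ?S" unfolding T_def by (rule I.hmap_trans[OF cI KI])
  \<comment> \<open>The coefficient for the directions j and k of the differential of the canonical
    form, by \<open>form_partial_diff\<close>. It is holomorphic on the whole overlap and not just
    along L, as the continuity argument wants.\<close>
  define \<omega> where "\<omega> = (\<lambda>z. \<Sum>i\<in>UNIV. pd j (\<lambda>z. T z $ Inr i) z * pd k (\<lambda>z. T z $ Inl i) z
       - pd k (\<lambda>z. T z $ Inr i) z * pd j (\<lambda>z. T z $ Inl i) z)"
  have h\<omega>: "holo \<omega> ?S"
    unfolding \<omega>_def by (intro holo_sum holo_diff holo_mult holo_pd[OF hmap_nth[OF hT] oS])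
  have semi: "\<omega> (snd c' r) = 0" if r: "r \<in> L" "r \<in> fst c'" "r \<in> fst ?K" "fst r \<in> mspace A - caustic A m" for r
  proof -
    let ?z = "snd c' r" and ?t = "snd d (fst r)"
    have rd: "fst r \<in> fst d" using r(3) by (simp add: fst_cot_chart)
    have sm: "sem (St d) (loc d e) ?t" using r(4) semisimple_iff[OF d(1) rd] by (simp add: caustic_def)
    have y: "cf d r \<in> ch d ?t" using spectrum_iff[OF d(1) r(3)] r(1) by simp
    have Tz: "T ?z = join ?t (cf d r)" using r(2) by (simp add: T_def I.chart_inv1[OF cI] snd_cot_chart)
    obtain N l \<epsilon> where N: "open N" "?t \<in> N" "N \<subseteq> snd d ` fst d" and l: "hmap l N" "\<forall>s\<in>N. l s \<in> ch d s" "l ?t = cf d r"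
      and \<epsilon>: "hmap \<epsilon> N" "\<forall>s\<in>N. dot (l s) (\<epsilon> s) = 1" "\<forall>s\<in>N. \<forall>\<psi>\<in>ch d s. dot \<psi> (\<epsilon> s) \<in> ball 1 1 \<longrightarrow> \<psi> = l s"
      by (rule sheet_at[OF d(1) _ sm y]) (use rd in auto)
    have cl: "closed_at l ?t" using C d(1) N l sm unfolding sheets_closed_def by blast
    define M1 where "M1 = ?S \<inter> (\<lambda>z. tc (T z)) -` N"
    have htT: "hmap (\<lambda>z. tc (T z)) ?S" and hyT: "hmap (\<lambda>z. yc (T z)) ?S"
      by (rule hmap_compose[OF hT hmap_tc[of UNIV]], simp, rule hmap_compose[OF hT hmap_yc[of UNIV]], simp)
    have oM1: "open M1" unfolding M1_def by (rule continuous_open_preimage[OF hmap_continuous_on[OF htT] oS N(1)])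
    have M1S: "M1 \<subseteq> ?S" by (auto simp: M1_def)
    have ht1: "hmap (\<lambda>z. tc (T z)) M1" by (rule hmap_subset[OF htT M1S])
    have tM1: "tc (T z) \<in> N" if "z \<in> M1" for z using that by (auto simp: M1_def)
    have he: "hmap (\<lambda>z. \<epsilon> (tc (T z))) M1" by (rule hmap_compose[OF ht1 \<epsilon>(1) tM1])
    define M where "M = M1 \<inter> (\<lambda>z. dot (yc (T z)) (\<epsilon> (tc (T z)))) -` ball 1 1"
    have oM: "open M" unfolding M_def
      by (rule continuous_open_preimage[OF holo_continuous_on[OF holo_dot[OF hmap_subset[OF hyT M1S] he]] oM1 open_ball])
    have zM: "?z \<in> M"
    proof -
      have "dot (l ?t) (\<epsilon> ?t) = 1" using \<epsilon>(2) N(2) by blast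
      then show ?thesis unfolding M_def M1_def using r N(2) l(3) Tz by auto
    qed
    have MS: "M \<subseteq> ?S" using M1S by (auto simp: M_def)
    have hlM: "holo (\<lambda>z. l (tc (T z)) $ i) M" for i
      by (rule holo_compose[OF hmap_subset[OF ht1] hmap_nth[OF l(1)] tM1]) (auto simp: M_def)
    have hTM: "holo (\<lambda>z. T z $ s) M" for s by (rule holo_subset[OF hmap_nth[OF hT] MS])
    \<comment> \<open>Points of the coordinate plane belong to L, and \<epsilon> confines them to a
      single sheet, so their fibre coordinates are the values of l.\<close>
    have graph: "T z $ Inr i = l (tc (T z)) $ i" if z: "z \<in> M" and z0: "\<forall>k. k \<notin> J \<longrightarrow> z $ k = 0" for z i
    proof -
      obtain q where q: "q \<in> fst c'" "q \<in> fst ?K" "z = snd c' q" using z MS by blast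
      have "q \<in> L" using plane q z0 by blast
      have Tq: "T z = snd ?K q" using q by (simp add: T_def I.chart_inv1[OF cI])
      have "yc (T z) \<in> ch d (tc (T z))" using spectrum_iff[OF d(1) q(2)] \<open>q \<in> L\<close> unfolding Tq snd_cot_chart by simp
      then have "yc (T z) = l (tc (T z))"
        using \<epsilon>(3) tM1[of z] z unfolding M_def by blast
      then show ?thesis by (simp add: vec_eq_iff yc_nth)
    qed
    have rplane: "\<forall>k. k \<notin> J \<longrightarrow> ?z $ k = 0" using plane r(1,2) by blast
    have pdl: "pd i' (\<lambda>z. T z $ Inr i) ?z = (\<Sum>s\<in>UNIV. pd s (\<lambda>t. l t $ i) ?t * pd i' (\<lambda>z. T z $ Inl s) ?z)" if i': "i' \<in> J" for i' i
    proof -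
      \<comment> \<open>The graph equation holds only on the plane, but a direction in J stays in
        the plane, so the two partial derivatives still agree.\<close>
      have "pd i' (\<lambda>z. T z $ Inr i) ?z = pd i' (\<lambda>z. l (tc (T z)) $ i) ?z"
      proof (rule pd_along[OF hTM hlM zM])
        have "continuous_on UNIV (\<lambda>u. ?z + u *s (axis i' 1 :: complex^('k + 'k)))"
          by (intro continuous_intros bounded_linear.continuous_on[OF bounded_linear_smult_vec])
        then have "open ((\<lambda>u. ?z + u *s (axis i' 1 :: complex^('k + 'k))) -` M)"
          using continuous_open_preimage[OF _ open_UNIV oM] by simp
        then have "\<forall>\<^sub>F u in nhds 0. u \<in> (\<lambda>u. ?z + u *s (axis i' 1 :: complex^('k + 'k))) -` M"
          by (rule eventually_nhds_in_open) (use zM in simp)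
        then show "\<forall>\<^sub>F u in nhds 0. T (?z + u *s axis i' 1) $ Inr i = l (tc (T (?z + u *s axis i' 1))) $ i"
        proof eventually_elim
          case (elim u)
          show ?case by (rule graph) (use elim rplane i' in \<open>auto simp: axis_def\<close>)
        qed
      qed
      also have "\<dots> = (\<Sum>s\<in>UNIV. pd s (\<lambda>t. l t $ i) (tc (T ?z)) * pd i' (\<lambda>z. tc (T z) $ s) ?z)"
        by (rule pd_compose[OF ht1 hmap_nth[OF l(1)]]) (use zM tM1 in \<open>auto simp: M_def\<close>)
      finally show ?thesis unfolding tc_nth by (simp add: Tz)
    qed
    have sw: "(\<Sum>i\<in>UNIV. \<Sum>s\<in>UNIV. pd s (\<lambda>t. l t $ i) ?t * pd k (\<lambda>z. T z $ Inl s) ?z * pd j (\<lambda>z. T z $ Inl i) ?z)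
        = (\<Sum>i\<in>UNIV. \<Sum>s\<in>UNIV. pd s (\<lambda>t. l t $ i) ?t * pd j (\<lambda>z. T z $ Inl s) ?z * pd k (\<lambda>z. T z $ Inl i) ?z)"
    proof -
      have "pd s (\<lambda>t. l t $ i) ?t = pd i (\<lambda>t. l t $ s) ?t" for s i using cl by (simp add: closed_at_def)
      then show ?thesis by (subst sum.swap) (intro sum.cong refl, simp add: mult_ac)
    qed
    show ?thesis
      unfolding \<omega>_def pdl[OF j] pdl[OF k] sum_subtractf sum_distrib_right sw by simp
  qed
  have "\<omega> (snd c' x) = 0"
  proof (rule ccontr)
    assume nz: "\<omega> (snd c' x) \<noteq> 0"
    let ?g = "\<lambda>w. \<omega> (snd c' (chart_inv ?K w))"
    have hg: "holo ?g ?R"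
      by (rule holo_compose[OF I.hmap_trans[OF KI cI] h\<omega>]) (auto simp: I.chart_inv1[OF KI])
    have oN: "open (?R \<inter> ?g -` (- {0}))"
      by (rule continuous_open_preimage[OF holo_continuous_on[OF hg] oR]) auto
    let ?W = "{r \<in> fst ?K. snd ?K r \<in> ?R \<inter> ?g -` (- {0})}"
    have RI: "r \<in> fst c'" if "r \<in> fst ?K" "snd ?K r \<in> ?R" for r
      using that cot_chart_inj[OF d(1)] by (auto dest: inj_onD)
    have xW: "x \<in> ?W" using xK xL(2) nz by (auto simp: I.chart_inv1[OF KI])
    obtain r where r: "r \<in> L" "r \<in> ?W" "fst r \<in> mspace A - caustic A m"
      by (rule spectrum_semisimple_dense[OF xL(1) xW cot.openin_preimage[OF K oN]])
    have rK: "r \<in> fst ?K" "r \<in> fst c'" using r(2) RI by auto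
    then have "\<omega> (snd c' r) = 0" by (intro semi r)
    moreover have "?g (snd ?K r) \<noteq> 0" using r(2) by blast
    then have "\<omega> (snd c' r) \<noteq> 0" unfolding I.chart_inv1[OF KI rK(1)] .
    ultimately show False by blast
  qed
  then show "form_partial (cot_atlas A) (canonical_form A) c' j k x = form_partial (cot_atlas A) (canonical_form A) c' k j x"
    using form_partial_diff[OF c' d(1) xL(2) xK, of j k] unfolding \<omega>_def T_def by simp
qed

text \<open>The graph of a sheet is made a coordinate plane of a chart in the maximal atlas. The
  base coordinates t are coordinates on it, and in these the canonical form has the coefficients of
  the sheet.\<close>

lemma lagrange_sheets_closed:
  assumes lag: "lagrange_variety A L"
  shows "sheets_closed"
  unfolding sheets_closed_def
proof (intro ballI allI impI)
  fix c N' l' t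
  assume c: "c \<in> A" and N': "open N'" "N' \<subseteq> snd c ` fst c" and l': "hmap l' N'" "\<forall>s\<in>N'. l' s \<in> ch c s"
    and t: "t \<in> N'" "sem (St c) (loc c e) t"
  obtain N1 l1 \<epsilon> where N1: "open N1" "t \<in> N1" "N1 \<subseteq> snd c ` fst c" and \<epsilon>: "hmap \<epsilon> N1" and l1: "l1 t = l' t" "\<forall>s\<in>N1. dot (l1 s) (\<epsilon> s) = 1"
    "\<forall>s\<in>N1. \<forall>\<psi>\<in>ch c s. dot \<psi> (\<epsilon> s) \<in> ball 1 1 \<longrightarrow> \<psi> = l1 s"
    by (rule sheet_at[OF c subsetD[OF N'(2) t(1)] t(2) bspec[OF l'(2) t(1)]])
  \<comment> \<open>The sheets l1 and l' are known to agree at t; where \<epsilon> recognises l'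
    they agree throughout.\<close>
  define N where "N = (N' \<inter> N1) \<inter> (\<lambda>s. dot (l' s) (\<epsilon> s)) -` ball 1 1"
  have hd: "holo (\<lambda>s. dot (l' s) (\<epsilon> s)) (N' \<inter> N1)" by (intro holo_dot hmap_subset[OF l'(1)] hmap_subset[OF \<epsilon>]) auto
  have oN: "open N" unfolding N_def
    by (rule continuous_open_preimage[OF holo_continuous_on[OF hd] open_Int[OF N'(1) N1(1)] open_ball])
  have tN: "t \<in> N" using t N1 l1(2) by (auto simp: N_def l1(1)[symmetric])
  have NN: "N \<subseteq> snd c ` fst c" using N'(2) by (auto simp: N_def)
  have l: "hmap l' N" "\<And>s. s \<in> N \<Longrightarrow> l' s \<in> ch c s" and h\<epsilon>: "hmap \<epsilon> N"
    using l' by (auto simp: N_def intro: hmap_subset hmap_subset[OF \<epsilon>])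
  have ll: "l1 s = l' s" if s: "s \<in> N" for s
  proof -
    have a: "s \<in> N1" "l' s \<in> ch c s" "dot (l' s) (\<epsilon> s) \<in> ball 1 1" using s l'(2) unfolding N_def by blast+
    show ?thesis by (rule bspec[OF bspec[OF l1(3) a(1)] a(2), THEN mp, OF a(3), symmetric])
  qed
  let ?K = "cot_chart A c"
  \<comment> \<open>The condition on \<epsilon> cuts off the other sheets, so that L meets G only in
    the graph of l'.\<close>
  define G where "G = {z. tc z \<in> N} \<inter> (\<lambda>z. dot (yc z) (\<epsilon> (tc z))) -` ball 1 1"
  have hlt: "hmap (\<lambda>z. l' (tc z)) {z. tc z \<in> N}" and het: "hmap (\<lambda>z. \<epsilon> (tc z)) {z. tc z \<in> N}"
    by (rule hmap_compose[OF hmap_tc l(1)], simp, rule hmap_compose[OF hmap_tc h\<epsilon>], simp)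
  have oG: "open G" unfolding G_def
    by (rule continuous_open_preimage[OF holo_continuous_on[OF holo_dot[OF hmap_yc het]] open_tc[OF oN] open_ball])
  have Gs: "G \<subseteq> {z. tc z \<in> N}" by (auto simp: G_def)
  have Gc: "yc z \<in> ch c (tc z) \<longleftrightarrow> yc z = l' (tc z)" if "z \<in> G" for z
  proof
    have z: "tc z \<in> N" "dot (yc z) (\<epsilon> (tc z)) \<in> ball 1 1" using that unfolding G_def by blast+
    then have n: "tc z \<in> N1" unfolding N_def by blast
    show "yc z = l' (tc z)" if "yc z \<in> ch c (tc z)"
      using bspec[OF bspec[OF l1(3) n] that, THEN mp, OF z(2)] ll[OF z(1)] by simp
    show "yc z \<in> ch c (tc z)" if "yc z = l' (tc z)" unfolding that by (rule l(2)[OF z(1)])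
  qed
  have graphG: "join s (l' s) \<in> G" if s: "s \<in> N" for s
  proof -
    have "dot (l' s) (\<epsilon> s) \<in> ball 1 1" using s unfolding N_def by blast
    then show ?thesis using s unfolding G_def by simp
  qed
  \<comment> \<open>The shear (t, y) -> (t, y - l'(t)) moves the graph to the plane y = 0, and
    \<Psi> undoes it.\<close>
  define \<Phi> where "\<Phi> = (\<lambda>z. join (tc z) (yc z - l' (tc z)))"
  define \<Psi> where "\<Psi> = (\<lambda>z. join (tc z) (yc z + l' (tc z)))"
  have h\<Phi>: "hmap \<Phi> {z. tc z \<in> N}" and h\<Psi>: "hmap \<Psi> {z. tc z \<in> N}"
    unfolding \<Phi>_def \<Psi>_def
    by (rule hmap_join[OF hmap_tc], rule hmapI, unfold vector_minus_component, rule holo_diff[OF hmap_nth[OF hmap_yc] hmap_nth[OF hlt]],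
        rule hmap_join[OF hmap_tc], rule hmapI, unfold vector_add_component, rule holo_add[OF hmap_nth[OF hmap_yc] hmap_nth[OF hlt]])
  have \<Psi>\<Phi>: "\<Psi> (\<Phi> z) = z" and \<Phi>\<Psi>: "\<Phi> (\<Psi> z) = z" for z by (simp_all add: \<Phi>_def \<Psi>_def)
  have im: "\<Phi> ` G = {z. tc z \<in> N} \<inter> \<Psi> -` G"
  proof (rule Set.set_eqI, rule iffI)
    fix w assume "w \<in> \<Phi> ` G"
    then show "w \<in> {z. tc z \<in> N} \<inter> \<Psi> -` G" using Gs by (auto simp: \<Psi>\<Phi>) (auto simp: \<Phi>_def)
  next
    fix w assume "w \<in> {z. tc z \<in> N} \<inter> \<Psi> -` G"
    then show "w \<in> \<Phi> ` G" using \<Phi>\<Psi>[of w] by (intro image_eqI[of _ _ "\<Psi> w"]) auto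
  qed
  have oim: "open (\<Phi> ` G)" unfolding im
    by (rule continuous_open_preimage[OF hmap_continuous_on[OF h\<Psi>] open_tc[OF oN] oG])
  define c' where "c' = ({r \<in> fst ?K. snd ?K r \<in> G}, \<lambda>r. \<Phi> (snd ?K r))"
  have GK: "G \<subseteq> snd ?K ` fst ?K" unfolding cot_chart_image_full[OF c] using Gs NN by blast
  have c': "compatible_chart (cot_atlas A) c'"
    unfolding c'_def
    by (rule cot.compatible_chart_compose[OF cot_chart_in[OF c] oG GK hmap_subset[OF h\<Phi> Gs] oim hmap_subset[OF h\<Psi>] \<Psi>\<Phi>])
       (auto simp: im)
  have sub: "submanifold_chart (cot_atlas A) L c' (range Inl)"
    unfolding submanifold_chart_def
  proof (intro conjI c' Set.set_eqI iffI)
    have plane: "(\<forall>k. k \<notin> range Inl \<longrightarrow> \<Phi> z $ k = 0) \<longleftrightarrow> yc z = l' (tc z)" for z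
    proof -
      have "(\<forall>k. k \<notin> range Inl \<longrightarrow> \<Phi> z $ k = 0) \<longleftrightarrow> (\<forall>i. \<Phi> z $ Inr i = 0)"
        by (metis (no_types, lifting) Inl_Inr_False imageE obj_sumE rangeI)
      then show ?thesis by (simp add: \<Phi>_def join_def vec_eq_iff)
    qed
    have key: "r \<in> L \<longleftrightarrow> (\<forall>k. k \<notin> range Inl \<longrightarrow> snd c' r $ k = 0)" if "r \<in> fst c'" for r
    proof -
      have r: "r \<in> fst ?K" "snd ?K r \<in> G" using that by (auto simp: c'_def)
      show ?thesis
        using spectrum_iff[OF c r(1)] Gc[OF r(2)] plane[of "snd ?K r"] by (simp add: c'_def snd_cot_chart)
    qed
    show "r \<in> {x \<in> fst c'. \<forall>k. k \<notin> range Inl \<longrightarrow> snd c' x $ k = 0}" if "r \<in> L \<inter> fst c'" for r using that key by blast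
    show "r \<in> L \<inter> fst c'" if "r \<in> {x \<in> fst c'. \<forall>k. k \<notin> range Inl \<longrightarrow> snd c' x $ k = 0}" for r using that key by blast
  qed
  define x where "x = pt c (join t (l' t))"
  have tcn: "tc (join t (l' t)) \<in> snd c ` fst c" using NN tN by auto
  have xK: "x \<in> fst ?K" "snd ?K x = join t (l' t)" unfolding x_def by (rule pt_in[OF c tcn])+
  have xc': "x \<in> fst c'" using xK graphG[OF tN] by (simp add: c'_def)
  have xL: "x \<in> L" unfolding x_def using pt_spectrum[OF c tcn] l(2)[OF tN] by simp
  have xr: "x \<in> regular_locus (cot_atlas A) L \<inter> fst c'"
    unfolding regular_locus_def using xL xc' sub by blast
  interpret I: atlas "insert c' (cot_atlas A)" by unfold_locales (use c' in \<open>simp add: compatible_chart_def\<close>)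
  have cI: "c' \<in> insert c' (cot_atlas A)" by simp
  let ?w = "snd c' x"
  have w: "?w = \<Phi> (join t (l' t))" by (simp add: c'_def xK)
  have wim: "?w \<in> \<Phi> ` G" unfolding w by (rule imageI[OF graphG[OF tN]])
  have T: "snd ?K (chart_inv c' z) = \<Psi> z" if z: "z \<in> \<Phi> ` G" for z
  proof -
    obtain g where g: "g \<in> G" "z = \<Phi> g" using z by blast
    obtain r where r: "r \<in> fst ?K" "g = snd ?K r" using g(1) GK by blast
    have "r \<in> fst c'" "snd c' r = z" using r g by (simp_all add: c'_def)
    then have "chart_inv c' z = r" using I.chart_inv1[OF cI] by blast
    then show ?thesis using r(2) g(2) \<Psi>\<Phi> by simp
  qed
  have h\<Psi>G: "hmap \<Psi> (\<Phi> ` G)" by (rule hmap_subset[OF h\<Psi>]) (auto simp: im)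
  have pdT: "pd i (\<lambda>z. snd ?K (chart_inv c' z) $ s) ?w = pd i (\<lambda>z. \<Psi> z $ s) ?w" for i s
    by (rule pd_cong[OF oim wim _ hmap_nth[OF h\<Psi>G]]) (simp add: T)
  have pl: "pd i (\<lambda>z. \<Psi> z $ Inl s) ?w = (if i = Inl s then 1 else 0)" for i s
    by (simp add: \<Psi>_def join_def tc_nth pd_coord)
  have pr: "pd (Inl i) (\<lambda>z. \<Psi> z $ Inr s) ?w = pd i (\<lambda>t. l' t $ s) t" for i s
  proof -
    have wN: "?w \<in> {z. tc z \<in> N}" using wim im by blast
    have twt: "tc ?w = t" by (simp add: w \<Phi>_def)
    have "pd (Inl i) (\<lambda>z. \<Psi> z $ Inr s) ?w = pd (Inl i) (\<lambda>z. z $ Inr s + l' (tc z) $ s) ?w"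
      by (simp add: \<Psi>_def join_def yc_nth)
    also have "\<dots> = pd (Inl i) (\<lambda>z. z $ Inr s) ?w + pd (Inl i) (\<lambda>z. l' (tc z) $ s) ?w"
      by (rule pd_add[OF holo_coord hmap_nth[OF hlt] wN])
    also have "pd (Inl i) (\<lambda>z. l' (tc z) $ s) ?w = (\<Sum>r\<in>UNIV. pd r (\<lambda>t. l' t $ s) (tc ?w) * pd (Inl i) (\<lambda>z. tc z $ r) ?w)"
      by (rule pd_compose[OF hmap_tc hmap_nth[OF l(1)] wN]) (use wN in simp)
    finally show ?thesis by (simp add: pd_coord tc_nth twt mult_delta_right)
  qed
  show "closed_at l' t"
    unfolding closed_at_def
  proof (intro allI)
    fix i j
    have "form_partial (cot_atlas A) (canonical_form A) c' (Inl i) (Inl j) x = form_partial (cot_atlas A) (canonical_form A) c' (Inl j) (Inl i) x"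
      using lag sub xr unfolding lagrange_variety_def closed_on_regular_locus_def by blast
    then have "(\<Sum>s\<in>UNIV. pd i (\<lambda>t. l' t $ s) t * (if j = s then 1 else 0) - pd j (\<lambda>t. l' t $ s) t * (if i = s then 1 else 0)) = 0"
      using form_partial_diff[OF c' c xc' xK(1), of "Inl i" "Inl j"] by (simp add: pdT pl pr)
    then show "pd i (\<lambda>s. l' s $ j) t = pd j (\<lambda>s. l' s $ i) t"
      by (simp add: sum_subtractf mult_delta_right)
  qed
qed

end

theorem theorem6p2:
  fixes A :: "('m, 'n::finite) chart set"
    and m :: "('m, 'n) tmult"
    and e :: "('m, 'n) vfield"
  assumes "complex_manifold A"
    and "connected_space (mtop A)"
    and "unital_mult A m e"
    and "massive A m"
  shows "analytic_subset (cot_atlas A) (spectrum A m e) \<and>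
    (\<forall>q\<in>spectrum A m e. reduced_ring (spectrum_local_ring A m e q)) \<and>
    finite_map (subtopology (mtop (cot_atlas A)) (spectrum A m e)) (mtop A) fst \<and>
    spectrum_flat TYPE('x) TYPE('z) A m e \<and>
    branched_covering (cot_atlas A) (spectrum A m e) A fst CARD('n) (caustic A m) \<and>
    ((F_manifold A m e \<and> massive A m) \<longleftrightarrow> idempotents_commute A m e) \<and>
    (idempotents_commute A m e \<longleftrightarrow> lagrange_variety A (spectrum A m e))"
proof -
  interpret massive_manifold A m e
    by unfold_locales (use assms in \<open>simp_all add: complex_manifold_def\<close>)
  have F: "F_manifold A m e" if sheets_closed
    unfolding F_manifold_def using assms(1-3) sheets_closed_F[OF that] by blast
  have "F_manifold A m e \<longleftrightarrow> idempotents_commute A m e"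
    using F F_manifold_idempotents idempotents_sheets_closed by blast
  moreover have "idempotents_commute A m e \<longleftrightarrow> lagrange_variety A (spectrum A m e)"
    using F F_manifold_idempotents idempotents_sheets_closed sheets_closed_lagrange lagrange_sheets_closed by blast
  ultimately show ?thesis
    using assms(4) spectrum_analytic reduced spectrum_finite_map flat[where 'x='x and 'z='z] spectrum_covering by blast
qed

end
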